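(* For all real $m\geq 0$, all $\lambda\in\{1,-1\}$ and all $u_0\in H^1_+$, there exists a unique function $u\in C(\mathbb{R};H^1_+)$ solving $$i\partial_t u+\partial_x^2 u=\lambda\,\Pi(|u|^{2m}u),\qquad (t,x)\in\mathbb{R}\times\mathbb{R},\qquad u(0,x)=u_0(x).$$
   Context: $\Pi:L^2(\mathbb{R})\to L^2(\mathbb{R})$ is the Szegő projector onto nonnegative frequencies: $\Pi(f)(x)=\frac{1}{2\pi}\int_0^{+\infty}e^{ix\xi}\hat f(\xi)\,\mathrm{d}\xi$, where $\hat f(\xi)=\int_{\mathbb{R}}e^{-ix\xi}f(x)\,\mathrm{d}x$. Functions are complex-valued. $L^2_+=\Pi(L^2(\mathbb{R}))$ and $H^1_+=H^1(\mathbb{R})\cap L^2_+$, with the $H^1(\mathbb{R})$ norm. *)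

theory Defs
  imports "HOL-Analysis.Analysis"
begin

text \<open>
  Elements of \<open>L\<^sup>2(\<real>)\<close> are represented by Borel functions; equality of classes is equality almost
  everywhere.
\<close>

definition L2 :: "(real \<Rightarrow> complex) set" where
  "L2 = {f. f \<in> borel_measurable lborel \<and> integrable lborel (\<lambda>x. (cmod (f x))\<^sup>2)}"

definition L2_norm :: "(real \<Rightarrow> complex) \<Rightarrow> real" where
  "L2_norm f = sqrt (LINT x|lborel. (cmod (f x))\<^sup>2)"

text \<open>
  For functions that are only square integrable, the integrals defining the Fourier transform and
  the Szego projector are limits in \<open>L\<^sup>2\<close> of truncated integrals, as in Plancherel's theorem.
  The limits are unique up to null sets.
\<close>

definition L2_tendsto :: "(real \<Rightarrow> real \<Rightarrow> complex) \<Rightarrow> (real \<Rightarrow> complex) \<Rightarrow> bool" where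
  "L2_tendsto F g \<longleftrightarrow> g \<in> L2 \<and>
     ((\<lambda>R. \<integral>\<^sup>+ x. ennreal ((cmod (F R x - g x))\<^sup>2) \<partial>lborel) \<longlongrightarrow> 0) at_top"

definition fourier :: "(real \<Rightarrow> complex) \<Rightarrow> real \<Rightarrow> complex" where
  "fourier f = (SOME g. L2_tendsto
     (\<lambda>R \<xi>. LINT x:{-R..R}|lborel. exp (- (\<i> * of_real x * of_real \<xi>)) * f x) g)"

definition szego :: "(real \<Rightarrow> complex) \<Rightarrow> real \<Rightarrow> complex" where
  "szego f = (SOME g. L2_tendsto
     (\<lambda>R x. 1 / (2 * of_real pi) *
        (LINT \<xi>:{0..R}|lborel. exp (\<i> * of_real x * of_real \<xi>) * fourier f \<xi>)) g)"

definition L2_plus :: "(real \<Rightarrow> complex) set" where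
  "L2_plus = {f \<in> L2. \<exists>g\<in>L2. AE x in lborel. f x = szego g x}"

primrec Ck :: "nat \<Rightarrow> ('a::euclidean_space \<Rightarrow> real) \<Rightarrow> bool" where
  "Ck 0 f \<longleftrightarrow> continuous_on UNIV f"
| "Ck (Suc k) f \<longleftrightarrow> (\<forall>x. f differentiable (at x)) \<and>
     (\<forall>b\<in>Basis. Ck k (\<lambda>x. frechet_derivative f (at x) b))"

text \<open>
  Real-valued test functions suffice, also for complex-valued distributions: pairings are taken
  without conjugation, so an identity extends to complex test functions by linearity.
\<close>

definition test_functions :: "('a::euclidean_space \<Rightarrow> real) set" where
  "test_functions = {\<phi>. (\<forall>k. Ck k \<phi>) \<and> compact (closure {x. \<phi> x \<noteq> 0})}"

definition has_weak_deriv :: "(real \<Rightarrow> complex) \<Rightarrow> (real \<Rightarrow> complex) \<Rightarrow> bool" where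
  "has_weak_deriv f g \<longleftrightarrow> (\<forall>\<phi>\<in>test_functions.
     (LINT x|lborel. f x * of_real (deriv \<phi> x)) = - (LINT x|lborel. g x * of_real (\<phi> x)))"

definition H1 :: "(real \<Rightarrow> complex) set" where
  "H1 = {f \<in> L2. \<exists>g\<in>L2. has_weak_deriv f g}"

definition weak_deriv :: "(real \<Rightarrow> complex) \<Rightarrow> real \<Rightarrow> complex" where
  "weak_deriv f = (SOME g. g \<in> L2 \<and> has_weak_deriv f g)"

definition H1_norm :: "(real \<Rightarrow> complex) \<Rightarrow> real" where
  "H1_norm f = sqrt ((L2_norm f)\<^sup>2 + (L2_norm (weak_deriv f))\<^sup>2)"

definition H1_plus :: "(real \<Rightarrow> complex) set" where
  "H1_plus = H1 \<inter> L2_plus"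

definition C_H1_plus :: "(real \<Rightarrow> real \<Rightarrow> complex) set" where
  "C_H1_plus = {u. (\<forall>t. u t \<in> H1_plus) \<and>
     (\<forall>t. ((\<lambda>s. H1_norm (\<lambda>x. u s x - u t x)) \<longlongrightarrow> 0) (at t))}"

text \<open>
  The function \<open>|u|\<^sup>2\<^sup>mu\<close>. The convention \<open>0 powr 0 = 0\<close> is harmless for \<open>m = 0\<close> because of the
  factor \<open>u\<close>.
\<close>

definition nonlinearity :: "real \<Rightarrow> (real \<Rightarrow> complex) \<Rightarrow> real \<Rightarrow> complex" where
  "nonlinearity m f x = of_real (cmod (f x) powr (2 * m)) * f x"

text \<open>
  The equation \<open>i\<partial>\<^sub>tu + \<partial>\<^sub>x\<^sup>2u = \<lambda>\<Pi>(|u|\<^sup>2\<^sup>mu)\<close> in the sense of distributions on \<open>\<real> \<times> \<real>\<close>, with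
  points \<open>(t, x)\<close>. The pairings are iterated integrals, because the values \<open>u t\<close> and the Szego
  projections are representatives chosen separately for each \<open>t\<close>, which need not be jointly
  measurable. For \<open>u\<close> in \<open>C_H1_plus\<close> the inner integrals are continuous in \<open>t\<close>, with compact support.
\<close>

definition solves_equation :: "real \<Rightarrow> real \<Rightarrow> (real \<Rightarrow> real \<Rightarrow> complex) \<Rightarrow> bool" where
  "solves_equation m lam u \<longleftrightarrow> (\<forall>\<phi>\<in>test_functions.
     (LINT t|lborel. LINT x|lborel. u t x *
        (- \<i> * of_real (deriv (\<lambda>s. \<phi> (s, x)) t) + of_real ((deriv ^^ 2) (\<lambda>y. \<phi> (t, y)) x)))
     = of_real lam *
       (LINT t|lborel. LINT x|lborel. szego (nonlinearity m (u t)) x * of_real (\<phi> (t, x))))"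

definition is_solution ::
  "real \<Rightarrow> real \<Rightarrow> (real \<Rightarrow> complex) \<Rightarrow> (real \<Rightarrow> real \<Rightarrow> complex) \<Rightarrow> bool" where
  "is_solution m lam u0 u \<longleftrightarrow>
     u \<in> C_H1_plus \<and> solves_equation m lam u \<and> (AE x in lborel. u 0 x = u0 x)"

end

theory Submission
  imports Defs "HOL-Probability.Characteristic_Functions"
begin

text \<open>
  On the Fourier side, with the free flow factored out, the equation is an ordinary differential
  equation in \<open>L\<^sup>2\<close>. For functions with nonnegative frequencies the momentum is the square of the
  homogeneous \<open>H\<^sup>1\<^sup>/\<^sup>2\<close> norm, and it is conserved because the nonlinearity is the gradient of a
  translation invariant potential. Mass and momentum together bound the supremum norm up to the
  square root of the logarithm of the \<open>H\<^sup>1\<close> norm, so the potential energy grows more slowly than the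
  kinetic one, and conservation of energy bounds the \<open>H\<^sup>1\<close> norm for every \<open>m\<close> and both signs of
  \<open>lam\<close>.

  To have global solutions from the start, the nonlinearity is truncated at height \<open>R\<close>, which makes
  it globally Lipschitz on \<open>L\<^sup>2\<close>. The conservation laws are proved for the Galerkin equation, where
  the frequencies are bounded, and survive the passage to the limit as an a priori bound that does
  not depend on \<open>R\<close>. Choosing \<open>R\<close> above the resulting bound for the supremum makes the truncation
  disappear. For uniqueness, testing the weak equation with products \<open>a(t) b(x)\<close> gives the equation
  on bounded frequencies, where Gronwall's inequality applies.
\<close>

section \<open>The Hilbert space of square integrable functions modulo null sets\<close>

text \<open>The truncation acts through |z|^2 only, so the truncated nonlinearity is still the
  gradient of a gauge and translation invariant potential; this is why mass, momentum and energy
  survive it. The potential is estimated by the true power of |u|, never by the truncation height,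
  so the a priori bound closes in the form K^2 <= C + C' (log K)^m with no trace of
  \<open>R\<close>. For small real \<open>m\<close> the nonlinearity is not smooth, and the
  truncation has a corner, so no fixed point argument in H^1 is made. The differential equations
  live in L^2, and the H^1 information is obtained separately: the bound from the energy, the
  regularity of the nonlinearity from difference quotients, the continuity in time from the
  interaction picture. The multiplier \<xi>^2 is unbounded on L^2, so it is used on bands [0, n],
  where it is bounded. Restricting to such a band contains the projection onto nonnegative
  frequencies. The band projection does not commute with the nonlinearity, but it commutes with
  phase rotations and translations, and this is what the conservation laws rest on.\<close>

lemma L2_I:
  "f \<in> borel_measurable borel \<Longrightarrow> integrable lborel (\<lambda>x. (cmod (f x))\<^sup>2) \<Longrightarrow> f \<in> L2"
  by (simp add: L2_def)

lemma L2_measurable: "f \<in> L2 \<Longrightarrow> f \<in> borel_measurable borel"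
  by (auto simp: L2_def)

lemma L2_integrable [simp, intro]: "f \<in> L2 \<Longrightarrow> integrable lborel (\<lambda>x. (cmod (f x))\<^sup>2)"
  by (auto simp: L2_def)

lemma L2_bound:
  assumes g: "g \<in> L2" and f: "f \<in> borel_measurable borel"
    and le: "AE x in lborel. cmod (f x) \<le> C * cmod (g x)"
  shows "f \<in> L2"
proof -
  have "integrable lborel (\<lambda>x. (cmod (f x))\<^sup>2)"
  proof (rule Bochner_Integration.integrable_bound[where f = "\<lambda>x. C\<^sup>2 * (cmod (g x))\<^sup>2"])
    show "integrable lborel (\<lambda>x. C\<^sup>2 * (cmod (g x))\<^sup>2)" using g by auto
    show "AE x in lborel. norm ((cmod (f x))\<^sup>2) \<le> norm (C\<^sup>2 * (cmod (g x))\<^sup>2)"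
      using le
    proof eventually_elim
      case (elim x)
      then have "(cmod (f x))\<^sup>2 \<le> (C * cmod (g x))\<^sup>2"
        by (intro power_mono) auto
      then show ?case by (simp add: power_mult_distrib)
    qed
  qed (use f in measurable)
  with f show ?thesis by (rule L2_I)
qed

lemma L2_0 [simp]: "(\<lambda>_. 0) \<in> L2"
  by (rule L2_I) auto

lemma L2_add:
  assumes "f \<in> L2" "g \<in> L2" shows "(\<lambda>x. f x + g x) \<in> L2"
proof -
  have [measurable]: "f \<in> borel_measurable borel" "g \<in> borel_measurable borel" using assms by (auto intro: L2_measurable)
  have "integrable lborel (\<lambda>x. (cmod (f x + g x))\<^sup>2)"
  proof (rule Bochner_Integration.integrable_bound
      [where f = "\<lambda>x. 2 * (cmod (f x))\<^sup>2 + 2 * (cmod (g x))\<^sup>2"])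
    show "AE x in lborel. norm ((cmod (f x + g x))\<^sup>2)
       \<le> norm (2 * (cmod (f x))\<^sup>2 + 2 * (cmod (g x))\<^sup>2)"
    proof (intro AE_I2)
      fix x
      have "(cmod (f x + g x))\<^sup>2 \<le> (cmod (f x) + cmod (g x))\<^sup>2"
        by (intro power_mono norm_triangle_ineq) auto
      also have "\<dots> \<le> 2 * (cmod (f x))\<^sup>2 + 2 * (cmod (g x))\<^sup>2"
        using sum_squares_bound[of "cmod (f x)" "cmod (g x)"] by (simp add: power2_sum)
      finally show "norm ((cmod (f x + g x))\<^sup>2) \<le> norm (2 * (cmod (f x))\<^sup>2 + 2 * (cmod (g x))\<^sup>2)"
        by simp
    qed
  qed (use assms in auto)
  then show ?thesis by (intro L2_I) measurable
qed

lemma L2_mult: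
  assumes "f \<in> L2" "a \<in> borel_measurable borel" "\<And>x. cmod (a x) \<le> C"
  shows "(\<lambda>x. a x * f x) \<in> L2"
proof (rule L2_bound[OF assms(1), where C = C])
  have [measurable]: "f \<in> borel_measurable borel" "a \<in> borel_measurable borel"
    using assms by (simp_all add: L2_measurable)
  show "(\<lambda>x. a x * f x) \<in> borel_measurable borel" by measurable
  show "AE x in lborel. cmod (a x * f x) \<le> C * cmod (f x)"
    by (intro AE_I2) (simp add: norm_mult assms(3) mult_right_mono)
qed

lemma L2_scaleR: "f \<in> L2 \<Longrightarrow> (\<lambda>x. c *\<^sub>R f x) \<in> L2"
  using L2_mult[of f "\<lambda>_. of_real c" "\<bar>c\<bar>"] by (simp add: scaleR_conv_of_real)

lemma L2_uminus: "f \<in> L2 \<Longrightarrow> (\<lambda>x. - f x) \<in> L2"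
  using L2_scaleR[of f "-1"] by simp

lemma L2_diff: "f \<in> L2 \<Longrightarrow> g \<in> L2 \<Longrightarrow> (\<lambda>x. f x - g x) \<in> L2"
  using L2_add[of f "\<lambda>x. - g x"] L2_uminus[of g] by simp

section \<open>The quotient of square integrable functions by null sets\<close>

definition ae_eq :: "(real \<Rightarrow> complex) \<Rightarrow> (real \<Rightarrow> complex) \<Rightarrow> bool" where
  "ae_eq f g \<longleftrightarrow> f \<in> L2 \<and> g \<in> L2 \<and> (AE x in lborel. f x = g x)"

\<comment> \<open>The relation is partial: it is reflexive exactly on \<open>L2\<close>. Hence every
  \<open>fn a\<close> is a Borel square integrable representative, and \<open>cls f\<close> is
  meaningful only under \<open>f \<in> L2\<close>, a side condition that recurs throughout.\<close>
quotient_type l2 = "real \<Rightarrow> complex" / partial: ae_eq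
  morphisms fn cls
proof (rule part_equivpI)
  show "\<exists>f. ae_eq f f" by (rule exI[of _ "\<lambda>_. 0"]) (auto simp: ae_eq_def)
  show "symp ae_eq" by (simp add: symp_def ae_eq_def eq_commute)
  show "transp ae_eq"
  proof (rule transpI)
    fix f g h assume "ae_eq f g" "ae_eq g h"
    then have "AE x in lborel. f x = g x" "AE x in lborel. g x = h x" by (auto simp: ae_eq_def)
    then have "AE x in lborel. f x = h x" by eventually_elim simp
    with \<open>ae_eq f g\<close> \<open>ae_eq g h\<close> show "ae_eq f h" by (auto simp: ae_eq_def)
  qed
qed

lemma fn_L2 [simp, intro]: "fn a \<in> L2"
  using Quotient3_rep_reflp[OF Quotient3_l2, of a] by (auto simp: ae_eq_def)

lemma fn_measurable [measurable, simp]: "fn a \<in> borel_measurable borel"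
  by (rule L2_measurable) simp

lemma cls_fn [simp]: "cls (fn a) = a"
  by (rule Quotient3_abs_rep[OF Quotient3_l2])

lemma cls_eq_iff:
  "f \<in> L2 \<Longrightarrow> g \<in> L2 \<Longrightarrow> cls f = cls g \<longleftrightarrow> (AE x in lborel. f x = g x)"
  using Quotient3_rel[OF Quotient3_l2, of f g] by (auto simp: ae_eq_def)

lemma fn_cls: "f \<in> L2 \<Longrightarrow> AE x in lborel. fn (cls f) x = f x"
  using cls_eq_iff[of "fn (cls f)" f] by simp

lemma l2_eq_iff: "a = b \<longleftrightarrow> (AE x in lborel. fn a x = fn b x)"
  using cls_eq_iff[of "fn a" "fn b"] by simp

lemma L2_prod_integrable:
  assumes "f \<in> L2" "g \<in> L2" shows "integrable lborel (\<lambda>x. f x * g x)"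
proof -
  have [measurable]: "f \<in> borel_measurable borel" "g \<in> borel_measurable borel" using assms by (auto intro: L2_measurable)
  show ?thesis
  proof (rule Bochner_Integration.integrable_bound
      [where f = "\<lambda>x. (cmod (f x))\<^sup>2 + (cmod (g x))\<^sup>2"])
    show "AE x in lborel. norm (f x * g x) \<le> norm ((cmod (f x))\<^sup>2 + (cmod (g x))\<^sup>2)"
    proof (intro AE_I2)
      fix x
      have "2 * (cmod (f x) * cmod (g x)) \<le> (cmod (f x))\<^sup>2 + (cmod (g x))\<^sup>2"
        using sum_squares_bound[of "cmod (f x)" "cmod (g x)"] by simp
      moreover have "0 \<le> cmod (f x) * cmod (g x)" by simp
      ultimately show "norm (f x * g x) \<le> norm ((cmod (f x))\<^sup>2 + (cmod (g x))\<^sup>2)"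
        unfolding norm_mult by (smt (verit) real_norm_def)
    qed
  qed (use assms in auto)
qed

lemma cnj_measurable [measurable]: "cnj \<in> borel_measurable borel"
  by (intro borel_measurable_continuous_onI continuous_intros)

lemma inner_complex_cnj: "inner z w = Re (cnj z * w)"
  by (simp add: inner_complex_def)

lemma L2_inner_integrable:
  assumes "f \<in> L2" "g \<in> L2" shows "integrable lborel (\<lambda>x. inner (f x) (g x))"
proof -
  have [measurable]: "f \<in> borel_measurable borel" using assms by (auto intro: L2_measurable)
  have "(\<lambda>x. cnj (f x)) \<in> L2"
    by (rule L2_bound[OF assms(1), where C = 1]) auto
  then show ?thesis
    unfolding inner_complex_cnj by (intro integrable_Re L2_prod_integrable assms(2))
qed

instantiation l2 :: real_inner
begin

definition zero_l2 :: l2 where "0 = cls (\<lambda>_. 0)"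
definition plus_l2 :: "l2 \<Rightarrow> l2 \<Rightarrow> l2" where "a + b = cls (\<lambda>x. fn a x + fn b x)"
definition minus_l2 :: "l2 \<Rightarrow> l2 \<Rightarrow> l2" where "a - b = cls (\<lambda>x. fn a x - fn b x)"
definition uminus_l2 :: "l2 \<Rightarrow> l2" where "- a = cls (\<lambda>x. - fn a x)"
definition scaleR_l2 :: "real \<Rightarrow> l2 \<Rightarrow> l2" where "c *\<^sub>R a = cls (\<lambda>x. c *\<^sub>R fn a x)"
definition inner_l2 :: "l2 \<Rightarrow> l2 \<Rightarrow> real" where
  "inner a b = (LINT x|lborel. inner (fn a x) (fn b x))"
definition norm_l2 :: "l2 \<Rightarrow> real" where "norm (a::l2) = sqrt (inner a a)"
definition dist_l2 :: "l2 \<Rightarrow> l2 \<Rightarrow> real" where "dist (a::l2) b = norm (a - b)"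
definition sgn_l2 :: "l2 \<Rightarrow> l2" where "sgn (a::l2) = inverse (norm a) *\<^sub>R a"
definition uniformity_l2 :: "(l2 \<times> l2) filter" where
  "uniformity_l2 = (INF e\<in>{0 <..}. principal {(x, y). dist x y < e})"
definition open_l2 :: "l2 set \<Rightarrow> bool" where
  "open_l2 U \<longleftrightarrow> (\<forall>x\<in>U. \<forall>\<^sub>F (x', y) in uniformity. x' = x \<longrightarrow> y \<in> U)"

lemma fn_zero: "AE x in lborel. fn 0 x = 0"
  unfolding zero_l2_def by (rule fn_cls) simp
lemma fn_plus: "AE x in lborel. fn (a + b) x = fn a x + fn b x"
  unfolding plus_l2_def by (rule fn_cls) (simp add: L2_add)
lemma fn_minus: "AE x in lborel. fn (a - b) x = fn a x - fn b x"
  unfolding minus_l2_def by (rule fn_cls) (simp add: L2_diff)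
lemma fn_uminus: "AE x in lborel. fn (- a) x = - fn a x"
  unfolding uminus_l2_def by (rule fn_cls) (simp add: L2_uminus)
lemma fn_scaleR: "AE x in lborel. fn (c *\<^sub>R a) x = c *\<^sub>R fn a x"
  unfolding scaleR_l2_def by (rule fn_cls) (simp add: L2_scaleR)

lemma inner_l2_cong:
  assumes "AE x in lborel. inner (fn a x) (fn b x) = h x" "h \<in> borel_measurable borel"
  shows "inner a b = (LINT x|lborel. h x)"
  unfolding inner_l2_def by (rule integral_cong_AE) (use assms in auto)

instance
proof
  fix a b c :: l2 and r s :: real
  show "dist a b = norm (a - b)" by (simp add: dist_l2_def)
  show "sgn a = inverse (norm a) *\<^sub>R a" by (simp add: sgn_l2_def)
  show "norm a = sqrt (inner a a)" by (simp add: norm_l2_def)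
  show "(uniformity :: (l2 \<times> l2) filter) = (INF e\<in>{0 <..}. principal {(x, y). dist x y < e})"
    by (simp add: uniformity_l2_def)
  show "open U \<longleftrightarrow> (\<forall>x\<in>U. \<forall>\<^sub>F (x', y) in uniformity. x' = x \<longrightarrow> y \<in> U)" for U :: "l2 set"
    by (simp add: open_l2_def)
  show "a + b + c = a + (b + c)"
    unfolding l2_eq_iff using fn_plus[of "a + b" c] fn_plus[of a b] fn_plus[of a "b + c"] fn_plus[of b c]
    by eventually_elim simp
  show "a + b = b + a"
    unfolding l2_eq_iff using fn_plus[of a b] fn_plus[of b a] by eventually_elim simp
  show "0 + a = a"
    unfolding l2_eq_iff using fn_plus[of 0 a] fn_zero by eventually_elim simp
  show "- a + a = 0"
    unfolding l2_eq_iff using fn_plus[of "-a" a] fn_zero fn_uminus[of a] by eventually_elim simp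
  show "a - b = a + - b"
    unfolding l2_eq_iff using fn_plus[of a "-b"] fn_uminus[of b] fn_minus[of a b]
    by eventually_elim simp
  show "r *\<^sub>R (a + b) = r *\<^sub>R a + r *\<^sub>R b"
    unfolding l2_eq_iff
    using fn_plus[of a b] fn_scaleR[of r "a + b"] fn_plus[of "r *\<^sub>R a" "r *\<^sub>R b"]
      fn_scaleR[of r a] fn_scaleR[of r b]
    by eventually_elim (simp add: scaleR_right_distrib)
  show "(r + s) *\<^sub>R a = r *\<^sub>R a + s *\<^sub>R a"
    unfolding l2_eq_iff
    using fn_plus[of "r *\<^sub>R a" "s *\<^sub>R a"] fn_scaleR[of "r + s" a] fn_scaleR[of r a] fn_scaleR[of s a]
    by eventually_elim (simp add: scaleR_left_distrib)
  show "r *\<^sub>R s *\<^sub>R a = (r * s) *\<^sub>R a"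
    unfolding l2_eq_iff
    using fn_scaleR[of "r * s" a] fn_scaleR[of r "s *\<^sub>R a"] fn_scaleR[of s a]
    by eventually_elim simp
  show "1 *\<^sub>R a = a"
    unfolding l2_eq_iff using fn_scaleR[of 1 a] by eventually_elim simp
  show "inner a b = inner b a" by (simp add: inner_l2_def inner_commute)
  show "inner (a + b) c = inner a c + inner b c"
  proof -
    have "inner (a + b) c = (LINT x|lborel. inner (fn a x) (fn c x) + inner (fn b x) (fn c x))"
      using fn_plus[of a b]
      by (intro inner_l2_cong) (auto simp: inner_add_left)
    then show ?thesis by (simp add: inner_l2_def L2_inner_integrable)
  qed
  show "inner (r *\<^sub>R a) b = r * inner a b"
  proof -
    have "inner (r *\<^sub>R a) b = (LINT x|lborel. r * inner (fn a x) (fn b x))"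
      using fn_scaleR[of r a] by (intro inner_l2_cong) auto
    then show ?thesis by (simp add: inner_l2_def)
  qed
  show "0 \<le> inner a a" by (simp add: inner_l2_def)
  show "inner a a = 0 \<longleftrightarrow> a = 0"
  proof -
    have "inner a a = 0 \<longleftrightarrow> (AE x in lborel. inner (fn a x) (fn a x) = 0)"
      unfolding inner_l2_def by (rule integral_nonneg_eq_0_iff_AE) (auto intro: L2_inner_integrable)
    also have "\<dots> \<longleftrightarrow> (AE x in lborel. fn a x = fn 0 x)"
    proof
      assume "AE x in lborel. inner (fn a x) (fn a x) = 0"
      then show "AE x in lborel. fn a x = fn 0 x" using fn_zero by eventually_elim simp
    next
      assume "AE x in lborel. fn a x = fn 0 x"
      then show "AE x in lborel. inner (fn a x) (fn a x) = 0" using fn_zero by eventually_elim simp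
    qed
    finally show ?thesis by (simp add: l2_eq_iff)
  qed
qed

end

lemma norm_l2_sq: "(norm a)\<^sup>2 = (LINT x|lborel. (cmod (fn a x))\<^sup>2)"
  by (simp add: power2_norm_eq_inner inner_l2_def)

lemma cls_add: "f \<in> L2 \<Longrightarrow> g \<in> L2 \<Longrightarrow> cls (\<lambda>x. f x + g x) = cls f + cls g"
  unfolding l2_eq_iff
  using fn_cls[of f] fn_cls[of g] fn_cls[OF L2_add[of f g]] fn_plus[of "cls f" "cls g"] by auto

lemma cls_diff: "f \<in> L2 \<Longrightarrow> g \<in> L2 \<Longrightarrow> cls (\<lambda>x. f x - g x) = cls f - cls g"
  unfolding l2_eq_iff
  using fn_cls[of f] fn_cls[of g] fn_cls[OF L2_diff[of f g]] fn_minus[of "cls f" "cls g"] by auto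

lemma cls_scaleR: "f \<in> L2 \<Longrightarrow> cls (\<lambda>x. c *\<^sub>R f x) = c *\<^sub>R cls f"
  unfolding l2_eq_iff
  using fn_cls[of f] fn_cls[OF L2_scaleR[of f c]] fn_scaleR[of c "cls f"] by auto

lemma norm_cls_sq:
  assumes "f \<in> L2" shows "(norm (cls f))\<^sup>2 = (LINT x|lborel. (cmod (f x))\<^sup>2)"
proof -
  have [measurable]: "f \<in> borel_measurable borel" using assms by (auto intro: L2_measurable)
  show ?thesis
    unfolding norm_l2_sq by (rule integral_cong_AE) (use fn_cls[OF assms] in auto)
qed

lemma norm_cls: "f \<in> L2 \<Longrightarrow> norm (cls f) = L2_norm f"
  using norm_cls_sq[of f] by (simp add: L2_norm_def real_sqrt_unique)

lemma nn_norm_cls: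
  "f \<in> L2 \<Longrightarrow> (\<integral>\<^sup>+x. ennreal ((cmod (f x))\<^sup>2) \<partial>lborel) = ennreal ((norm (cls f))\<^sup>2)"
  unfolding norm_cls_sq by (intro nn_integral_eq_integral) auto

lemma inner_cls:
  assumes "f \<in> L2" "g \<in> L2" shows "inner (cls f) (cls g) = (LINT x|lborel. inner (f x) (g x))"
proof -
  have [measurable]: "f \<in> borel_measurable borel" "g \<in> borel_measurable borel" using assms by (auto intro: L2_measurable)
  show ?thesis
    by (rule inner_l2_cong) (use fn_cls[OF assms(1)] fn_cls[OF assms(2)] in auto)
qed

lemma norm_l2_mono:
  assumes "AE x in lborel. cmod (fn a x) \<le> C * cmod (fn b x)" "0 \<le> C"
  shows "norm a \<le> C * norm b"
proof (rule power2_le_imp_le)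
  have "(norm a)\<^sup>2 \<le> (LINT x|lborel. C\<^sup>2 * (cmod (fn b x))\<^sup>2)"
    unfolding norm_l2_sq
  proof (rule integral_mono_AE)
    show "AE x in lborel. (cmod (fn a x))\<^sup>2 \<le> C\<^sup>2 * (cmod (fn b x))\<^sup>2"
      using assms(1) by eventually_elim (metis norm_ge_zero power_mono power_mult_distrib)
  qed (auto intro: L2_integrable)
  then show "(norm a)\<^sup>2 \<le> (C * norm b)\<^sup>2" by (simp add: norm_l2_sq power_mult_distrib)
qed (use assms(2) in simp)

lemma L2_I_nn:
  assumes "f \<in> borel_measurable borel" "(\<integral>\<^sup>+x. ennreal ((cmod (f x))\<^sup>2) \<partial>lborel) < \<infinity>"
  shows "f \<in> L2"
  using assms by (intro L2_I integrableI_nonneg) auto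

lemma norm_cls_le_nn:
  assumes "f \<in> borel_measurable borel" "(\<integral>\<^sup>+x. ennreal ((cmod (f x))\<^sup>2) \<partial>lborel) \<le> ennreal (e\<^sup>2)" "0 \<le> e"
  shows "f \<in> L2" "norm (cls f) \<le> e"
proof -
  show f: "f \<in> L2" using assms by (intro L2_I_nn) (auto simp: less_top[symmetric] top_unique)
  have "ennreal ((norm (cls f))\<^sup>2) \<le> ennreal (e\<^sup>2)" using assms(2) nn_norm_cls[OF f] by simp
  then have "(norm (cls f))\<^sup>2 \<le> e\<^sup>2" by simp
  then show "norm (cls f) \<le> e" using assms(3) by (rule power2_le_imp_le)
qed

text \<open>Riesz-Fischer: a rapidly converging subsequence converges almost everywhere, and Fatou's
  lemma turns the pointwise limit into a norm limit.\<close>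

instance l2 :: complete_space
proof
  fix X :: "nat \<Rightarrow> l2" assume X: "Cauchy X"
  have "\<exists>r. strict_mono r \<and> (\<forall>k. norm (X (r (Suc k)) - X (r k)) < (1/4)^k)"
  proof -
    have "\<forall>k. \<exists>N. \<forall>m\<ge>N. \<forall>n\<ge>N. norm (X m - X n) < (1/4)^k"
      using X unfolding Cauchy_iff by (metis zero_less_divide_1_iff zero_less_numeral zero_less_power)
    then obtain N where N: "\<And>k m n. m \<ge> N k \<Longrightarrow> n \<ge> N k \<Longrightarrow> norm (X m - X n) < (1/4)^k" by metis
    define r where "r = (\<lambda>k. k + (\<Sum>j\<le>k. N j))"
    have "strict_mono r" unfolding strict_mono_Suc_iff r_def by auto
    moreover have "N k \<le> r k" for k
      unfolding r_def using member_le_sum[of k "{..k}" N] by simp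
    moreover have "N k \<le> r (Suc k)" for k
      using \<open>strict_mono r\<close> \<open>N k \<le> r k\<close> by (meson le_less_trans less_imp_le strict_mono_Suc_iff)
    ultimately show ?thesis using N by blast
  qed
  then obtain r where r: "strict_mono r" and rd: "\<And>k. norm (X (r (Suc k)) - X (r k)) < (1/4)^k" by auto
  define f where "f k = fn (X (r k))" for k
  have [measurable]: "f k \<in> borel_measurable borel" for k by (simp add: f_def fn_measurable)
  have fL2: "f k \<in> L2" and clsf: "cls (f k) = X (r k)" for k by (simp_all add: f_def)
  \<comment> \<open>Increments of norm below (1/4)^k leave room for the weight 4^k: the weighted
    squares have total integral at most the sum of (1/4)^k. Finiteness almost everywhere then forces
    |f (k+1) - f k| <= (1/2)^k eventually, so the telescoping series converges.\<close>
  have "(\<integral>\<^sup>+x. (\<Sum>k. ennreal (4^k * (cmod (f (Suc k) x - f k x))\<^sup>2)) \<partial>lborel)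
      = (\<Sum>k. \<integral>\<^sup>+x. ennreal (4^k * (cmod (f (Suc k) x - f k x))\<^sup>2) \<partial>lborel)"
    by (rule nn_integral_suminf) simp
  also have "\<dots> \<le> (\<Sum>k. ennreal ((1/4)^k))"
  proof (intro suminf_le)
    fix k
    have L: "(\<lambda>x. f (Suc k) x - f k x) \<in> L2" by (intro L2_diff fL2)
    have "(\<integral>\<^sup>+x. ennreal (4^k * (cmod (f (Suc k) x - f k x))\<^sup>2) \<partial>lborel)
        = ennreal (4^k) * (\<integral>\<^sup>+x. ennreal ((cmod (f (Suc k) x - f k x))\<^sup>2) \<partial>lborel)"
      by (subst nn_integral_cmult[symmetric]) (auto simp: ennreal_mult)
    also have "\<dots> = ennreal (4^k) * ennreal ((norm (X (r (Suc k)) - X (r k)))\<^sup>2)"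
      by (subst nn_norm_cls[OF L]) (simp add: cls_diff fL2 clsf)
    also have "\<dots> = ennreal (4^k * (norm (X (r (Suc k)) - X (r k)))\<^sup>2)" by (simp add: ennreal_mult)
    also have "\<dots> \<le> ennreal (4^k * ((1/4)^k)\<^sup>2)"
      by (intro ennreal_leI mult_left_mono power_mono less_imp_le[OF rd]) auto
    also have "4^k * ((1/4::real)^k)\<^sup>2 = (1/4)^k"
      by (simp add: power2_eq_square power_mult_distrib[symmetric] flip: mult.assoc)
    finally show "(\<integral>\<^sup>+x. ennreal (4^k * (cmod (f (Suc k) x - f k x))\<^sup>2) \<partial>lborel) \<le> ennreal ((1/4)^k)" .
  qed auto
  also have "\<dots> < \<infinity>"
    using summable_geometric[of "1/4::real"] by (subst suminf_ennreal2) (auto simp: less_top[symmetric])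
  finally have "AE x in lborel. (\<Sum>k. ennreal (4^k * (cmod (f (Suc k) x - f k x))\<^sup>2)) \<noteq> \<infinity>"
    by (intro nn_integral_PInf_AE) auto
  then have conv: "AE x in lborel. convergent (\<lambda>k. f k x)"
  proof eventually_elim
    case (elim x)
    have "summable (\<lambda>k. 4^k * (cmod (f (Suc k) x - f k x))\<^sup>2)"
      by (rule summable_suminf_not_top) (use elim in auto)
    then have "(\<lambda>k. 4^k * (cmod (f (Suc k) x - f k x))\<^sup>2) \<longlonglongrightarrow> 0" by (rule summable_LIMSEQ_zero)
    then have "\<forall>\<^sub>F k in sequentially. 4^k * (cmod (f (Suc k) x - f k x))\<^sup>2 < 1"
      by (rule order_tendstoD) simp
    then have "\<forall>\<^sub>F k in sequentially. norm (f (Suc k) x - f k x) \<le> (1/2)^k"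
    proof eventually_elim
      case (elim k)
      have "(2^k * cmod (f (Suc k) x - f k x))\<^sup>2 < 1\<^sup>2"
      proof -
        have "(2^k::real)\<^sup>2 = 4^k" by (simp add: power2_eq_square flip: power_mult_distrib)
        then show ?thesis using elim by (simp add: power_mult_distrib)
      qed
      then have "2^k * cmod (f (Suc k) x - f k x) < 1" by (rule power2_less_imp_less) simp
      then show ?case by (simp add: power_one_over field_simps)
    qed
    then have "summable (\<lambda>k. f (Suc k) x - f k x)"
      by (rule summable_comparison_test_ev) (simp add: summable_geometric)
    then have "convergent (\<lambda>n. f 0 x + (\<Sum>k<n. f (Suc k) x - f k x))"
      by (intro convergent_add convergent_const) (simp add: summable_iff_convergent)
    then show ?case by (simp add: sum_lessThan_telescope[of "\<lambda>k. f k x"])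
  qed
  define g where "g x = lim (\<lambda>k. f k x)" for x
  have [measurable]: "g \<in> borel_measurable borel" unfolding g_def by measurable
  have lim: "AE x in lborel. (\<lambda>k. f k x) \<longlonglongrightarrow> g x"
    using conv by eventually_elim (simp add: g_def convergent_LIMSEQ_iff)
  \<comment> \<open>Fatou gives at once that the limit differs from \<open>f k\<close> by an L^2
    function and that the difference is small.\<close>
  have bnd: "(\<lambda>x. g x - f k x) \<in> L2 \<and> norm (cls (\<lambda>x. g x - f k x)) \<le> e"
    if "e > 0" and K: "\<And>j. j \<ge> k \<Longrightarrow> norm (X (r j) - X (r k)) \<le> e" for k e
  proof -
    have "(\<integral>\<^sup>+x. ennreal ((cmod (g x - f k x))\<^sup>2) \<partial>lborel)
        = (\<integral>\<^sup>+x. liminf (\<lambda>j. ennreal ((cmod (f j x - f k x))\<^sup>2)) \<partial>lborel)"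
    proof (rule nn_integral_cong_AE)
      show "AE x in lborel. ennreal ((cmod (g x - f k x))\<^sup>2) = liminf (\<lambda>j. ennreal ((cmod (f j x - f k x))\<^sup>2))"
        using lim
      proof eventually_elim
        case (elim x)
        have "(\<lambda>j. ennreal ((cmod (f j x - f k x))\<^sup>2)) \<longlonglongrightarrow> ennreal ((cmod (g x - f k x))\<^sup>2)"
          by (intro tendsto_intros elim)
        from lim_imp_Liminf[OF _ this] show ?case by simp
      qed
    qed
    also have "\<dots> \<le> liminf (\<lambda>j. \<integral>\<^sup>+x. ennreal ((cmod (f j x - f k x))\<^sup>2) \<partial>lborel)"
      by (rule nn_integral_liminf) simp
    also have "\<dots> \<le> ennreal (e\<^sup>2)"
    proof (rule Liminf_le)
      show "\<forall>\<^sub>F j in sequentially. (\<integral>\<^sup>+x. ennreal ((cmod (f j x - f k x))\<^sup>2) \<partial>lborel) \<le> ennreal (e\<^sup>2)"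
        using eventually_ge_at_top[of k]
      proof eventually_elim
        case (elim j)
        have L: "(\<lambda>x. f j x - f k x) \<in> L2" by (intro L2_diff fL2)
        show ?case
          by (subst nn_norm_cls[OF L])
            (use K[OF elim] in \<open>auto simp: cls_diff fL2 clsf intro!: ennreal_leI power_mono\<close>)
      qed
    qed simp
    finally show ?thesis using norm_cls_le_nn[of "\<lambda>x. g x - f k x" e] \<open>e > 0\<close> by auto
  qed
  have Cr: "\<exists>k. \<forall>i\<ge>k. \<forall>j\<ge>k. norm (X (r j) - X (r i)) \<le> e" if "e > 0" for e :: real
  proof -
    obtain N where "\<And>m n. m \<ge> N \<Longrightarrow> n \<ge> N \<Longrightarrow> norm (X m - X n) < e"
      using X \<open>e > 0\<close> unfolding Cauchy_iff by metis
    moreover have "r i \<ge> i" for i using r by (rule seq_suble)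
    ultimately show ?thesis by (meson le_trans less_imp_le)
  qed
  have gL2: "g \<in> L2"
  proof -
    obtain k where "\<And>j. j \<ge> k \<Longrightarrow> norm (X (r j) - X (r k)) \<le> 1" using Cr[of 1] by auto
    then have "(\<lambda>x. g x - f k x) \<in> L2" using bnd[of 1 k] by auto
    then have "(\<lambda>x. (g x - f k x) + f k x) \<in> L2" by (intro L2_add fL2)
    then show ?thesis by simp
  qed
  have "(X \<circ> r) \<longlonglongrightarrow> cls g"
  proof (rule LIMSEQ_I)
    fix e :: real assume "e > 0"
    then obtain k where k: "\<And>i j. i \<ge> k \<Longrightarrow> j \<ge> k \<Longrightarrow> norm (X (r j) - X (r i)) \<le> e/2"
      using Cr[of "e/2"] by auto
    have "norm ((X \<circ> r) i - cls g) < e" if "i \<ge> k" for i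
    proof -
      have "norm (cls (\<lambda>x. g x - f i x)) \<le> e/2" using bnd[of "e/2" i] k[of i] that \<open>e > 0\<close> by auto
      then have "norm (cls g - X (r i)) \<le> e/2" by (simp add: cls_diff gL2 fL2 clsf)
      then show ?thesis using \<open>e > 0\<close> by (simp add: norm_minus_commute)
    qed
    then show "\<exists>k. \<forall>i\<ge>k. norm ((X \<circ> r) i - cls g) < e" by blast
  qed
  then show "convergent X"
    using Cauchy_converges_subseq[OF X r] unfolding convergent_def by (metis LIMSEQ_unique)
qed

instance l2 :: banach ..

lemma L2_dominated:
  assumes g: "g \<in> L2" and f: "\<And>n::nat. f n \<in> borel_measurable borel" and h: "h \<in> borel_measurable borel"
    and le: "\<And>n. AE x in lborel. cmod (f n x) \<le> C * cmod (g x)"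
    and lim: "AE x in lborel. (\<lambda>n. f n x) \<longlonglongrightarrow> h x"
  shows "\<And>n. f n \<in> L2" "h \<in> L2" "(\<lambda>n. cls (f n)) \<longlonglongrightarrow> cls h"
proof -
  note [measurable] = f h L2_measurable[OF g]
  show fL2: "f n \<in> L2" for n by (rule L2_bound[OF g f le])
  have all: "AE x in lborel. \<forall>n. cmod (f n x) \<le> C * cmod (g x)"
    using le by (simp add: AE_all_countable)
  have hle: "AE x in lborel. cmod (h x) \<le> C * cmod (g x)"
    using all lim
  proof eventually_elim
    case (elim x)
    have "(\<lambda>n. cmod (f n x)) \<longlonglongrightarrow> cmod (h x)" by (intro tendsto_intros elim)
    then show ?case by (rule Lim_bounded) (use elim in auto)
  qed
  show hL2: "h \<in> L2" by (rule L2_bound[OF g h hle])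
  have "(\<lambda>n. LINT x|lborel. (cmod (f n x - h x))\<^sup>2) \<longlonglongrightarrow> (LINT (x::real)|lborel. (0::real))"
  proof (rule integral_dominated_convergence[where w = "\<lambda>x. (2 * C)\<^sup>2 * (cmod (g x))\<^sup>2"])
    show "AE x in lborel. (\<lambda>n. (cmod (f n x - h x))\<^sup>2) \<longlonglongrightarrow> 0"
      using lim
    proof eventually_elim
      case (elim x)
      have "(\<lambda>n. (cmod (f n x - h x))\<^sup>2) \<longlonglongrightarrow> (cmod (h x - h x))\<^sup>2" by (intro tendsto_intros elim)
      then show ?case by simp
    qed
    show "AE x in lborel. norm ((cmod (f n x - h x))\<^sup>2) \<le> (2 * C)\<^sup>2 * (cmod (g x))\<^sup>2" for n
      using le[of n] hle
    proof eventually_elim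
      case (elim x)
      have "cmod (f n x - h x) \<le> 2 * C * cmod (g x)"
        using norm_triangle_ineq4[of "f n x" "h x"] elim by linarith
      then have "(cmod (f n x - h x))\<^sup>2 \<le> (2 * C * cmod (g x))\<^sup>2" by (intro power_mono) auto
      then show ?case by (simp add: power_mult_distrib)
    qed
    show "integrable lborel (\<lambda>x. (2 * C)\<^sup>2 * (cmod (g x))\<^sup>2)" using g by auto
  qed auto
  then have "(\<lambda>n. (norm (cls (f n) - cls h))\<^sup>2) \<longlonglongrightarrow> 0"
    by (simp add: cls_diff[symmetric] fL2 hL2 norm_cls_sq L2_diff)
  then have "(\<lambda>n. sqrt ((norm (cls (f n) - cls h))\<^sup>2)) \<longlonglongrightarrow> sqrt 0" by (intro tendsto_intros)
  then show "(\<lambda>n. cls (f n)) \<longlonglongrightarrow> cls h" by (simp add: LIM_zero_iff tendsto_norm_zero_iff)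
qed

subsection \<open>Multiplication operators\<close>

definition bmult :: "(real \<Rightarrow> complex) \<Rightarrow> bool" where
  "bmult a \<longleftrightarrow> a \<in> borel_measurable borel \<and> (\<exists>C. \<forall>x. cmod (a x) \<le> C)"

text \<open>One operator with two roles: on the frequency side it is a Fourier multiplier, and with
  a constant symbol it is multiplication by a complex scalar.\<close>

definition mul :: "(real \<Rightarrow> complex) \<Rightarrow> l2 \<Rightarrow> l2" where
  "mul a u = cls (\<lambda>x. a x * fn u x)"

lemma bmultI: "a \<in> borel_measurable borel \<Longrightarrow> (\<And>x. cmod (a x) \<le> C) \<Longrightarrow> bmult a"
  by (auto simp: bmult_def)

lemma bmult_measurable: "bmult a \<Longrightarrow> a \<in> borel_measurable borel"
  by (simp add: bmult_def)

lemma bmult_const [simp]: "bmult (\<lambda>_. c)"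
  by (auto simp: bmult_def)

lemma bmult_times [simp]: "bmult a \<Longrightarrow> bmult b \<Longrightarrow> bmult (\<lambda>x. a x * b x)"
  unfolding bmult_def by (auto simp: norm_mult) (meson mult_mono' norm_ge_zero)

lemma bmult_add [simp]: "bmult a \<Longrightarrow> bmult b \<Longrightarrow> bmult (\<lambda>x. a x + b x)"
  unfolding bmult_def by auto (meson add_mono norm_triangle_le)

lemma bmult_uminus [simp]: "bmult a \<Longrightarrow> bmult (\<lambda>x. - a x)"
  unfolding bmult_def by auto

lemma bmult_diff [simp]: "bmult a \<Longrightarrow> bmult b \<Longrightarrow> bmult (\<lambda>x. a x - b x)"
  using bmult_add[of a "\<lambda>x. - b x"] by simp

lemma bmult_cnj [simp]: "bmult a \<Longrightarrow> bmult (\<lambda>x. cnj (a x))"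
  unfolding bmult_def by auto

lemma L2_bmult: "bmult a \<Longrightarrow> f \<in> L2 \<Longrightarrow> (\<lambda>x. a x * f x) \<in> L2"
  unfolding bmult_def using L2_mult by blast

lemma fn_mul: "bmult a \<Longrightarrow> AE x in lborel. fn (mul a u) x = a x * fn u x"
  unfolding mul_def by (intro fn_cls L2_bmult) auto

lemma mul_cls:
  assumes "bmult a" "f \<in> L2" shows "mul a (cls f) = cls (\<lambda>x. a x * f x)"
  unfolding l2_eq_iff
  using fn_mul[OF assms(1), of "cls f"] fn_cls[OF assms(2)] fn_cls[OF L2_bmult[OF assms]]
  by eventually_elim simp

lemma mul_add: "bmult a \<Longrightarrow> mul a (u + v) = mul a u + mul a v"
  unfolding l2_eq_iff
  using fn_mul[of a "u + v"] fn_mul[of a u] fn_mul[of a v] fn_plus[of u v] fn_plus[of "mul a u" "mul a v"]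
  by (auto simp: distrib_left)

lemma mul_scaleR: "bmult a \<Longrightarrow> mul a (c *\<^sub>R u) = c *\<^sub>R mul a u"
  unfolding l2_eq_iff
  using fn_mul[of a "c *\<^sub>R u"] fn_mul[of a u] fn_scaleR[of c u] fn_scaleR[of c "mul a u"]
  by auto

lemma norm_mul_le:
  assumes "a \<in> borel_measurable borel" "\<And>x. cmod (a x) \<le> C" shows "norm (mul a u) \<le> C * norm u"
proof (rule norm_l2_mono)
  show "AE x in lborel. cmod (fn (mul a u) x) \<le> C * cmod (fn u x)"
    using fn_mul[OF bmultI, OF assms, of u]
  proof eventually_elim
    case (elim x)
    then show ?case by (auto simp: norm_mult assms intro!: mult_right_mono)
  qed
  show "0 \<le> C" using assms(2)[of 0] norm_ge_zero order_trans by blast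
qed

lemma bounded_linear_mul: "bmult a \<Longrightarrow> bounded_linear (mul a)"
proof -
  assume a: "bmult a"
  then obtain C where C: "\<And>x. cmod (a x) \<le> C" by (auto simp: bmult_def)
  show ?thesis
    by (rule bounded_linear_intro[where K = C])
      (use norm_mul_le[OF bmult_measurable[OF a] C] in \<open>auto simp: mul_add mul_scaleR a mult.commute\<close>)
qed

lemma mul_zero [simp]: "bmult a \<Longrightarrow> mul a 0 = 0"
  using bounded_linear_mul bounded_linear.linear linear_0 by blast

lemma mul_diff: "bmult a \<Longrightarrow> mul a (u - v) = mul a u - mul a v"
  using bounded_linear_mul bounded_linear.linear linear_diff by blast

lemma mul_mul: "bmult a \<Longrightarrow> bmult b \<Longrightarrow> mul a (mul b u) = mul (\<lambda>x. a x * b x) u"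
  unfolding l2_eq_iff
  using fn_mul[of a "mul b u"] fn_mul[of b u] fn_mul[of "\<lambda>x. a x * b x" u] by auto

lemma mul_plus_left: "bmult a \<Longrightarrow> bmult b \<Longrightarrow> mul (\<lambda>x. a x + b x) u = mul a u + mul b u"
  unfolding l2_eq_iff
  using fn_mul[of a u] fn_mul[of b u] fn_mul[of "\<lambda>x. a x + b x" u] fn_plus[of "mul a u" "mul b u"]
  by (auto simp: distrib_right)

lemma mul_const_real: "mul (\<lambda>_. complex_of_real c) u = c *\<^sub>R u"
  unfolding l2_eq_iff
  using fn_mul[of "\<lambda>_. complex_of_real c" u] fn_scaleR[of c u] by (auto simp: scaleR_conv_of_real)

lemma mul_one [simp]: "mul (\<lambda>_. 1) u = u"
  using mul_const_real[of 1 u] by simp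

lemma mul_minus_left: "bmult a \<Longrightarrow> bmult b \<Longrightarrow> mul (\<lambda>x. a x - b x) u = mul a u - mul b u"
  unfolding l2_eq_iff
  using fn_mul[of a u] fn_mul[of b u] fn_mul[of "\<lambda>x. a x - b x" u] fn_minus[of "mul a u" "mul b u"]
  by (auto simp: left_diff_distrib)

lemma mul_real_left: "bmult a \<Longrightarrow> mul (\<lambda>x. complex_of_real c * a x) u = c *\<^sub>R mul a u"
  using mul_mul[of "\<lambda>_. complex_of_real c" a u] by (simp add: mul_const_real)

lemma inner_mul:
  assumes "bmult a" shows "inner (mul a u) v = inner u (mul (\<lambda>x. cnj (a x)) v)"
proof -
  have "inner (mul a u) v = (LINT x|lborel. inner (a x * fn u x) (fn v x))"
    unfolding mul_def using inner_cls[OF L2_bmult[OF assms fn_L2] fn_L2] by simp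
  also have "\<dots> = (LINT x|lborel. inner (fn u x) (cnj (a x) * fn v x))"
    by (intro Bochner_Integration.integral_cong) (auto simp: inner_complex_cnj mult_ac)
  also have "\<dots> = inner u (mul (\<lambda>x. cnj (a x)) v)"
    unfolding mul_def using inner_cls[OF fn_L2 L2_bmult[OF bmult_cnj[OF assms] fn_L2]] by simp
  finally show ?thesis .
qed

lemma mul_tendsto:
  assumes "\<And>n::nat. a n \<in> borel_measurable borel" "b \<in> borel_measurable borel"
    "\<And>n x. cmod (a n x) \<le> C" "AE x in lborel. (\<lambda>n. a n x) \<longlonglongrightarrow> b x"
  shows "(\<lambda>n. mul (a n) u) \<longlonglongrightarrow> mul b u"
  unfolding mul_def
proof (rule L2_dominated(3)[OF fn_L2, of _ _ C u])
  show "(\<lambda>x. a n x * fn u x) \<in> borel_measurable borel" for n using assms(1) by measurable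
  show "(\<lambda>x. b x * fn u x) \<in> borel_measurable borel" using assms(2) by measurable
  show "AE x in lborel. cmod (a n x * fn u x) \<le> C * cmod (fn u x)" for n
    using assms(3) by (auto simp: norm_mult intro!: mult_right_mono)
  show "AE x in lborel. (\<lambda>n. a n x * fn u x) \<longlonglongrightarrow> b x * fn u x"
    using assms(4) by eventually_elim (intro tendsto_intros)
qed

subsection \<open>Density of step functions\<close>

lemma L2_indicator [simp]: "A \<in> sets borel \<Longrightarrow> emeasure lborel A < \<infinity> \<Longrightarrow> indicator A \<in> L2"
proof (rule L2_I_nn)
  assume A: "A \<in> sets borel" "emeasure lborel A < \<infinity>"
  have "(\<integral>\<^sup>+ x. ennreal ((cmod (indicator A x))\<^sup>2) \<partial>lborel) = (\<integral>\<^sup>+ x. indicator A x \<partial>lborel)"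
    by (intro nn_integral_cong) (auto simp: indicator_def)
  then show "(\<integral>\<^sup>+ x. ennreal ((cmod (indicator A x))\<^sup>2) \<partial>lborel) < \<infinity>" using A by simp
qed (auto simp: borel_measurable_indicator)

lemma L2_indicator_Icc [simp]: "indicator {a..b::real} \<in> L2"
proof -
  have "emeasure lborel {a..b} \<le> ennreal \<bar>b - a\<bar>"
    by (cases "a \<le> b") auto
  then have "emeasure lborel {a..b} < \<infinity>" by (metis ennreal_less_top infinity_ennreal_def le_less_trans)
  then show ?thesis by simp
qed

text \<open>A property stable under complex linear combinations and limits passes from intervals to
  bounded Borel sets by Dynkin's argument, then to simple functions, then to all of L^2. It serves
  to prove that translations are continuous.\<close>

lemma l2_dense_induct [consumes 0, case_names add scale lim interval]:
  assumes add: "\<And>u v. P u \<Longrightarrow> P v \<Longrightarrow> P (u + v)"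
    and scale: "\<And>c u. P u \<Longrightarrow> P (mul (\<lambda>_. c) u)"
    and lim: "\<And>X u. (\<And>n::nat. P (X n)) \<Longrightarrow> X \<longlonglongrightarrow> u \<Longrightarrow> P u"
    and interval: "\<And>a b. P (cls (indicator {a..b}))"
  shows "P u"
proof -
  have diff: "P (u - v)" if "P u" "P v" for u v
    using add[OF that(1) scale[OF that(2), of "-1"]] mul_const_real[of "-1" v] by simp
  have P0: "P 0"
    using diff[OF interval interval, of 0 0 0 0] by simp
  have Psum: "P (\<Sum>i\<in>I. f i)" if "\<And>i. i \<in> I \<Longrightarrow> P (f i)" "finite I" for f and I :: "'i set"
    using that(2,1) by (induction rule: finite_induct) (auto intro: P0 add)
  have mulind: "mul (indicator A) (cls (indicator {-r..r})) = cls (indicator (A \<inter> {-r..r}))"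
    if "A \<in> sets borel" for A and r :: real
  proof -
    have "bmult (indicator A)"
      using that by (intro bmultI[of _ 1]) (auto simp: borel_measurable_indicator indicator_def)
    then show ?thesis by (subst mul_cls) (auto intro!: arg_cong[of _ _ cls] simp: indicator_def fun_eq_iff)
  qed
  \<comment> \<open>Intersecting with a fixed window [-r, r] keeps the measure finite, so that
    complements remain inside L^2 and intervals form an intersection stable generator.\<close>
  have borel: "P (cls (indicator (A \<inter> {-r..r})))" if "A \<in> sets borel" for A and r :: real
  proof -
    have gen: "sets (borel :: real measure) = sigma_sets UNIV (range (\<lambda>(a, b). {a..b}))"
      unfolding borel_eq_atLeastAtMost by simp
    have "Int_stable (range (\<lambda>(a, b). {a..b::real}))"
      by (auto simp: Int_stable_def)
    moreover have "range (\<lambda>(a, b). {a..b::real}) \<subseteq> Pow UNIV" by simp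
    moreover have "A \<in> sigma_sets UNIV (range (\<lambda>(a, b). {a..b}))" using that gen by simp
    ultimately show ?thesis
    proof (induction rule: sigma_sets_induct_disjoint)
      case (basic A)
      then show ?case using interval by auto
    next
      case empty
      then show ?case using interval[of 1 0] by (simp add: indicator_def[abs_def])
    next
      case (compl A)
      then have [measurable]: "A \<in> sets borel" using gen by simp
      have bm: "bmult (indicator A)"
        by (intro bmultI[of _ 1]) (auto simp: borel_measurable_indicator indicator_def)
      have "cls (indicator ((UNIV - A) \<inter> {-r..r})) = mul (\<lambda>x. 1 - indicator A x) (cls (indicator {-r..r}))"
        using bm by (subst mul_cls[OF bmult_diff[OF bmult_const bm] L2_indicator_Icc])
          (auto intro!: arg_cong[of _ _ cls] simp: indicator_def fun_eq_iff)
      also have "\<dots> = cls (indicator {-r..r}) - cls (indicator (A \<inter> {-r..r}))"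
        using bm by (simp add: mul_minus_left mulind)
      finally show ?case using diff[OF interval compl(2)] by simp
    next
      case (union A)
      then have [measurable]: "A i \<in> sets borel" for i using gen by (auto del: subsetI dest: range_subsetD)
      have bm: "bmult (indicator (A i))" for i
        by (intro bmultI[of _ 1]) (auto simp: borel_measurable_indicator indicator_def)
      have Pn: "P (mul (indicator (\<Union>i<n. A i)) (cls (indicator {-r..r})))" for n :: nat
      proof (induction n)
        case 0
        then show ?case using interval[of 1 0] by (subst mulind) auto
      next
        case (Suc n)
        have bn: "bmult (indicator (\<Union>i<n. A i))"
          by (intro bmultI[of _ 1]) (auto simp: borel_measurable_indicator indicator_def)
        have "indicator (\<Union>i<Suc n. A i) = (\<lambda>x. indicator (\<Union>i<n. A i) x + indicator (A n) x :: complex)"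
        proof
          fix x
          have "x \<notin> A i" if "x \<in> A n" "i < n" for i
            using union(1) that unfolding disjoint_family_on_def by (metis Int_iff UNIV_I empty_iff less_irrefl)
          then show "indicator (\<Union>i<Suc n. A i) x = (indicator (\<Union>i<n. A i) x + indicator (A n) x :: complex)"
            by (auto simp: indicator_def less_Suc_eq)
        qed
        then show ?case using add[OF Suc union(3)[of n]] bm bn by (simp add: mul_plus_left mulind)
      qed
      have "(\<lambda>n. mul (indicator (\<Union>i<n. A i)) (cls (indicator {-r..r})))
          \<longlonglongrightarrow> mul (indicator (\<Union>i. A i)) (cls (indicator {-r..r}))"
      proof (rule mul_tendsto[where C = 1])
        show "AE x in lborel. (\<lambda>n. indicator (\<Union>i<n. A i) x) \<longlonglongrightarrow> (indicator (\<Union>i. A i) x :: complex)"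
          using LIMSEQ_indicator_UN[of A] by (intro AE_I2) simp
      qed (auto simp: borel_measurable_indicator indicator_def)
      from lim[OF Pn this] show ?case by (subst mulind[symmetric]) auto
    qed
  qed
  \<comment> \<open>The bound by 2 |fn u| makes the simple functions dominated. They need not have
    finite support, so they are also cut off to [-i, i].\<close>
  obtain F where F: "\<And>i. simple_function lborel (F i)" "\<And>x. (\<lambda>i. F i x) \<longlonglongrightarrow> fn u x"
      "\<And>i x. dist (F i x) 0 \<le> 2 * dist (fn u x) 0"
    using borel_measurable_implies_sequence_metric[of "fn u" lborel 0] by (auto simp: space_borel)
  have [measurable]: "F i \<in> borel_measurable borel" for i
    using F(1)[of i] borel_measurable_simple_function by fastforce
  define G where "G i x = indicator {-real i..real i} x * F i x" for i x
  have "P (cls (G i))" for i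
  proof -
    have fin: "finite (range (F i))" using F(1)[of i] by (auto simp: simple_function_def)
    have sb: "F i -` {c} \<in> sets borel" for c
    proof (cases "c \<in> range (F i)")
      case True
      then show ?thesis using F(1)[of i] by (auto simp: simple_function_def)
    next
      case False
      then have "F i -` {c} = {}" by auto
      then show ?thesis by simp
    qed
    define b where "b c = cls (indicator ((F i -` {c}) \<inter> {-real i..real i}))" for c
    have L: "indicator ((F i -` {c}) \<inter> {-real i..real i}) \<in> L2" for c
      using sb by (intro L2_bound[OF L2_indicator_Icc[of "-real i" "real i"], of _ 1])
        (auto simp: borel_measurable_indicator indicator_def)
    define k where "k c x = c * indicator ((F i -` {c}) \<inter> {-real i..real i}) x" for c x
    have kL: "k c \<in> L2" and kb: "mul (\<lambda>_. c) (b c) = cls (k c)" for c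
      using L2_bmult[OF bmult_const L, of c c] mul_cls[OF bmult_const L, of c c]
      by (simp_all add: k_def[abs_def] b_def)
    have "(\<Sum>c\<in>I. mul (\<lambda>_. c) (b c)) = cls (\<lambda>x. \<Sum>c\<in>I. k c x) \<and> (\<lambda>x. \<Sum>c\<in>I. k c x) \<in> L2"
      if "finite I" for I
      using that
    proof (induction I rule: finite_induct)
      case empty
      then show ?case by (simp add: zero_l2_def)
    next
      case (insert c I)
      then show ?case by (simp add: cls_add L2_add kL kb)
    qed
    from this[OF fin] have "(\<Sum>c\<in>range (F i). mul (\<lambda>_. c) (b c)) = cls (\<lambda>x. \<Sum>c\<in>range (F i). k c x)" by simp
    also have "(\<lambda>x. \<Sum>c\<in>range (F i). k c x) = G i"
    proof
      fix x
      have "(\<Sum>c\<in>range (F i). k c x)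
          = (\<Sum>c\<in>range (F i). if c = F i x then indicator {-real i..real i} x * F i x else 0)"
        by (intro sum.cong) (auto simp: indicator_def k_def)
      then show "(\<Sum>c\<in>range (F i). k c x) = G i x"
        using fin by (simp add: G_def)
    qed
    finally have eq: "(\<Sum>c\<in>range (F i). mul (\<lambda>_. c) (b c)) = cls (G i)" .
    have Pb: "P (b c)" for c unfolding b_def by (rule borel[OF sb])
    show ?thesis unfolding eq[symmetric] by (intro Psum scale Pb fin)
  qed
  moreover have "(\<lambda>i. cls (G i)) \<longlonglongrightarrow> cls (fn u)"
  proof (rule L2_dominated(3)[OF fn_L2, of _ _ 2 u])
    show "G n \<in> borel_measurable borel" for n unfolding G_def by measurable
    show "AE x in lborel. cmod (G n x) \<le> 2 * cmod (fn u x)" for n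
      using F(3)[of n] by (intro AE_I2) (auto simp: G_def indicator_def)
    show "AE x in lborel. (\<lambda>n. G n x) \<longlonglongrightarrow> fn u x"
    proof (intro AE_I2)
      fix x :: real
      obtain N :: nat where N: "\<bar>x\<bar> \<le> real N" using real_arch_simple by blast
      have "\<forall>\<^sub>F n in sequentially. F n x = G n x"
        using eventually_ge_at_top[of N] by eventually_elim (use N in \<open>auto simp: G_def indicator_def abs_le_iff\<close>)
      then show "(\<lambda>n. G n x) \<longlonglongrightarrow> fn u x" using F(2)[of x] by (rule Lim_transform_eventually[rotated])
    qed
  qed simp
  ultimately have "P (cls (fn u))" by (rule lim)
  then show ?thesis by simp
qed

subsection \<open>Translations\<close>

definition translate :: "real \<Rightarrow> l2 \<Rightarrow> l2" where
  "translate h u = cls (\<lambda>x. fn u (x + h))"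

lemma AE_lborel_shift: "(AE x in lborel. P (x + h)) \<longleftrightarrow> (AE x in lborel. P (x :: real))"
proof -
  have *: "AE x in lborel. P (x + h)" if "AE x in lborel. P x" for P and h :: real
  proof -
    have "AE x in distr lborel borel ((+) h). P x" using that by (subst lborel_distr_plus)
    then have "AE x in lborel. P (h + x)" by (rule AE_distrD[rotated]) simp
    then show ?thesis by (simp add: add.commute)
  qed
  have "AE x in lborel. P x" if "AE x in lborel. P (x + h)"
    using *[OF that, of "- h"] by simp
  with *[of P h] show ?thesis by blast
qed

lemma L2_shift: "f \<in> L2 \<Longrightarrow> (\<lambda>x. f (x + h)) \<in> L2"
proof (rule L2_I)
  assume f: "f \<in> L2"
  show "(\<lambda>x. f (x + h)) \<in> borel_measurable borel" using L2_measurable[OF f] by measurable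
  show "integrable lborel (\<lambda>x. (cmod (f (x + h)))\<^sup>2)"
    using lborel_integrable_real_affine[OF L2_integrable[OF f], of 1 h] by (simp add: add.commute)
qed

lemma fn_translate: "AE x in lborel. fn (translate h u) x = fn u (x + h)"
  unfolding translate_def by (intro fn_cls L2_shift) simp

lemma translate_cls:
  assumes "f \<in> L2" shows "translate h (cls f) = cls (\<lambda>x. f (x + h))"
proof -
  have "AE x in lborel. fn (cls f) (x + h) = f (x + h)"
    using fn_cls[OF assms] AE_lborel_shift[of "\<lambda>x. fn (cls f) x = f x" h] by simp
  then show ?thesis unfolding translate_def by (simp add: cls_eq_iff L2_shift assms)
qed

lemma translate_add: "translate h (u + v) = translate h u + translate h v"
  unfolding l2_eq_iff
  using fn_translate[of h u] fn_translate[of h v] fn_translate[of h "u + v"] fn_plus[of "translate h u" "translate h v"]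
    fn_plus[of u v, folded AE_lborel_shift[of "\<lambda>x. fn (u + v) x = fn u x + fn v x" h]]
  by eventually_elim simp

lemma translate_mul_const: "translate h (mul (\<lambda>_. c) u) = mul (\<lambda>_. c) (translate h u)"
  unfolding l2_eq_iff
  using fn_translate[of h u] fn_translate[of h "mul (\<lambda>_. c) u"] fn_mul[of "\<lambda>_. c" "translate h u"]
    fn_mul[of "\<lambda>_. c" u, folded AE_lborel_shift[of "\<lambda>x. fn (mul (\<lambda>_. c) u) x = c * fn u x" h]]
  by (auto elim: eventually_elim2)

lemma norm_translate [simp]: "norm (translate h u) = norm u"
proof -
  have "(norm (translate h u))\<^sup>2 = (LINT x|lborel. (cmod (fn u (x + h)))\<^sup>2)"
    unfolding translate_def by (intro norm_cls_sq L2_shift) simp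
  also have "\<dots> = (norm u)\<^sup>2"
    unfolding norm_l2_sq using lborel_integral_real_affine[of 1 "\<lambda>x. (cmod (fn u x))\<^sup>2" h]
    by (simp add: add.commute)
  finally show ?thesis by simp
qed

lemma translate_diff: "translate h (u - v) = translate h u - translate h v"
  using translate_add[of h "u - v" v] by (simp add: algebra_simps)

text \<open>Strong continuity of translations. Both sides are linear and isometric in
  \<open>u\<close>, so density reduces it to indicators of intervals, where pointwise convergence
  can fail only at the two end points.\<close>

lemma translate_tendsto:
  assumes "X \<longlonglongrightarrow> 0" shows "(\<lambda>n. translate (X n) u) \<longlonglongrightarrow> u"
proof (induction u rule: l2_dense_induct)
  case (add u v)
  then show ?case by (simp add: translate_add tendsto_add)
next
  case (scale c u)
  then show ?case
    unfolding translate_mul_const by (rule bounded_linear.tendsto[OF bounded_linear_mul[OF bmult_const]])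
next
  case (lim Y u)
  show ?case
  proof (rule LIMSEQ_I)
    fix e :: real assume "e > 0"
    obtain k where k: "norm (Y k - u) < e / 3"
      using LIMSEQ_D[OF lim(2), of "e/3"] \<open>e > 0\<close> by auto
    obtain N where N: "\<And>n. n \<ge> N \<Longrightarrow> norm (translate (X n) (Y k) - Y k) < e / 3"
      using LIMSEQ_D[OF lim(1)[of k], of "e/3"] \<open>e > 0\<close> by auto
    have "norm (translate (X n) u - u) < e" if "n \<ge> N" for n
    proof -
      have "translate (X n) u - u = translate (X n) (u - Y k) + (translate (X n) (Y k) - Y k) + (Y k - u)"
        by (simp add: translate_diff)
      then have "norm (translate (X n) u - u)
          \<le> norm (translate (X n) (u - Y k)) + norm (translate (X n) (Y k) - Y k) + norm (Y k - u)"
        by (metis norm_triangle_ineq norm_triangle_mono order_refl)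
      then show ?thesis using k N[OF that] by (simp add: norm_minus_commute)
    qed
    then show "\<exists>N. \<forall>n\<ge>N. norm (translate (X n) u - u) < e" by blast
  qed
next
  case (interval a b)
  obtain K where K: "\<And>n. \<bar>X n\<bar> \<le> K"
    using convergent_imp_bounded[OF assms] by (auto simp: bounded_iff)
  have "(\<lambda>n. cls (\<lambda>x. indicator {a..b} (x + X n))) \<longlonglongrightarrow> cls (indicator {a..b})"
  \<comment> \<open>All shifts stay below \<open>K\<close>, so the indicator of the enlarged
    interval dominates every shifted one.\<close>
  proof (rule L2_dominated(3)[OF L2_indicator_Icc[of "a - K" "b + K"], where C = 1])
    show "AE x in lborel. cmod (indicator {a..b} (x + X n)) \<le> 1 * cmod (indicator {a - K..b + K} x)" for n
    proof (intro AE_I2)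
      fix x
      show "cmod (indicator {a..b} (x + X n)) \<le> 1 * cmod (indicator {a - K..b + K} x)"
        using K[of n] by (auto simp: indicator_def abs_le_iff)
    qed
    show "AE x in lborel. (\<lambda>n. indicator {a..b} (x + X n)) \<longlonglongrightarrow> (indicator {a..b} x :: complex)"
      using AE_lborel_singleton[of a] AE_lborel_singleton[of b]
    proof eventually_elim
      case (elim x)
      have lim: "(\<lambda>n. x + X n) \<longlonglongrightarrow> x" using tendsto_add[OF tendsto_const assms] by simp
      have "\<forall>\<^sub>F n in sequentially. x + X n \<in> {a..b} \<longleftrightarrow> x \<in> {a..b}"
      proof -
        consider "x < a" | "x > b" | "a < x" "x < b" using elim by linarith
        then show ?thesis
        proof cases
          case 1
          from order_tendstoD(2)[OF lim this] show ?thesis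
            by eventually_elim (use 1 elim in auto)
        next
          case 2
          from order_tendstoD(1)[OF lim this] show ?thesis by eventually_elim (use 2 elim in auto)
        next
          case 3
          from order_tendstoD(1)[OF lim 3(1)] order_tendstoD(2)[OF lim 3(2)] show ?thesis
            by eventually_elim (use 3 in auto)
        qed
      qed
      then have "\<forall>\<^sub>F n in sequentially. indicator {a..b} x = (indicator {a..b} (x + X n) :: complex)"
        by eventually_elim (auto simp: indicator_def)
      then show ?case by (rule Lim_transform_eventually[OF tendsto_const])
    qed
  qed auto
  then show ?case by (simp add: translate_cls)
qed

section \<open>The Fourier transform\<close>

text \<open>The unnormalized pointwise transform, with the sign and constant of
  \<open>fourier\<close>. It is meaningful for integrable functions.\<close>

definition ft :: "(real \<Rightarrow> complex) \<Rightarrow> real \<Rightarrow> complex" where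
  "ft f \<xi> = (LINT x|lborel. exp (- (\<i> * of_real x * of_real \<xi>)) * f x)"

definition L12 :: "(real \<Rightarrow> complex) set" where
  "L12 = {f \<in> L2. integrable lborel f}"

lemma L12_I: "f \<in> L2 \<Longrightarrow> integrable lborel f \<Longrightarrow> f \<in> L12"
  by (simp add: L12_def)

lemma L12_L2: "f \<in> L12 \<Longrightarrow> f \<in> L2"
  by (simp add: L12_def)

lemma L12_integrable: "f \<in> L12 \<Longrightarrow> integrable lborel f"
  by (simp add: L12_def)

declare L12_L2 [simp] L12_integrable [simp]

lemma integrable_mult_bounded:
  fixes f :: "real \<Rightarrow> complex"
  assumes f: "integrable lborel f" and a: "a \<in> borel_measurable borel" "\<And>x. cmod (a x) \<le> C"
  shows "integrable lborel (\<lambda>x. a x * f x)"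
proof (rule Bochner_Integration.integrable_bound[where f = "\<lambda>x. C * norm (f x)"])
  show "AE x in lborel. norm (a x * f x) \<le> norm (C * norm (f x))"
  proof (intro AE_I2)
    fix x
    have "0 \<le> C" using a(2)[of 0] norm_ge_zero order_trans by blast
    then show "norm (a x * f x) \<le> norm (C * norm (f x))"
      using a(2)[of x] by (simp add: norm_mult mult_right_mono)
  qed
qed (use f a in auto)

lemma integrable_ft: "integrable lborel f \<Longrightarrow> integrable lborel (\<lambda>x. exp (- (\<i> * of_real x * of_real \<xi>)) * f x)"
  by (rule integrable_mult_bounded[where C = 1]) auto

lemma ft_measurable [measurable]:
  assumes "f \<in> borel_measurable borel" shows "ft f \<in> borel_measurable borel"
proof -
  note [measurable] = assms
  show ?thesis unfolding ft_def
    by (rule lborel.borel_measurable_lebesgue_integral[of _ borel, simplified]) measurable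
qed

lemma norm_ft_le: "cmod (ft f \<xi>) \<le> (LINT x|lborel. cmod (f x))"
proof -
  have "cmod (ft f \<xi>) \<le> (LINT x|lborel. cmod (exp (- (\<i> * of_real x * of_real \<xi>)) * f x))"
    unfolding ft_def by (rule integral_norm_bound)
  then show ?thesis by (simp add: norm_mult)
qed

lemma ft_cong_AE:
  assumes "AE x in lborel. f x = g x" "f \<in> borel_measurable borel" "g \<in> borel_measurable borel"
  shows "ft f = ft g"
  unfolding ft_def fun_eq_iff using assms by (intro allI integral_cong_AE) auto

lemma ft_add: "integrable lborel f \<Longrightarrow> integrable lborel g \<Longrightarrow> ft (\<lambda>x. f x + g x) = (\<lambda>\<xi>. ft f \<xi> + ft g \<xi>)"
  unfolding ft_def fun_eq_iff by (simp add: distrib_left integrable_ft)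

lemma ft_mult_const: "ft (\<lambda>x. c * f x) = (\<lambda>\<xi>. c * ft f \<xi>)"
  unfolding ft_def fun_eq_iff by (simp add: mult.left_commute)

lemma ft_diff: "integrable lborel f \<Longrightarrow> integrable lborel g \<Longrightarrow> ft (\<lambda>x. f x - g x) = (\<lambda>\<xi>. ft f \<xi> - ft g \<xi>)"
  unfolding ft_def fun_eq_iff by (simp add: right_diff_distrib integrable_ft)

lemma ft_shift: "ft (\<lambda>x. f (x + h)) \<xi> = exp (\<i> * of_real h * of_real \<xi>) * ft f \<xi>"
proof -
  have "ft f \<xi> = (LINT x|lborel. exp (- (\<i> * of_real (h + x) * of_real \<xi>)) * f (h + x))"
    unfolding ft_def by (subst lborel_integral_real_affine[of 1 _ h]) auto
  also have "\<dots> = (LINT x|lborel. exp (- (\<i> * of_real h * of_real \<xi>))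
      * (exp (- (\<i> * of_real x * of_real \<xi>)) * f (x + h)))"
  proof (intro Bochner_Integration.integral_cong refl)
    fix x
    have "exp (- (\<i> * of_real (h + x) * of_real \<xi>))
        = exp (- (\<i> * of_real h * of_real \<xi>)) * exp (- (\<i> * of_real x * of_real \<xi>))"
      by (simp add: exp_add[symmetric] algebra_simps)
    then show "exp (- (\<i> * of_real (h + x) * of_real \<xi>)) * f (h + x)
        = exp (- (\<i> * of_real h * of_real \<xi>)) * (exp (- (\<i> * of_real x * of_real \<xi>)) * f (x + h))"
      by (simp add: add.commute)
  qed
  also have "\<dots> = exp (- (\<i> * of_real h * of_real \<xi>)) * ft (\<lambda>x. f (x + h)) \<xi>"
    by (simp add: ft_def)
  finally show ?thesis by (simp add: exp_minus)
qed

subsection \<open>Plancherel's identity\<close>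

lemma integral_gauss_char:
  "(LINT s|lborel. of_real (std_normal_density s) * iexp (t * s)) = complex_of_real (exp (- t\<^sup>2 / 2))"
proof -
  have "complex_of_real (exp (- t\<^sup>2 / 2)) = char std_normal_distribution t"
    by (simp add: char_std_normal_distribution)
  also have "\<dots> = (LINT s|lborel. std_normal_density s *\<^sub>R iexp (t * s))"
    unfolding char_def by (subst integral_density) (auto intro: normal_density_nonneg)
  finally show ?thesis by (simp add: scaleR_conv_of_real)
qed

text \<open>The characteristic function of the normal law after rescaling by \<open>n\<close>. As a
  function of \<open>h\<close> the result is 2 pi times a probability density of width 1/n, an
  approximate identity.\<close>

lemma gauss_kernel:
  assumes "n > 0"
  shows "(LINT \<xi>|lborel. of_real (exp (- (\<xi> / n)\<^sup>2 / 2)) * exp (\<i> * of_real h * of_real \<xi>))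
     = complex_of_real (2 * pi * n * std_normal_density (n * h))"
proof -
  let ?g = "\<lambda>\<xi>. of_real (exp (- (\<xi> / n)\<^sup>2 / 2)) * exp (\<i> * of_real h * of_real \<xi>)"
  have e: "exp (- s\<^sup>2 / 2) = sqrt (2 * pi) * std_normal_density s" for s
    by (simp add: std_normal_density_def)
  have "(LINT \<xi>|lborel. ?g \<xi>) = n *\<^sub>R (LINT s|lborel. ?g (0 + n * s))"
    using assms by (subst lborel_integral_real_affine[of n _ 0]) auto
  also have "(LINT s|lborel. ?g (0 + n * s))
      = (LINT s|lborel. of_real (sqrt (2 * pi)) * (of_real (std_normal_density s) * iexp ((n * h) * s)))"
  proof (intro Bochner_Integration.integral_cong refl)
    fix s
    have "complex_of_real (exp (- s\<^sup>2 / 2)) = of_real (sqrt (2 * pi)) * of_real (std_normal_density s)"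
      unfolding e by simp
    then show "?g (0 + n * s) = of_real (sqrt (2 * pi)) * (of_real (std_normal_density s) * iexp ((n * h) * s))"
      using assms by (simp add: mult_ac)
  qed
  also have "\<dots> = of_real (sqrt (2 * pi)) * complex_of_real (exp (- (n * h)\<^sup>2 / 2))"
    by (simp add: integral_gauss_char del: of_real_mult)
  also have "n *\<^sub>R \<dots> = complex_of_real (n * (sqrt (2 * pi) * (sqrt (2 * pi) * std_normal_density (n * h))))"
    unfolding e by (simp add: scaleR_conv_of_real)
  also have "n * (sqrt (2 * pi) * (sqrt (2 * pi) * std_normal_density (n * h)))
      = 2 * pi * n * std_normal_density (n * h)"
    by simp
  finally show ?thesis .
qed

lemma autocorrelation_integrable:
  fixes f :: "real \<Rightarrow> complex"
  assumes "integrable lborel f"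
  shows "integrable (lborel \<Otimes>\<^sub>M lborel) (\<lambda>(x, h). f x * cnj (f (x + h)))"
proof (rule lborel_pair.Fubini_integrable)
  have [measurable]: "f \<in> borel_measurable borel" using assms by auto
  show "(\<lambda>(x, h). f x * cnj (f (x + h))) \<in> borel_measurable (lborel \<Otimes>\<^sub>M lborel)" by measurable
  have i: "integrable lborel (\<lambda>h. f (x + h))" for x
    using lborel_integrable_real_affine[OF assms, of 1 x] by simp
  have "(LINT h|lborel. cmod (f (x + h))) = (LINT h|lborel. cmod (f h))" for x
    using lborel_integral_real_affine[of 1 "\<lambda>h. cmod (f h)" x] by simp
  then show "integrable lborel (\<lambda>x. LINT y|lborel. norm (case (x, y) of (x, h) \<Rightarrow> f x * cnj (f (x + h))))"
    using assms by (simp add: norm_mult)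
  show "AE x in lborel. integrable lborel (\<lambda>y. case (x, y) of (x, h) \<Rightarrow> f x * cnj (f (x + h)))"
    using i by simp
qed

text \<open>Writing |ft f|^2 as a double integral and substituting y = x + h collects the phase in
  \<open>h\<close> alone. The autocorrelation is integrable in the pair (x, h), so Fubini
  applies.\<close>

lemma ft_sq_autocorrelation:
  assumes f: "integrable lborel f"
  shows "of_real ((cmod (ft f \<xi>))\<^sup>2)
     = (LINT h|lborel. exp (\<i> * of_real h * of_real \<xi>) * (LINT x|lborel. f x * cnj (f (x + h))))"
proof -
  have [measurable]: "f \<in> borel_measurable borel" using f by auto
  let ?G = "\<lambda>x h. exp (\<i> * of_real h * of_real \<xi>) * (f x * cnj (f (x + h)))"
  have G: "integrable (lborel \<Otimes>\<^sub>M lborel) (case_prod ?G)"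
  proof (rule Bochner_Integration.integrable_bound[OF autocorrelation_integrable[OF f]])
    show "case_prod ?G \<in> borel_measurable (lborel \<Otimes>\<^sub>M lborel)" by measurable
  qed (auto simp: norm_mult)
  have "of_real ((cmod (ft f \<xi>))\<^sup>2) = ft f \<xi> * cnj (ft f \<xi>)"
    by (rule complex_norm_square)
  also have "\<dots> = (LINT x|lborel. exp (- (\<i> * of_real x * of_real \<xi>)) * f x * cnj (ft f \<xi>))"
    by (simp add: ft_def)
  also have "\<dots> = (LINT x|lborel. LINT h|lborel. ?G x h)"
  proof (intro Bochner_Integration.integral_cong refl)
    fix x
    have "cnj (ft f \<xi>) = (LINT y|lborel. cnj (exp (- (\<i> * of_real y * of_real \<xi>)) * f y))"
      unfolding ft_def by (rule Bochner_Integration.integral_cnj[symmetric])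
    also have "\<dots> = (LINT h|lborel. exp (\<i> * of_real (x + h) * of_real \<xi>) * cnj (f (x + h)))"
      by (subst lborel_integral_real_affine[of 1 _ x]) (auto simp: exp_cnj)
    finally have "exp (- (\<i> * of_real x * of_real \<xi>)) * f x * cnj (ft f \<xi>)
        = (LINT h|lborel. exp (- (\<i> * of_real x * of_real \<xi>)) * f x
            * (exp (\<i> * of_real (x + h) * of_real \<xi>) * cnj (f (x + h))))"
      by simp
    also have "\<dots> = (LINT h|lborel. ?G x h)"
    proof (intro Bochner_Integration.integral_cong refl)
      fix h
      have "exp (- (\<i> * of_real x * of_real \<xi>)) * exp (\<i> * of_real (x + h) * of_real \<xi>)
          = exp (\<i> * of_real h * of_real \<xi>)"
        by (simp add: exp_add[symmetric] algebra_simps)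
      then show "exp (- (\<i> * of_real x * of_real \<xi>)) * f x
            * (exp (\<i> * of_real (x + h) * of_real \<xi>) * cnj (f (x + h))) = ?G x h"
        by (simp add: mult_ac)
    qed
    finally show "exp (- (\<i> * of_real x * of_real \<xi>)) * f x * cnj (ft f \<xi>) = (LINT h|lborel. ?G x h)" .
  qed
  also have "\<dots> = (LINT h|lborel. LINT x|lborel. ?G x h)"
    by (rule lborel_pair.Fubini_integral[OF G, symmetric])
  finally show ?thesis by simp
qed

text \<open>The Gaussian weight makes the frequency integral absolutely convergent, so it can be
  exchanged with the integral over the shift and evaluated by \<open>gauss_kernel\<close>. The left
  side is real, so only the real part of the autocorrelation counts, and that is the inner product
  of \<open>f\<close> with its translate.\<close>

lemma ft_sq_gauss:
  assumes f: "f \<in> L12" and n: "n > 0"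
  shows "integrable lborel (\<lambda>\<xi>. exp (- (\<xi> / n)\<^sup>2 / 2) * (cmod (ft f \<xi>))\<^sup>2)"
    and "(LINT \<xi>|lborel. exp (- (\<xi> / n)\<^sup>2 / 2) * (cmod (ft f \<xi>))\<^sup>2)
      = 2 * pi * (LINT s|lborel. std_normal_density s * inner (translate (s / n) (cls f)) (cls f))"
proof -
  have int: "integrable lborel f" and [measurable]: "f \<in> borel_measurable borel"
    using f by (auto simp: L2_measurable)
  define w where "w \<xi> = exp (- (\<xi> / n)\<^sup>2 / 2)" for \<xi>
  have [measurable]: "w \<in> borel_measurable borel" unfolding w_def by measurable
  have w: "integrable lborel w"
  proof -
    have "integrable lborel (\<lambda>\<xi>. sqrt (2 * pi) * std_normal_density (0 + (1 / n) * \<xi>))"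
      using n by (intro integrable_mult_right lborel_integrable_real_affine integrable_normal_density) auto
    then show ?thesis by (simp add: w_def[abs_def] std_normal_density_def)
  qed
  have wpos: "0 \<le> w \<xi>" for \<xi> by (simp add: w_def)
  show i: "integrable lborel (\<lambda>\<xi>. exp (- (\<xi> / n)\<^sup>2 / 2) * (cmod (ft f \<xi>))\<^sup>2)"
    unfolding w_def[symmetric]
  proof (rule Bochner_Integration.integrable_bound[where f = "\<lambda>\<xi>. w \<xi> * (LINT x|lborel. cmod (f x))\<^sup>2"])
    show "AE \<xi> in lborel. norm (w \<xi> * (cmod (ft f \<xi>))\<^sup>2) \<le> norm (w \<xi> * (LINT x|lborel. cmod (f x))\<^sup>2)"
      using wpos by (intro AE_I2) (auto simp: abs_mult intro!: mult_left_mono power_mono norm_ft_le)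
  qed (use w in auto)
  define A where "A h = (LINT x|lborel. f x * cnj (f (x + h)))" for h
  have Aint: "integrable lborel A"
    unfolding A_def using lborel_pair.integrable_snd[OF autocorrelation_integrable[OF int]] .
  then have [measurable]: "A \<in> borel_measurable borel" by auto
  let ?K = "\<lambda>\<xi> h. of_real (w \<xi>) * (exp (\<i> * of_real h * of_real \<xi>) * A h)"
  have K: "integrable (lborel \<Otimes>\<^sub>M lborel) (case_prod ?K)"
  proof (rule lborel_pair.Fubini_integrable)
    show "case_prod ?K \<in> borel_measurable (lborel \<Otimes>\<^sub>M lborel)" by measurable
    show "integrable lborel (\<lambda>x. LINT y|lborel. norm (case (x, y) of (\<xi>, h) \<Rightarrow> ?K \<xi> h))"
      using w wpos by (simp add: norm_mult)
    show "AE x in lborel. integrable lborel (\<lambda>y. case (x, y) of (\<xi>, h) \<Rightarrow> ?K \<xi> h)"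
      using integrable_mult_bounded[OF Aint, of "\<lambda>h. exp (\<i> * of_real h * of_real _)" 1] by (intro AE_I2) simp
  qed
  have ReA: "Re (A h) = inner (translate h (cls f)) (cls f)" for h
  proof -
    have fs: "(\<lambda>x. f (x + h)) \<in> L2" using f by (simp add: L2_shift)
    have "integrable lborel (\<lambda>x. f x * cnj (f (x + h)))"
    proof (rule L2_prod_integrable)
      show "f \<in> L2" using f by simp
      show "(\<lambda>x. cnj (f (x + h))) \<in> L2" by (rule L2_bound[OF fs, of _ 1]) auto
    qed
    then have "Re (A h) = (LINT x|lborel. Re (f x * cnj (f (x + h))))"
      unfolding A_def by (rule integral_Re[symmetric])
    also have "\<dots> = (LINT x|lborel. inner (f (x + h)) (f x))"
      by (intro Bochner_Integration.integral_cong) (auto simp: inner_complex_def)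
    finally show ?thesis using f fs by (simp add: translate_cls inner_cls)
  qed
  have "complex_of_real (LINT \<xi>|lborel. w \<xi> * (cmod (ft f \<xi>))\<^sup>2)
      = (LINT \<xi>|lborel. of_real (w \<xi>) * of_real ((cmod (ft f \<xi>))\<^sup>2))"
    by (subst integral_complex_of_real[symmetric]) simp
  also have "\<dots> = (LINT \<xi>|lborel. LINT h|lborel. ?K \<xi> h)"
    unfolding ft_sq_autocorrelation[OF int] A_def[symmetric] by simp
  also have "\<dots> = (LINT h|lborel. LINT \<xi>|lborel. ?K \<xi> h)"
    by (rule lborel_pair.Fubini_integral[OF K, symmetric])
  also have "\<dots> = (LINT h|lborel. complex_of_real (2 * pi * n * std_normal_density (n * h)) * A h)"
  proof (intro Bochner_Integration.integral_cong refl)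
    fix h
    have "(LINT \<xi>|lborel. ?K \<xi> h) = (LINT \<xi>|lborel. of_real (w \<xi>) * exp (\<i> * of_real h * of_real \<xi>) * A h)"
      by (simp add: mult.assoc)
    also have "\<dots> = (LINT \<xi>|lborel. of_real (w \<xi>) * exp (\<i> * of_real h * of_real \<xi>)) * A h"
      by simp
    finally show "(LINT \<xi>|lborel. ?K \<xi> h) = complex_of_real (2 * pi * n * std_normal_density (n * h)) * A h"
      unfolding w_def gauss_kernel[OF n] .
  qed
  also have "\<dots> = (1 / n) *\<^sub>R (LINT s|lborel. complex_of_real (2 * pi * n * std_normal_density s) * A (s / n))"
    using n by (subst lborel_integral_real_affine[of "1 / n" _ 0]) auto
  also have "\<dots> = (LINT s|lborel. complex_of_real (2 * pi * std_normal_density s) * A (s / n))"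
    unfolding integral_scaleR_right[symmetric]
    using n by (intro Bochner_Integration.integral_cong refl) (simp add: scaleR_conv_of_real)
  finally have E: "complex_of_real (LINT \<xi>|lborel. w \<xi> * (cmod (ft f \<xi>))\<^sup>2)
      = (LINT s|lborel. complex_of_real (2 * pi * std_normal_density s) * A (s / n))" .
  have Aint2: "integrable lborel (\<lambda>s. complex_of_real (2 * pi * std_normal_density s) * A (s / n))"
  proof (rule integrable_mult_bounded)
    show "integrable lborel (\<lambda>s. A (s / n))"
      using lborel_integrable_real_affine[OF Aint, of "1/n" 0] n by simp
    show "cmod (complex_of_real (2 * pi * std_normal_density s)) \<le> 2 * pi * (1 / sqrt (2 * pi))" for s
      unfolding norm_of_real std_normal_density_def by (auto simp: abs_mult divide_right_mono)
  qed measurable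
  have "(LINT \<xi>|lborel. w \<xi> * (cmod (ft f \<xi>))\<^sup>2)
      = Re (LINT s|lborel. complex_of_real (2 * pi * std_normal_density s) * A (s / n))"
    by (subst E[symmetric]) simp
  also have "\<dots> = (LINT s|lborel. Re (complex_of_real (2 * pi * std_normal_density s) * A (s / n)))"
    by (rule integral_Re[symmetric, OF Aint2])
  also have "\<dots> = (LINT s|lborel. 2 * pi * (std_normal_density s * inner (translate (s / n) (cls f)) (cls f)))"
    by (simp add: ReA[symmetric] mult.assoc)
  finally show "(LINT \<xi>|lborel. exp (- (\<xi> / n)\<^sup>2 / 2) * (cmod (ft f \<xi>))\<^sup>2)
      = 2 * pi * (LINT s|lborel. std_normal_density s * inner (translate (s / n) (cls f)) (cls f))"
    by (simp add: w_def)
qed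

text \<open>Let n tend to infinity in \<open>ft_sq_gauss\<close>. The right side converges by
  continuity of translations and dominated convergence. The Gaussian weights increase to 1, so
  monotone convergence yields both the integrability of |ft f|^2 and its value.\<close>

theorem plancherel_L12:
  assumes f: "f \<in> L12"
  shows "ft f \<in> L2" "(norm (cls (ft f)))\<^sup>2 = 2 * pi * (norm (cls f))\<^sup>2"
proof -
  have [measurable]: "f \<in> borel_measurable borel" using f by (simp add: L2_measurable)
  let ?u = "cls f"
  define I where "I n \<xi> = exp (- (\<xi> / real (Suc n))\<^sup>2 / 2) * (cmod (ft f \<xi>))\<^sup>2" for n \<xi>
  have inn_meas [measurable]: "(\<lambda>h. inner (translate h ?u) ?u) \<in> borel_measurable borel"
  proof -
    have "continuous_on UNIV (\<lambda>h. inner (translate h ?u) ?u)"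
    proof (rule continuous_on_sequentiallyI, simp_all)
      fix X :: "nat \<Rightarrow> real" and a assume X: "X \<longlonglongrightarrow> a"
      have eq: "translate (X n) ?u = translate (X n - a) (translate a ?u)" for n
        using f by (simp add: translate_cls L2_shift add.assoc)
      have "(\<lambda>n. X n - a) \<longlonglongrightarrow> 0" using X by (simp add: LIM_zero)
      from translate_tendsto[OF this, of "translate a ?u"]
      have "(\<lambda>n. translate (X n) ?u) \<longlonglongrightarrow> translate a ?u" by (simp add: eq)
      then show "(\<lambda>n. inner (translate (X n) ?u) ?u) \<longlonglongrightarrow> inner (translate a ?u) ?u" by (intro tendsto_intros)
    qed
    then show ?thesis by (rule borel_measurable_continuous_onI)
  qed
  have lim: "(\<lambda>n. LINT \<xi>|lborel. I n \<xi>) \<longlonglongrightarrow> 2 * pi * (norm ?u)\<^sup>2"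
  proof -
    have "(\<lambda>n. LINT s|lborel. std_normal_density s * inner (translate (s / real (Suc n)) ?u) ?u)
        \<longlonglongrightarrow> (LINT s|lborel. std_normal_density s * inner ?u ?u)"
    proof (rule integral_dominated_convergence[where w = "\<lambda>s. std_normal_density s * (norm ?u)\<^sup>2"])
      show "AE s in lborel. (\<lambda>n. std_normal_density s * inner (translate (s / real (Suc n)) ?u) ?u)
          \<longlonglongrightarrow> std_normal_density s * inner ?u ?u"
      proof (intro AE_I2 tendsto_intros translate_tendsto)
        fix s :: real
        show "(\<lambda>n. s / real (Suc n)) \<longlonglongrightarrow> 0"
          by (rule LIMSEQ_Suc[OF lim_const_over_n])
      qed
      show "AE s in lborel. norm (std_normal_density s * inner (translate (s / real (Suc n)) ?u) ?u)
          \<le> std_normal_density s * (norm ?u)\<^sup>2" for n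
      proof (intro AE_I2)
        fix s :: real
        have "\<bar>inner (translate (s / real (Suc n)) ?u) ?u\<bar> \<le> (norm ?u)\<^sup>2"
          using Cauchy_Schwarz_ineq2[of "translate (s / real (Suc n)) ?u" ?u] by (simp add: power2_eq_square)
        then show "norm (std_normal_density s * inner (translate (s / real (Suc n)) ?u) ?u)
            \<le> std_normal_density s * (norm ?u)\<^sup>2"
          by (simp add: abs_mult normal_density_nonneg mult_left_mono)
      qed
      show "integrable lborel (\<lambda>s. std_normal_density s * (norm ?u)\<^sup>2)"
        by (intro integrable_mult_left integrable_normal_density) auto
    qed auto
    also have "(LINT s|lborel. std_normal_density s * inner ?u ?u) = (norm ?u)\<^sup>2"
      using integral_normal_density[of 1 0] by (simp add: power2_norm_eq_inner)
    finally show ?thesis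
      unfolding I_def using ft_sq_gauss(2)[OF f] by (auto intro!: tendsto_intros)
  qed
  have mono: "AE \<xi> in lborel. mono (\<lambda>n. I n \<xi>)"
  proof (intro AE_I2 monoI)
    fix \<xi> :: real and m n :: nat assume "m \<le> n"
    then have "(\<xi> / real (Suc n))\<^sup>2 \<le> (\<xi> / real (Suc m))\<^sup>2"
      unfolding power_divide by (intro divide_left_mono power_mono) auto
    then show "I m \<xi> \<le> I n \<xi>" unfolding I_def by (intro mult_right_mono) auto
  qed
  have ptw: "AE \<xi> in lborel. (\<lambda>n. I n \<xi>) \<longlonglongrightarrow> (cmod (ft f \<xi>))\<^sup>2"
  proof (intro AE_I2)
    fix \<xi> :: real
    have "(\<lambda>n. \<xi> / real (Suc n)) \<longlonglongrightarrow> 0"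
      by (rule LIMSEQ_Suc[OF lim_const_over_n])
    then have "(\<lambda>n. I n \<xi>) \<longlonglongrightarrow> exp (- 0\<^sup>2 / 2) * (cmod (ft f \<xi>))\<^sup>2"
      unfolding I_def by (intro tendsto_intros) auto
    then show "(\<lambda>n. I n \<xi>) \<longlonglongrightarrow> (cmod (ft f \<xi>))\<^sup>2" by simp
  qed
  have Iint: "integrable lborel (I n)" for n
    unfolding I_def using ft_sq_gauss(1)[OF f, of "real (Suc n)"] by simp
  have "integrable lborel (\<lambda>\<xi>. (cmod (ft f \<xi>))\<^sup>2)"
    by (rule integrable_monotone_convergence[OF Iint mono ptw lim]) measurable
  then show L2: "ft f \<in> L2" by (intro L2_I) auto
  have "(LINT \<xi>|lborel. (cmod (ft f \<xi>))\<^sup>2) = 2 * pi * (norm ?u)\<^sup>2"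
    by (rule integral_monotone_convergence[OF Iint mono ptw lim]) measurable
  then show "(norm (cls (ft f)))\<^sup>2 = 2 * pi * (norm (cls f))\<^sup>2" by (simp add: norm_cls_sq L2)
qed

lemma inverse_sqrt_2pi: "(1 / sqrt (2 * pi))\<^sup>2 * (2 * pi) = 1"
  by (simp add: power_divide)

text \<open>The factor makes the transform unitary.\<close>

definition F1 :: "(real \<Rightarrow> complex) \<Rightarrow> l2" where
  "F1 f = (1 / sqrt (2 * pi)) *\<^sub>R cls (ft f)"

lemma norm_F1: assumes "f \<in> L12" shows "norm (F1 f) = norm (cls f)"
proof -
  have "(norm (F1 f))\<^sup>2 = (1 / sqrt (2 * pi))\<^sup>2 * (2 * pi) * (norm (cls f))\<^sup>2"
    unfolding F1_def by (simp add: power_mult_distrib plancherel_L12(2)[OF assms] power_divide)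
  then show ?thesis unfolding inverse_sqrt_2pi by simp
qed

lemma L12_diff: "f \<in> L12 \<Longrightarrow> g \<in> L12 \<Longrightarrow> (\<lambda>x. f x - g x) \<in> L12"
  by (intro L12_I L2_diff) auto

lemma F1_add: "f \<in> L12 \<Longrightarrow> g \<in> L12 \<Longrightarrow> F1 (\<lambda>x. f x + g x) = F1 f + F1 g"
  by (simp add: F1_def ft_add cls_add plancherel_L12(1) scaleR_add_right)

lemma F1_diff: "f \<in> L12 \<Longrightarrow> g \<in> L12 \<Longrightarrow> F1 (\<lambda>x. f x - g x) = F1 f - F1 g"
  by (simp add: F1_def ft_diff cls_diff plancherel_L12(1) scaleR_diff_right)

lemma F1_mult: "f \<in> L12 \<Longrightarrow> F1 (\<lambda>x. c * f x) = mul (\<lambda>_. c) (F1 f)"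
  by (simp add: F1_def ft_mult_const mul_scaleR mul_cls plancherel_L12(1))

section \<open>Extension of the transform to L^2 by truncation\<close>

definition cutoff :: "real \<Rightarrow> real \<Rightarrow> complex" where
  "cutoff R x = indicator {-R..R} x"

lemma bmult_indicator: "A \<in> sets borel \<Longrightarrow> bmult (indicator A)"
  by (intro bmultI[of _ 1]) (auto simp: borel_measurable_indicator indicator_def)

lemma bmult_cutoff [simp]: "bmult (cutoff R)"
  unfolding cutoff_def[abs_def] by (rule bmult_indicator) simp

lemma cutoff_measurable [measurable]: "cutoff R \<in> borel_measurable borel"
  by (rule bmult_measurable) simp

lemma norm_cutoff_le: "cmod (cutoff R x) \<le> 1"
  by (simp add: cutoff_def indicator_def)

lemma L12_cutoff: assumes "f \<in> L2" shows "(\<lambda>x. cutoff R x * f x) \<in> L12"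
proof (rule L12_I)
  show "(\<lambda>x. cutoff R x * f x) \<in> L2" using assms by (intro L2_bmult) auto
  show "integrable lborel (\<lambda>x. cutoff R x * f x)"
    unfolding cutoff_def by (intro L2_prod_integrable assms L2_indicator_Icc)
qed

lemma cutoff_tendsto: "(\<lambda>n. mul (cutoff (real n)) u) \<longlonglongrightarrow> u"
proof -
  have "(\<lambda>n. mul (cutoff (real n)) u) \<longlonglongrightarrow> mul (\<lambda>_. 1) u"
  proof (rule mul_tendsto[where C = 1])
    show "AE x in lborel. (\<lambda>n. cutoff (real n) x) \<longlonglongrightarrow> 1"
    proof (intro AE_I2)
      fix x :: real
      obtain N :: nat where N: "\<bar>x\<bar> \<le> real N" using real_arch_simple by blast
      have "\<forall>\<^sub>F n in sequentially. 1 = cutoff (real n) x"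
        using eventually_ge_at_top[of N]
        by eventually_elim (use N in \<open>auto simp: cutoff_def indicator_def abs_le_iff\<close>)
      then show "(\<lambda>n. cutoff (real n) x) \<longlonglongrightarrow> 1" by (rule Lim_transform_eventually[OF tendsto_const])
    qed
  qed (auto simp: norm_cutoff_le)
  then show ?thesis by simp
qed

lemma l2_L12_induct [case_names L12 lim]:
  assumes "\<And>f. f \<in> L12 \<Longrightarrow> P (cls f)"
    and lim: "\<And>X u. (\<And>n::nat. P (X n)) \<Longrightarrow> X \<longlonglongrightarrow> u \<Longrightarrow> P u"
  shows "P u"
proof (rule lim)
  show "(\<lambda>n. mul (cutoff (real n)) u) \<longlonglongrightarrow> u" by (rule cutoff_tendsto)
  show "P (mul (cutoff (real n)) u)" for n unfolding mul_def by (intro assms(1) L12_cutoff) simp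
qed

text \<open>The limit exists because \<open>F1\<close> is isometric on \<open>L12\<close> and
  truncations converge in L^2.\<close>

definition FT :: "l2 \<Rightarrow> l2" where
  "FT u = lim (\<lambda>n. F1 (\<lambda>x. cutoff (real n) x * fn u x))"

lemma FT_lim: "(\<lambda>n. F1 (\<lambda>x. cutoff (real n) x * fn u x)) \<longlonglongrightarrow> FT u"
proof -
  let ?f = "\<lambda>n x. cutoff (real n) x * fn u x"
  have "norm (F1 (?f m) - F1 (?f n)) = norm (mul (cutoff (real m)) u - mul (cutoff (real n)) u)" for m n
  proof -
    have "norm (F1 (?f m) - F1 (?f n)) = norm (F1 (\<lambda>x. ?f m x - ?f n x))"
      by (simp add: F1_diff L12_cutoff)
    also have "\<dots> = norm (cls (\<lambda>x. ?f m x - ?f n x))"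
      by (intro norm_F1 L12_diff L12_cutoff) auto
    finally show ?thesis by (simp add: cls_diff L12_cutoff mul_def)
  qed
  then have "Cauchy (\<lambda>n. F1 (?f n))"
    using LIMSEQ_imp_Cauchy[OF cutoff_tendsto[of u]] unfolding Cauchy_iff by simp
  then show ?thesis unfolding FT_def using Cauchy_convergent convergent_LIMSEQ_iff by blast
qed

lemma FT_cls: assumes f: "f \<in> L12" shows "FT (cls f) = F1 f"
proof (rule LIMSEQ_unique[OF FT_lim])
  let ?f = "\<lambda>n x. cutoff (real n) x * f x"
  have [measurable]: "f \<in> borel_measurable borel" using f by (simp add: L2_measurable)
  have eq: "F1 (\<lambda>x. cutoff (real n) x * fn (cls f) x) = F1 (?f n)" for n
  proof -
    have "ft (\<lambda>x. cutoff (real n) x * fn (cls f) x) = ft (?f n)"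
      using fn_cls[OF L12_L2[OF f]] by (intro ft_cong_AE) auto
    then show ?thesis by (simp add: F1_def)
  qed
  have "norm (F1 (?f n) - F1 f) = norm (mul (cutoff (real n)) (cls f) - cls f)" for n
  proof -
    have "norm (F1 (?f n) - F1 f) = norm (F1 (\<lambda>x. ?f n x - f x))"
      using f by (simp add: F1_diff L12_cutoff)
    also have "\<dots> = norm (cls (\<lambda>x. ?f n x - f x))"
      using f by (intro norm_F1 L12_diff L12_cutoff) auto
    finally show ?thesis using f by (simp add: cls_diff L12_cutoff mul_cls)
  qed
  then have "(\<lambda>n. norm (F1 (?f n) - F1 f)) \<longlonglongrightarrow> 0"
    using cutoff_tendsto[of "cls f"] by (simp add: LIM_zero_iff tendsto_norm_zero_iff)
  then show "(\<lambda>n. F1 (\<lambda>x. cutoff (real n) x * fn (cls f) x)) \<longlonglongrightarrow> F1 f"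
    unfolding eq by (simp add: LIM_zero_iff tendsto_norm_zero_iff)
qed

lemma norm_FT [simp]: "norm (FT u) = norm u"
proof (rule LIMSEQ_unique)
  show "(\<lambda>n. norm (F1 (\<lambda>x. cutoff (real n) x * fn u x))) \<longlonglongrightarrow> norm (FT u)"
    by (intro tendsto_intros FT_lim)
  show "(\<lambda>n. norm (F1 (\<lambda>x. cutoff (real n) x * fn u x))) \<longlonglongrightarrow> norm u"
    using tendsto_norm[OF cutoff_tendsto[of u]] by (simp add: norm_F1 L12_cutoff mul_def)
qed

lemma FT_add: "FT (u + v) = FT u + FT v"
proof (rule LIMSEQ_unique[OF FT_lim])
  have "F1 (\<lambda>x. cutoff (real n) x * fn (u + v) x)
      = F1 (\<lambda>x. cutoff (real n) x * fn u x) + F1 (\<lambda>x. cutoff (real n) x * fn v x)" for n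
  proof -
    have "ft (\<lambda>x. cutoff (real n) x * fn (u + v) x) = ft (\<lambda>x. cutoff (real n) x * fn u x + cutoff (real n) x * fn v x)"
      using fn_plus[of u v] by (intro ft_cong_AE) (auto simp: distrib_left)
    then show ?thesis unfolding F1_add[OF L12_cutoff[OF fn_L2] L12_cutoff[OF fn_L2], symmetric] by (simp add: F1_def)
  qed
  then show "(\<lambda>n. F1 (\<lambda>x. cutoff (real n) x * fn (u + v) x)) \<longlonglongrightarrow> FT u + FT v"
    by (simp add: tendsto_add FT_lim)
qed

lemma FT_mul_const: "FT (mul (\<lambda>_. c) u) = mul (\<lambda>_. c) (FT u)"
proof (rule LIMSEQ_unique[OF FT_lim])
  have "F1 (\<lambda>x. cutoff (real n) x * fn (mul (\<lambda>_. c) u) x) = mul (\<lambda>_. c) (F1 (\<lambda>x. cutoff (real n) x * fn u x))" for n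
  proof -
    have "ft (\<lambda>x. cutoff (real n) x * fn (mul (\<lambda>_. c) u) x) = ft (\<lambda>x. c * (cutoff (real n) x * fn u x))"
      using fn_mul[OF bmult_const, of c u] by (intro ft_cong_AE) auto
    then show ?thesis unfolding F1_mult[OF L12_cutoff[OF fn_L2], symmetric] by (simp add: F1_def)
  qed
  then show "(\<lambda>n. F1 (\<lambda>x. cutoff (real n) x * fn (mul (\<lambda>_. c) u) x)) \<longlonglongrightarrow> mul (\<lambda>_. c) (FT u)"
    by (simp add: bounded_linear.tendsto[OF bounded_linear_mul] FT_lim)
qed

lemma FT_scaleR: "FT (c *\<^sub>R u) = c *\<^sub>R FT u"
  using FT_mul_const[of "of_real c" u] by (simp add: mul_const_real)

lemma bounded_linear_FT: "bounded_linear FT"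
  by (rule bounded_linear_intro[where K = 1]) (simp_all add: FT_add FT_scaleR)

lemma FT_diff: "FT (u - v) = FT u - FT v"
  using bounded_linear_FT bounded_linear.linear linear_diff by blast

lemma FT_0 [simp]: "FT 0 = 0"
  using bounded_linear_FT bounded_linear.linear linear_0 by blast

lemma inner_FT_FT: "inner (FT u) (FT v) = inner u v"
proof -
  have p: "inner a b = ((norm (a + b))\<^sup>2 - (norm a)\<^sup>2 - (norm b)\<^sup>2) / 2" for a b :: l2
    by (simp add: power2_norm_eq_inner inner_add_left inner_add_right inner_commute)
  show ?thesis unfolding p[of "FT u"] p[of u] FT_add[symmetric] norm_FT ..
qed

subsection \<open>Inversion\<close>

definition cj :: "l2 \<Rightarrow> l2" where "cj u = cls (\<lambda>x. cnj (fn u x))"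

lemma L2_cnj: "f \<in> L2 \<Longrightarrow> (\<lambda>x. cnj (f x)) \<in> L2"
  by (rule L2_bound[of f _ 1]) (auto intro: measurable_compose[OF L2_measurable])

lemma L12_cnj: "f \<in> L12 \<Longrightarrow> (\<lambda>x. cnj (f x)) \<in> L12"
  by (intro L12_I L2_cnj) auto

lemma fn_cj: "AE x in lborel. fn (cj u) x = cnj (fn u x)"
  unfolding cj_def by (intro fn_cls L2_cnj) simp

lemma cj_cls: "f \<in> L2 \<Longrightarrow> cj (cls f) = cls (\<lambda>x. cnj (f x))"
  unfolding l2_eq_iff using fn_cj[of "cls f"] fn_cls[of f] fn_cls[OF L2_cnj[of f]] by auto

lemma cj_cj [simp]: "cj (cj u) = u"
  unfolding l2_eq_iff using fn_cj[of "cj u"] fn_cj[of u] by eventually_elim simp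

lemma cj_add: "cj (u + v) = cj u + cj v"
  unfolding l2_eq_iff
  using fn_cj[of "u + v"] fn_cj[of u] fn_cj[of v] fn_plus[of "cj u" "cj v"] fn_plus[of u v]
  by eventually_elim simp

lemma cj_scaleR: "cj (c *\<^sub>R u) = c *\<^sub>R cj u"
  unfolding l2_eq_iff
  using fn_cj[of "c *\<^sub>R u"] fn_cj[of u] fn_scaleR[of c "cj u"] fn_scaleR[of c u]
  by eventually_elim simp

lemma cj_mul: "bmult a \<Longrightarrow> cj (mul a u) = mul (\<lambda>x. cnj (a x)) (cj u)"
  unfolding l2_eq_iff
  using fn_cj[of "mul a u"] fn_cj[of u] fn_mul[of a u] fn_mul[of "\<lambda>x. cnj (a x)" "cj u"]
  by auto

lemma norm_cj [simp]: "norm (cj u) = norm u"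
proof -
  have "(norm (cj u))\<^sup>2 = (norm u)\<^sup>2"
    unfolding cj_def by (subst norm_cls_sq[OF L2_cnj[OF fn_L2]]) (simp add: norm_l2_sq)
  then show ?thesis by simp
qed

lemma bounded_linear_cj: "bounded_linear cj"
  by (rule bounded_linear_intro[where K = 1]) (simp_all add: cj_add cj_scaleR)

text \<open>The inverse kernel is the complex conjugate of the direct one, so conjugation before and
  after \<open>FT\<close> gives the inverse without a second construction.\<close>

definition IFT :: "l2 \<Rightarrow> l2" where "IFT u = cj (FT (cj u))"

lemma bounded_linear_IFT: "bounded_linear IFT"
  unfolding IFT_def[abs_def]
  by (intro bounded_linear_compose[OF bounded_linear_cj] bounded_linear_compose[OF bounded_linear_FT] bounded_linear_cj)

lemma norm_IFT [simp]: "norm (IFT u) = norm u"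
  by (simp add: IFT_def)

lemma inner_FT_L12:
  assumes f: "f \<in> L12" and g: "g \<in> L12"
  shows "inner (FT (cls f)) (cls g) = inner (cls f) (IFT (cls g))"
proof -
  have [measurable]: "f \<in> borel_measurable borel" "g \<in> borel_measurable borel"
    using f g by (simp_all add: L2_measurable)
  let ?c = "1 / sqrt (2 * pi)"
  let ?K = "\<lambda>\<xi> x. exp (- (\<i> * of_real x * of_real \<xi>)) * f x * cnj (g \<xi>)"
  have K: "integrable (lborel \<Otimes>\<^sub>M lborel) (case_prod ?K)"
  proof (rule lborel_pair.Fubini_integrable)
    show "case_prod ?K \<in> borel_measurable (lborel \<Otimes>\<^sub>M lborel)" by measurable
    show "integrable lborel (\<lambda>x. LINT y|lborel. norm (case (x, y) of (\<xi>, x) \<Rightarrow> ?K \<xi> x))"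
      using g by (simp add: norm_mult)
    show "AE x in lborel. integrable lborel (\<lambda>y. case (x, y) of (\<xi>, x) \<Rightarrow> ?K \<xi> x)"
      using f by (simp add: integrable_ft)
  qed
  have fg: "ft f \<in> L2" and gc: "(\<lambda>x. cnj (ft (\<lambda>x. cnj (g x)) x)) \<in> L2"
    by (intro plancherel_L12 f L2_cnj L12_cnj g)+
  have "inner (FT (cls f)) (cls g) = ?c * (LINT \<xi>|lborel. inner (ft f \<xi>) (g \<xi>))"
    using f g fg by (simp add: FT_cls F1_def inner_cls)
  also have "(LINT \<xi>|lborel. inner (ft f \<xi>) (g \<xi>)) = (LINT \<xi>|lborel. Re (LINT x|lborel. ?K \<xi> x))"
  proof (intro Bochner_Integration.integral_cong refl)
    fix \<xi>
    have "(LINT x|lborel. ?K \<xi> x) = ft f \<xi> * cnj (g \<xi>)" by (simp add: ft_def)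
    show "inner (ft f \<xi>) (g \<xi>) = Re (LINT x|lborel. ?K \<xi> x)"
      unfolding \<open>(LINT x|lborel. ?K \<xi> x) = _\<close> by (simp add: inner_complex_def)
  qed
  also have "\<dots> = Re (LINT \<xi>|lborel. LINT x|lborel. ?K \<xi> x)"
    by (rule integral_Re[OF lborel_pair.integrable_fst[OF K]])
  also have "(LINT \<xi>|lborel. LINT x|lborel. ?K \<xi> x) = (LINT x|lborel. LINT \<xi>|lborel. ?K \<xi> x)"
    by (rule lborel_pair.Fubini_integral[OF K, symmetric])
  also have "Re (LINT x|lborel. LINT \<xi>|lborel. ?K \<xi> x) = (LINT x|lborel. Re (LINT \<xi>|lborel. ?K \<xi> x))"
    by (rule integral_Re[OF lborel_pair.integrable_snd[OF K], symmetric])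
  also have "\<dots> = (LINT x|lborel. inner (f x) (cnj (ft (\<lambda>x. cnj (g x)) x)))"
  proof (intro Bochner_Integration.integral_cong refl)
    fix x
    have "(LINT \<xi>|lborel. ?K \<xi> x) = (LINT \<xi>|lborel. f x * (exp (- (\<i> * of_real \<xi> * of_real x)) * cnj (g \<xi>)))"
      by (intro Bochner_Integration.integral_cong refl) (simp add: mult_ac)
    also have "\<dots> = f x * ft (\<lambda>x. cnj (g x)) x" by (simp add: ft_def)
    finally show "Re (LINT \<xi>|lborel. ?K \<xi> x) = inner (f x) (cnj (ft (\<lambda>x. cnj (g x)) x))"
      by (simp add: inner_complex_def)
  qed
  also have "?c * \<dots> = inner (cls f) (IFT (cls g))"
    unfolding IFT_def using f g gc
    by (simp add: cj_cls FT_cls L12_cnj F1_def cj_scaleR plancherel_L12(1) inner_cls)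
  finally show ?thesis .
qed

lemma inner_FT: "inner (FT u) v = inner u (IFT v)"
proof (induction u rule: l2_L12_induct)
  case (L12 f)
  show ?case
  proof (induction v rule: l2_L12_induct)
    case (L12 g)
    show ?case by (rule inner_FT_L12[OF \<open>f \<in> L12\<close> L12])
  next
    case (lim X v)
    show ?case
    proof (rule LIMSEQ_unique)
      show "(\<lambda>n. inner (FT (cls f)) (X n)) \<longlonglongrightarrow> inner (FT (cls f)) v" by (intro tendsto_intros lim)
      show "(\<lambda>n. inner (FT (cls f)) (X n)) \<longlonglongrightarrow> inner (cls f) (IFT v)"
        unfolding lim(1) by (intro tendsto_intros bounded_linear.tendsto[OF bounded_linear_IFT] lim)
    qed
  qed
next
  case (lim X u)
  show ?case
  proof (rule LIMSEQ_unique)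
    show "(\<lambda>n. inner (X n) (IFT v)) \<longlonglongrightarrow> inner u (IFT v)" by (intro tendsto_intros lim)
    show "(\<lambda>n. inner (X n) (IFT v)) \<longlonglongrightarrow> inner (FT u) v"
      unfolding lim(1)[symmetric] by (intro tendsto_intros bounded_linear.tendsto[OF bounded_linear_FT] lim)
  qed
qed

text \<open>\<open>IFT\<close> is the adjoint of \<open>FT\<close>, and \<open>FT\<close> preserves
  inner products.\<close>

lemma IFT_FT [simp]: "IFT (FT u) = u"
proof -
  have "inner v (IFT (FT u) - u) = 0" for v
    by (simp add: inner_diff_right inner_FT[symmetric] inner_FT_FT)
  from this[of "IFT (FT u) - u"] show ?thesis by simp
qed

text \<open>Conjugating the left inverse identity exchanges the roles of \<open>FT\<close> and
  \<open>IFT\<close>, so surjectivity comes for free.\<close>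

lemma FT_IFT [simp]: "FT (IFT u) = u"
  using arg_cong[OF IFT_FT[of "cj u"], of cj] by (simp add: IFT_def)

lemma IFT_diff: "IFT (u - v) = IFT u - IFT v"
  using bounded_linear_IFT bounded_linear.linear linear_diff by blast

lemma IFT_add: "IFT (u + v) = IFT u + IFT v"
  using bounded_linear_IFT bounded_linear.linear linear_add by blast

lemma IFT_0 [simp]: "IFT 0 = 0"
  using bounded_linear_IFT bounded_linear.linear linear_0 by blast

lemma IFT_mul_const: "IFT (mul (\<lambda>_. c) u) = mul (\<lambda>_. c) (IFT u)"
  by (simp add: IFT_def cj_mul FT_mul_const)

lemma FT_translate: "FT (translate h u) = mul (\<lambda>\<xi>. exp (\<i> * of_real h * of_real \<xi>)) (FT u)"
proof (induction u rule: l2_L12_induct)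
  case (L12 f)
  have s: "(\<lambda>x. f (x + h)) \<in> L12"
    using L12 lborel_integrable_real_affine[OF L12_integrable[OF L12], of 1 h]
    by (intro L12_I L2_shift) (simp_all add: add.commute)
  have b: "bmult (\<lambda>\<xi>. exp (\<i> * of_real h * of_real \<xi>))"
    by (rule bmultI[of _ 1]) auto
  show ?case using L12 s b
    by (simp add: translate_cls FT_cls F1_def ft_shift[abs_def] mul_scaleR mul_cls plancherel_L12(1))
next
  case (lim X u)
  have b: "bmult (\<lambda>\<xi>. exp (\<i> * of_real h * of_real \<xi>))"
    by (rule bmultI[of _ 1]) auto
  have bt: "bounded_linear (translate h)"
  proof (rule bounded_linear_intro[where K = 1])
    show "translate h (r *\<^sub>R x) = r *\<^sub>R translate h x" for r x
      using translate_mul_const[of h "of_real r" x] by (simp add: mul_const_real)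
  qed (simp_all add: translate_add)
  show ?case
  proof (rule LIMSEQ_unique)
    show "(\<lambda>n. FT (translate h (X n))) \<longlonglongrightarrow> FT (translate h u)"
      by (intro bounded_linear.tendsto[OF bounded_linear_FT] bounded_linear.tendsto[OF bt] lim)
    show "(\<lambda>n. FT (translate h (X n))) \<longlonglongrightarrow> mul (\<lambda>\<xi>. exp (\<i> * of_real h * of_real \<xi>)) (FT u)"
      unfolding lim(1) by (intro bounded_linear.tendsto[OF bounded_linear_FT] bounded_linear.tendsto[OF bounded_linear_mul[OF b]] lim)
  qed
qed

subsection \<open>The transforms as limits of truncated integrals\<close>

lemma mul_cutoff_tendsto_at_top: "((\<lambda>R. mul (cutoff R) u) \<longlongrightarrow> u) at_top"
proof (rule tendsto_at_topI_sequentially)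
  fix X :: "nat \<Rightarrow> real" assume X: "filterlim X at_top sequentially"
  have "(\<lambda>n. mul (cutoff (X n)) u) \<longlonglongrightarrow> mul (\<lambda>_. 1) u"
  proof (rule mul_tendsto[where C = 1])
    show "AE x in lborel. (\<lambda>n. cutoff (X n) x) \<longlonglongrightarrow> 1"
    proof (intro AE_I2)
      fix x :: real
      have "\<forall>\<^sub>F n in sequentially. \<bar>x\<bar> \<le> X n" using X by (simp add: filterlim_at_top)
      then have "\<forall>\<^sub>F n in sequentially. 1 = cutoff (X n) x"
        by eventually_elim (auto simp: cutoff_def indicator_def abs_le_iff)
      then show "(\<lambda>n. cutoff (X n) x) \<longlonglongrightarrow> 1" by (rule Lim_transform_eventually[OF tendsto_const])
    qed
  qed (auto simp: norm_cutoff_le)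
  then show "(\<lambda>n. mul (cutoff (X n)) u) \<longlonglongrightarrow> u" by simp
qed

text \<open>The bridge from the limits in the definitions of \<open>fourier\<close> and
  \<open>szego\<close> to norm convergence in \<open>l2\<close>.\<close>

lemma L2_tendsto_iff:
  assumes "\<And>R. F R \<in> L2" "g \<in> L2"
  shows "L2_tendsto F g \<longleftrightarrow> ((\<lambda>R. cls (F R)) \<longlongrightarrow> cls g) at_top"
proof -
  have "(\<integral>\<^sup>+ x. ennreal ((cmod (F R x - g x))\<^sup>2) \<partial>lborel) = ennreal ((norm (cls (F R) - cls g))\<^sup>2)" for R
    using assms by (simp add: nn_norm_cls[OF L2_diff] cls_diff)
  then have "L2_tendsto F g \<longleftrightarrow> ((\<lambda>R. ennreal ((norm (cls (F R) - cls g))\<^sup>2)) \<longlongrightarrow> ennreal 0) at_top"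
    unfolding L2_tendsto_def using assms by simp
  also have "\<dots> \<longleftrightarrow> ((\<lambda>R. (norm (cls (F R) - cls g))\<^sup>2) \<longlongrightarrow> 0) at_top"
    by (rule tendsto_ennreal_iff) auto
  also have "\<dots> \<longleftrightarrow> ((\<lambda>R. norm (cls (F R) - cls g)) \<longlongrightarrow> 0) at_top"
  proof
    assume "((\<lambda>R. (norm (cls (F R) - cls g))\<^sup>2) \<longlongrightarrow> 0) at_top"
    from tendsto_real_sqrt[OF this] show "((\<lambda>R. norm (cls (F R) - cls g)) \<longlongrightarrow> 0) at_top" by simp
  next
    assume "((\<lambda>R. norm (cls (F R) - cls g)) \<longlongrightarrow> 0) at_top"
    from tendsto_power[OF this, of 2] show "((\<lambda>R. (norm (cls (F R) - cls g))\<^sup>2) \<longlongrightarrow> 0) at_top" by simp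
  qed
  also have "\<dots> \<longleftrightarrow> ((\<lambda>R. cls (F R)) \<longlongrightarrow> cls g) at_top"
    by (simp add: LIM_zero_iff tendsto_norm_zero_iff)
  finally show ?thesis .
qed

text \<open>The choice operator is harmless: a limit exists, and any two limits have the same
  class.\<close>

lemma L2_tendsto_SOME:
  assumes F: "\<And>R. F R \<in> L2" and lim: "((\<lambda>R. cls (F R)) \<longlongrightarrow> u) at_top"
  shows "(SOME g. L2_tendsto F g) \<in> L2" "cls (SOME g. L2_tendsto F g) = u"
proof -
  have "L2_tendsto F (fn u)" using lim L2_tendsto_iff[of F "fn u"] F by simp
  then have *: "L2_tendsto F (SOME g. L2_tendsto F g)" by (rule someI[where P = "L2_tendsto F"])
  then show L2: "(SOME g. L2_tendsto F g) \<in> L2" by (simp add: L2_tendsto_def)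
  have "((\<lambda>R. cls (F R)) \<longlongrightarrow> cls (SOME g. L2_tendsto F g)) at_top"
    using * L2_tendsto_iff[OF F L2] by simp
  then show "cls (SOME g. L2_tendsto F g) = u" using lim tendsto_unique trivial_limit_at_top_linorder by blast
qed

lemma fourier_FT:
  assumes f: "f \<in> L2"
  shows "fourier f \<in> L2" "cls (fourier f) = sqrt (2 * pi) *\<^sub>R FT (cls f)"
proof -
  let ?F = "\<lambda>R \<xi>. LINT x:{-R..R}|lborel. exp (- (\<i> * of_real x * of_real \<xi>)) * f x"
  have F: "?F R = ft (\<lambda>x. cutoff R x * f x)" for R
    unfolding ft_def set_lebesgue_integral_def cutoff_def fun_eq_iff
    by (intro allI Bochner_Integration.integral_cong) (auto simp: indicator_def)
  have L2: "?F R \<in> L2" for R unfolding F by (intro plancherel_L12 L12_cutoff f)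
  have "cls (?F R) = sqrt (2 * pi) *\<^sub>R FT (mul (cutoff R) (cls f))" for R
    unfolding F using f by (simp add: mul_cls FT_cls L12_cutoff F1_def)
  moreover have "((\<lambda>R. sqrt (2 * pi) *\<^sub>R FT (mul (cutoff R) (cls f))) \<longlongrightarrow> sqrt (2 * pi) *\<^sub>R FT (cls f)) at_top"
    by (intro tendsto_intros bounded_linear.tendsto[OF bounded_linear_FT] mul_cutoff_tendsto_at_top)
  ultimately have "((\<lambda>R. cls (?F R)) \<longlongrightarrow> sqrt (2 * pi) *\<^sub>R FT (cls f)) at_top" by simp
  from L2_tendsto_SOME[OF L2 this]
  show "fourier f \<in> L2" "cls (fourier f) = sqrt (2 * pi) *\<^sub>R FT (cls f)"
    by (simp_all add: fourier_def)
qed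

definition pos :: "real \<Rightarrow> complex" where "pos \<xi> = indicator {0..} \<xi>"

lemma bmult_pos [simp]: "bmult pos"
  unfolding pos_def[abs_def] by (rule bmult_indicator) simp

lemma pos_measurable [measurable]: "pos \<in> borel_measurable borel"
  by (rule bmult_measurable) simp

lemma norm_pos_le: "cmod (pos x) \<le> 1"
  by (simp add: pos_def indicator_def)

lemma IFT_cls: "f \<in> L12 \<Longrightarrow> IFT (cls f) = (1 / sqrt (2 * pi)) *\<^sub>R cls (\<lambda>x. cnj (ft (\<lambda>x. cnj (f x)) x))"
  by (simp add: IFT_def cj_cls FT_cls L12_cnj F1_def cj_scaleR plancherel_L12(1))

lemma cnj_ft_cnj: "cnj (ft (\<lambda>\<xi>. cnj (f \<xi>)) x) = (LINT \<xi>|lborel. exp (\<i> * of_real x * of_real \<xi>) * f \<xi>)"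
  unfolding ft_def Bochner_Integration.integral_cnj[symmetric]
  by (intro Bochner_Integration.integral_cong refl) (simp add: exp_cnj mult_ac)

text \<open>Integrating over [0, R] is the cutoff to [-R, R] followed by \<open>pos\<close>. The
  factor 1/(2 pi) splits into two factors 1/sqrt(2 pi): one cancels the constant in
  \<open>fourier_FT\<close>, the other is the normalization of \<open>IFT\<close>.\<close>

lemma szego_IFT:
  assumes f: "f \<in> L2"
  shows "szego f \<in> L2" "cls (szego f) = IFT (mul pos (FT (cls f)))"
proof -
  let ?F = "\<lambda>R x. 1 / (2 * of_real pi) * (LINT \<xi>:{0..R}|lborel. exp (\<i> * of_real x * of_real \<xi>) * fourier f \<xi>)"
  let ?g = "\<lambda>R \<xi>. cutoff R \<xi> * (pos \<xi> * fourier f \<xi>)"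
  note ff = fourier_FT[OF f]
  have pf: "(\<lambda>\<xi>. pos \<xi> * fourier f \<xi>) \<in> L2" by (intro L2_bmult ff) simp
  have g: "?g R \<in> L12" for R by (intro L12_cutoff pf)
  have F: "?F R = (\<lambda>x. (1 / (2 * pi)) *\<^sub>R cnj (ft (\<lambda>\<xi>. cnj (?g R \<xi>)) x))" for R
  proof
    fix x
    have "(LINT \<xi>:{0..R}|lborel. exp (\<i> * of_real x * of_real \<xi>) * fourier f \<xi>)
        = (LINT \<xi>|lborel. exp (\<i> * of_real x * of_real \<xi>) * ?g R \<xi>)"
      unfolding set_lebesgue_integral_def
      by (intro Bochner_Integration.integral_cong refl) (auto simp: cutoff_def pos_def indicator_def)
    then show "?F R x = (1 / (2 * pi)) *\<^sub>R cnj (ft (\<lambda>\<xi>. cnj (?g R \<xi>)) x)"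
      unfolding cnj_ft_cnj by (simp add: scaleR_conv_of_real)
  qed
  have h: "(\<lambda>x. cnj (ft (\<lambda>\<xi>. cnj (?g R \<xi>)) x)) \<in> L2" for R
    by (intro L2_cnj plancherel_L12 L12_cnj g)
  have L2: "?F R \<in> L2" for R unfolding F by (rule L2_scaleR[OF h])
  have "cls (?F R) = IFT (mul (cutoff R) (mul pos (FT (cls f))))" for R
  proof -
    have "cls (?F R) = (1 / (2 * pi)) *\<^sub>R cls (\<lambda>x. cnj (ft (\<lambda>\<xi>. cnj (?g R \<xi>)) x))"
      unfolding F by (rule cls_scaleR[OF h])
    also have "\<dots> = (1 / sqrt (2 * pi)) *\<^sub>R IFT (cls (?g R))"
      unfolding IFT_cls[OF g] by simp
    also have "cls (?g R) = mul (cutoff R) (mul pos (cls (fourier f)))"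
      by (simp only: mul_cls[OF bmult_pos ff(1)] mul_cls[OF bmult_cutoff pf])
    also have "\<dots> = sqrt (2 * pi) *\<^sub>R mul (cutoff R) (mul pos (FT (cls f)))"
      unfolding ff by (simp add: mul_scaleR)
    finally show ?thesis
      by (simp add: linear_scale[OF bounded_linear.linear[OF bounded_linear_IFT]])
  qed
  moreover have "((\<lambda>R. IFT (mul (cutoff R) (mul pos (FT (cls f))))) \<longlongrightarrow> IFT (mul pos (FT (cls f)))) at_top"
    by (intro bounded_linear.tendsto[OF bounded_linear_IFT] mul_cutoff_tendsto_at_top)
  ultimately have "((\<lambda>R. cls (?F R)) \<longlongrightarrow> IFT (mul pos (FT (cls f)))) at_top" by simp
  from L2_tendsto_SOME[OF L2 this]
  show "szego f \<in> L2" "cls (szego f) = IFT (mul pos (FT (cls f)))" by (simp_all add: szego_def)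
qed


text \<open>An integrable transform bounds the function in the supremum norm; this is the only route
  to pointwise bounds in the development.\<close>

lemma AE_bound_IFT:
  assumes "f \<in> L12"
  shows "AE x in lborel. cmod (fn (IFT (cls f)) x) \<le> 1 / sqrt (2 * pi) * (LINT \<xi>|lborel. cmod (f \<xi>))"
proof -
  have h: "(\<lambda>x. cnj (ft (\<lambda>\<xi>. cnj (f \<xi>)) x)) \<in> L2"
    by (intro L2_cnj plancherel_L12 L12_cnj assms)
  show ?thesis
    unfolding IFT_cls[OF assms] using fn_scaleR[of "1 / sqrt (2 * pi)" "cls (\<lambda>x. cnj (ft (\<lambda>\<xi>. cnj (f \<xi>)) x))"] fn_cls[OF h]
  proof eventually_elim
    case (elim x)
    have "cmod (ft (\<lambda>\<xi>. cnj (f \<xi>)) x) \<le> (LINT \<xi>|lborel. cmod (f \<xi>))"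
      using norm_ft_le[of "\<lambda>\<xi>. cnj (f \<xi>)" x] by simp
    then show ?case using elim by (simp add: divide_right_mono)
  qed
qed

section \<open>Ordinary differential equations in Banach spaces\<close>

text \<open>For \<open>t < 0\<close> the first interval is empty and the second integral carries the
  sign, so this is the primitive vanishing at 0 on the whole line.\<close>

definition prim :: "(real \<Rightarrow> 'a::banach) \<Rightarrow> real \<Rightarrow> 'a" where
  "prim f t = integral {0..t} f - integral {t..0} f"

lemma prim_0 [simp]: "prim f 0 = 0"
  by (simp add: prim_def)

lemma prim_has_vector_derivative:
  fixes f :: "real \<Rightarrow> 'a::banach"
  assumes f: "continuous_on UNIV f"
  shows "(prim f has_vector_derivative f t) (at t)"
proof -
  define T where "T = \<bar>t\<bar> + 1"
  have i: "f integrable_on {a..b}" for a b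
    by (rule integrable_continuous_real) (rule continuous_on_subset[OF f subset_UNIV])
  have eq: "prim f s = integral {-T..s} f - integral {-T..0} f" if "\<bar>s\<bar> < T" for s
  proof (cases "0 \<le> s")
    case True
    have "integral {-T..0} f + integral {0..s} f = integral {-T..s} f"
      using True by (intro Henstock_Kurzweil_Integration.integral_combine i) (auto simp: T_def)
    moreover have "integral {s..0} f = 0" using True by (cases "s = 0") auto
    ultimately show ?thesis by (simp add: prim_def algebra_simps)
  next
    case False
    have "integral {-T..s} f + integral {s..0} f = integral {-T..0} f"
      using False that by (intro Henstock_Kurzweil_Integration.integral_combine i) auto
    then show ?thesis using False by (simp add: prim_def algebra_simps)
  qed
  have "((\<lambda>u. integral {-T..u} f) has_vector_derivative f t) (at t within {-T..T})"
    by (intro integral_has_vector_derivative continuous_on_subset[OF f subset_UNIV]) (auto simp: T_def)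
  then have "((\<lambda>u. integral {-T..u} f) has_vector_derivative f t) (at t)"
    by (subst (asm) at_within_interior) (auto simp: T_def)
  then have "((\<lambda>u. integral {-T..u} f - integral {-T..0} f) has_vector_derivative f t) (at t)"
    by (auto intro!: derivative_eq_intros)
  then show ?thesis
    by (rule has_vector_derivative_transform_within_open[where S = "{-T<..<T}"]) (auto simp: T_def eq)
qed

lemma prim_continuous:
  "continuous_on UNIV f \<Longrightarrow> continuous_on UNIV (prim f)"
  by (auto simp: continuous_on_eq_continuous_within
      intro!: has_vector_derivative_continuous prim_has_vector_derivative)

text \<open>The mean value inequality for vector valued functions, applied for negative times to the
  reflected function; the majorant depends on |s| only, so it is unchanged by reflection.\<close>

lemma norm_bound_two_sided:
  fixes F :: "real \<Rightarrow> 'a::real_normed_vector"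
  assumes F: "\<And>s. \<bar>s\<bar> \<le> T \<Longrightarrow> (F has_vector_derivative F' s) (at s)"
    and \<psi>: "\<And>s. (\<psi> has_real_derivative \<psi>' s) (at s)"
    and le: "\<And>s. \<bar>s\<bar> \<le> T \<Longrightarrow> norm (F' s) \<le> \<psi>' \<bar>s\<bar>"
    and t: "\<bar>t\<bar> \<le> T"
  shows "norm (F t - F 0) \<le> \<psi> \<bar>t\<bar> - \<psi> 0"
proof -
  have main: "norm (H t - H 0) \<le> \<psi> t - \<psi> 0"
    if H: "\<And>s. \<bar>s\<bar> \<le> T \<Longrightarrow> (H has_vector_derivative H' s) (at s)"
      and le: "\<And>s. \<bar>s\<bar> \<le> T \<Longrightarrow> norm (H' s) \<le> \<psi>' \<bar>s\<bar>" and t: "0 < t" "t \<le> T"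
    for H H' :: "real \<Rightarrow> 'a" and t
  proof (rule differentiable_bound_general[OF t(1)])
    show "continuous_on {0..t} H"
      using t by (auto intro!: continuous_at_imp_continuous_on has_vector_derivative_continuous[OF H])
    show "continuous_on {0..t} \<psi>"
      by (meson \<psi> DERIV_isCont continuous_at_imp_continuous_on)
    show "(H has_vector_derivative H' x) (at x)" if "0 < x" "x < t" for x
      using that t by (intro H) auto
    show "(\<psi> has_vector_derivative \<psi>' x) (at x)" for x
      using \<psi> by (simp add: has_real_derivative_iff_has_vector_derivative)
    show "norm (H' x) \<le> \<psi>' x" if "0 < x" "x < t" for x
      using le[of x] that t by simp
  qed
  consider "t = 0" | "t > 0" | "t < 0" by linarith
  then show ?thesis
  proof cases
    case 2
    with main[OF F le, of t] t show ?thesis by simp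
  next
    case 3
    have "((\<lambda>s. F (- s)) has_vector_derivative - F' (- s)) (at s)" if "\<bar>s\<bar> \<le> T" for s
    proof -
      have "((\<lambda>s. F (- s)) has_vector_derivative (- 1) *\<^sub>R F' (- s)) (at s)"
        using that by (intro vector_diff_chain_at[of uminus, unfolded o_def] F)
          (auto intro!: derivative_eq_intros)
      then show ?thesis by simp
    qed
    then have "norm (F (- (- t)) - F (- 0)) \<le> \<psi> (- t) - \<psi> 0"
      using 3 t le by (intro main[of "\<lambda>s. F (- s)" "\<lambda>s. - F' (- s)"]) (auto simp: le[of "- _", simplified])
    then show ?thesis using 3 by simp
  qed simp
qed

lemma continuous_on_lipschitz_param:
  fixes G :: "real \<Rightarrow> 'a::metric_space \<Rightarrow> 'b::real_normed_vector"
  assumes G: "\<And>x. continuous_on UNIV (\<lambda>t. G t x)"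
    and lip: "\<And>t x y. norm (G t x - G t y) \<le> L * dist x y" and c: "continuous_on UNIV c"
  shows "continuous_on UNIV (\<lambda>t. G t (c t))"
  unfolding continuous_on_def
proof
  fix t :: real
  have ct: "(c \<longlongrightarrow> c t) (at t)" using c by (simp add: continuous_on_def)
  have Gt: "((\<lambda>s. G s (c t)) \<longlongrightarrow> G t (c t)) (at t)" using G[of "c t"] by (simp add: continuous_on_def)
  have "((\<lambda>s. G s (c s) - G s (c t)) \<longlongrightarrow> 0) (at t)"
  proof (rule Lim_null_comparison)
    show "\<forall>\<^sub>F s in at t. norm (G s (c s) - G s (c t)) \<le> L * dist (c s) (c t)" by (simp add: lip)
    show "((\<lambda>s. L * dist (c s) (c t)) \<longlongrightarrow> 0) (at t)"
      using tendsto_mult[OF tendsto_const tendsto_dist[OF ct tendsto_const[of "c t"]], of L] by simp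
  qed
  from tendsto_add[OF this Gt] show "((\<lambda>s. G s (c s)) \<longlongrightarrow> G t (c t)) (at t)" by simp
qed

text \<open>Picard iteration is a contraction for the weighted norm \<open>sup\<^sub>t e\<^bsup>-2L|t|\<^esup> \<parallel>x(t)\<parallel>\<close>.\<close>

theorem ode_global:
  fixes G :: "real \<Rightarrow> 'a::banach \<Rightarrow> 'a"
  assumes G: "\<And>x. continuous_on UNIV (\<lambda>t. G t x)"
    and lip: "\<And>t x y. norm (G t x - G t y) \<le> L * norm (x - y)" and L: "L > 0"
    and G0: "\<And>t. G t 0 = 0"
  obtains x where "x 0 = x0" "\<And>t. (x has_vector_derivative G t (x t)) (at t)"
proof -
  define e where "e t = exp (2 * L * \<bar>t\<bar>)" for t
  have e_pos [simp]: "e t > 0" "e t \<ge> 0" "e t \<noteq> 0" for t by (auto simp: e_def)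
  have e_cont: "continuous_on UNIV e" unfolding e_def by (intro continuous_intros)
  \<comment> \<open>The unknown \<open>y\<close> is the solution divided by the weight
    \<open>e\<close>, so it lives among bounded continuous functions. \<open>H\<close> restores the
    weight before applying \<open>G\<close>.\<close>
  define H where "H y s = G s (e s *\<^sub>R y s)" for y s
  have H_cont: "continuous_on UNIV (H y)" if "continuous_on UNIV y" for y
    unfolding H_def
    by (rule continuous_on_lipschitz_param[OF G, where L = L])
      (auto simp: dist_norm lip intro!: continuous_intros e_cont that)
  \<comment> \<open>The source of the contraction factor: the rate \<open>2 * L\<close> in the
    weight is twice the Lipschitz constant, and integrating L D exp(2 L s) yields D/2 times the
    weight.\<close>
  have est: "norm (prim (H y) t - prim (H z) t) \<le> D / 2 * (e t - 1)"
    if y: "continuous_on UNIV y" and z: "continuous_on UNIV z" and D: "\<And>s. norm (y s - z s) \<le> D" for y z D t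
  proof -
    have "norm ((\<lambda>s. prim (H y) s - prim (H z) s) t - (\<lambda>s. prim (H y) s - prim (H z) s) 0)
       \<le> D / 2 * exp (2 * L * \<bar>t\<bar>) - D / 2 * exp (2 * L * 0)"
    proof (rule norm_bound_two_sided[where \<psi>' = "\<lambda>s. L * D * exp (2 * L * s)" and T = "\<bar>t\<bar>"])
      show "((\<lambda>s. prim (H y) s - prim (H z) s) has_vector_derivative H y s - H z s) (at s)" for s
        by (intro has_vector_derivative_diff prim_has_vector_derivative H_cont y z)
      show "((\<lambda>s. D / 2 * exp (2 * L * s)) has_real_derivative L * D * exp (2 * L * s)) (at s)" for s
        by (auto intro!: derivative_eq_intros)
      show "norm (H y s - H z s) \<le> L * D * exp (2 * L * \<bar>s\<bar>)" for s
      proof -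
        have "norm (H y s - H z s) \<le> L * norm (e s *\<^sub>R y s - e s *\<^sub>R z s)" unfolding H_def by (rule lip)
        also have "\<dots> = L * (e s * norm (y s - z s))" by (simp add: scaleR_diff_right[symmetric])
        also have "\<dots> \<le> L * (e s * D)" using L D[of s] by (intro mult_left_mono) auto
        finally show ?thesis by (simp add: e_def mult_ac)
      qed
    qed simp
    then show ?thesis by (simp add: e_def algebra_simps)
  qed
  define P where "P y t = inverse (e t) *\<^sub>R (x0 + prim (H y) t)" for y t
  have P_cont: "continuous_on UNIV (P y)" if "continuous_on UNIV y" for y
    unfolding P_def by (intro continuous_intros e_cont prim_continuous H_cont that) simp
  have P_diff: "norm (P y t - P z t) \<le> D / 2"
    if y: "continuous_on UNIV y" and z: "continuous_on UNIV z" and D: "\<And>s. norm (y s - z s) \<le> D" for y z D t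
  proof -
    have D0: "0 \<le> D" using D[of 0] norm_ge_zero order_trans by blast
    have "norm (P y t - P z t) = inverse (e t) * norm (prim (H y) t - prim (H z) t)"
      by (simp add: P_def scaleR_diff_right[symmetric])
    also have "\<dots> \<le> inverse (e t) * (D / 2 * (e t - 1))"
      by (intro mult_left_mono est[OF y z D]) (auto simp: less_imp_le)
    also have "\<dots> \<le> inverse (e t) * (D / 2 * e t)"
      using D0 by (intro mult_left_mono) (auto simp: less_imp_le)
    also have "\<dots> = D / 2" by (simp add: field_simps)
    finally show ?thesis .
  qed
  have P_bc: "P (apply_bcontfun y) \<in> bcontfun" for y
  proof (rule bcontfun_normI)
    show "continuous_on UNIV (P (apply_bcontfun y))" by (intro P_cont) simp
    fix t
    have H0: "H (\<lambda>_. 0) = (\<lambda>_. 0)" by (simp add: H_def G0 fun_eq_iff)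
    have "norm (P (apply_bcontfun y) t - P (\<lambda>_. 0) t) \<le> norm y / 2"
      by (intro P_diff) (auto simp: norm_bounded)
    moreover have "norm (P (\<lambda>_. 0) t) \<le> norm x0"
    proof -
      have "1 \<le> e t" using L by (simp add: e_def)
      then have "inverse (e t) \<le> 1" by (rule inverse_le_1_iff[THEN iffD2, OF disjI2])
      then show ?thesis unfolding P_def H0 by (simp add: prim_def mult_left_le_one_le less_imp_le)
    qed
    ultimately show "norm (P (apply_bcontfun y) t) \<le> norm y / 2 + norm x0"
      using norm_triangle_sub[of "P (apply_bcontfun y) t" "P (\<lambda>_. 0) t"] by linarith
  qed
  define \<Phi> where "\<Phi> y = Bcontfun (P (apply_bcontfun y))" for y
  have ap: "apply_bcontfun (\<Phi> y) = P (apply_bcontfun y)" for y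
    unfolding \<Phi>_def using P_bc by (simp add: Bcontfun_inverse)
  have "\<exists>!y. \<Phi> y = y"
  proof (rule banach_fix_type[where c = "1/2"], safe)
    fix y z
    have "norm (apply_bcontfun (\<Phi> y) t - apply_bcontfun (\<Phi> z) t) \<le> dist y z / 2" for t
      unfolding ap by (intro P_diff) (auto simp: dist_norm[symmetric] dist_bounded)
    then show "dist (\<Phi> y) (\<Phi> z) \<le> 1/2 * dist y z" by (intro dist_bound) (simp add: dist_norm)
  qed auto
  then obtain y where y: "\<Phi> y = y" by blast
  let ?y = "apply_bcontfun y"
  define x where "x t = x0 + prim (H ?y) t" for t
  have xy: "e t *\<^sub>R ?y t = x t" for t
    by (subst y[symmetric], subst ap) (simp add: P_def x_def)
  show thesis
  proof (rule that)
    show "x 0 = x0" by (simp add: x_def)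
    fix t
    have "(x has_vector_derivative 0 + H ?y t) (at t)"
      unfolding x_def by (intro has_vector_derivative_add has_vector_derivative_const prim_has_vector_derivative H_cont) simp
    then show "(x has_vector_derivative G t (x t)) (at t)" by (simp add: H_def xy)
  qed
qed

section \<open>Gronwall estimates, forward and backward in time\<close>

lemma gronwall:
  fixes f :: "real \<Rightarrow> real"
  assumes f: "\<And>s. (f has_real_derivative f' s) (at s)" and f0: "f 0 = 0"
    and q: "continuous_on UNIV q" "\<And>s. 0 \<le> q s" and a: "0 \<le> a"
    and le: "\<And>s. \<bar>s\<bar> \<le> T \<Longrightarrow> \<bar>f' s\<bar> \<le> a * f s + q s" and t: "\<bar>t\<bar> \<le> T"
  shows "f t \<le> exp (a * T) * integral {-T..T} q"
proof -
  have main: "h t \<le> exp (a * t) * integral {0..t} p"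
    if h: "\<And>s. (h has_real_derivative h' s) (at s)" and h0: "h 0 = 0"
      and p: "continuous_on UNIV p" "\<And>s. 0 \<le> p s"
      and le: "\<And>s. \<bar>s\<bar> \<le> T \<Longrightarrow> \<bar>h' s\<bar> \<le> a * h s + p s" and t: "0 \<le> t" "t \<le> T" for h h' p t
  proof -
    \<comment> \<open>The integrating factor turns the inequality into monotonicity. Since
      \<open>p\<close> is nonnegative and exp(-a s) <= 1, subtracting the plain primitive of
      \<open>p\<close> is enough to make \<open>k\<close> nonincreasing.\<close>
    define k where "k s = exp (- a * s) * h s - prim p s" for s
    have pd: "(prim p has_real_derivative p s) (at s)" for s
      using prim_has_vector_derivative[OF p(1)] by (simp add: has_real_derivative_iff_has_vector_derivative)
    have "k t \<le> k 0"
    proof (rule DERIV_nonpos_imp_nonincreasing[OF t(1)])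
      fix s assume s: "0 \<le> s" "s \<le> t"
      have d: "(k has_real_derivative exp (- a * s) * h' s - a * exp (- a * s) * h s - p s) (at s)"
        unfolding k_def by (auto intro!: derivative_eq_intros h pd)
      have "h' s \<le> a * h s + p s" using le[of s] s t by simp
      then have "exp (- a * s) * h' s \<le> exp (- a * s) * (a * h s + p s)" by simp
      moreover have "exp (- a * s) * p s \<le> 1 * p s"
        using p(2)[of s] a s by (intro mult_right_mono) auto
      ultimately have "exp (- a * s) * h' s - a * exp (- a * s) * h s - p s \<le> 0"
        by (simp add: algebra_simps)
      with d show "\<exists>y. (k has_real_derivative y) (at s) \<and> y \<le> 0" by blast
    qed
    then have "exp (- a * t) * h t \<le> prim p t" by (simp add: k_def h0)
    then have "exp (a * t) * (exp (- a * t) * h t) \<le> exp (a * t) * prim p t"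
      by (rule mult_left_mono) simp
    moreover have "exp (a * t) * (exp (- a * t) * h t) = h t"
      by (simp add: mult.assoc[symmetric] exp_add[symmetric] del: mult_cancel_right2)
    moreover have "prim p t = integral {0..t} p" using t by (cases "t = 0") (auto simp: prim_def)
    ultimately show ?thesis by metis
  qed
  have i: "q integrable_on {c..d}" for c d
    by (rule integrable_continuous_real) (rule continuous_on_subset[OF q(1) subset_UNIV])
  have T: "0 \<le> T" using t by linarith
  show ?thesis
  proof (cases "0 \<le> t")
    case True
    have "f t \<le> exp (a * t) * integral {0..t} q" using True t by (intro main[OF f f0 q le]) auto
    also have "\<dots> \<le> exp (a * T) * integral {-T..T} q"
      using True t a q by (intro mult_mono integral_subset_le i integral_nonneg) (auto intro: mult_left_mono)
    finally show ?thesis .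
  next
    case False
    \<comment> \<open>The hypothesis bounds the absolute value of the derivative, so it is preserved
      by reversing time.\<close>
    have d: "((\<lambda>s. f (- s)) has_real_derivative - f' (- s)) (at s)" for s
      using DERIV_mirror[of f "f' (- s)" s] f[of "- s"] by simp
    have "f (- (- t)) \<le> exp (a * - t) * integral {0..- t} (\<lambda>s. q (- s))"
    proof (rule main[OF d])
      show "continuous_on UNIV (\<lambda>s. q (- s))" by (rule continuous_on_compose2[OF q(1)]) (auto intro: continuous_intros)
      show "\<bar>- f' (- s)\<bar> \<le> a * f (- s) + q (- s)" if "\<bar>s\<bar> \<le> T" for s using le[of "- s"] that by simp
    qed (use f0 q False t in auto)
    also have "integral {0..- t} (\<lambda>s. q (- s)) = integral {t..0} q"
      using Henstock_Kurzweil_Integration.integral_reflect_real[of 0 t q] by simp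
    also have "exp (a * - t) * integral {t..0} q \<le> exp (a * T) * integral {-T..T} q"
      using False t T a q mult_left_mono[of "- t" T a]
      by (intro mult_mono integral_subset_le i integral_nonneg) auto
    finally show ?thesis by simp
  qed
qed

text \<open>The form in which band truncations are compared: the source \<open>q n\<close> is the
  contribution of the frequencies above \<open>n\<close>, which vanishes pointwise in time and is
  dominated.\<close>

lemma gronwall_tendsto_0:
  fixes f :: "nat \<Rightarrow> real \<Rightarrow> real"
  assumes f: "\<And>n s. (f n has_real_derivative f' n s) (at s)" and f0: "\<And>n. f n 0 = 0"
    and nonneg: "\<And>n s. 0 \<le> f n s"
    and q: "\<And>n. continuous_on UNIV (q n)" "\<And>n s. 0 \<le> q n s" and a: "0 \<le> a"
    and le: "\<And>n s. \<bar>s\<bar> \<le> T \<Longrightarrow> \<bar>f' n s\<bar> \<le> a * f n s + q n s" and t: "\<bar>t\<bar> \<le> T"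
    and h: "continuous_on UNIV h" "\<And>n s. q n s \<le> h s" and lim: "\<And>s. (\<lambda>n. q n s) \<longlonglongrightarrow> 0"
  shows "(\<lambda>n. f n t) \<longlonglongrightarrow> 0"
proof (rule tendsto_sandwich)
  show "\<forall>\<^sub>F n in sequentially. 0 \<le> f n t" by (simp add: nonneg)
  show "\<forall>\<^sub>F n in sequentially. f n t \<le> exp (a * T) * integral {-T..T} (q n)"
    using gronwall[OF f f0 q a le t] by simp
  have i: "g integrable_on {-T..T}" if "continuous_on UNIV g" for g :: "real \<Rightarrow> real"
    by (rule integrable_continuous_real) (rule continuous_on_subset[OF that subset_UNIV])
  have "(\<lambda>n. integral {-T..T} (q n)) \<longlonglongrightarrow> integral {-T..T} (\<lambda>_. 0)"
    by (rule dominated_convergence(2)[OF i[OF q(1)] i[OF h(1)]]) (use q h lim in auto)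
  then show "(\<lambda>n. exp (a * T) * integral {-T..T} (q n)) \<longlonglongrightarrow> 0"
    using tendsto_mult[OF tendsto_const, of "\<lambda>n. integral {-T..T} (q n)" 0 sequentially "exp (a * T)"] by simp
qed simp

section \<open>The truncated nonlinearity\<close>

text \<open>
  Since \<open>0 powr 0 = 0\<close>, the case \<open>m = 0\<close> is separated to keep the function continuous.
\<close>

definition kap :: "real \<Rightarrow> real \<Rightarrow> real \<Rightarrow> real" where
  "kap m R s = (if m = 0 then 1 else (min (max s 0) (R\<^sup>2)) powr m)"

definition tnl :: "real \<Rightarrow> real \<Rightarrow> complex \<Rightarrow> complex" where
  "tnl m R z = kap m R ((cmod z)\<^sup>2) *\<^sub>R z"

text \<open>The primitive is taken in the variable s = |z|^2, so the chain rule produces a factor 2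
  z, and the division by 2 makes \<open>tnl m R\<close> the gradient.\<close>

definition pot :: "real \<Rightarrow> real \<Rightarrow> complex \<Rightarrow> real" where
  "pot m R z = prim (kap m R) ((cmod z)\<^sup>2) / 2"

text \<open>A multiple of (2m+1) R^(2m), the largest radial slope of r^(2m+1) below the truncation
  height.\<close>

definition Lip :: "real \<Rightarrow> real \<Rightarrow> real" where
  "Lip m R = 2 * ((2 * m + 1) * R powr (2 * m))"

lemma sq_powr: "0 \<le> (x::real) \<Longrightarrow> (x\<^sup>2) powr m = x powr (2 * m)"
  by (cases "x = 0") (simp_all add: powr_powr[symmetric] flip: powr_numeral)

lemma kap_continuous: "0 \<le> m \<Longrightarrow> continuous_on UNIV (kap m R)"
proof (cases "m = 0")
  case False
  moreover assume "0 \<le> m"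
  ultimately have "0 < m" by simp
  then show ?thesis
    unfolding kap_def using \<open>0 < m\<close> by simp (rule continuous_on_powr'; auto intro!: continuous_intros)
qed (simp add: kap_def)

lemma kap_mono: "0 \<le> m \<Longrightarrow> s \<le> t \<Longrightarrow> kap m R s \<le> kap m R t"
  unfolding kap_def by (auto intro!: powr_mono2)

lemma kap_nonneg: "0 \<le> kap m R s"
  by (simp add: kap_def)

lemma kap_sq: "0 < m \<Longrightarrow> 0 \<le> R \<Longrightarrow> 0 \<le> r \<Longrightarrow> kap m R (r\<^sup>2) = (min r R) powr (2 * m)"
  unfolding kap_def by (subst sq_powr[symmetric]) (auto simp: min_def power2_le_iff_abs_le abs_le_square_iff)

lemma kap_le: "0 \<le> m \<Longrightarrow> 0 < R \<Longrightarrow> kap m R s \<le> R powr (2 * m)"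
  using sq_powr[of R m] powr_mono2[of m "min (max s 0) (R\<^sup>2)" "R\<^sup>2"] by (auto simp: kap_def)

lemma kap_le_powr: "0 < m \<Longrightarrow> 0 \<le> R \<Longrightarrow> 0 \<le> r \<Longrightarrow> kap m R (r\<^sup>2) \<le> r powr (2 * m)"
  by (subst kap_sq) (auto intro!: powr_mono2)

lemma Lip_nonneg: "0 \<le> m \<Longrightarrow> 0 \<le> Lip m R"
  by (simp add: Lip_def)

lemma Lip_pos: "0 \<le> m \<Longrightarrow> 0 < R \<Longrightarrow> 0 < Lip m R"
  by (simp add: Lip_def)

text \<open>The mean value theorem, multiplied by \<open>b\<close>: for q < 1 the derivative q
  z^(q-1) blows up at 0, but b z^(q-1) <= z^q because b < z.\<close>

lemma powr_diff_le:
  fixes b c q :: real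
  assumes "0 \<le> b" "b \<le> c" "0 < q"
  shows "(c powr q - b powr q) * b \<le> q * c powr q * (c - b)"
proof (cases "b = c \<or> b = 0")
  case False
  with assms have bc: "0 < b" "b < c" by auto
  have "\<exists>z>b. z < c \<and> c powr q - b powr q = (c - b) * (q * z powr (q - 1))"
    by (rule MVT2[OF bc(2)]) (use bc in \<open>auto intro!: has_real_derivative_powr\<close>)
  then obtain z where z: "b < z" "z < c" "c powr q - b powr q = (c - b) * (q * z powr (q - 1))"
    by blast
  have "z powr (q - 1) * b \<le> z powr (q - 1) * z" using z by (intro mult_left_mono) auto
  also have "\<dots> = z powr q" using z bc by (simp add: powr_diff)
  also have "\<dots> \<le> c powr q" using z bc assms by (intro powr_mono2) auto
  finally have "(c - b) * q * (z powr (q - 1) * b) \<le> (c - b) * q * c powr q"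
    using bc assms by (intro mult_left_mono) auto
  then show ?thesis using z by (simp add: mult_ac)
qed (use assms in auto)

text \<open>Above \<open>R\<close> the weight is constant, so \<open>a\<close> may be replaced by
  min(a, R), and \<open>powr_diff_le\<close> applies below the truncation height.\<close>

lemma kap_radial_lipschitz:
  assumes m: "0 \<le> m" and R: "0 < R" and ba: "0 \<le> b" "b \<le> a"
  shows "(kap m R (a\<^sup>2) - kap m R (b\<^sup>2)) * b \<le> 2 * m * R powr (2 * m) * (a - b)"
proof (cases "m = 0 \<or> R \<le> b")
  case True
  then show ?thesis
  proof
    assume b: "R \<le> b"
    have "kap m R (a\<^sup>2) = kap m R (b\<^sup>2)"
    proof (cases "m = 0")
      case False
      then show ?thesis using kap_sq[of m R a] kap_sq[of m R b] m R ba b by simp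
    qed (simp add: kap_def)
    then show ?thesis using m ba by simp
  qed (auto simp: kap_def)
next
  case False
  define c where "c = min a R"
  have m0: "0 < m" using False m by simp
  have c: "b \<le> c" "c \<le> R" "0 \<le> c" "c \<le> a" using False ba by (auto simp: c_def)
  have "(kap m R (a\<^sup>2) - kap m R (b\<^sup>2)) * b = (c powr (2 * m) - b powr (2 * m)) * b"
    using kap_sq[OF m0, of R] R ba False by (simp add: c_def min_def)
  also have "\<dots> \<le> 2 * m * c powr (2 * m) * (c - b)"
    using powr_diff_le[of b c "2 * m"] c ba m0 by simp
  also have "\<dots> \<le> 2 * m * R powr (2 * m) * (a - b)"
    using c m0 by (intro mult_mono powr_mono2 mult_nonneg_nonneg) auto
  finally show ?thesis .
qed

lemma tnl_lipschitz:
  assumes m: "0 \<le> m" and R: "0 < R"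
  shows "cmod (tnl m R z - tnl m R w) \<le> Lip m R * cmod (z - w)"
proof -
  have main: "cmod (tnl m R z - tnl m R w) \<le> Lip m R * cmod (z - w)" if le: "cmod w \<le> cmod z" for z w
  proof -
    let ?kz = "kap m R ((cmod z)\<^sup>2)" and ?kw = "kap m R ((cmod w)\<^sup>2)"
    have "?kw \<le> ?kz" using le m by (intro kap_mono power_mono) auto
    \<comment> \<open>The difference of the weights multiplies the vector of smaller modulus, which
      is what \<open>kap_radial_lipschitz\<close> can control.\<close>
    moreover have "tnl m R z - tnl m R w = ?kz *\<^sub>R (z - w) + (?kz - ?kw) *\<^sub>R w"
      by (simp add: tnl_def algebra_simps)
    ultimately have "cmod (tnl m R z - tnl m R w) \<le> ?kz * cmod (z - w) + (?kz - ?kw) * cmod w"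
      using norm_triangle_ineq[of "?kz *\<^sub>R (z - w)" "(?kz - ?kw) *\<^sub>R w"] kap_nonneg[of m R] by simp
    also have "\<dots> \<le> R powr (2 * m) * cmod (z - w) + 2 * m * R powr (2 * m) * (cmod z - cmod w)"
      using m R le by (intro add_mono kap_radial_lipschitz mult_right_mono kap_le) auto
    also have "\<dots> \<le> R powr (2 * m) * cmod (z - w) + 2 * m * R powr (2 * m) * cmod (z - w)"
      using m by (intro add_mono mult_left_mono norm_triangle_ineq2) auto
    also have "\<dots> = (2 * m + 1) * R powr (2 * m) * cmod (z - w)" by (simp add: algebra_simps)
    also have "\<dots> \<le> Lip m R * cmod (z - w)"
      unfolding Lip_def using m by (intro mult_right_mono) auto
    finally show ?thesis .
  qed
  show ?thesis
    using main[of w z] main[of z w] by (cases "cmod w \<le> cmod z") (auto simp: norm_minus_commute)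
qed

lemma tnl_0 [simp]: "tnl m R 0 = 0"
  by (simp add: tnl_def)

lemma tnl_eq_nonlinearity:
  assumes "0 \<le> m" "0 < R" "cmod (f x) \<le> R"
  shows "tnl m R (f x) = nonlinearity m f x"
proof (cases "m = 0")
  case True
  then show ?thesis by (simp add: tnl_def nonlinearity_def kap_def)
next
  case False
  then show ?thesis
    using assms kap_sq[of m R "cmod (f x)"] by (simp add: tnl_def nonlinearity_def scaleR_conv_of_real min_def)
qed

lemma pot_bounds:
  assumes m: "0 \<le> m"
  shows "0 \<le> pot m R z" "pot m R z \<le> kap m R ((cmod z)\<^sup>2) * (cmod z)\<^sup>2"
proof -
  let ?s = "(cmod z)\<^sup>2"
  have i: "kap m R integrable_on {0..?s}"
    by (rule integrable_continuous_real) (rule continuous_on_subset[OF kap_continuous[OF m] subset_UNIV])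
  have "prim (kap m R) ?s = integral {0..?s} (kap m R)"
    by (cases "?s = 0") (auto simp: prim_def)
  moreover have "0 \<le> integral {0..?s} (kap m R)"
    by (intro integral_nonneg i kap_nonneg)
  moreover have "integral {0..?s} (kap m R) \<le> integral {0..?s} (\<lambda>_. kap m R ?s)"
    by (intro integral_le i kap_mono m) auto
  moreover have "integral {0..?s} (\<lambda>_. kap m R ?s) = kap m R ?s * ?s" by simp
  moreover have "0 \<le> kap m R ?s * ?s" by (simp add: kap_nonneg)
  ultimately show "0 \<le> pot m R z" "pot m R z \<le> kap m R ((cmod z)\<^sup>2) * (cmod z)\<^sup>2"
    unfolding pot_def by linarith+
qed

lemma pot_continuous: "0 \<le> m \<Longrightarrow> continuous_on UNIV (pot m R)"
  unfolding pot_def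
  by (intro continuous_intros continuous_on_compose2[OF prim_continuous[OF kap_continuous]]) auto

text \<open>The remainder is quadratic because the gradient is Lipschitz: the mean value theorem
  along the segment leaves a difference of gradients. Second derivatives, which fail to exist at the
  truncation corner, are avoided.\<close>

lemma pot_taylor:
  assumes m: "0 \<le> m" and R: "0 < R"
  shows "\<bar>pot m R (z + w) - pot m R z - inner (tnl m R z) w\<bar> \<le> Lip m R * (cmod w)\<^sup>2"
proof -
  define \<phi> where "\<phi> t = pot m R (z + t *\<^sub>R w)" for t
  have sq: "(cmod (z + t *\<^sub>R w))\<^sup>2 = (cmod z)\<^sup>2 + 2 * t * inner z w + t\<^sup>2 * (cmod w)\<^sup>2" for t
    unfolding power2_norm_eq_inner
    by (simp add: inner_add_left inner_add_right inner_commute[of w z] algebra_simps power2_eq_square)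
  have d: "(\<phi> has_real_derivative inner (tnl m R (z + t *\<^sub>R w)) w) (at t)" for t
  proof -
    have p: "(prim (kap m R) has_real_derivative kap m R s) (at s)" for s
      using prim_has_vector_derivative[OF kap_continuous[OF m]]
      by (simp add: has_real_derivative_iff_has_vector_derivative)
    have "((\<lambda>t. (cmod (z + t *\<^sub>R w))\<^sup>2) has_real_derivative 2 * inner z w + 2 * t * (cmod w)\<^sup>2) (at t)"
      unfolding sq by (auto intro!: derivative_eq_intros)
    from DERIV_chain2[OF p this] have "(\<phi> has_real_derivative
        kap m R ((cmod (z + t *\<^sub>R w))\<^sup>2) * (2 * inner z w + 2 * t * (cmod w)\<^sup>2) / 2) (at t)"
      unfolding \<phi>_def pot_def by (rule DERIV_cdivide)
    moreover have "kap m R ((cmod (z + t *\<^sub>R w))\<^sup>2) * (2 * inner z w + 2 * t * (cmod w)\<^sup>2) / 2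
        = inner (tnl m R (z + t *\<^sub>R w)) w"
      by (simp add: tnl_def inner_add_left power2_norm_eq_inner algebra_simps)
    ultimately show ?thesis by simp
  qed
  obtain t where t: "0 < t" "t < 1" "\<phi> 1 - \<phi> 0 = (1 - 0) * inner (tnl m R (z + t *\<^sub>R w)) w"
    using MVT2[of 0 1 \<phi> "\<lambda>t. inner (tnl m R (z + t *\<^sub>R w)) w"] d by auto
  have "pot m R (z + w) - pot m R z - inner (tnl m R z) w = inner (tnl m R (z + t *\<^sub>R w) - tnl m R z) w"
    using t by (simp add: \<phi>_def inner_diff_left)
  then have "\<bar>pot m R (z + w) - pot m R z - inner (tnl m R z) w\<bar> \<le> cmod (tnl m R (z + t *\<^sub>R w) - tnl m R z) * cmod w"
    using Cauchy_Schwarz_ineq2 by metis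
  also have "\<dots> \<le> (Lip m R * cmod ((z + t *\<^sub>R w) - z)) * cmod w"
    by (intro mult_right_mono tnl_lipschitz m R) auto
  also have "\<dots> = Lip m R * t * (cmod w)\<^sup>2" using t by (simp add: power2_eq_square)
  also have "\<dots> \<le> Lip m R * 1 * (cmod w)\<^sup>2"
    using t Lip_nonneg[OF m, of R] by (intro mult_right_mono mult_left_mono) auto
  finally show ?thesis by simp
qed

subsection \<open>The induced operator and the potential energy\<close>

definition nlop :: "real \<Rightarrow> real \<Rightarrow> l2 \<Rightarrow> l2" where
  "nlop m R u = cls (\<lambda>x. tnl m R (fn u x))"

definition Pot :: "real \<Rightarrow> real \<Rightarrow> l2 \<Rightarrow> real" where
  "Pot m R u = (LINT x|lborel. pot m R (fn u x))"

locale truncation =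
  fixes m R :: real
  assumes m: "0 \<le> m" and R: "0 < R"
begin

lemma tnl_le: "cmod (tnl m R z) \<le> Lip m R * cmod z"
  using tnl_lipschitz[OF m R, of z 0] by simp

lemma tnl_measurable [measurable]: "tnl m R \<in> borel_measurable borel"
proof (intro borel_measurable_continuous_onI)
  have "(Lip m R)-lipschitz_on UNIV (tnl m R)"
    using tnl_lipschitz[OF m R] Lip_nonneg[OF m] by (auto simp: lipschitz_on_def dist_norm)
  then show "continuous_on UNIV (tnl m R)" by (rule lipschitz_on_continuous_on)
qed

lemma pot_measurable [measurable]: "pot m R \<in> borel_measurable borel"
  by (intro borel_measurable_continuous_onI pot_continuous m)

lemma L2_tnl: assumes "f \<in> L2" shows "(\<lambda>x. tnl m R (f x)) \<in> L2"
proof -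
  note [measurable] = L2_measurable[OF assms]
  show ?thesis by (rule L2_bound[OF assms, of _ "Lip m R"]) (auto simp: tnl_le)
qed

lemma fn_nlop: "AE x in lborel. fn (nlop m R u) x = tnl m R (fn u x)"
  unfolding nlop_def by (intro fn_cls L2_tnl) simp

lemma nlop_lipschitz: "norm (nlop m R u - nlop m R v) \<le> Lip m R * norm (u - v)"
proof (rule norm_l2_mono)
  show "AE x in lborel. cmod (fn (nlop m R u - nlop m R v) x) \<le> Lip m R * cmod (fn (u - v) x)"
    using fn_nlop[of u] fn_nlop[of v] fn_minus[of "nlop m R u" "nlop m R v"] fn_minus[of u v]
    by eventually_elim (simp add: tnl_lipschitz[OF m R])
qed (rule Lip_nonneg[OF m])

lemma nlop_0 [simp]: "nlop m R 0 = 0"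
  unfolding l2_eq_iff using fn_nlop[of 0] fn_zero by eventually_elim simp

lemma nlop_translate: "nlop m R (translate h u) = translate h (nlop m R u)"
  unfolding l2_eq_iff
  using fn_nlop[of "translate h u"] fn_translate[of h u] fn_translate[of h "nlop m R u"]
    fn_nlop[of u, folded AE_lborel_shift[of "\<lambda>x. fn (nlop m R u) x = tnl m R (fn u x)" h]]
  by eventually_elim simp

lemma pot_le: "pot m R z \<le> R powr (2 * m) * (cmod z)\<^sup>2"
  using pot_bounds(2)[OF m, of R z] kap_le[OF m R, of "(cmod z)\<^sup>2"]
  by (meson mult_right_mono order_trans zero_le_power2)

lemma pot_integrable: assumes "f \<in> L2" shows "integrable lborel (\<lambda>x. pot m R (f x))"
proof (rule Bochner_Integration.integrable_bound[where f = "\<lambda>x. R powr (2 * m) * (cmod (f x))\<^sup>2"])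
  note [measurable] = L2_measurable[OF assms]
  show "(\<lambda>x. pot m R (f x)) \<in> borel_measurable lborel" by measurable
  show "AE x in lborel. norm (pot m R (f x)) \<le> norm (R powr (2 * m) * (cmod (f x))\<^sup>2)"
    using pot_bounds(1)[OF m, of R] pot_le by simp
qed (use assms in auto)

lemma Pot_translate: "Pot m R (translate h u) = Pot m R u"
proof -
  have "Pot m R (translate h u) = (LINT x|lborel. pot m R (fn u (x + h)))"
    unfolding Pot_def by (rule integral_cong_AE) (use fn_translate[of h u] in auto)
  also have "\<dots> = Pot m R u"
    unfolding Pot_def using lborel_integral_real_affine[of 1 "\<lambda>x. pot m R (fn u x)" h]
    by (simp add: add.commute)
  finally show ?thesis .
qed

text \<open>The pointwise remainder is quadratic with a uniform constant, so it integrates to the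
  squared L^2 norm. This makes the potential energy differentiable on L^2 itself.\<close>

lemma Pot_taylor: "\<bar>Pot m R (u + v) - Pot m R u - inner (nlop m R u) v\<bar> \<le> Lip m R * (norm v)\<^sup>2"
proof -
  let ?D = "\<lambda>x. pot m R (fn u x + fn v x) - pot m R (fn u x) - inner (tnl m R (fn u x)) (fn v x)"
  have i1: "integrable lborel (\<lambda>x. pot m R (fn u x + fn v x))" by (intro pot_integrable L2_add fn_L2)
  have i2: "integrable lborel (\<lambda>x. pot m R (fn u x))" by (intro pot_integrable fn_L2)
  have i3: "integrable lborel (\<lambda>x. inner (tnl m R (fn u x)) (fn v x))"
    by (intro L2_inner_integrable L2_tnl fn_L2)
  have "Pot m R (u + v) = (LINT x|lborel. pot m R (fn u x + fn v x))"
    unfolding Pot_def by (rule integral_cong_AE) (use fn_plus[of u v] in auto)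
  moreover have "inner (nlop m R u) v = (LINT x|lborel. inner (tnl m R (fn u x)) (fn v x))"
    by (rule inner_l2_cong) (use fn_nlop[of u] in auto)
  ultimately have "Pot m R (u + v) - Pot m R u - inner (nlop m R u) v = (LINT x|lborel. ?D x)"
    using i1 i2 i3 by (simp add: Pot_def)
  also have "\<bar>\<dots>\<bar> \<le> (LINT x|lborel. Lip m R * (cmod (fn v x))\<^sup>2)"
    by (rule integral_abs_bound_integral) (use i1 i2 i3 pot_taylor[OF m R] in auto)
  also have "\<dots> = Lip m R * (norm v)\<^sup>2" by (simp add: norm_l2_sq)
  finally show ?thesis .
qed

lemma Pot_has_derivative: "(Pot m R has_derivative (\<lambda>v. inner (nlop m R u) v)) (at u)"
  unfolding has_derivative_at
proof (intro conjI bounded_linear_inner_right)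
  show "(\<lambda>h. norm (Pot m R (u + h) - Pot m R u - inner (nlop m R u) h) / norm h) \<midarrow>0\<rightarrow> 0"
  proof (rule Lim_null_comparison)
    show "\<forall>\<^sub>F h in at 0. norm (norm (Pot m R (u + h) - Pot m R u - inner (nlop m R u) h) / norm h) \<le> Lip m R * norm h"
    proof (intro always_eventually allI)
      fix h
      show "norm (norm (Pot m R (u + h) - Pot m R u - inner (nlop m R u) h) / norm h) \<le> Lip m R * norm h"
        using Pot_taylor[of u h]
        by (cases "h = 0") (auto simp: divide_simps power2_eq_square mult.assoc)
    qed
    show "(\<lambda>h. Lip m R * norm h) \<midarrow>0\<rightarrow> 0"
      by (auto intro!: tendsto_eq_intros)
  qed
qed

lemma Pot_nonneg: "0 \<le> Pot m R u"
  unfolding Pot_def by (intro Bochner_Integration.integral_nonneg pot_bounds m)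

text \<open>The bound involves the true power of the supremum and not the height \<open>R\<close>,
  which is what allows \<open>R\<close> to be chosen after the a priori bound.\<close>

lemma Pot_le_sup:
  assumes "AE x in lborel. cmod (fn u x) \<le> M" "0 \<le> M"
  shows "Pot m R u \<le> (if m = 0 then 1 else M powr (2 * m)) * (norm u)\<^sup>2"
proof -
  let ?c = "if m = 0 then 1 else M powr (2 * m)"
  have "Pot m R u \<le> (LINT x|lborel. ?c * (cmod (fn u x))\<^sup>2)"
    unfolding Pot_def
  proof (rule integral_mono_AE)
    show "AE x in lborel. pot m R (fn u x) \<le> ?c * (cmod (fn u x))\<^sup>2"
      using assms(1)
    proof eventually_elim
      case (elim x)
      have "kap m R ((cmod (fn u x))\<^sup>2) \<le> ?c"
      proof (cases "m = 0")
        case False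
        have "kap m R ((cmod (fn u x))\<^sup>2) \<le> cmod (fn u x) powr (2 * m)"
          using False m R by (intro kap_le_powr) auto
        also have "\<dots> \<le> M powr (2 * m)" using elim m by (intro powr_mono2) auto
        finally show ?thesis using False by simp
      qed (simp add: kap_def)
      then show ?case
        using pot_bounds(2)[OF m, of R "fn u x"] by (meson mult_right_mono order_trans zero_le_power2)
    qed
  qed (auto intro: pot_integrable)
  then show ?thesis by (simp add: norm_l2_sq)
qed

lemma nlop_eq_nonlinearity:
  assumes f: "f \<in> L2" and b: "AE x in lborel. cmod (f x) \<le> R"
  shows "nonlinearity m f \<in> L2" "nlop m R (cls f) = cls (nonlinearity m f)"
proof -
  have [measurable]: "f \<in> borel_measurable borel" using f by (rule L2_measurable)
  have meas: "nonlinearity m f \<in> borel_measurable borel" unfolding nonlinearity_def[abs_def] by measurable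
  have eq: "AE x in lborel. tnl m R (f x) = nonlinearity m f x"
    using b by eventually_elim (rule tnl_eq_nonlinearity[OF m R])
  show L2: "nonlinearity m f \<in> L2"
    by (rule L2_bound[OF L2_tnl[OF f] meas, of 1]) (use eq in auto)
  show "nlop m R (cls f) = cls (nonlinearity m f)"
    unfolding l2_eq_iff
    using fn_nlop[of "cls f"] fn_cls[OF f] fn_cls[OF L2] eq by eventually_elim simp
qed

text \<open>Pointwise the nonlinearity is a real multiple of z, hence orthogonal to i z.\<close>

lemma inner_nlop_i: "inner (nlop m R u) (mul (\<lambda>_. \<i>) u) = 0"
proof -
  have "inner (nlop m R u) (mul (\<lambda>_. \<i>) u) = (LINT x|lborel. inner (tnl m R (fn u x)) (\<i> * fn u x))"
    by (rule inner_l2_cong) (use fn_nlop[of u] fn_mul[OF bmult_const, of \<i> u] in auto)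
  also have "\<dots> = (LINT (x::real)|lborel. 0)"
    by (intro Bochner_Integration.integral_cong refl) (simp add: tnl_def inner_complex_def)
  finally show ?thesis by simp
qed

end

section \<open>Fourier multipliers\<close>

text \<open>The bands start at 0, so the cutoff to bounded frequencies contains the projection
  \<open>pos\<close>, and the symbols \<open>xi1\<close>, \<open>xi2\<close> are bounded versions of
  \<xi> and \<xi>^2.\<close>

definition chi :: "real \<Rightarrow> real \<Rightarrow> complex" where "chi n \<xi> = indicator {0..n} \<xi>"
definition xi1 :: "real \<Rightarrow> real \<Rightarrow> complex" where "xi1 n \<xi> = of_real \<xi> * chi n \<xi>"
definition xi2 :: "real \<Rightarrow> real \<Rightarrow> complex" where "xi2 n \<xi> = of_real (\<xi>\<^sup>2) * chi n \<xi>"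

lemma chi_measurable [measurable]: "chi n \<in> borel_measurable borel"
  unfolding chi_def[abs_def] by measurable

lemma xi_measurable [measurable]: "xi1 n \<in> borel_measurable borel" "xi2 n \<in> borel_measurable borel"
  unfolding xi1_def[abs_def] xi2_def[abs_def] by measurable

lemma bmult_chi [simp]: "bmult (chi n)"
  by (rule bmultI[of _ 1]) (auto simp: chi_def indicator_def)

lemma bmult_xi [simp]: "bmult (xi1 n)" "bmult (xi2 n)"
proof -
  show "bmult (xi1 n)"
    by (rule bmultI[of _ "\<bar>n\<bar>"]) (auto simp: xi1_def chi_def indicator_def)
  have "cmod (xi2 n x) \<le> n\<^sup>2" for x
    by (auto simp: xi2_def chi_def indicator_def norm_power intro!: power_mono)
  then show "bmult (xi2 n)" by (intro bmultI) measurable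
qed

lemma norm_chi_le: "cmod (chi n x) \<le> 1"
  by (simp add: chi_def indicator_def)

lemma norm_mul_chi_le: "norm (mul (chi n) y) \<le> norm y"
  using norm_mul_le[OF chi_measurable norm_chi_le] by simp

lemma mul_cong:
  assumes "bmult a" "bmult b" "AE \<xi> in lborel. a \<xi> * fn y \<xi> = b \<xi> * fn y \<xi>"
  shows "mul a y = mul b y"
  unfolding l2_eq_iff using fn_mul[OF assms(1), of y] fn_mul[OF assms(2), of y] assms(3)
  by eventually_elim simp

lemma chi_mul_chi: "chi n \<xi> * chi n \<xi> = chi n \<xi>"
  by (simp add: chi_def indicator_def)

text \<open>A purely imaginary symbol is skew for the real inner product. All cancellations of the
  dispersive term reduce to this.\<close>

lemma inner_mul_imag:
  assumes a: "bmult a" and im: "\<And>\<xi>. Re (a \<xi>) = 0" shows "inner y (mul a y) = 0"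
proof -
  have "cnj (a \<xi>) = - a \<xi>" for \<xi> using im by (simp add: complex_eq_iff)
  then have "inner (mul a y) y = inner y (- mul a y)"
    using inner_mul[OF a, of y y] mul_minus_left[OF bmult_const a, of 0 y] mul_const_real[of 0 y] by simp
  then show ?thesis by (simp add: inner_commute)
qed

lemma mul_chi_tendsto:
  assumes "mul pos y = y" shows "(\<lambda>n. mul (chi (real n)) y) \<longlonglongrightarrow> y"
proof -
  have "(\<lambda>n. mul (chi (real n)) y) \<longlonglongrightarrow> mul pos y"
  proof (rule mul_tendsto[where C = 1])
    show "AE x in lborel. (\<lambda>n. chi (real n) x) \<longlonglongrightarrow> pos x"
    proof (intro AE_I2)
      fix x :: real
      obtain N :: nat where N: "\<bar>x\<bar> \<le> real N" using real_arch_simple by blast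
      have "\<forall>\<^sub>F n in sequentially. pos x = chi (real n) x"
        using eventually_ge_at_top[of N]
        by eventually_elim (use N in \<open>auto simp: chi_def pos_def indicator_def abs_le_iff\<close>)
      then show "(\<lambda>n. chi (real n) x) \<longlonglongrightarrow> pos x" by (rule Lim_transform_eventually[OF tendsto_const])
    qed
  qed (auto simp: norm_chi_le)
  then show ?thesis using assms by simp
qed

lemma chi_pos: "chi n \<xi> * pos \<xi> = chi n \<xi>" "pos \<xi> * chi n \<xi> = chi n \<xi>"
  by (auto simp: chi_def pos_def indicator_def)

lemma mul_pos_AE: "mul pos y = y \<Longrightarrow> AE \<xi> in lborel. \<xi> < 0 \<longrightarrow> fn y \<xi> = 0"
  using fn_mul[OF bmult_pos, of y] by (auto simp: pos_def indicator_def elim!: eventually_mono)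

lemma norm_exp_taylor: "cmod (exp (\<i> * of_real t) - 1 - \<i> * of_real t) \<le> t\<^sup>2"
proof -
  have "cmod (exp (\<i> * of_real t) - 1 - \<i> * of_real t) \<le> \<bar>t\<bar>^2 / 2"
    using iexp_approx1[of t 1] by (simp add: diff_diff_eq numeral_2_eq_2)
  also have "\<dots> \<le> t\<^sup>2" by simp
  finally show ?thesis .
qed

text \<open>Boundedness of \<open>p\<close> makes the Taylor remainder of the exponential uniform in
  \<xi>, so the group is differentiable on every vector. It is applied to translations and to the
  free flow after their symbols have been cut to a band.\<close>

lemma exp_mul_has_vector_derivative:
  assumes p: "p \<in> borel_measurable borel" "\<And>\<xi>. \<bar>p \<xi>\<bar> \<le> B"
  shows "((\<lambda>t. mul (\<lambda>\<xi>. exp (\<i> * of_real (t * p \<xi>))) y)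
    has_vector_derivative mul (\<lambda>\<xi>. \<i> * of_real (p \<xi>) * exp (\<i> * of_real (t * p \<xi>))) y) (at t)"
proof -
  note [measurable] = p(1)
  define E where "E t \<xi> = exp (\<i> * of_real (t * p \<xi>))" for t \<xi>
  define D where "D \<xi> = \<i> * of_real (p \<xi>) * E t \<xi>" for \<xi>
  have nE: "cmod (E t \<xi>) = 1" for t \<xi> unfolding E_def by (rule norm_exp_i_times)
  have [measurable]: "E t \<in> borel_measurable borel" for t unfolding E_def[abs_def] by measurable
  have bE: "bmult (E t)" for t by (rule bmultI[of _ 1]) (auto simp: nE)
  have bD: "bmult D"
    by (rule bmultI[of _ B]) (auto simp: D_def[abs_def] nE norm_mult p)
  have est: "norm (mul (E (t + h)) y - mul (E t) y - h *\<^sub>R mul D y) \<le> B\<^sup>2 * h\<^sup>2 * norm y" for h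
  proof -
    have "mul (E (t + h)) y - mul (E t) y - h *\<^sub>R mul D y
        = mul (\<lambda>\<xi>. E (t + h) \<xi> - E t \<xi> - of_real h * D \<xi>) y"
      using bE bD by (simp add: mul_minus_left mul_real_left)
    also have "norm \<dots> \<le> B\<^sup>2 * h\<^sup>2 * norm y"
    proof (rule norm_mul_le)
      show "(\<lambda>\<xi>. E (t + h) \<xi> - E t \<xi> - of_real h * D \<xi>) \<in> borel_measurable borel"
        using bmult_measurable[OF bD] by measurable
      fix \<xi>
      have "E (t + h) \<xi> - E t \<xi> - of_real h * D \<xi>
          = E t \<xi> * (exp (\<i> * of_real (h * p \<xi>)) - 1 - \<i> * of_real (h * p \<xi>))"
        by (simp add: E_def D_def algebra_simps exp_add)
      then have "cmod (E (t + h) \<xi> - E t \<xi> - of_real h * D \<xi>) \<le> (h * p \<xi>)\<^sup>2"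
        using norm_exp_taylor[of "h * p \<xi>"] by (simp add: norm_mult nE)
      also have "\<dots> \<le> B\<^sup>2 * h\<^sup>2"
        using power_mono[OF p(2)[of \<xi>], of 2] by (simp add: power_mult_distrib mult.commute[of "B\<^sup>2"] mult_left_mono)
      finally show "cmod (E (t + h) \<xi> - E t \<xi> - of_real h * D \<xi>) \<le> B\<^sup>2 * h\<^sup>2" .
    qed
    finally show ?thesis .
  qed
  have "((\<lambda>t. mul (E t) y) has_derivative (\<lambda>h. h *\<^sub>R mul D y)) (at t)"
    unfolding has_derivative_at
  proof (intro conjI bounded_linear_scaleR_left)
    show "(\<lambda>h. norm (mul (E (t + h)) y - mul (E t) y - h *\<^sub>R mul D y) / norm h) \<midarrow>0\<rightarrow> 0"
    proof (rule Lim_null_comparison)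
      show "\<forall>\<^sub>F h in at 0. norm (norm (mul (E (t + h)) y - mul (E t) y - h *\<^sub>R mul D y) / norm h) \<le> B\<^sup>2 * norm y * \<bar>h\<bar>"
      proof (intro always_eventually allI)
        fix h :: real
        show "norm (norm (mul (E (t + h)) y - mul (E t) y - h *\<^sub>R mul D y) / norm h) \<le> B\<^sup>2 * norm y * \<bar>h\<bar>"
          using est[of h] by (cases "h = 0") (auto simp: divide_simps power2_eq_square mult_ac)
      qed
      show "(\<lambda>h. B\<^sup>2 * norm y * \<bar>h\<bar>) \<midarrow>0\<rightarrow> 0" by (auto intro!: tendsto_eq_intros)
    qed
  qed
  then show ?thesis by (simp add: has_vector_derivative_def E_def[abs_def] D_def[abs_def])
qed

subsection \<open>Multiplication by the frequency\<close>

text \<open>The graph of the unbounded operator of multiplication by \<xi>. That some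
  \<open>b\<close> exists says that \<open>IFT y\<close> belongs to H^1, and the norm of
  \<open>b\<close> is then the norm of its derivative.\<close>

definition has_xi :: "l2 \<Rightarrow> l2 \<Rightarrow> bool" where
  "has_xi y b \<longleftrightarrow> (AE \<xi> in lborel. fn b \<xi> = of_real \<xi> * fn y \<xi>)"

lemma has_xi_unique: "has_xi y b \<Longrightarrow> has_xi y c \<Longrightarrow> b = c"
  unfolding has_xi_def l2_eq_iff by (auto elim: eventually_elim2)

lemma has_xi_diff:
  assumes "has_xi y b" "has_xi z c" shows "has_xi (y - z) (b - c)"
  using assms fn_minus[of y z] fn_minus[of b c] unfolding has_xi_def
  by eventually_elim (simp add: right_diff_distrib)

lemma has_xi_mul: "bmult a \<Longrightarrow> has_xi y b \<Longrightarrow> has_xi (mul a y) (mul a b)"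
  unfolding has_xi_def using fn_mul[of a y] fn_mul[of a b] by auto

lemma has_xi_chi: "has_xi (mul (chi n) y) (mul (xi1 n) y)"
  unfolding has_xi_def using fn_mul[of "chi n" y] fn_mul[of "xi1 n" y] by (auto simp: xi1_def)

lemma has_xi_xi1: "has_xi y b \<Longrightarrow> mul (xi1 n) y = mul (chi n) b"
  unfolding has_xi_def l2_eq_iff using fn_mul[of "xi1 n" y] fn_mul[of "chi n" b] by (auto simp: xi1_def)

text \<open>Uniform bounds on the bands suffice, by Fatou's lemma. Negative frequencies are absent
  from \<open>y\<close>, so the bands [0, n] exhaust its support.\<close>

lemma has_xi_exists:
  assumes y: "mul pos y = y" and B: "\<And>n::nat. norm (mul (xi1 (real n)) y) \<le> B"
  obtains b where "has_xi y b" "norm b \<le> B" "mul pos b = b"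
proof -
  have B0: "0 \<le> B" using B[of 0] norm_ge_zero order_trans by blast
  let ?f = "\<lambda>\<xi>. of_real \<xi> * fn y \<xi>"
  have "(\<integral>\<^sup>+\<xi>. ennreal ((cmod (?f \<xi>))\<^sup>2) \<partial>lborel)
      = (\<integral>\<^sup>+\<xi>. liminf (\<lambda>n. ennreal ((cmod (xi1 (real n) \<xi> * fn y \<xi>))\<^sup>2)) \<partial>lborel)"
  proof (rule nn_integral_cong_AE)
    show "AE \<xi> in lborel. ennreal ((cmod (?f \<xi>))\<^sup>2) = liminf (\<lambda>n. ennreal ((cmod (xi1 (real n) \<xi> * fn y \<xi>))\<^sup>2))"
      using mul_pos_AE[OF y]
    proof eventually_elim
      case (elim x)
      obtain N :: nat where N: "\<bar>x\<bar> \<le> real N" using real_arch_simple by blast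
      have "\<forall>\<^sub>F n in sequentially. ennreal ((cmod (?f x))\<^sup>2) = ennreal ((cmod (xi1 (real n) x * fn y x))\<^sup>2)"
        using eventually_ge_at_top[of N]
        by eventually_elim (use N elim in \<open>auto simp: xi1_def chi_def indicator_def abs_le_iff\<close>)
      then have "(\<lambda>n. ennreal ((cmod (xi1 (real n) x * fn y x))\<^sup>2)) \<longlonglongrightarrow> ennreal ((cmod (?f x))\<^sup>2)"
        by (rule Lim_transform_eventually[OF tendsto_const])
      from lim_imp_Liminf[OF _ this] show ?case by simp
    qed
  qed
  also have "\<dots> \<le> liminf (\<lambda>n. \<integral>\<^sup>+\<xi>. ennreal ((cmod (xi1 (real n) \<xi> * fn y \<xi>))\<^sup>2) \<partial>lborel)"
    by (rule nn_integral_liminf) simp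
  also have "\<dots> \<le> ennreal (B\<^sup>2)"
  proof (rule Liminf_le)
    have "(\<integral>\<^sup>+\<xi>. ennreal ((cmod (xi1 (real n) \<xi> * fn y \<xi>))\<^sup>2) \<partial>lborel) \<le> ennreal (B\<^sup>2)" for n
      by (subst nn_norm_cls[OF L2_bmult])
        (use B[of n] in \<open>auto simp: mul_def[symmetric] intro!: ennreal_leI power_mono\<close>)
    then show "\<forall>\<^sub>F n in sequentially. (\<integral>\<^sup>+\<xi>. ennreal ((cmod (xi1 (real n) \<xi> * fn y \<xi>))\<^sup>2) \<partial>lborel) \<le> ennreal (B\<^sup>2)"
      by simp
  qed simp
  finally have le: "(\<integral>\<^sup>+\<xi>. ennreal ((cmod (?f \<xi>))\<^sup>2) \<partial>lborel) \<le> ennreal (B\<^sup>2)" .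
  have meas: "?f \<in> borel_measurable borel" by measurable
  note f = norm_cls_le_nn[OF meas le B0]
  have hx: "has_xi y (cls ?f)" unfolding has_xi_def by (rule fn_cls[OF f(1)])
  moreover have "mul pos (cls ?f) = cls ?f"
    using has_xi_unique[OF has_xi_mul[OF bmult_pos hx]] hx y by simp
  ultimately show thesis using that f(2) by blast
qed

lemma norm_xi1_le: assumes "has_xi y b" shows "norm (mul (xi1 n) y) \<le> norm b"
  unfolding has_xi_xi1[OF assms] by (rule norm_mul_chi_le)

section \<open>The logarithmic supremum bound\<close>

lemma integral_inverse_1_plus:
  assumes "0 \<le> K"
  shows "(\<integral>\<^sup>+\<xi>. ennreal (1 / (1 + \<xi>)) * indicator {0..K} \<xi> \<partial>lborel) = ennreal (ln (1 + K))"
proof -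
  have "(\<integral>\<^sup>+\<xi>. ennreal (1 / (1 + \<xi>)) * indicator {0..K} \<xi> \<partial>lborel) = ennreal (ln (1 + K) - ln (1 + 0))"
    by (rule nn_integral_FTC_Icc) (use assms in \<open>auto intro!: derivative_eq_intros\<close>)
  then show ?thesis by simp
qed

lemma integral_inverse_square:
  assumes K: "0 < K"
  shows "(\<integral>\<^sup>+\<xi>. ennreal (1 / \<xi>\<^sup>2) * indicator {K..} \<xi> \<partial>lborel) = ennreal (1 / K)"
proof -
  have "(\<integral>\<^sup>+\<xi>. ennreal (1 / \<xi>\<^sup>2) * indicator {K..} \<xi> \<partial>lborel) = ennreal (0 - (- (1 / K)))"
  proof (rule nn_integral_FTC_atLeast)
    show "((\<lambda>x. - (1 / x)) has_real_derivative 1 / x\<^sup>2) (at x)" if "K \<le> x" for x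
      using that K by (auto intro!: derivative_eq_intros simp: power2_eq_square)
    show "((\<lambda>x::real. - (1 / x)) \<longlongrightarrow> 0) at_top"
      using tendsto_minus[OF tendsto_inverse_0_at_top[OF filterlim_ident]] by (simp add: inverse_eq_divide)
  qed auto
  then show ?thesis by simp
qed

text \<open>
  The low frequencies are estimated with the conserved \<open>H\<^sup>1\<^sup>/\<^sup>2\<close> norm and the high ones with the
  \<open>H\<^sup>1\<close> norm, so that the latter enters only logarithmically after optimizing in \<open>K\<close>.
\<close>

lemma sup_bound:
  assumes xi: "has_xi y b" and y: "mul pos y = y" and K: "0 < K"
  shows "0 \<le> inner y b"
    "AE x in lborel. cmod (fn (IFT y) x) \<le> sqrt (ln (1 + K)) * sqrt ((norm y)\<^sup>2 + inner y b) + norm b / sqrt K"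
proof -
  define S where "S = sqrt ((norm y)\<^sup>2 + inner y b)"
  \<comment> \<open>The weight is the square root of 1 + \<xi>, so the L^2 norm of \<open>w\<close>
    is the inhomogeneous H^(1/2) norm \<open>S\<close>. The maximum with 0 only makes the formula
    meaningful for negative frequencies, where \<open>fn y\<close> vanishes.\<close>
  define w where "w \<xi> = complex_of_real (sqrt (1 + max 0 \<xi>) * cmod (fn y \<xi>))" for \<xi>
  have b: "AE \<xi> in lborel. fn b \<xi> = of_real \<xi> * fn y \<xi>" using xi by (simp add: has_xi_def)
  note yneg = mul_pos_AE[OF y]
  have inn: "AE \<xi> in lborel. inner (fn y \<xi>) (fn b \<xi>) = max 0 \<xi> * (cmod (fn y \<xi>))\<^sup>2"
    using b yneg by eventually_elim (auto simp: scaleR_conv_of_real[symmetric] power2_norm_eq_inner)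
  have ib: "inner y b = (LINT \<xi>|lborel. max 0 \<xi> * (cmod (fn y \<xi>))\<^sup>2)"
    by (rule inner_l2_cong[OF inn]) measurable
  then show nonneg: "0 \<le> inner y b" by simp
  have iint: "integrable lborel (\<lambda>\<xi>. max 0 \<xi> * (cmod (fn y \<xi>))\<^sup>2)"
    by (rule integrable_cong_AE[THEN iffD1, OF _ _ inn]) (auto intro: L2_inner_integrable)
  have wsq: "(cmod (w \<xi>))\<^sup>2 = (cmod (fn y \<xi>))\<^sup>2 + max 0 \<xi> * (cmod (fn y \<xi>))\<^sup>2" for \<xi>
  proof -
    have "cmod (w \<xi>) = sqrt (1 + max 0 \<xi>) * cmod (fn y \<xi>)"
      unfolding w_def norm_of_real by (simp add: abs_mult)
    then show ?thesis by (simp add: power_mult_distrib algebra_simps)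
  qed
  have [measurable]: "w \<in> borel_measurable borel" unfolding w_def by measurable
  have wL2: "w \<in> L2" by (rule L2_I) (auto simp: wsq iint)
  have "(norm (cls w))\<^sup>2 = (norm y)\<^sup>2 + inner y b"
    using norm_cls_sq[OF wL2] iint by (simp add: wsq ib norm_l2_sq[of y])
  then have nw: "norm (cls w) = S" unfolding S_def by (metis norm_ge_zero real_sqrt_unique)
  \<comment> \<open>\<open>p\<close> and \<open>q\<close> are the reciprocal weights on the two
    frequency ranges: 1/(1+\<xi>) integrates to the logarithm over [0, K], and 1/\<xi>^2 to 1/K
    beyond.\<close>
  define p where "p \<xi> = complex_of_real (sqrt (1 / (1 + \<xi>)) * indicator {0..K} \<xi>)" for \<xi> :: real
  define q where "q \<xi> = complex_of_real (1 / \<xi> * indicator {K..} \<xi>)" for \<xi> :: real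
  have [measurable]: "p \<in> borel_measurable borel" "q \<in> borel_measurable borel"
    unfolding p_def q_def by measurable
  have "(\<integral>\<^sup>+\<xi>. ennreal ((cmod (p \<xi>))\<^sup>2) \<partial>lborel) = (\<integral>\<^sup>+\<xi>. ennreal (1 / (1 + \<xi>)) * indicator {0..K} \<xi> \<partial>lborel)"
    by (intro nn_integral_cong) (auto simp: p_def indicator_def power_divide)
  also have "\<dots> = ennreal ((sqrt (ln (1 + K)))\<^sup>2)"
    using K by (subst integral_inverse_1_plus) auto
  finally have p: "p \<in> L2" "norm (cls p) \<le> sqrt (ln (1 + K))"
    using K by (auto intro!: norm_cls_le_nn[of p "sqrt (ln (1 + K))"])
  have "(\<integral>\<^sup>+\<xi>. ennreal ((cmod (q \<xi>))\<^sup>2) \<partial>lborel) = (\<integral>\<^sup>+\<xi>. ennreal (1 / \<xi>\<^sup>2) * indicator {K..} \<xi> \<partial>lborel)"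
    by (intro nn_integral_cong) (auto simp: q_def indicator_def norm_divide power_divide)
  also have "\<dots> = ennreal ((1 / sqrt K)\<^sup>2)"
    using K by (subst integral_inverse_square) (auto simp: power_divide)
  finally have q: "q \<in> L2" "norm (cls q) \<le> 1 / sqrt K"
    using K by (auto intro!: norm_cls_le_nn[of q "1 / sqrt K"])
  define ab where "ab \<xi> = complex_of_real (cmod (fn b \<xi>))" for \<xi>
  have abL2: "ab \<in> L2" by (rule L2_bound[OF fn_L2, of _ 1 b]) (auto simp: ab_def[abs_def])
  have nab: "norm (cls ab) = norm b"
    using norm_cls_sq[OF abL2] by (simp add: ab_def norm_l2_sq[symmetric])
  have pw: "(LINT \<xi>|lborel. inner (p \<xi>) (w \<xi>)) \<le> sqrt (ln (1 + K)) * S"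
  proof -
    have "inner (cls p) (cls w) \<le> norm (cls p) * norm (cls w)" by (rule norm_cauchy_schwarz)
    also have "\<dots> \<le> sqrt (ln (1 + K)) * S" unfolding nw by (intro mult_right_mono p) (simp add: S_def nonneg)
    finally show ?thesis by (simp add: inner_cls p wL2)
  qed
  have qb: "(LINT \<xi>|lborel. inner (q \<xi>) (ab \<xi>)) \<le> norm b / sqrt K"
  proof -
    have "inner (cls q) (cls ab) \<le> norm (cls q) * norm (cls ab)" by (rule norm_cauchy_schwarz)
    also have "\<dots> \<le> 1 / sqrt K * norm b" unfolding nab by (intro mult_right_mono q) simp
    finally show ?thesis by (simp add: inner_cls q abL2)
  qed
  have i1: "integrable lborel (\<lambda>\<xi>. inner (p \<xi>) (w \<xi>))" by (rule L2_inner_integrable[OF p(1) wL2])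
  have i2: "integrable lborel (\<lambda>\<xi>. inner (q \<xi>) (ab \<xi>))" by (rule L2_inner_integrable[OF q(1) abL2])
  \<comment> \<open>On low frequencies the first product equals |fn y|, on high ones the second
    does. Thus two applications of Cauchy-Schwarz bound the L^1 norm of the transform.\<close>
  have le: "AE \<xi> in lborel. cmod (fn y \<xi>) \<le> inner (p \<xi>) (w \<xi>) + inner (q \<xi>) (ab \<xi>)"
    using yneg b
  proof eventually_elim
    case (elim \<xi>)
    have pw0: "0 \<le> inner (p \<xi>) (w \<xi>)"
      by (auto simp: p_def w_def inner_complex_def indicator_def)
    have qb0: "0 \<le> inner (q \<xi>) (ab \<xi>)"
      using K by (auto simp: q_def ab_def inner_complex_def indicator_def)
    consider "\<xi> < 0" | "0 \<le> \<xi>" "\<xi> \<le> K" | "K < \<xi>" by linarith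
    then show ?case
    proof cases
      case 1
      then show ?thesis using elim pw0 qb0 by simp
    next
      case 2
      have "inner (p \<xi>) (w \<xi>) = (sqrt (1 / (1 + \<xi>)) * sqrt (1 + \<xi>)) * cmod (fn y \<xi>)"
        using 2 by (simp add: p_def w_def inner_complex_def)
      also have "sqrt (1 / (1 + \<xi>)) * sqrt (1 + \<xi>) = 1"
        using 2 by (simp add: real_sqrt_mult[symmetric])
      finally show ?thesis using qb0 by simp
    next
      case 3
      then have "inner (q \<xi>) (ab \<xi>) = cmod (fn y \<xi>)"
        using elim K by (simp add: q_def ab_def inner_complex_def norm_mult)
      then show ?thesis using pw0 by simp
    qed
  qed
  have yint: "integrable lborel (fn y)"
    by (rule Bochner_Integration.integrable_bound[OF Bochner_Integration.integrable_add[OF i1 i2]])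
      (use le in \<open>auto elim!: eventually_mono\<close>)
  have "(LINT \<xi>|lborel. cmod (fn y \<xi>)) \<le> (LINT \<xi>|lborel. inner (p \<xi>) (w \<xi>) + inner (q \<xi>) (ab \<xi>))"
    by (rule integral_mono_AE) (use yint i1 i2 le in auto)
  then have L1: "(LINT \<xi>|lborel. cmod (fn y \<xi>)) \<le> sqrt (ln (1 + K)) * S + norm b / sqrt K"
    using pw qb i1 i2 by simp
  have "1 / sqrt (2 * pi) \<le> 1"
  proof -
    have "1 \<le> 2 * pi" using pi_gt3 by linarith
    then show ?thesis by simp
  qed
  then have c: "1 / sqrt (2 * pi) * (LINT \<xi>|lborel. cmod (fn y \<xi>)) \<le> 1 * (LINT \<xi>|lborel. cmod (fn y \<xi>))"
    by (intro mult_right_mono) auto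
  have "fn y \<in> L12" by (intro L12_I yint) simp
  from AE_bound_IFT[OF this]
  show "AE x in lborel. cmod (fn (IFT y) x) \<le> sqrt (ln (1 + K)) * sqrt ((norm y)\<^sup>2 + inner y b) + norm b / sqrt K"
  proof eventually_elim
    case (elim x)
    then show ?case using c L1 by (simp add: S_def)
  qed
qed

section \<open>Galerkin approximation and conservation laws\<close>

lemma inner_mul_right: "bmult a \<Longrightarrow> inner u (mul a v) = inner (mul (\<lambda>x. cnj (a x)) u) v"
  using inner_mul[of "\<lambda>x. cnj (a x)" u v] by simp

lemma norm_xi2_le: "cmod (xi2 n x) \<le> n\<^sup>2"
  by (auto simp: xi2_def chi_def indicator_def norm_power intro!: power_mono)

text \<open>A real symbol is self-adjoint, so both terms of the product rule agree.\<close>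

lemma quadratic_form_derivative:
  assumes y: "(y has_vector_derivative y') (at t)" and a: "bmult a" "\<And>\<xi>. Im (a \<xi>) = 0"
  shows "((\<lambda>t. inner (y t) (mul a (y t))) has_real_derivative 2 * inner (mul a (y t)) y') (at t)"
proof -
  have c: "(\<lambda>\<xi>. cnj (a \<xi>)) = a" using a(2) by (simp add: fun_eq_iff complex_eq_iff)
  have "((\<lambda>t. mul a (y t)) has_vector_derivative mul a y') (at t)"
    by (rule bounded_linear.has_vector_derivative[OF bounded_linear_mul[OF a(1)] y])
  from bounded_bilinear.has_vector_derivative[OF bounded_bilinear_inner y this]
  have "((\<lambda>t. inner (y t) (mul a (y t))) has_vector_derivative
      inner (y t) (mul a y') + inner y' (mul a (y t))) (at t)" .
  moreover have "inner (y t) (mul a y') + inner y' (mul a (y t)) = 2 * inner (mul a (y t)) y'"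
    using inner_mul[OF a(1), of "y t" y'] c by (simp add: inner_commute)
  ultimately show ?thesis by (simp add: has_real_derivative_iff_has_vector_derivative)
qed

locale nls = truncation +
  fixes lam :: real
  assumes lam: "lam \<in> {1, -1}"
begin

lemma abs_lam [simp]: "\<bar>lam\<bar> = 1"
  using lam by auto

definition N :: "l2 \<Rightarrow> l2" where "N y = FT (nlop m R (IFT y))"
text \<open>The energy on the band is half the squared norm of \<open>xi1\<close> y plus
  \<open>lam\<close> times the potential of \<open>IFT y\<close>. \<open>grad\<close> is its L^2
  gradient, and \<open>vf\<close> is the Hamiltonian field: -i times the gradient, projected back to
  the band.\<close>

definition grad :: "real \<Rightarrow> l2 \<Rightarrow> l2" where "grad n y = mul (xi2 n) y + lam *\<^sub>R N y"
definition vf :: "real \<Rightarrow> l2 \<Rightarrow> l2" where "vf n y = mul (\<lambda>\<xi>. - \<i> * chi n \<xi>) (grad n y)"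

lemma N_lipschitz: "norm (N y - N z) \<le> Lip m R * norm (y - z)"
  using nlop_lipschitz[of "IFT y" "IFT z"] by (simp add: N_def FT_diff[symmetric] IFT_diff[symmetric])

lemma N_0 [simp]: "N 0 = 0"
  by (simp add: N_def)

lemma inner_N: "inner z (N y) = inner (nlop m R (IFT y)) (IFT z)"
  unfolding N_def using inner_FT by (simp add: inner_commute)

lemma norm_mul_i_chi_le: "norm (mul (\<lambda>\<xi>. - \<i> * chi n \<xi>) y) \<le> norm y"
  using norm_mul_le[of "\<lambda>\<xi>. - \<i> * chi n \<xi>" 1 y] by (auto simp: norm_mult norm_chi_le)

lemma vf_0 [simp]: "vf n 0 = 0"
  by (simp add: vf_def grad_def)

lemma vf_diff: "vf n y - vf n z = mul (\<lambda>\<xi>. - \<i> * chi n \<xi>) (mul (xi2 n) (y - z) + lam *\<^sub>R (N y - N z))"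
  unfolding vf_def grad_def by (simp add: mul_add mul_diff mul_scaleR scaleR_diff_right)

lemma vf_lipschitz: "norm (vf n y - vf n z) \<le> (n\<^sup>2 + Lip m R) * norm (y - z)"
proof -
  have "norm (vf n y - vf n z) \<le> norm (mul (xi2 n) (y - z) + lam *\<^sub>R (N y - N z))"
    unfolding vf_diff by (rule norm_mul_i_chi_le)
  also have "\<dots> \<le> norm (mul (xi2 n) (y - z)) + norm (N y - N z)"
    using norm_triangle_ineq[of "mul (xi2 n) (y - z)" "lam *\<^sub>R (N y - N z)"] by simp
  also have "\<dots> \<le> n\<^sup>2 * norm (y - z) + Lip m R * norm (y - z)"
    by (intro add_mono N_lipschitz norm_mul_le norm_xi2_le) measurable
  finally show ?thesis by (simp add: algebra_simps)
qed

lemma chi_vf: "mul (chi n) (vf n y) = vf n y"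
  unfolding vf_def by (simp add: mul_mul mult.left_commute chi_mul_chi)

text \<open>On the band the dispersive term is bounded by n^2, so the field is globally Lipschitz.
  The part of the solution outside the band has zero derivative and starts at 0.\<close>

lemma galerkin_exists:
  obtains y where "y 0 = mul (chi n) y0" "\<And>t. (y has_vector_derivative vf n (y t)) (at t)"
    "\<And>t. mul (chi n) (y t) = y t"
proof -
  obtain y where y: "y 0 = mul (chi n) y0" "\<And>t. (y has_vector_derivative vf n (y t)) (at t)"
  proof (rule ode_global[where G = "\<lambda>_. vf n" and L = "n\<^sup>2 + Lip m R"])
    show "0 < n\<^sup>2 + Lip m R" using Lip_pos[OF m R] by (simp add: add_nonneg_pos)
  qed (use vf_lipschitz in auto)
  have "mul (chi n) (y t) = y t" for t
  proof -
    have d: "((\<lambda>t. mul (chi n) (y t) - y t) has_vector_derivative 0) (at t)" for t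
      using has_vector_derivative_diff[OF bounded_linear.has_vector_derivative
          [OF bounded_linear_mul[OF bmult_chi[of n]] y(2)[of t]] y(2)[of t]]
      by (simp add: chi_vf)
    obtain c where "\<And>t. mul (chi n) (y t) - y t = c"
      using has_vector_derivative_zero_constant[of UNIV "\<lambda>t. mul (chi n) (y t) - y t"] d by auto
    then have "mul (chi n) (y t) - y t = mul (chi n) (y 0) - y 0" by metis
    also have "\<dots> = 0" by (simp add: y(1) mul_mul chi_mul_chi)
    finally show ?thesis by simp
  qed
  with y show thesis by (rule that)
qed

text \<open>The quadratic quantity with real symbol \<open>a\<close> changes only through the
  nonlinearity, since the dispersive part contributes a purely imaginary symbol. What remains pairs
  \<open>N y\<close> with i a y, the infinitesimal symmetry generated by that quantity: a phase
  rotation for a = 1, a translation for a = \<xi>.\<close>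

lemma inner_vf:
  assumes a: "bmult a" "\<And>\<xi>. Im (a \<xi>) = 0"
  shows "inner (mul a y) (vf n y) = lam * inner (mul (\<lambda>\<xi>. \<i> * chi n \<xi> * a \<xi>) y) (N y)"
proof -
  have c: "cnj (a \<xi>) = a \<xi>" for \<xi> using a(2) by (simp add: complex_eq_iff)
  have cc: "cnj (chi n \<xi>) = chi n \<xi>" for \<xi> by (simp add: chi_def indicator_def)
  let ?c = "\<lambda>\<xi>. - \<i> * chi n \<xi>"
  have "inner (mul a y) (mul ?c (mul (xi2 n) y)) = inner y (mul (\<lambda>\<xi>. a \<xi> * (?c \<xi> * xi2 n \<xi>)) y)"
    using a by (subst inner_mul) (simp_all add: mul_mul c)
  also have "\<dots> = 0"
  proof (rule inner_mul_imag)
    show "bmult (\<lambda>\<xi>. a \<xi> * (?c \<xi> * xi2 n \<xi>))" using a by simp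
  qed (use a in \<open>auto simp: xi2_def chi_def indicator_def\<close>)
  finally have 1: "inner (mul a y) (mul ?c (mul (xi2 n) y)) = 0" .
  have "inner (mul a y) (mul ?c (N y)) = inner (mul (\<lambda>\<xi>. \<i> * chi n \<xi> * a \<xi>) y) (N y)"
    using a by (subst inner_mul_right) (simp_all add: mul_mul cc)
  then show ?thesis
    unfolding vf_def grad_def using 1 by (simp add: mul_add mul_scaleR inner_add_right)
qed

text \<open>Gauge invariance of the potential energy.\<close>

lemma inner_i_N: "inner (mul (\<lambda>_. \<i>) y) (N y) = 0"
  unfolding inner_N IFT_mul_const by (rule inner_nlop_i)

text \<open>Translation invariance of the potential energy.\<close>

lemma inner_xi_N:
  assumes y: "mul (chi n) y = y"
  shows "inner (mul (\<lambda>\<xi>. \<i> * xi1 n \<xi>) y) (N y) = 0"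
proof -
  \<comment> \<open>Translations act by exp(i h \<xi>), whose generator is unbounded. On functions
    with frequencies in [0, n] the bounded symbol \<open>p\<close> gives the same operators, so the
    orbit is differentiable in \<open>h\<close>.\<close>
  define p where "p \<xi> = (if 0 \<le> \<xi> \<and> \<xi> \<le> n then \<xi> else 0)" for \<xi> :: real
  have pm [measurable]: "p \<in> borel_measurable borel" unfolding p_def by measurable
  have pb: "\<bar>p \<xi>\<bar> \<le> \<bar>n\<bar>" for \<xi> by (auto simp: p_def)
  have pxi: "complex_of_real (p \<xi>) = xi1 n \<xi>" for \<xi> by (auto simp: p_def xi1_def chi_def indicator_def)
  define z where "z h = IFT (mul (\<lambda>\<xi>. exp (\<i> * of_real (h * p \<xi>))) y)" for h
  have z0: "z 0 = IFT y" by (simp add: z_def)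
  have "z h = translate h (IFT y)" for h
  proof -
    have "mul (\<lambda>\<xi>. exp (\<i> * of_real h * of_real \<xi>)) y = mul (\<lambda>\<xi>. exp (\<i> * of_real (h * p \<xi>))) y"
    proof (rule mul_cong)
      show "bmult (\<lambda>\<xi>. exp (\<i> * of_real h * of_real \<xi>))" by (rule bmultI[of _ 1]) auto
      show "bmult (\<lambda>\<xi>. exp (\<i> * of_real (h * p \<xi>)))"
      proof (rule bmultI[of _ 1])
        show "(\<lambda>\<xi>. exp (\<i> * of_real (h * p \<xi>))) \<in> borel_measurable borel" by measurable
      qed (simp only: norm_exp_i_times order_refl)
      have "AE \<xi> in lborel. fn y \<xi> = chi n \<xi> * fn y \<xi>" using fn_mul[OF bmult_chi, of n y] unfolding y .
      then show "AE \<xi> in lborel. exp (\<i> * of_real h * of_real \<xi>) * fn y \<xi> = exp (\<i> * of_real (h * p \<xi>)) * fn y \<xi>"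
        by eventually_elim (auto simp: chi_def p_def indicator_def mult.assoc split: if_splits)
    qed
    then have "FT (translate h (IFT y)) = FT (z h)" by (simp add: FT_translate z_def)
    then show ?thesis using arg_cong[of _ _ IFT] by (metis IFT_FT)
  qed
  then have const: "Pot m R (z h) = Pot m R (IFT y)" for h by (simp add: Pot_translate)
  have zd: "(z has_vector_derivative IFT (mul (\<lambda>\<xi>. \<i> * xi1 n \<xi>) y)) (at 0)"
    unfolding z_def
    using bounded_linear.has_vector_derivative[OF bounded_linear_IFT exp_mul_has_vector_derivative[OF pm pb, of y 0]]
    by (simp add: pxi)
  \<comment> \<open>The potential is constant along the orbit of translations, so its derivative
    there, given by the chain rule, is zero.\<close>
  have "((Pot m R \<circ> z) has_vector_derivative inner (nlop m R (z 0)) (IFT (mul (\<lambda>\<xi>. \<i> * xi1 n \<xi>) y))) (at 0)"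
    by (rule vector_derivative_diff_chain_within[OF zd has_derivative_at_withinI[OF Pot_has_derivative]])
  moreover have "(Pot m R \<circ> z) = (\<lambda>_. Pot m R (IFT y))" by (simp add: fun_eq_iff const)
  ultimately have "((\<lambda>_. Pot m R (IFT y)) has_vector_derivative
      inner (nlop m R (IFT y)) (IFT (mul (\<lambda>\<xi>. \<i> * xi1 n \<xi>) y))) (at (0::real))"
    by (simp add: z0)
  then have "inner (nlop m R (IFT y)) (IFT (mul (\<lambda>\<xi>. \<i> * xi1 n \<xi>) y)) = 0"
    by (rule vector_derivative_unique_at) (rule has_vector_derivative_const)
  then show ?thesis by (simp add: inner_N)
qed

context
  fixes n :: real and y :: "real \<Rightarrow> l2"
  assumes ode: "\<And>t. (y has_vector_derivative vf n (y t)) (at t)"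
    and band: "\<And>t. mul (chi n) (y t) = y t"
begin

lemma mass_conserved: "norm (y t) = norm (y 0)"
proof -
  have "((\<lambda>t. inner (y t) (mul (\<lambda>_. 1) (y t))) has_real_derivative 0) (at t)" for t
  proof -
    have "mul (\<lambda>\<xi>. \<i> * chi n \<xi>) (y t) = mul (\<lambda>_. \<i>) (mul (chi n) (y t))" by (simp add: mul_mul)
    then have "inner (mul (\<lambda>_. 1) (y t)) (vf n (y t)) = 0"
      using inner_vf[of "\<lambda>_. 1" "y t" n] inner_i_N[of "y t"] band[of t] by simp
    then show ?thesis
      using quadratic_form_derivative[OF ode, of "\<lambda>_. 1" t] by simp
  qed
  then have "inner (y t) (mul (\<lambda>_. 1) (y t)) = inner (y 0) (mul (\<lambda>_. 1) (y 0))"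
    by (intro DERIV_isconst_all) auto
  then show ?thesis by (simp add: norm_eq_sqrt_inner)
qed

lemma momentum_conserved: "inner (y t) (mul (xi1 n) (y t)) = inner (y 0) (mul (xi1 n) (y 0))"
proof -
  have re: "Im (xi1 n \<xi>) = 0" for \<xi> by (simp add: xi1_def chi_def indicator_def)
  have e: "\<i> * chi n \<xi> * xi1 n \<xi> = \<i> * xi1 n \<xi>" for \<xi> by (simp add: xi1_def chi_def indicator_def)
  have "((\<lambda>t. inner (y t) (mul (xi1 n) (y t))) has_real_derivative 0) (at t)" for t
    using quadratic_form_derivative[OF ode[of t] bmult_xi(1)[of n] re] inner_vf[OF bmult_xi(1)[of n] re, of "y t" n]
      inner_xi_N[OF band, of t] by (simp add: e)
  then show ?thesis by (intro DERIV_isconst_all) auto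
qed

text \<open>The time derivative is the inner product of the gradient with -i times its own
  projection to the band, which vanishes by \<open>inner_mul_imag\<close>.\<close>

lemma energy_conserved:
  "(norm (mul (xi1 n) (y t)))\<^sup>2 / 2 + lam * Pot m R (IFT (y t))
    = (norm (mul (xi1 n) (y 0)))\<^sup>2 / 2 + lam * Pot m R (IFT (y 0))"
proof -
  have re: "Im (xi2 n \<xi>) = 0" for \<xi> by (simp add: xi2_def chi_def indicator_def)
  have sq: "inner z (mul (xi2 n) z) = (norm (mul (xi1 n) z))\<^sup>2" for z
  proof -
    have "cnj (xi1 n \<xi>) * xi1 n \<xi> = xi2 n \<xi>" for \<xi>
      by (simp add: xi1_def xi2_def chi_def indicator_def power2_eq_square)
    then show ?thesis by (simp add: power2_norm_eq_inner inner_mul mul_mul)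
  qed
  have "((\<lambda>t. inner (y t) (mul (xi2 n) (y t)) / 2 + lam * Pot m R (IFT (y t))) has_real_derivative 0) (at t)" for t
  proof -
    have "((Pot m R \<circ> (\<lambda>t. IFT (y t))) has_vector_derivative inner (nlop m R (IFT (y t))) (IFT (vf n (y t)))) (at t)"
      by (rule vector_derivative_diff_chain_within
          [OF bounded_linear.has_vector_derivative[OF bounded_linear_IFT ode] has_derivative_at_withinI[OF Pot_has_derivative]])
    then have "((\<lambda>t. Pot m R (IFT (y t))) has_real_derivative inner (vf n (y t)) (N (y t))) (at t)"
      by (simp add: has_real_derivative_iff_has_vector_derivative inner_N o_def)
    then have "((\<lambda>t. inner (y t) (mul (xi2 n) (y t)) / 2 + lam * Pot m R (IFT (y t))) has_real_derivative
        2 * inner (mul (xi2 n) (y t)) (vf n (y t)) / 2 + lam * inner (vf n (y t)) (N (y t))) (at t)"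
      by (intro derivative_intros DERIV_cdivide quadratic_form_derivative[OF ode bmult_xi(2) re])
        (auto intro: derivative_eq_intros)
    moreover have "2 * inner (mul (xi2 n) (y t)) (vf n (y t)) / 2 + lam * inner (vf n (y t)) (N (y t))
        = inner (grad n (y t)) (vf n (y t))"
      by (simp add: grad_def inner_add_left inner_commute[of "vf n (y t)"])
    moreover have "inner (grad n (y t)) (vf n (y t)) = 0"
      unfolding vf_def by (rule inner_mul_imag, simp) (auto simp: chi_def indicator_def)
    ultimately show ?thesis by simp
  qed
  then have "inner (y t) (mul (xi2 n) (y t)) / 2 + lam * Pot m R (IFT (y t))
      = inner (y 0) (mul (xi2 n) (y 0)) / 2 + lam * Pot m R (IFT (y 0))"
    by (intro DERIV_isconst_all) auto
  then show ?thesis by (simp add: sq)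
qed

end

end

subsection \<open>The a priori bound\<close>

text \<open>The factor of the squared L^2 norm in \<open>Pot_le_sup\<close>; the separate case
  matches the convention chosen there for \<open>m = 0\<close>.\<close>

definition pw :: "real \<Rightarrow> real \<Rightarrow> real" where
  "pw m x = (if m = 0 then 1 else x powr (2 * m))"

text \<open>The right side of \<open>sup_bound\<close> when the frequencies are split at 1 + K^2.
  With norm of \<open>b\<close> at most \<open>K\<close>, the high frequency term is then at most
  1.\<close>

definition sb :: "real \<Rightarrow> real \<Rightarrow> real" where
  "sb A K = sqrt (ln (2 + K\<^sup>2)) * A + 1"

lemma sb_nonneg: "0 \<le> A \<Longrightarrow> 0 \<le> sb A K"
  by (simp add: sb_def)

lemma pw_nonneg: "0 \<le> pw m x"
  by (simp add: pw_def)

text \<open>A power of a logarithm grows slower than any power. With the exponent 1/(2m) in ln Y <=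
  Y^\<delta> / \<delta>, raising the square root to the power 2m gives exactly sqrt Y, which is
  linear in \<open>K\<close>.\<close>

lemma pw_sb_le:
  assumes "0 \<le> m" "0 \<le> A" obtains D where "0 \<le> D" "\<And>K. 0 \<le> K \<Longrightarrow> pw m (sb A K) \<le> D * (2 + K)"
proof (cases "m = 0")
  case True
  then show ?thesis by (intro that[of 1]) (auto simp: pw_def)
next
  case False
  then have m: "0 < m" using assms by simp
  define \<delta> where "\<delta> = 1 / (2 * m)"
  have \<delta>: "0 < \<delta>" using m by (simp add: \<delta>_def)
  define D where "D = (A / sqrt \<delta> + 1) powr (2 * m)"
  show ?thesis
  proof (rule that[of D])
    show "0 \<le> D" by (simp add: D_def)
    fix K :: real assume K: "0 \<le> K"
    define Y where "Y = 2 + K\<^sup>2"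
    have Y: "1 \<le> Y" by (simp add: Y_def add_increasing2)
    have y1: "1 \<le> sqrt (Y powr \<delta>)" using ge_one_powr_ge_zero[OF Y, of \<delta>] \<delta> by simp
    have "sqrt (ln Y) \<le> sqrt (Y powr \<delta> / \<delta>)"
      using ln_powr_bound[OF Y \<delta>] by simp
    then have "sb A K \<le> sqrt (Y powr \<delta>) / sqrt \<delta> * A + 1"
      unfolding sb_def Y_def[symmetric] using assms by (intro add_right_mono mult_right_mono) (simp_all add: real_sqrt_divide)
    also have "\<dots> \<le> (A / sqrt \<delta> + 1) * sqrt (Y powr \<delta>)"
      using y1 by (simp add: algebra_simps)
    finally have "pw m (sb A K) \<le> ((A / sqrt \<delta> + 1) * sqrt (Y powr \<delta>)) powr (2 * m)"
      using False m sb_nonneg[OF assms(2), of K] by (auto simp: pw_def intro!: powr_mono2)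
    also have "\<dots> = D * sqrt (Y powr \<delta>) powr (2 * m)"
      unfolding D_def using assms \<delta> by (subst powr_mult) auto
    also have "sqrt (Y powr \<delta>) powr (2 * m) = sqrt Y"
      using m Y by (simp add: powr_half_sqrt[symmetric] powr_powr \<delta>_def)
    also have "D * sqrt Y \<le> D * (2 + K)"
    proof (rule mult_left_mono)
      have "Y \<le> (2 + K)\<^sup>2" using K by (simp add: Y_def power2_eq_square algebra_simps)
      then show "sqrt Y \<le> 2 + K" using K by (intro real_le_lsqrt) auto
      show "0 \<le> D" by (simp add: D_def)
    qed
    finally show "pw m (sb A K) \<le> D * (2 + K)" .
  qed
qed

text \<open>By \<open>pw_sb_le\<close> the right side grows linearly in \<open>K\<close>, so the
  square on the left wins. This replaces a smallness or sign condition on the nonlinearity.\<close>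

lemma a_priori:
  assumes "0 \<le> m" "0 \<le> A" "0 \<le> C" "0 \<le> C'"
  obtains B where "\<And>K. 0 \<le> K \<Longrightarrow> K\<^sup>2 \<le> C + C' * pw m (sb A K) \<Longrightarrow> K \<le> B"
proof -
  obtain D where D: "0 \<le> D" "\<And>K. 0 \<le> K \<Longrightarrow> pw m (sb A K) \<le> D * (2 + K)"
    using pw_sb_le[OF assms(1,2)] by blast
  \<comment> \<open>For K > 1 both 2 + K <= 3 K and C <= C K hold; dividing by K gives the second
    summand, and the leading 1 covers K <= 1.\<close>
  show thesis
  proof (rule that[of "1 + (C + 3 * (C' * D))"])
    fix K assume K: "0 \<le> K" and le: "K\<^sup>2 \<le> C + C' * pw m (sb A K)"
    show "K \<le> 1 + (C + 3 * (C' * D))"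
    proof (cases "K \<le> 1")
      case True
      have "0 \<le> C' * D" using assms D by simp
      then show ?thesis using True assms(3) by linarith
    next
      case False
      have "C' * pw m (sb A K) \<le> C' * (D * (2 + K))" using D(2)[OF K] assms by (intro mult_left_mono) auto
      also have "\<dots> = C' * D * (2 + K)" by simp
      also have "\<dots> \<le> C' * D * (3 * K)" using False assms D by (intro mult_left_mono) auto
      finally have "K\<^sup>2 \<le> C + C' * D * (3 * K)" using le by linarith
      also have "\<dots> \<le> C * K + C' * D * (3 * K)" using False assms mult_left_mono[of 1 K C] by simp
      finally have "K * K \<le> (C + 3 * (C' * D)) * K" by (simp add: power2_eq_square algebra_simps)
      then have "K \<le> C + 3 * (C' * D)" using False by simp
      then show ?thesis by simp
    qed
  qed
qed

text \<open>By Cauchy-Schwarz an upper bound for the H^(1/2) norm that involves only the norms of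
  the initial datum and of its derivative.\<close>

definition h12 :: "l2 \<Rightarrow> l2 \<Rightarrow> real" where
  "h12 y b = sqrt ((norm y)\<^sup>2 + norm y * norm b)"

lemma sup_bound_sb:
  assumes xi: "has_xi y b" and y: "mul pos y = y" and A: "(norm y)\<^sup>2 + inner y b \<le> A\<^sup>2" "0 \<le> A"
    and K: "norm b \<le> K"
  shows "AE x in lborel. cmod (fn (IFT y) x) \<le> sb A K"
proof -
  have K0: "0 \<le> K" using K norm_ge_zero order_trans by blast
  have k: "0 < 1 + K\<^sup>2" by (simp add: add_pos_nonneg)
  have "norm b / sqrt (1 + K\<^sup>2) \<le> 1"
  proof -
    have "norm b \<le> sqrt (1 + K\<^sup>2)" using K by (intro real_le_rsqrt) (smt (verit) norm_ge_zero power_mono)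
    then show ?thesis using k by (simp add: divide_le_eq)
  qed
  moreover have "sqrt (ln (1 + (1 + K\<^sup>2))) * sqrt ((norm y)\<^sup>2 + inner y b) \<le> sqrt (ln (2 + K\<^sup>2)) * A"
    using A by (intro mult_mono) (auto intro!: real_le_lsqrt add_nonneg_nonneg sup_bound(1)[OF xi y k])
  ultimately show ?thesis
    using sup_bound(2)[OF xi y k] by (auto simp: sb_def elim!: eventually_mono)
qed

text \<open>Independent of \<open>n\<close> and \<open>R\<close>, so that \<open>R\<close> can be chosen afterwards.\<close>

lemma (in nls) galerkin_bound:
  assumes ode: "\<And>t. (y has_vector_derivative vf n (y t)) (at t)"
    and band: "\<And>t. mul (chi n) (y t) = y t"
    and y0: "y 0 = mul (chi n) z" "mul pos z = z" and z: "has_xi z b"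
  defines "A \<equiv> h12 z b"
  shows "(norm (mul (xi1 n) (y t)))\<^sup>2
    \<le> ((norm b)\<^sup>2 + 2 * (norm z)\<^sup>2 * pw m (sb A (norm b))) + 2 * (norm z)\<^sup>2 * pw m (sb A (norm (mul (xi1 n) (y t))))"
proof -
  have A0: "0 \<le> A" by (simp add: A_def h12_def)
  let ?b = "\<lambda>t. mul (xi1 n) (y t)"
  have xi: "has_xi (y t) (?b t)" for t using has_xi_chi[of n "y t"] band by simp
  have pos: "mul pos (y t) = y t" for t
    by (subst (1 2) band[symmetric]) (simp add: mul_mul chi_pos)
  have b0: "norm (?b 0) \<le> norm b"
  proof -
    have "(\<lambda>\<xi>. xi1 n \<xi> * chi n \<xi>) = xi1 n"
      by (simp add: fun_eq_iff xi1_def mult.assoc chi_mul_chi)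
    then have "?b 0 = mul (xi1 n) z" unfolding y0 by (simp add: mul_mul)
    then show ?thesis using norm_xi1_le[OF z] by simp
  qed
  have n0: "norm (y t) \<le> norm z" for t
    unfolding mass_conserved[OF ode band, of t] y0 by (rule norm_mul_chi_le)
  have "inner (y t) (?b t) \<le> norm z * norm b" for t
  proof -
    have "inner (y t) (?b t) \<le> norm (y 0) * norm (?b 0)"
      unfolding momentum_conserved[OF ode band, of t] by (rule norm_cauchy_schwarz)
    also have "\<dots> \<le> norm z * norm b" by (intro mult_mono n0 b0) auto
    finally show ?thesis .
  qed
  \<comment> \<open>Mass plus momentum at time t is controlled by the initial datum alone, so the
    constant \<open>A\<close> is the same at all times.\<close>
  then have h: "(norm (y t))\<^sup>2 + inner (y t) (?b t) \<le> A\<^sup>2" for t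
    using n0[of t] by (auto simp: A_def h12_def intro!: add_mono power_mono)
  have P: "Pot m R (IFT (y t)) \<le> pw m (sb A K) * (norm z)\<^sup>2" if "norm (?b t) \<le> K" for t K
  proof -
    have "Pot m R (IFT (y t)) \<le> pw m (sb A K) * (norm (IFT (y t)))\<^sup>2"
      unfolding pw_def
      by (rule Pot_le_sup[OF sup_bound_sb[OF xi pos h A0 that] sb_nonneg[OF A0]])
    also have "\<dots> \<le> pw m (sb A K) * (norm z)\<^sup>2"
      using n0[of t] by (intro mult_left_mono power_mono) (auto simp: pw_nonneg)
    finally show ?thesis .
  qed
  have "(norm (?b t))\<^sup>2 = (norm (?b 0))\<^sup>2 + 2 * (lam * Pot m R (IFT (y 0))) - 2 * (lam * Pot m R (IFT (y t)))"
    using energy_conserved[OF ode band, of t] by simp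
  also have "\<dots> \<le> (norm b)\<^sup>2 + 2 * Pot m R (IFT (y 0)) + 2 * Pot m R (IFT (y t))"
  proof -
    \<comment> \<open>The potential energies at both times are bounded in absolute value, which is
      why the sign of \<open>lam\<close> is irrelevant.\<close>
    have l: "lam * a \<le> a \<and> - (lam * a) \<le> a" if "0 \<le> a" for a using lam that by auto
    have "(norm (?b 0))\<^sup>2 \<le> (norm b)\<^sup>2" by (intro power_mono b0) simp
    then show ?thesis
      using l[OF Pot_nonneg[of "IFT (y 0)"]] l[OF Pot_nonneg[of "IFT (y t)"]] by linarith
  qed
  also have "\<dots> \<le> (norm b)\<^sup>2 + 2 * (pw m (sb A (norm b)) * (norm z)\<^sup>2) + 2 * (pw m (sb A (norm (?b t))) * (norm z)\<^sup>2)"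
    by (intro add_mono mult_left_mono P b0) auto
  finally show ?thesis by (simp add: mult_ac)
qed

section \<open>The global solution on the Fourier side\<close>

definition propagator :: "real \<Rightarrow> l2 \<Rightarrow> l2" where
  "propagator t = mul (\<lambda>\<xi>. exp (\<i> * of_real (- (t * \<xi>\<^sup>2))))"

lemma bmult_exp [simp]: "p \<in> borel_measurable borel \<Longrightarrow> bmult (\<lambda>\<xi>. exp (\<i> * of_real (p \<xi>)))"
proof (rule bmultI[of _ 1])
  assume [measurable]: "p \<in> borel_measurable borel"
  show "(\<lambda>\<xi>. exp (\<i> * of_real (p \<xi>))) \<in> borel_measurable borel" by measurable
qed (simp only: norm_exp_i_times order_refl)

lemma bmult_exp_mult: "bmult (\<lambda>\<xi>. exp (\<i> * of_real h * of_real \<xi>))"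
  by (rule bmultI[of _ 1]) auto

lemma bmult_S [simp]: "bmult (\<lambda>\<xi>. exp (\<i> * of_real (- (t * \<xi>\<^sup>2))))"
  by (rule bmult_exp) measurable

lemma bounded_linear_propagator: "bounded_linear (propagator t)"
  unfolding propagator_def by (rule bounded_linear_mul) (rule bmult_S)

lemma norm_propagator_le: "norm (propagator t y) \<le> norm y"
proof -
  have "norm (propagator t y) \<le> 1 * norm y"
    unfolding propagator_def
    by (rule norm_mul_le[OF bmult_measurable[OF bmult_S]]) (simp only: norm_exp_i_times order_refl)
  then show ?thesis by simp
qed

lemma propagator_mul: "bmult a \<Longrightarrow> propagator t (mul a y) = mul (\<lambda>\<xi>. exp (\<i> * of_real (- (t * \<xi>\<^sup>2))) * a \<xi>) y"
  unfolding propagator_def by (rule mul_mul[OF bmult_S])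

lemma mul_propagator: "bmult a \<Longrightarrow> mul a (propagator t y) = propagator t (mul a y)"
  unfolding propagator_def using bmult_S[of t] by (simp only: mul_mul mult.commute)

lemma propagator_inverse: "propagator t (propagator (- t) y) = y" "propagator (- t) (propagator t y) = y"
proof -
  have e: "exp (\<i> * of_real (- (s * \<xi>\<^sup>2))) * exp (\<i> * of_real (- (- s * \<xi>\<^sup>2))) = 1" for s \<xi>
    by (simp add: exp_add[symmetric])
  then have "propagator s (propagator (- s) y) = y" for s
    unfolding propagator_def mul_mul[OF bmult_S bmult_S] e by simp
  from this[of t] this[of "- t"] show "propagator t (propagator (- t) y) = y" "propagator (- t) (propagator t y) = y" by simp_all
qed

text \<open>The symbol \<xi>^2 is unbounded, so the continuity is only strong: it is dominated
  convergence for each fixed vector.\<close>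

lemma propagator_continuous: "continuous_on UNIV (\<lambda>t. propagator t y)"
proof (rule continuous_on_sequentiallyI)
  fix X :: "nat \<Rightarrow> real" and a assume X: "X \<longlonglongrightarrow> a"
  show "(\<lambda>n. propagator (X n) y) \<longlonglongrightarrow> propagator a y"
    unfolding propagator_def
  proof (rule mul_tendsto[where C = 1])
    show "AE x in lborel. (\<lambda>n. exp (\<i> * of_real (- (X n * x\<^sup>2)))) \<longlonglongrightarrow> exp (\<i> * of_real (- (a * x\<^sup>2)))"
      by (intro AE_I2 tendsto_intros X)
    show "cmod (exp (\<i> * of_real (- (X n * x\<^sup>2)))) \<le> 1" for n x by (simp only: norm_exp_i_times order_refl)
  qed (rule bmult_measurable[OF bmult_S])+
qed

lemma propagator_continuous_compose: "continuous_on UNIV c \<Longrightarrow> continuous_on UNIV (\<lambda>t. propagator t (c t))"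
  by (rule continuous_on_lipschitz_param[OF propagator_continuous, where L = 1])
    (auto simp: dist_norm norm_propagator_le linear_diff[OF bounded_linear.linear[OF bounded_linear_propagator], symmetric])

text \<open>A product rule for a family of linear contractions applied to a moving vector. The
  contraction bound absorbs the remainder of \<open>z\<close>, so differentiability of the family at
  the single vector \<open>z t\<close> and continuity at \<open>z'\<close> suffice.\<close>

lemma has_vector_derivative_apply_family:
  fixes A :: "real \<Rightarrow> 'a::real_normed_vector \<Rightarrow> 'b::real_normed_vector"
  assumes lin: "\<And>s. linear (A s)" and le: "\<And>s x. norm (A s x) \<le> norm x"
    and A: "((\<lambda>s. A s (z t)) has_vector_derivative D) (at t)"
    and z: "(z has_vector_derivative z') (at t)" and c: "((\<lambda>s. A s z') \<longlongrightarrow> A t z') (at t)"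
  shows "((\<lambda>s. A s (z s)) has_vector_derivative A t z' + D) (at t)"
proof -
  let ?r = "\<lambda>s. norm (z s - z t - (s - t) *\<^sub>R z') / norm (s - t)"
  let ?q = "\<lambda>s. norm (A s (z t) - A t (z t) - (s - t) *\<^sub>R D) / norm (s - t)"
  have r: "(?r \<longlongrightarrow> 0) (at t)" and q: "(?q \<longlongrightarrow> 0) (at t)"
    using z A by (auto simp: has_vector_derivative_def has_derivative_iff_norm)
  have "((\<lambda>s. norm (A s (z s) - A t (z t) - (s - t) *\<^sub>R (A t z' + D)) / norm (s - t)) \<longlongrightarrow> 0) (at t)"
  proof (rule Lim_null_comparison)
    have "((\<lambda>s. norm (A s z' - A t z')) \<longlongrightarrow> 0) (at t)"
      using c by (simp add: LIM_zero tendsto_norm_zero)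
    from tendsto_add[OF tendsto_add[OF r q] this]
    show "((\<lambda>s. ?r s + ?q s + norm (A s z' - A t z')) \<longlongrightarrow> 0) (at t)" by simp
    show "\<forall>\<^sub>F s in at t. norm (norm (A s (z s) - A t (z t) - (s - t) *\<^sub>R (A t z' + D)) / norm (s - t))
        \<le> ?r s + ?q s + norm (A s z' - A t z')"
      unfolding eventually_at_filter
    proof (intro always_eventually allI impI)
      fix s assume s: "s \<noteq> t"
      have "A s (z s) - A t (z t) - (s - t) *\<^sub>R (A t z' + D)
          = A s (z s - z t - (s - t) *\<^sub>R z') + (A s (z t) - A t (z t) - (s - t) *\<^sub>R D)
            + (s - t) *\<^sub>R (A s z' - A t z')"
        by (simp add: linear_diff[OF lin] linear_add[OF lin] linear_scale[OF lin] algebra_simps)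
      then have "norm (A s (z s) - A t (z t) - (s - t) *\<^sub>R (A t z' + D))
          \<le> norm (z s - z t - (s - t) *\<^sub>R z') + norm (A s (z t) - A t (z t) - (s - t) *\<^sub>R D)
            + norm (s - t) * norm (A s z' - A t z')"
        using le[of s "z s - z t - (s - t) *\<^sub>R z'"]
        by (smt (verit, ccfv_threshold) norm_scaleR norm_triangle_ineq real_norm_def)
      then show "norm (norm (A s (z s) - A t (z t) - (s - t) *\<^sub>R (A t z' + D)) / norm (s - t))
          \<le> ?r s + ?q s + norm (A s z' - A t z')"
        using s by (simp add: divide_simps mult.commute)
    qed
  qed
  then show ?thesis
    by (simp add: has_vector_derivative_def has_derivative_iff_norm bounded_linear_scaleR_left)
qed

text \<open>A common core for the convergence of the Galerkin solutions and for uniqueness. Only the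
  part \<open>d\<close> of \<open>w\<close> in the band satisfies a differential equation. The
  forcing is controlled by all of \<open>w\<close>, so the tail \<open>e\<close> enters as a source
  that vanishes as n grows.\<close>

lemma chi_gronwall:
  fixes w g :: "nat \<Rightarrow> real \<Rightarrow> l2"
  assumes cont: "\<And>n. continuous_on UNIV (w n)"
    and der: "\<And>n t. ((\<lambda>t. mul (chi (real n)) (w n t)) has_vector_derivative
        mul (\<lambda>\<xi>. - \<i> * chi (real n) \<xi>) (mul (xi2 (real n)) (w n t) + g n t)) (at t)"
    and g: "\<And>n s. \<bar>s\<bar> \<le> T \<Longrightarrow> norm (g n s) \<le> L * norm (w n s)" and L: "0 \<le> L"
    and w0: "\<And>n. mul (chi (real n)) (w n 0) = 0"
    and h: "continuous_on UNIV h" "\<And>n s. norm (w n s - mul (chi (real n)) (w n s)) \<le> h s"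
    and tail: "\<And>s. (\<lambda>n. w n s - mul (chi (real n)) (w n s)) \<longlonglongrightarrow> 0" and t: "\<bar>t\<bar> \<le> T"
  shows "(\<lambda>n. mul (chi (real n)) (w n t)) \<longlonglongrightarrow> 0"
proof -
  define d where "d n s = mul (chi (real n)) (w n s)" for n s
  define e where "e n s = w n s - d n s" for n s
  define f' where "f' n s = 2 * inner (d n s) (mul (\<lambda>\<xi>. - \<i> * chi (real n) \<xi>) (g n s))" for n s
  have bc: "bmult (\<lambda>\<xi>. - \<i> * chi (real n) \<xi>)" for n by (rule bmult_times[OF bmult_const bmult_chi])
  \<comment> \<open>The rate \<open>3 * L\<close> comes from 2 |d| (|d| + |e|) <= 3 |d|^2 +
    |e|^2.\<close>
  have "(\<lambda>n. (norm (d n t))\<^sup>2) \<longlonglongrightarrow> 0"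
  proof (rule gronwall_tendsto_0[where f' = f' and a = "3 * L" and q = "\<lambda>n s. L * (norm (e n s))\<^sup>2"
        and h = "\<lambda>s. L * (h s)\<^sup>2" and T = T])
    show "((\<lambda>s. (norm (d n s))\<^sup>2) has_real_derivative f' n s) (at s)" for n s
    proof -
      let ?D = "mul (\<lambda>\<xi>. - \<i> * chi (real n) \<xi>) (mul (xi2 (real n)) (w n s) + g n s)"
      have "((\<lambda>s. inner (d n s) (mul (\<lambda>_. 1) (d n s))) has_real_derivative 2 * inner (mul (\<lambda>_. 1) (d n s)) ?D) (at s)"
        unfolding d_def by (rule quadratic_form_derivative[OF der]) auto
      \<comment> \<open>The symbol \<open>xi2\<close> already contains the cutoff, so the dispersive
        term sees only \<open>d\<close> and is skew on it.\<close>
      moreover have "inner (d n s) (mul (\<lambda>\<xi>. - \<i> * chi (real n) \<xi>) (mul (xi2 (real n)) (w n s))) = 0"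
      proof -
        have "mul (xi2 (real n)) (w n s) = mul (xi2 (real n)) (d n s)"
        proof -
          have "(\<lambda>\<xi>. xi2 (real n) \<xi> * chi (real n) \<xi>) = xi2 (real n)"
            by (simp add: fun_eq_iff xi2_def mult.assoc chi_mul_chi)
          then show ?thesis by (simp add: d_def mul_mul)
        qed
        then have "inner (d n s) (mul (\<lambda>\<xi>. - \<i> * chi (real n) \<xi>) (mul (xi2 (real n)) (w n s)))
            = inner (d n s) (mul (\<lambda>\<xi>. - \<i> * chi (real n) \<xi> * xi2 (real n) \<xi>) (d n s))"
          using mul_mul[OF bc bmult_xi(2)] by simp
        also have "\<dots> = 0"
          by (rule inner_mul_imag, rule bmult_times[OF bc bmult_xi(2)]) (simp add: xi2_def chi_def indicator_def)
        finally show ?thesis .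
      qed
      ultimately show ?thesis
        unfolding f'_def mul_add[OF bc] inner_add_right power2_norm_eq_inner by simp
    qed
    show "continuous_on UNIV (\<lambda>s. L * (norm (e n s))\<^sup>2)" for n
      unfolding e_def d_def
      by (intro continuous_intros cont bounded_linear.continuous_on[OF bounded_linear_mul[OF bmult_chi]])
    show "\<bar>f' n s\<bar> \<le> 3 * L * (norm (d n s))\<^sup>2 + L * (norm (e n s))\<^sup>2" if "\<bar>s\<bar> \<le> T" for n s
    proof -
      have "norm (w n s) \<le> norm (d n s) + norm (e n s)"
        using norm_triangle_ineq[of "d n s" "e n s"] by (simp add: e_def)
      then have gl: "norm (g n s) \<le> L * (norm (d n s) + norm (e n s))"
        using g[OF that, of n] L by (meson mult_left_mono order_trans)
      have "norm (mul (\<lambda>\<xi>. - \<i> * chi (real n) \<xi>) (g n s)) \<le> 1 * norm (g n s)"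
        by (rule norm_mul_le[OF bmult_measurable[OF bc]]) (simp add: norm_mult norm_chi_le)
      then have "\<bar>f' n s\<bar> \<le> 2 * (norm (d n s) * (L * (norm (d n s) + norm (e n s))))"
        using Cauchy_Schwarz_ineq2[of "d n s" "mul (\<lambda>\<xi>. - \<i> * chi (real n) \<xi>) (g n s)"] gl
          mult_left_mono[of "norm (mul (\<lambda>\<xi>. - \<i> * chi (real n) \<xi>) (g n s))" "L * (norm (d n s) + norm (e n s))" "norm (d n s)"]
        unfolding f'_def abs_mult by simp
      also have "\<dots> = L * (2 * (norm (d n s))\<^sup>2 + 2 * norm (d n s) * norm (e n s))"
        by (simp add: power2_eq_square algebra_simps)
      also have "\<dots> \<le> L * (2 * (norm (d n s))\<^sup>2 + ((norm (d n s))\<^sup>2 + (norm (e n s))\<^sup>2))"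
        using L sum_squares_bound[of "norm (d n s)" "norm (e n s)"] by (intro mult_left_mono add_left_mono) auto
      finally show ?thesis by (simp add: algebra_simps)
    qed
    show "L * (norm (e n s))\<^sup>2 \<le> L * (h s)\<^sup>2" for n s
      using h(2)[of n s] L by (auto simp: e_def d_def intro!: mult_left_mono power_mono)
    show "(\<lambda>n. L * (norm (e n s))\<^sup>2) \<longlonglongrightarrow> 0" for s
      using tendsto_mult[OF tendsto_const tendsto_power[OF tendsto_norm[OF tail[of s]], of 2], of L]
      by (simp add: e_def d_def)
    show "continuous_on UNIV (\<lambda>s. L * (h s)\<^sup>2)" by (intro continuous_intros h)
  qed (use w0 L t in \<open>auto simp: d_def\<close>)
  from tendsto_real_sqrt[OF this] have "(\<lambda>n. norm (d n t)) \<longlonglongrightarrow> 0" by simp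
  then show ?thesis by (simp add: d_def tendsto_norm_zero_iff)
qed

context nls begin

text \<open>The H^1 bound for the nonlinearity by difference quotients: a Lipschitz map commuting
  with translations does not increase them beyond its Lipschitz constant. On the frequency side the
  quotient is multiplication by (exp(i h \<xi>) - 1)/h.\<close>

lemma norm_mul_xi1_N:
  assumes c: "has_xi y c" shows "norm (mul (xi1 k) (N y)) \<le> Lip m R * norm c"
proof -
  let ?u = "IFT y"
  define e where "e j \<xi> = exp (\<i> * of_real (1 / real (Suc j)) * of_real \<xi>) - 1" for j :: nat and \<xi> :: real
  have ele: "cmod (e j \<xi>) \<le> \<bar>\<xi>\<bar> / real (Suc j)" for j \<xi>
    using iexp_approx1[of "\<xi> / real (Suc j)" 0] by (simp add: e_def)
  have be: "bmult (e j)" for j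
    unfolding e_def[abs_def] by (rule bmult_diff[OF bmult_exp_mult bmult_const])
  have FTe: "mul (e j) (FT u) = FT (translate (1 / real (Suc j)) u - u)" for j u
  proof -
    show ?thesis
      unfolding e_def[abs_def] FT_diff FT_translate mul_minus_left[OF bmult_exp_mult bmult_const] by simp
  qed
  have le: "norm (mul (e j) (N y)) \<le> Lip m R * norm c / real (Suc j)" for j
  proof -
    have "norm (mul (e j) (N y)) = norm (nlop m R (translate (1 / real (Suc j)) ?u) - nlop m R ?u)"
      unfolding N_def FTe by (simp add: nlop_translate)
    also have "\<dots> \<le> Lip m R * norm (translate (1 / real (Suc j)) ?u - ?u)" by (rule nlop_lipschitz)
    also have "norm (translate (1 / real (Suc j)) ?u - ?u) = norm (mul (e j) y)"
      using FTe[of j ?u] by (metis FT_IFT norm_FT)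
    also have "norm (mul (e j) y) \<le> 1 / real (Suc j) * norm c"
    proof (rule norm_l2_mono)
      show "AE \<xi> in lborel. cmod (fn (mul (e j) y) \<xi>) \<le> 1 / real (Suc j) * cmod (fn c \<xi>)"
        using fn_mul[OF be, of j y] c[unfolded has_xi_def]
      proof eventually_elim
        case (elim \<xi>)
        then show ?case
          using mult_right_mono[OF ele[of j \<xi>], of "cmod (fn y \<xi>)"] by (simp add: norm_mult)
      qed
    qed simp
    finally show ?thesis using Lip_nonneg[OF m, of R] by (simp add: mult_left_mono)
  qed
  \<comment> \<open>With step 1/(j+1), multiplying \<open>e j\<close> by -i (j+1) recovers \<xi> in
    the limit. The band cutoff makes these symbols uniformly bounded, as dominated convergence
    demands.\<close>
  define a where "a j \<xi> = (- \<i> * of_real (real (Suc j)) * chi k \<xi>) * e j \<xi>" for j \<xi>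
  have "(\<lambda>j. mul (a j) (N y)) \<longlonglongrightarrow> mul (xi1 k) (N y)"
  proof (rule mul_tendsto[where C = "\<bar>k\<bar>"])
    show "a j \<in> borel_measurable borel" for j
      unfolding a_def[abs_def] using bmult_measurable[OF be] by measurable
    show "cmod (a j \<xi>) \<le> \<bar>k\<bar>" for j \<xi>
    proof (cases "0 \<le> \<xi> \<and> \<xi> \<le> k")
      case True
      have "cmod (a j \<xi>) \<le> real (Suc j) * (\<bar>\<xi>\<bar> / real (Suc j))"
        using mult_left_mono[OF ele[of j \<xi>], of "real (Suc j)"] True
        by (simp add: a_def norm_mult chi_def indicator_def del: of_nat_Suc)
      then show ?thesis using True by simp
    qed (auto simp: a_def chi_def indicator_def)
    show "AE \<xi> in lborel. (\<lambda>j. a j \<xi>) \<longlonglongrightarrow> xi1 k \<xi>"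
    proof (rule AE_I2, rule LIM_zero_cancel)
      fix \<xi> :: real
      show "(\<lambda>j. a j \<xi> - xi1 k \<xi>) \<longlonglongrightarrow> 0"
      proof (rule Lim_null_comparison)
        show "(\<lambda>j. \<xi>\<^sup>2 / real (Suc j)) \<longlonglongrightarrow> 0" by (rule LIMSEQ_Suc[OF lim_const_over_n])
        show "\<forall>\<^sub>F j in sequentially. norm (a j \<xi> - xi1 k \<xi>) \<le> \<xi>\<^sup>2 / real (Suc j)"
        proof (intro always_eventually allI)
          fix j
          let ?\<theta> = "\<xi> / real (Suc j)"
          have "a j \<xi> - xi1 k \<xi> = (- \<i> * of_real (real (Suc j)) * chi k \<xi>) * (exp (\<i> * of_real ?\<theta>) - 1 - \<i> * of_real ?\<theta>)"
            by (simp add: a_def e_def xi1_def field_simps del: of_nat_Suc)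
          then have "norm (a j \<xi> - xi1 k \<xi>) = real (Suc j) * cmod (chi k \<xi>) * cmod (exp (\<i> * of_real ?\<theta>) - 1 - \<i> * of_real ?\<theta>)"
            by (simp add: norm_mult del: of_nat_Suc)
          also have "\<dots> \<le> real (Suc j) * 1 * ?\<theta>\<^sup>2"
            by (intro mult_mono norm_exp_taylor norm_chi_le) auto
          also have "\<dots> = \<xi>\<^sup>2 / real (Suc j)" by (simp add: power2_eq_square)
          finally show "norm (a j \<xi> - xi1 k \<xi>) \<le> \<xi>\<^sup>2 / real (Suc j)" .
        qed
      qed
    qed
  qed measurable
  then have lim: "(\<lambda>j. norm (mul (a j) (N y))) \<longlonglongrightarrow> norm (mul (xi1 k) (N y))" by (rule tendsto_norm)
  have "norm (mul (a j) (N y)) \<le> Lip m R * norm c" for j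
  proof -
    have b: "bmult (\<lambda>\<xi>. - \<i> * of_real (real (Suc j)) * chi k \<xi>)" by (rule bmult_times[OF bmult_const bmult_chi])
    have "mul (a j) (N y) = mul (\<lambda>\<xi>. - \<i> * of_real (real (Suc j)) * chi k \<xi>) (mul (e j) (N y))"
      unfolding a_def[abs_def] by (rule mul_mul[OF b be, symmetric])
    also have "norm \<dots> \<le> real (Suc j) * norm (mul (e j) (N y))"
      by (rule norm_mul_le[OF bmult_measurable[OF b]])
        (simp add: norm_mult norm_chi_le mult_left_le del: of_nat_Suc)
    also have "\<dots> \<le> real (Suc j) * (Lip m R * norm c / real (Suc j))"
      by (intro mult_left_mono le) simp
    finally show ?thesis by simp
  qed
  then show ?thesis by (intro LIMSEQ_le_const2[OF lim]) auto
qed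

text \<open>In the interaction picture the free flow is removed, the unbounded symbol disappears,
  and the field is globally Lipschitz on L^2. The last conclusion returns to the original variable,
  where the time derivative is available only after cutting to a band.\<close>

lemma mild_solution:
  assumes z: "mul pos z = z"
  obtains v where "v 0 = z" "\<And>t. mul pos (v t) = v t" "continuous_on UNIV v"
    "\<And>t. (v has_vector_derivative propagator (- t) (mul (\<lambda>\<xi>. - \<i> * of_real lam * pos \<xi>) (N (propagator t (v t))))) (at t)"
    "\<And>n t. ((\<lambda>t. mul (chi n) (propagator t (v t))) has_vector_derivative vf n (propagator t (v t))) (at t)"
proof -
  let ?c = "\<lambda>\<xi>. - \<i> * of_real lam * pos \<xi>"
  have bc: "bmult ?c" by (rule bmult_times[OF bmult_const bmult_pos])
  have cle: "norm (mul ?c y) \<le> norm y" for y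
    using norm_mul_le[OF bmult_measurable[OF bc], of 1 y] by (simp add: norm_mult norm_pos_le)
  define G where "G t v = propagator (- t) (mul ?c (N (propagator t v)))" for t v
  have Ncont: "continuous_on UNIV N"
    using N_lipschitz Lip_nonneg[OF m]
    by (intro lipschitz_on_continuous_on[of "Lip m R"]) (auto simp: lipschitz_on_def dist_norm)
  have Gcont: "continuous_on UNIV (\<lambda>t. G t x)" for x
  proof -
    have "continuous_on UNIV (\<lambda>t. N (propagator t x))"
      by (rule continuous_on_compose2[OF Ncont propagator_continuous]) auto
    then have "continuous_on UNIV (\<lambda>t. mul ?c (N (propagator (- t) x)))"
      by (intro bounded_linear.continuous_on[OF bounded_linear_mul[OF bc]] continuous_on_compose2[of UNIV "\<lambda>t. N (propagator t x)" UNIV "\<lambda>t. - t"])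
        (auto intro: continuous_intros)
    then have "continuous_on UNIV (\<lambda>t. propagator t (mul ?c (N (propagator (- t) x))))" by (rule propagator_continuous_compose)
    from continuous_on_compose2[OF this continuous_on_minus[OF continuous_on_id]] show ?thesis
      unfolding G_def minus_minus by simp
  qed
  have lS: "linear (propagator t)" for t using bounded_linear_propagator by (rule bounded_linear.linear)
  obtain v where v: "v 0 = z" "\<And>t. (v has_vector_derivative G t (v t)) (at t)"
  proof (rule ode_global[of G "Lip m R" z, OF Gcont])
    show "norm (G t x - G t y) \<le> Lip m R * norm (x - y)" for t x y
    proof -
      have "norm (G t x - G t y) \<le> norm (N (propagator t x) - N (propagator t y))"
        unfolding G_def linear_diff[OF lS, symmetric] mul_diff[OF bc, symmetric]
        by (rule order_trans[OF norm_propagator_le cle])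
      also have "\<dots> \<le> Lip m R * norm (propagator t x - propagator t y)" by (rule N_lipschitz)
      also have "\<dots> \<le> Lip m R * norm (x - y)"
        unfolding linear_diff[OF lS, symmetric] by (intro mult_left_mono norm_propagator_le Lip_nonneg m)
      finally show ?thesis .
    qed
    show "G t 0 = 0" for t by (simp add: G_def linear_0[OF lS] mul_zero[OF bc])
  qed (use Lip_pos[OF m R] in auto)
  have posG: "mul pos (G t x) = G t x" for t x
  proof -
    have p: "pos \<xi> * (- \<i> * of_real lam * pos \<xi>) = - \<i> * of_real lam * pos \<xi>" for \<xi>
      by (simp add: pos_def indicator_def)
    show ?thesis unfolding G_def mul_propagator[OF bmult_pos] mul_mul[OF bmult_pos bc] p ..
  qed
  have pos: "mul pos (v t) = v t" for t
  proof -
    have d: "((\<lambda>t. mul pos (v t) - v t) has_vector_derivative 0) (at t)" for t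
      using has_vector_derivative_diff[OF bounded_linear.has_vector_derivative
          [OF bounded_linear_mul[OF bmult_pos] v(2)[of t]] v(2)[of t]]
      by (simp add: posG)
    obtain c where "\<And>t. mul pos (v t) - v t = c"
      using has_vector_derivative_zero_constant[of UNIV "\<lambda>t. mul pos (v t) - v t"] d by auto
    from this[of t] this[of 0] show ?thesis by (simp add: v(1) z)
  qed
  have vcont: "continuous_on UNIV v"
    by (auto simp: continuous_on_eq_continuous_within intro: has_vector_derivative_continuous v(2))
  have trunc: "((\<lambda>t. mul (chi n) (propagator t (v t))) has_vector_derivative vf n (propagator t (v t))) (at t)" for n t
  proof -
    \<comment> \<open>On the band the free flow has the bounded symbol \<open>p\<close>, so the
      product rule for operator families applies; the two summands are the nonlinear and the
      dispersive part of \<open>vf\<close>.\<close>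
    define p where "p \<xi> = (if 0 \<le> \<xi> \<and> \<xi> \<le> n then - (\<xi>\<^sup>2) else 0)" for \<xi> :: real
    have pm [measurable]: "p \<in> borel_measurable borel" unfolding p_def by measurable
    have pb: "\<bar>p \<xi>\<bar> \<le> n\<^sup>2" for \<xi> by (auto simp: p_def intro!: power_mono)
    define A where "A s = mul (\<lambda>\<xi>. exp (\<i> * of_real (s * p \<xi>)))" for s
    have bA: "bmult (\<lambda>\<xi>. exp (\<i> * of_real (s * p \<xi>)))" for s by (rule bmult_exp) measurable
    define w where "w s = mul (chi n) (v s)" for s
    define w' where "w' = mul (chi n) (G t (v t))"
    define D where "D = mul (\<lambda>\<xi>. \<i> * of_real (p \<xi>) * exp (\<i> * of_real (t * p \<xi>))) (w t)"
    have "((\<lambda>s. A s (w s)) has_vector_derivative A t w' + D) (at t)"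
    proof (rule has_vector_derivative_apply_family[where A = A and z = w])
      show "linear (A s)" for s
        unfolding A_def by (rule bounded_linear.linear[OF bounded_linear_mul[OF bA]])
      show "norm (A s x) \<le> norm x" for s x
        using norm_mul_le[OF bmult_measurable[OF bA], of s 1 x] unfolding A_def
        by (simp only: norm_exp_i_times order_refl mult_1)
      show "((\<lambda>s. A s (w t)) has_vector_derivative D) (at t)"
        unfolding A_def D_def by (rule exp_mul_has_vector_derivative[OF pm pb])
      show "(w has_vector_derivative w') (at t)"
        unfolding w_def[abs_def] w'_def
        by (rule bounded_linear.has_vector_derivative[OF bounded_linear_mul[OF bmult_chi] v(2)])
      show "((\<lambda>s. A s w') \<longlongrightarrow> A t w') (at t)"
        using has_vector_derivative_continuous[OF exp_mul_has_vector_derivative[OF pm pb, of w' t]]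
        unfolding A_def continuous_at .
    qed
    moreover have eAS: "exp (\<i> * of_real (s * p \<xi>)) * chi n \<xi> = exp (\<i> * of_real (- (s * \<xi>\<^sup>2))) * chi n \<xi>" for s \<xi>
      by (auto simp: p_def chi_def indicator_def)
    have AS: "A s (mul (chi n) x) = mul (chi n) (propagator s x)" for s x
      unfolding mul_propagator[OF bmult_chi] propagator_mul[OF bmult_chi] A_def mul_mul[OF bA bmult_chi] eAS ..
    moreover have "A t w' + D = vf n (propagator t (v t))"
    proof -
      let ?a = "\<lambda>\<xi>. - \<i> * chi n \<xi>"
      have ba: "bmult ?a" by (rule bmult_times[OF bmult_const bmult_chi])
      have "A t w' = mul (chi n) (mul ?c (N (propagator t (v t))))"
        unfolding w'_def AS G_def propagator_inverse ..
      also have "\<dots> = mul ?a (lam *\<^sub>R N (propagator t (v t)))"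
      proof -
        have e: "chi n \<xi> * (- \<i> * of_real lam * pos \<xi>) = of_real lam * (- \<i> * chi n \<xi>)" for \<xi>
          by (auto simp: chi_def pos_def indicator_def)
        show ?thesis unfolding mul_mul[OF bmult_chi bc] mul_scaleR[OF ba] mul_real_left[OF ba, symmetric] e ..
      qed
      finally have 1: "A t w' = mul ?a (lam *\<^sub>R N (propagator t (v t)))" .
      have bp: "bmult (\<lambda>\<xi>. \<i> * of_real (p \<xi>) * exp (\<i> * of_real (t * p \<xi>)))"
        by (intro bmult_times bA bmult_const bmultI[of "\<lambda>\<xi>. of_real (p \<xi>)" "n\<^sup>2"]) (use pb in auto)
      have bs: "bmult (\<lambda>\<xi>. - \<i> * chi n \<xi> * xi2 n \<xi>)" by (rule bmult_times[OF ba bmult_xi(2)])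
      have "D = mul (\<lambda>\<xi>. (\<i> * of_real (p \<xi>) * exp (\<i> * of_real (t * p \<xi>))) * chi n \<xi>) (v t)"
        unfolding D_def w_def by (rule mul_mul[OF bp bmult_chi])
      also have "(\<lambda>\<xi>. (\<i> * of_real (p \<xi>) * exp (\<i> * of_real (t * p \<xi>))) * chi n \<xi>)
          = (\<lambda>\<xi>. exp (\<i> * of_real (- (t * \<xi>\<^sup>2))) * (- \<i> * chi n \<xi> * xi2 n \<xi>))"
        by (auto simp: fun_eq_iff p_def xi2_def chi_def indicator_def)
      also have "mul \<dots> (v t) = mul ?a (mul (xi2 n) (propagator t (v t)))"
        unfolding mul_mul[OF ba bmult_xi(2)] mul_propagator[OF bs] propagator_mul[OF bs] ..
      finally show ?thesis unfolding 1 vf_def grad_def by (simp only: mul_add[OF ba] add.commute)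
    qed
    ultimately show ?thesis by (simp add: w_def AS)
  qed
  show thesis by (rule that[OF v(1) pos vcont v(2)[unfolded G_def] trunc])
qed

text \<open>\<open>Y n\<close> lies entirely in the band, so the tail of the difference is the tail
  of \<open>y\<close> alone, which tends to 0 and is bounded by twice the norm of
  \<open>y\<close>.\<close>

lemma galerkin_converges:
  assumes y: "continuous_on UNIV y" "y 0 = z" "\<And>t. mul pos (y t) = y t"
      "\<And>n t. ((\<lambda>t. mul (chi n) (y t)) has_vector_derivative vf n (y t)) (at t)"
    and Y: "\<And>n. Y n 0 = mul (chi (real n)) z" "\<And>n t. (Y n has_vector_derivative vf (real n) (Y n t)) (at t)"
      "\<And>n t. mul (chi (real n)) (Y n t) = Y n t"
  shows "(\<lambda>n. Y n t) \<longlonglongrightarrow> y t"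
proof -
  have e: "(y s - Y n s) - mul (chi (real n)) (y s - Y n s) = y s - mul (chi (real n)) (y s)" for n s
    by (simp add: mul_diff Y(3))
  have lim: "(\<lambda>n. mul (chi (real n)) (y s)) \<longlonglongrightarrow> y s" for s by (rule mul_chi_tendsto[OF y(3)])
  have "(\<lambda>n. mul (chi (real n)) (y t - Y n t)) \<longlonglongrightarrow> 0"
  proof (rule chi_gronwall[where g = "\<lambda>n s. lam *\<^sub>R (N (y s) - N (Y n s))" and L = "Lip m R" and T = "\<bar>t\<bar>"
        and h = "\<lambda>s. 2 * norm (y s)"])
    show "continuous_on UNIV (\<lambda>s. y s - Y n s)" for n
      by (intro continuous_intros y(1))
        (auto simp: continuous_on_eq_continuous_within intro: has_vector_derivative_continuous Y(2))
    show "((\<lambda>s. mul (chi (real n)) (y s - Y n s)) has_vector_derivative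
        mul (\<lambda>\<xi>. - \<i> * chi (real n) \<xi>) (mul (xi2 (real n)) (y s - Y n s) + lam *\<^sub>R (N (y s) - N (Y n s)))) (at s)" for n s
      unfolding vf_diff[symmetric] using has_vector_derivative_diff[OF y(4)[of "real n" s] Y(2)[of n s]]
      by (simp add: mul_diff Y(3))
    show "norm (lam *\<^sub>R (N (y s) - N (Y n s))) \<le> Lip m R * norm (y s - Y n s)" for n s
      using N_lipschitz by simp
    show "mul (chi (real n)) (y 0 - Y n 0) = 0" for n
      by (simp add: y(2) Y(1) mul_diff mul_mul chi_mul_chi)
    show "norm ((y s - Y n s) - mul (chi (real n)) (y s - Y n s)) \<le> 2 * norm (y s)" for n s
      unfolding e using norm_triangle_ineq4[of "y s" "mul (chi (real n)) (y s)"] norm_mul_chi_le[of "real n" "y s"]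
      by linarith
    show "(\<lambda>n. (y s - Y n s) - mul (chi (real n)) (y s - Y n s)) \<longlonglongrightarrow> 0" for s
      unfolding e using tendsto_diff[OF tendsto_const lim[of s], of "y s"] by simp
  qed (auto intro!: continuous_intros y(1) Lip_nonneg m)
  then have "(\<lambda>n. mul (chi (real n)) (y t) - mul (chi (real n)) (y t - Y n t)) \<longlonglongrightarrow> y t - 0"
    by (intro tendsto_diff lim)
  then show ?thesis by (simp add: mul_diff Y(3))
qed

text \<open>The bounds of the Galerkin solutions pass to the limit on each fixed band [0, k], where
  multiplication by \<xi> is continuous. The hypothesis on \<open>B\<close> is the a priori bound,
  which depends only on the initial datum.\<close>

lemma solution_bounds:
  assumes y: "continuous_on UNIV y" "y 0 = z" "\<And>t. mul pos (y t) = y t"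
      "\<And>n t. ((\<lambda>t. mul (chi n) (y t)) has_vector_derivative vf n (y t)) (at t)"
    and z: "has_xi z b"
    and B: "\<And>K. 0 \<le> K \<Longrightarrow> K\<^sup>2 \<le> ((norm b)\<^sup>2 + 2 * (norm z)\<^sup>2 * pw m (sb (h12 z b) (norm b)))
        + 2 * (norm z)\<^sup>2 * pw m (sb (h12 z b) K) \<Longrightarrow> K \<le> B"
  shows "norm (y t) \<le> norm z" "norm (mul (xi1 k) (y t)) \<le> B"
proof -
  have "\<exists>Y. Y 0 = mul (chi (real n)) z \<and> (\<forall>t. (Y has_vector_derivative vf (real n) (Y t)) (at t))
      \<and> (\<forall>t. mul (chi (real n)) (Y t) = Y t)" for n
    using galerkin_exists[of "real n" z] by metis
  then obtain Y where Y: "\<And>n. Y n 0 = mul (chi (real n)) z"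
      "\<And>n t. (Y n has_vector_derivative vf (real n) (Y n t)) (at t)" "\<And>n t. mul (chi (real n)) (Y n t) = Y n t"
    by metis
  have pz: "mul pos z = z" using y(2,3) by metis
  have lim: "(\<lambda>n. Y n t) \<longlonglongrightarrow> y t" by (rule galerkin_converges[OF y Y])
  have "norm (Y n t) \<le> norm z" for n
    unfolding mass_conserved[OF Y(2,3), of n t] Y(1) by (rule norm_mul_chi_le)
  then show "norm (y t) \<le> norm z" by (intro LIMSEQ_le_const2[OF tendsto_norm[OF lim]]) auto
  have b: "norm (mul (xi1 (real n)) (Y n t)) \<le> B" for n
    by (rule B[OF norm_ge_zero galerkin_bound[OF Y(2,3,1) pz z]])
  have "norm (mul (xi1 k) (Y n t)) \<le> B" if "n \<ge> nat \<lceil>k\<rceil>" for n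
  proof -
    have kn: "k \<le> real n" using that by linarith
    have e: "xi1 k = (\<lambda>\<xi>. chi k \<xi> * xi1 (real n) \<xi>)"
      \<comment> \<open>For n >= k the smaller band lies in the larger one, so the bound on [0, n]
        restricts to [0, k].\<close>
      using kn by (auto simp: fun_eq_iff xi1_def chi_def indicator_def)
    have "mul (xi1 k) (Y n t) = mul (chi k) (mul (xi1 (real n)) (Y n t))"
      unfolding mul_mul[OF bmult_chi bmult_xi(1)] by (subst e) (rule refl)
    then show ?thesis using norm_mul_chi_le[of k "mul (xi1 (real n)) (Y n t)"] b[of n] by simp
  qed
  then have le: "\<exists>n0. \<forall>n\<ge>n0. norm (mul (xi1 k) (Y n t)) \<le> B" by blast
  have "(\<lambda>n. norm (mul (xi1 k) (Y n t))) \<longlonglongrightarrow> norm (mul (xi1 k) (y t))"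
    by (intro tendsto_norm bounded_linear.tendsto[OF bounded_linear_mul] bmult_xi lim)
  from LIMSEQ_le_const2[OF this le] show "norm (mul (xi1 k) (y t)) \<le> B" .
qed

text \<open>
  In the interaction picture \<open>v(t) = propagator(-t) y(t)\<close> the equation loses no derivative, so \<open>\<xi> v\<close> is
  Lipschitz in time.
\<close>

lemma xi_continuous:
  assumes v: "\<And>t. mul pos (v t) = v t"
      "\<And>t. (v has_vector_derivative propagator (- t) (mul (\<lambda>\<xi>. - \<i> * of_real lam * pos \<xi>) (N (propagator t (v t))))) (at t)"
    and xi: "\<And>t. has_xi (propagator t (v t)) (b t)" and B: "\<And>t. norm (b t) \<le> B"
  shows "continuous_on UNIV b"
proof -
  let ?c = "\<lambda>\<xi>. - \<i> * of_real lam * pos \<xi>"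
  let ?L = "Lip m R * B"
  have bc: "bmult ?c" by (rule bmult_times[OF bmult_const bmult_pos])
  define w where "w t = propagator (- t) (b t)" for t
  have xw: "has_xi (v t) (w t)" for t
    using has_xi_mul[OF bmult_S[of "- t"] xi[of t]] propagator_inverse(2)[of t "v t"] by (simp add: w_def propagator_def)
  have lip: "norm (mul (xi1 (real k)) (v t - v s)) \<le> ?L * \<bar>t - s\<bar>" for k s t
  proof -
    have "norm ((\<lambda>r. mul (xi1 (real k)) (v (s + r))) (t - s) - (\<lambda>r. mul (xi1 (real k)) (v (s + r))) 0)
        \<le> ?L * \<bar>t - s\<bar> - ?L * 0"
    proof (rule norm_bound_two_sided[where T = "\<bar>t - s\<bar>" and \<psi>' = "\<lambda>_. ?L"])
      fix r
      let ?v' = "propagator (- (s + r)) (mul ?c (N (propagator (s + r) (v (s + r)))))"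
      have "((\<lambda>r. v (s + r)) has_vector_derivative 1 *\<^sub>R ?v') (at r)"
      proof -
        have "((\<lambda>r. s + r) has_vector_derivative 1) (at r)" by (auto intro!: derivative_eq_intros)
        from vector_diff_chain_at[OF this v(2)[of "s + r"]] show ?thesis by (simp add: o_def)
      qed
      then show "((\<lambda>r. mul (xi1 (real k)) (v (s + r))) has_vector_derivative mul (xi1 (real k)) ?v') (at r)"
        by (intro bounded_linear.has_vector_derivative[OF bounded_linear_mul[OF bmult_xi(1)]]) simp
      have "norm (mul (xi1 (real k)) ?v') \<le> norm (mul (xi1 (real k)) (mul ?c (N (propagator (s + r) (v (s + r))))))"
        unfolding mul_propagator[OF bmult_xi(1)] by (rule norm_propagator_le)
      also have "\<dots> = norm (mul ?c (mul (xi1 (real k)) (N (propagator (s + r) (v (s + r))))))"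
        unfolding mul_mul[OF bmult_xi(1) bc] mul_mul[OF bc bmult_xi(1)] by (simp only: mult.commute)
      also have "\<dots> \<le> 1 * norm (mul (xi1 (real k)) (N (propagator (s + r) (v (s + r)))))"
        by (rule norm_mul_le[OF bmult_measurable[OF bc]]) (simp add: norm_mult norm_pos_le)
      also have "\<dots> \<le> 1 * (Lip m R * norm (b (s + r)))"
        by (intro mult_left_mono norm_mul_xi1_N xi) simp
      also have "\<dots> \<le> ?L" using B[of "s + r"] Lip_nonneg[OF m, of R] by (simp add: mult_left_mono)
      finally show "norm (mul (xi1 (real k)) ?v') \<le> ?L" .
    qed (auto intro!: derivative_eq_intros)
    then show ?thesis by (simp add: mul_diff)
  qed
  \<comment> \<open>The Lipschitz estimate on bands is uniform in \<open>k\<close>, so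
    \<open>has_xi_exists\<close> upgrades it to the full product with \<xi>, which uniqueness
    identifies with the difference of the \<open>w\<close>.\<close>
  have wlip: "norm (w t - w s) \<le> ?L * \<bar>t - s\<bar>" for s t
  proof -
    obtain d where d: "has_xi (v t - v s) d" "norm d \<le> ?L * \<bar>t - s\<bar>"
      using has_xi_exists[of "v t - v s" "?L * \<bar>t - s\<bar>"] lip[of _ t s] v(1) by (metis bmult_pos mul_diff)
    then show ?thesis using has_xi_unique[OF d(1) has_xi_diff[OF xw xw]] by simp
  qed
  have B0: "0 \<le> B" using B[of 0] norm_ge_zero order_trans by blast
  have "continuous_on UNIV w"
    by (rule lipschitz_on_continuous_on[of ?L])
      (use wlip B0 Lip_nonneg[OF m, of R] in \<open>auto simp: lipschitz_on_def dist_norm\<close>)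
  from propagator_continuous_compose[OF this] show ?thesis by (simp add: w_def propagator_inverse)
qed

end

theorem regular_solution:
  assumes m: "0 \<le> m" and lam: "lam \<in> {1, -1}" and z: "mul pos z = z" "has_xi z c"
  obtains R y b where "nls m R lam" "y 0 = z" "continuous_on UNIV y" "continuous_on UNIV b"
    "\<And>t. mul pos (y t) = y t" "\<And>t. has_xi (y t) (b t)"
    "\<And>t. AE x in lborel. cmod (fn (IFT (y t)) x) \<le> R"
    "\<And>n t. ((\<lambda>t. mul (chi n) (y t)) has_vector_derivative nls.vf m R lam n (y t)) (at t)"
proof -
  have h0: "0 \<le> h12 z c" by (simp add: h12_def)
  obtain B0 where B0: "\<And>K. 0 \<le> K \<Longrightarrow> K\<^sup>2 \<le> ((norm c)\<^sup>2 + 2 * (norm z)\<^sup>2 * pw m (sb (h12 z c) (norm c)))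
        + 2 * (norm z)\<^sup>2 * pw m (sb (h12 z c) K) \<Longrightarrow> K \<le> B0"
    using a_priori[OF m h0, of "(norm c)\<^sup>2 + 2 * (norm z)\<^sup>2 * pw m (sb (h12 z c) (norm c))" "2 * (norm z)\<^sup>2"]
    by (auto simp: pw_nonneg)
  define B where "B = max B0 0"
  have B: "\<And>K. 0 \<le> K \<Longrightarrow> K\<^sup>2 \<le> ((norm c)\<^sup>2 + 2 * (norm z)\<^sup>2 * pw m (sb (h12 z c) (norm c)))
        + 2 * (norm z)\<^sup>2 * pw m (sb (h12 z c) K) \<Longrightarrow> K \<le> B"
    using B0 unfolding B_def by (meson le_max_iff_disj)
  have Bn: "0 \<le> B" by (simp add: B_def)
  define A where "A = sqrt ((norm z)\<^sup>2 + norm z * B)"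
  \<comment> \<open>Only now is the height fixed: \<open>B\<close> bounds the derivative and
    \<open>A\<close> the H^(1/2) norm of every truncated solution from this datum, so
    \<open>sb A B\<close> bounds its supremum and the truncation at this height is never
    felt.\<close>
  define R where "R = sb A B"
  have A0: "0 \<le> A" using Bn by (simp add: A_def)
  have R: "0 < R" using A0 by (simp add: R_def sb_def add_nonneg_pos)
  interpret nls m R lam by unfold_locales (use m R lam in auto)
  obtain v where v: "v 0 = z" "\<And>t. mul pos (v t) = v t" "continuous_on UNIV v"
    "\<And>t. (v has_vector_derivative propagator (- t) (mul (\<lambda>\<xi>. - \<i> * of_real lam * pos \<xi>) (N (propagator t (v t))))) (at t)"
    "\<And>n t. ((\<lambda>t. mul (chi n) (propagator t (v t))) has_vector_derivative vf n (propagator t (v t))) (at t)"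
    by (rule mild_solution[OF z(1)]) (rule that; assumption)
  let ?y = "\<lambda>t. propagator t (v t)"
  have y0: "?y 0 = z" by (simp add: v(1) propagator_def)
  have ypos: "mul pos (?y t) = ?y t" for t by (simp add: mul_propagator v(2))
  have ycont: "continuous_on UNIV ?y" by (rule propagator_continuous_compose[OF v(3)])
  note bnd = solution_bounds[OF ycont y0 ypos v(5) z(2) B]
  have "\<exists>b. has_xi (?y t) b \<and> norm b \<le> B" for t
    using has_xi_exists[OF ypos[of t], of B] bnd(2) by metis
  then obtain b where b: "\<And>t. has_xi (?y t) (b t)" "\<And>t. norm (b t) \<le> B" by metis
  have sup: "AE x in lborel. cmod (fn (IFT (?y t)) x) \<le> R" for t
    unfolding R_def
  proof (rule sup_bound_sb[OF b(1) ypos _ A0 b(2)])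
    have "inner (?y t) (b t) \<le> norm (?y t) * norm (b t)" by (rule norm_cauchy_schwarz)
    also have "\<dots> \<le> norm z * B" by (rule mult_mono[OF bnd(1) b(2) norm_ge_zero norm_ge_zero])
    finally have "inner (?y t) (b t) \<le> norm z * B" .
    moreover have "(norm (?y t))\<^sup>2 \<le> (norm z)\<^sup>2" by (rule power_mono[OF bnd(1) norm_ge_zero])
    moreover have "A\<^sup>2 = (norm z)\<^sup>2 + norm z * B" using Bn by (simp add: A_def)
    ultimately show "(norm (?y t))\<^sup>2 + inner (?y t) (b t) \<le> A\<^sup>2" by linarith
  qed
  show thesis
    by (rule that[OF nls_axioms y0 ycont xi_continuous[OF v(2,4) b] ypos b(1) sup v(5)])
qed

section \<open>Test functions\<close>

lemma frechet_derivative_real: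
  "(f has_real_derivative d) (at x) \<Longrightarrow> frechet_derivative f (at x) = (\<lambda>h. d * h)"
  by (rule frechet_derivative_at[symmetric]) (simp add: has_field_derivative_def)

lemma Ck_Suc_I:
  fixes f :: "real \<Rightarrow> real"
  assumes "\<And>x. (f has_real_derivative f' x) (at x)" "Ck k f'" shows "Ck (Suc k) f"
  using assms by (auto simp: frechet_derivative_real[OF assms(1)] intro: differentiableI has_field_derivative_imp_has_derivative)

lemma Ck_Suc_D:
  fixes f :: "real \<Rightarrow> real"
  assumes "Ck (Suc k) f" shows "(f has_real_derivative deriv f x) (at x)" "Ck k (deriv f)"
proof -
  have d: "(f has_real_derivative deriv f x) (at x)" for x
    using assms by (auto simp: DERIV_deriv_iff_real_differentiable)
  then show "(f has_real_derivative deriv f x) (at x)" .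
  show "Ck k (deriv f)"
    using assms by (auto simp: frechet_derivative_real[OF d])
qed

lemma Ck_continuous: "Ck k f \<Longrightarrow> continuous_on UNIV f"
  by (cases k) (auto simp: continuous_on_eq_continuous_within intro: differentiable_imp_continuous_within)

lemma Ck_mono: "Ck (Suc k) f \<Longrightarrow> Ck k f"
proof (induction k arbitrary: f)
  case 0
  then show ?case using Ck_continuous[of "Suc 0" f] by simp
next
  case (Suc k)
  then show ?case by simp
qed

text \<open>A family of functions closed under differentiation consists of smooth functions; this
  fits \<open>flat\<close>, whose derivatives are of the same shape.\<close>

lemma smooth_coinduct:
  fixes f :: "real \<Rightarrow> real"
  assumes X: "\<And>f. f \<in> X \<Longrightarrow> \<exists>f'\<in>X. \<forall>x. (f has_real_derivative f' x) (at x)" and f: "f \<in> X"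
  shows "Ck k f"
  using f
proof (induction k arbitrary: f)
  case 0
  then show ?case using X[OF 0] by (auto simp: continuous_on_eq_continuous_within intro!: DERIV_isCont)
next
  case (Suc k)
  then show ?case using X[OF Suc.prems] by (blast intro: Ck_Suc_I)
qed

lemma Ck_add: fixes f g :: "real \<Rightarrow> real" shows "Ck k f \<Longrightarrow> Ck k g \<Longrightarrow> Ck k (\<lambda>x. f x + g x)"
proof (induction k arbitrary: f g)
  case (Suc k)
  show ?case
    by (rule Ck_Suc_I[OF DERIV_add[OF Ck_Suc_D(1)[OF Suc.prems(1)] Ck_Suc_D(1)[OF Suc.prems(2)]]])
      (rule Suc.IH[OF Ck_Suc_D(2)[OF Suc.prems(1)] Ck_Suc_D(2)[OF Suc.prems(2)]])
qed (auto intro: continuous_intros)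

lemma Ck_mult: fixes f g :: "real \<Rightarrow> real" shows "Ck k f \<Longrightarrow> Ck k g \<Longrightarrow> Ck k (\<lambda>x. f x * g x)"
proof (induction k arbitrary: f g)
  case (Suc k)
  show ?case
    by (rule Ck_Suc_I[OF DERIV_mult[OF Ck_Suc_D(1)[OF Suc.prems(1)] Ck_Suc_D(1)[OF Suc.prems(2)]]])
      (intro Ck_add Suc.IH Ck_Suc_D(2)[OF Suc.prems(1)] Ck_Suc_D(2)[OF Suc.prems(2)]
        Ck_mono[OF Suc.prems(1)] Ck_mono[OF Suc.prems(2)])
qed (auto intro: continuous_intros)

lemma Ck_const: "Ck k (\<lambda>_::real. c :: real)"
proof (induction k arbitrary: c)
  case (Suc k)
  then show ?case by (intro Ck_Suc_I[of _ "\<lambda>_. 0"]) auto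
qed auto

lemma Ck_affine: fixes f :: "real \<Rightarrow> real" shows "Ck k f \<Longrightarrow> Ck k (\<lambda>x. f (c * x + d))"
proof (induction k arbitrary: f)
  case 0
  then show ?case by (auto intro!: continuous_on_compose2[of UNIV f] continuous_intros)
next
  case (Suc k)
  have "((\<lambda>x. f (c * x + d)) has_real_derivative deriv f (c * x + d) * c) (at x)" for x
    by (rule DERIV_chain2[OF Ck_Suc_D(1)[OF Suc.prems]]) (auto intro!: derivative_eq_intros)
  then show ?case
    by (rule Ck_Suc_I) (intro Ck_mult Ck_const Suc.IH Ck_Suc_D(2)[OF Suc.prems])
qed

lemma test_functions_iff:
  "\<phi> \<in> test_functions \<longleftrightarrow> (\<forall>k. Ck k \<phi>) \<and> (\<exists>M. \<forall>x. norm x > M \<longrightarrow> \<phi> x = 0)"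
proof -
  have "compact (closure {x. \<phi> x \<noteq> 0}) \<longleftrightarrow> bounded {x. \<phi> x \<noteq> 0}" by (rule compact_closure)
  also have "\<dots> \<longleftrightarrow> (\<exists>M. \<forall>x. norm x > M \<longrightarrow> \<phi> x = 0)"
    unfolding bounded_iff by (metis (mono_tags, lifting) linorder_not_le mem_Collect_eq)
  finally show ?thesis by (simp add: test_functions_def)
qed

lemma test_Ck: "\<phi> \<in> test_functions \<Longrightarrow> Ck k \<phi>"
  by (simp add: test_functions_iff)

lemma test_continuous: "\<phi> \<in> test_functions \<Longrightarrow> continuous_on UNIV \<phi>"
  using Ck_continuous test_Ck by blast

lemma test_has_deriv:
  fixes b :: "real \<Rightarrow> real"
  shows "b \<in> test_functions \<Longrightarrow> (b has_real_derivative deriv b x) (at x)"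
  by (rule Ck_Suc_D[OF test_Ck])

lemma test_support:
  assumes "\<phi> \<in> test_functions"
  obtains M where "0 < M" "\<And>x. norm x \<ge> M \<Longrightarrow> \<phi> x = 0"
proof -
  obtain M where M: "\<And>x. norm x > M \<Longrightarrow> \<phi> x = 0" using assms by (auto simp: test_functions_iff)
  show thesis by (rule that[of "\<bar>M\<bar> + 1"]) (use M in force)+
qed

lemma test_deriv:
  fixes b :: "real \<Rightarrow> real"
  assumes "b \<in> test_functions" shows "deriv b \<in> test_functions"
  unfolding test_functions_iff
proof (intro conjI allI)
  show "Ck k (deriv b)" for k by (rule Ck_Suc_D[OF test_Ck[OF assms]])
  obtain M where M: "\<And>x. norm x \<ge> M \<Longrightarrow> b x = 0" using test_support[OF assms] by metis
  have "deriv b x = 0" if x: "norm x > M" for x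
  proof -
    have "((\<lambda>_. 0) has_real_derivative deriv b x) (at x)"
    proof (rule DERIV_cong_ev[THEN iffD1, OF refl _ refl test_has_deriv[OF assms]])
      have "\<forall>\<^sub>F y in nhds x. norm y > M"
        using x by (intro order_tendstoD(1)[of norm "norm x"] tendsto_norm) (auto simp: filterlim_ident)
      then show "\<forall>\<^sub>F y in nhds x. b y = 0" by eventually_elim (simp add: M)
    qed
    from DERIV_unique[OF this DERIV_const] show ?thesis .
  qed
  then show "\<exists>M. \<forall>x. norm x > M \<longrightarrow> deriv b x = 0" by blast
qed

lemma test_derivs:
  fixes b :: "real \<Rightarrow> real"
  shows "b \<in> test_functions \<Longrightarrow> (deriv ^^ k) b \<in> test_functions"
  by (induction k) (auto intro: test_deriv)

lemma test_affine:
  fixes b :: "real \<Rightarrow> real"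
  assumes b: "b \<in> test_functions" and c: "c \<noteq> 0" shows "(\<lambda>x. b (c * x + d)) \<in> test_functions"
  unfolding test_functions_iff
proof (intro conjI allI)
  show "Ck k (\<lambda>x. b (c * x + d))" for k by (rule Ck_affine[OF test_Ck[OF b]])
  obtain M where M: "\<And>x. norm x \<ge> M \<Longrightarrow> b x = 0" using test_support[OF b] by metis
  have "b (c * x + d) = 0" if "norm x > (M + \<bar>d\<bar>) / \<bar>c\<bar>" for x
  proof -
    have "M + \<bar>d\<bar> < \<bar>c * x\<bar>" using that c by (simp add: divide_less_eq abs_mult mult.commute)
    then show ?thesis by (intro M) simp
  qed
  then show "\<exists>M. \<forall>x. norm x > M \<longrightarrow> b (c * x + d) = 0" by blast
qed

lemma test_shift:
  fixes b :: "real \<Rightarrow> real"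
  shows "b \<in> test_functions \<Longrightarrow> (\<lambda>x. b (x + h)) \<in> test_functions"
  using test_affine[of b 1 h] by simp

lemma derivs_shift:
  fixes b :: "real \<Rightarrow> real"
  assumes b: "b \<in> test_functions"
  shows "(deriv ^^ k) (\<lambda>x. b (x + h)) = (\<lambda>x. (deriv ^^ k) b (x + h))"
proof (induction k)
  case (Suc k)
  have "deriv (\<lambda>x. (deriv ^^ k) b (x + h)) x = deriv ((deriv ^^ k) b) (x + h)" for x
    using DERIV_shift[of "(deriv ^^ k) b" "deriv ((deriv ^^ k) b) (x + h)" x h] test_has_deriv[OF test_derivs[OF b]]
    by (intro DERIV_imp_deriv) (simp add: add.commute)
  then show ?case by (simp add: Suc)
qed simp

subsection \<open>A bump function\<close>

text \<open>The usual flat function with a polynomial in 1/x in front, which makes the family closed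
  under differentiation: d/dx acts on the polynomial as p -> X^2 (p - p').\<close>

definition flat :: "real poly \<Rightarrow> real \<Rightarrow> real" where
  "flat p x = (if 0 < x then poly p (1 / x) * exp (- (1 / x)) else 0)"

lemma poly_times_exp_tendsto_0: "((\<lambda>s. poly p s * exp (- s)) \<longlongrightarrow> (0::real)) at_top"
proof -
  have "((\<lambda>s. \<Sum>i\<le>degree p. coeff p i * (s ^ i / exp s)) \<longlongrightarrow> (\<Sum>i\<le>degree p. coeff p i * 0)) at_top"
    by (intro tendsto_intros tendsto_power_div_exp_0)
  then show ?thesis by (simp add: poly_altdef sum_distrib_right exp_minus divide_inverse mult.assoc)
qed

lemma flat_has_derivative:
  "(flat p has_real_derivative flat ([:0, 0, 1:] * (p - pderiv p)) x) (at x)"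
proof -
  consider "x < 0" | "x = 0" | "0 < x" by linarith
  then show ?thesis
  proof cases
    case 1
    have "((\<lambda>_. 0) has_real_derivative 0) (at x)" by simp
    then have "(flat p has_real_derivative 0) (at x)"
      by (rule has_field_derivative_transform_within_open[where S = "{..<0}"]) (use 1 in \<open>auto simp: flat_def\<close>)
    then show ?thesis using 1 by (simp add: flat_def)
  next
    case 3
    have "((\<lambda>x. poly p (1 / x) * exp (- (1 / x))) has_real_derivative
        flat ([:0, 0, 1:] * (p - pderiv p)) x) (at x)"
      using 3 by (auto intro!: derivative_eq_intros poly_DERIV[THEN DERIV_chain2]
          simp: flat_def power2_eq_square field_simps)
    then show ?thesis
      by (rule has_field_derivative_transform_within_open[where S = "{0<..}"]) (use 3 in \<open>auto simp: flat_def\<close>)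
  next
    case 2
    \<comment> \<open>With s = 1/h the difference quotient is again a polynomial in s times exp(-s),
      which tends to 0.\<close>
    have r: "((\<lambda>h. flat p h / h) \<longlongrightarrow> 0) (at_right 0)"
    proof (rule Lim_transform_eventually)
      have "((\<lambda>h. poly ([:0, 1:] * p) (inverse h) * exp (- inverse h)) \<longlongrightarrow> 0) (at_right 0)"
        by (rule filterlim_compose[OF poly_times_exp_tendsto_0 filterlim_inverse_at_top_right])
      then show "((\<lambda>h. poly ([:0, 1:] * p) (1 / h) * exp (- (1 / h))) \<longlongrightarrow> 0) (at_right 0)"
        by (simp add: inverse_eq_divide)
      show "\<forall>\<^sub>F h in at_right 0. poly ([:0, 1:] * p) (1 / h) * exp (- (1 / h)) = flat p h / h"
        unfolding eventually_at_right_field by (intro exI[of _ 1]) (auto simp: flat_def)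
    qed
    have l: "((\<lambda>h. flat p h / h) \<longlongrightarrow> 0) (at_left 0)"
    proof (rule Lim_transform_eventually[OF tendsto_const])
      show "\<forall>\<^sub>F h in at_left 0. 0 = flat p h / h"
        unfolding eventually_at_left_field by (intro exI[of _ "-1"]) (auto simp: flat_def)
    qed
    have "((\<lambda>h. flat p h / h) \<longlongrightarrow> 0) (at 0)"
      by (rule filterlim_split_at[OF l r])
    then show ?thesis using 2 by (simp add: has_field_derivative_iff flat_def)
  qed
qed

lemma Ck_flat: "Ck k (flat p)"
  by (rule smooth_coinduct[of "range flat"]) (use flat_has_derivative in blast)+

definition bump :: "real \<Rightarrow> real" where "bump x = flat 1 (1 + x) * flat 1 (1 - x)"

lemma bump_nonneg: "0 \<le> bump x"
  by (simp add: bump_def flat_def)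

lemma bump_pos: "\<bar>x\<bar> < 1 \<Longrightarrow> 0 < bump x"
  by (simp add: bump_def flat_def)

lemma bump_outside: "1 \<le> \<bar>x\<bar> \<Longrightarrow> bump x = 0"
  by (auto simp: bump_def flat_def)

lemma bump_test: "bump \<in> test_functions"
  unfolding test_functions_iff
proof (intro conjI allI)
  show "Ck k bump" for k
    using Ck_mult[OF Ck_affine[OF Ck_flat, of k 1 1 1] Ck_affine[OF Ck_flat, of k 1 "-1" 1]]
    by (simp add: bump_def[abs_def] add.commute)
  show "\<exists>M. \<forall>x. norm x > M \<longrightarrow> bump x = 0" by (intro exI[of _ 1]) (auto simp: bump_outside)
qed

subsection \<open>Fourier transforms of test functions\<close>

lemma compact_support_L12:
  fixes f :: "real \<Rightarrow> complex"
  assumes f: "continuous_on UNIV f" and M: "\<And>x. \<bar>x\<bar> \<ge> M \<Longrightarrow> f x = 0"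
  shows "f \<in> L12"
proof -
  have [measurable]: "f \<in> borel_measurable borel" using f by (rule borel_measurable_continuous_onI)
  have "compact (f ` {-M..M})" by (intro compact_continuous_image continuous_on_subset[OF f]) auto
  then obtain C where C: "\<And>x. x \<in> {-M..M} \<Longrightarrow> norm (f x) \<le> C"
    using compact_imp_bounded bounded_iff by (metis imageI)
  have le: "cmod (f x) \<le> \<bar>C\<bar> * cmod (indicator {-M..M} x)" for x
    using C[of x] M[of x] by (cases "x \<in> {-M..M}") (auto simp: indicator_def)
  have f2: "f \<in> L2" by (rule L2_bound[OF L2_indicator_Icc, of f "\<bar>C\<bar>" "-M" M]) (use le in auto)
  have "f x * indicator {-M..M} x = f x" for x
    using M[of x] by (cases "\<bar>x\<bar> \<ge> M") (auto simp: indicator_def)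
  then have "integrable lborel f"
    using L2_prod_integrable[OF f2 L2_indicator_Icc[of "-M" M]] by presburger
  with f2 show ?thesis by (rule L12_I)
qed

lemma ft_derivative:
  fixes f :: "real \<Rightarrow> complex"
  assumes f: "\<And>x. (f has_vector_derivative f' x) (at x)" and f': "continuous_on UNIV f'"
    and M: "\<And>x. \<bar>x\<bar> \<ge> M \<Longrightarrow> f x = 0" "\<And>x. \<bar>x\<bar> \<ge> M \<Longrightarrow> f' x = 0"
  shows "ft f' \<xi> = \<i> * of_real \<xi> * ft f \<xi>"
proof -
  let ?E = "\<lambda>x. exp (- (\<i> * of_real x * of_real \<xi>))"
  let ?h = "\<lambda>x. ?E x * f' x - \<i> * of_real \<xi> * (?E x * f x)"
  define K where "K = \<bar>M\<bar>"
  have fc: "continuous_on UNIV f"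
    by (auto simp: continuous_on_eq_continuous_within intro: has_vector_derivative_continuous f)
  have i: "integrable lborel f" "integrable lborel f'"
    using compact_support_L12[OF fc M(1)] compact_support_L12[OF f' M(2)] by simp_all
  have E: "(?E has_vector_derivative - \<i> * of_real \<xi> * ?E x) (at x)" for x
    by (rule has_vector_derivative_real_field) (auto intro!: derivative_eq_intros)
  have "has_bochner_integral lborel (\<lambda>x. indicator {-K..K} x *\<^sub>R ?h x) (?E K * f K - ?E (-K) * f (-K))"
  proof (rule has_bochner_integral_FTC_Icc)
    show "continuous_on {-K..K} ?h"
      by (intro continuous_intros continuous_on_subset[OF fc] continuous_on_subset[OF f']) auto
    show "((\<lambda>x. ?E x * f x) has_vector_derivative ?h x) (at x within {-K..K})" for x
      by (rule has_vector_derivative_at_within,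
          rule has_vector_derivative_eq_rhs[OF has_vector_derivative_mult[OF E f]]) (simp add: mult_ac)
  qed (simp add: K_def)
  also have "(\<lambda>x. indicator {-K..K} x *\<^sub>R ?h x) = ?h"
    using M by (auto simp: fun_eq_iff indicator_def K_def)
  also have "?E K * f K - ?E (-K) * f (-K) = 0" using M by (simp add: K_def)
  finally have "(LINT x|lborel. ?h x) = 0" by (rule has_bochner_integral_integral_eq)
  moreover have "(LINT x|lborel. ?h x) = ft f' \<xi> - \<i> * of_real \<xi> * ft f \<xi>"
    unfolding ft_def using integrable_ft[OF i(1), of \<xi>] integrable_ft[OF i(2), of \<xi>] by simp
  ultimately show ?thesis by simp
qed

definition cx :: "(real \<Rightarrow> real) \<Rightarrow> real \<Rightarrow> complex" where "cx b x = of_real (b x)"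

lemma test_cx:
  assumes "b \<in> test_functions"
  obtains M where "\<And>x. \<bar>x\<bar> \<ge> M \<Longrightarrow> cx b x = 0"
  using test_support[OF assms] by (metis cx_def of_real_0 real_norm_def)

lemma cx_continuous: "b \<in> test_functions \<Longrightarrow> continuous_on UNIV (cx b)"
  unfolding cx_def by (intro continuous_intros test_continuous)

lemma cx_L12: "b \<in> test_functions \<Longrightarrow> cx b \<in> L12"
  using compact_support_L12[OF cx_continuous] test_cx by metis

lemma ft_cx_derivs:
  assumes b: "b \<in> test_functions"
  shows "ft (cx ((deriv ^^ k) b)) \<xi> = (\<i> * of_real \<xi>) ^ k * ft (cx b) \<xi>"
proof (induction k)
  case (Suc k)
  let ?c = "(deriv ^^ k) b"
  have c: "?c \<in> test_functions" by (rule test_derivs[OF b])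
  obtain M1 where M1: "\<And>x. \<bar>x\<bar> \<ge> M1 \<Longrightarrow> cx ?c x = 0" using test_cx[OF c] by metis
  obtain M2 where M2: "\<And>x. \<bar>x\<bar> \<ge> M2 \<Longrightarrow> cx (deriv ?c) x = 0" using test_cx[OF test_deriv[OF c]] by metis
  have "ft (cx (deriv ?c)) \<xi> = \<i> * of_real \<xi> * ft (cx ?c) \<xi>"
  proof (rule ft_derivative[where M = "max M1 M2"])
    show "(cx ?c has_vector_derivative cx (deriv ?c) x) (at x)" for x
      unfolding cx_def using test_has_deriv[OF c]
      by (intro has_vector_derivative_of_real) (simp add: has_real_derivative_iff_has_vector_derivative)
  qed (use M1 M2 cx_continuous[OF test_deriv[OF c]] in auto)
  then show ?case by (simp add: Suc)
qed simp

text \<open>The dilated bump lives on |x| <= 1/K, so |x \<xi>| < 1 < pi/2 where it is nonzero. The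
  cosine is positive there, and the real part of the transform is a positive integral.\<close>

lemma ft_bump_nonzero:
  assumes "0 < K" "\<bar>\<xi>\<bar> < K" shows "ft (cx (\<lambda>x. bump (K * x))) \<xi> \<noteq> 0"
proof -
  let ?b = "\<lambda>x. bump (K * x)"
  have t: "?b \<in> test_functions" using test_affine[OF bump_test, of K 0] assms by simp
  have i: "integrable lborel (\<lambda>x. exp (- (\<i> * of_real x * of_real \<xi>)) * cx ?b x)"
    by (intro integrable_ft L12_integrable cx_L12 t)
  have re: "Re (exp (- (\<i> * of_real x * of_real \<xi>)) * cx ?b x) = cos (x * \<xi>) * ?b x" for x
    by (simp add: cx_def Re_exp)
  have cospos: "0 < cos (x * \<xi>)" if "\<bar>K * x\<bar> < 1" for x
  proof -
    have "\<bar>x * \<xi>\<bar> \<le> \<bar>x\<bar> * K" using assms by (simp add: abs_mult mult_left_mono)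
    also have "\<dots> < 1" using that assms by (simp add: abs_mult mult.commute)
    finally have "\<bar>x * \<xi>\<bar> < pi / 2" using pi_gt3 by linarith
    then show ?thesis by (intro cos_gt_zero_pi) auto
  qed
  have nonneg: "0 \<le> cos (x * \<xi>) * ?b x" for x
    using cospos[of x] bump_nonneg[of "K * x"] bump_outside[of "K * x"] by (cases "\<bar>K * x\<bar> < 1") (auto simp: less_imp_le)
  have ir: "integrable lborel (\<lambda>x. cos (x * \<xi>) * ?b x)"
    using integrable_Re[OF i] unfolding re .
  have "Re (ft (cx ?b) \<xi>) = (LINT x|lborel. cos (x * \<xi>) * ?b x)"
    unfolding ft_def integral_Re[OF i, symmetric] re ..
  moreover have "(LINT x|lborel. cos (x * \<xi>) * ?b x) \<noteq> 0"
  proof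
    assume "(LINT x|lborel. cos (x * \<xi>) * ?b x) = 0"
    then have "AE x in lborel. cos (x * \<xi>) * ?b x = 0"
      using integral_nonneg_eq_0_iff_AE[OF ir] nonneg by simp
    then have "AE x in lborel. x \<notin> {- (1 / K)<..<1 / K}"
    proof eventually_elim
      case (elim x)
      show ?case
      proof
        assume "x \<in> {- (1 / K)<..<1 / K}"
        then have "\<bar>x\<bar> < 1 / K" by auto
        then have "\<bar>K * x\<bar> < 1" using assms by (simp add: abs_mult less_divide_eq mult.commute)
        with cospos[OF this] bump_pos[OF this] elim show False by simp
      qed
    qed
    moreover have "{x. \<not> x \<notin> {- (1 / K)<..<1 / K}} = {- (1 / K)<..<1 / K}" by auto
    ultimately have "emeasure lborel {- (1 / K)<..<1 / K} = 0"
      by (subst (asm) AE_iff_measurable[OF _ refl]) (auto simp del: greaterThanLessThan_iff)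
    then show False using assms by simp
  qed
  ultimately show ?thesis by auto
qed

subsection \<open>Weak derivatives and Fourier multipliers\<close>

text \<open>Bilinear, without conjugation, as in the distributional pairings. Its real and imaginary
  parts are real inner products, through which it is transported to the Fourier side.\<close>

definition cip :: "l2 \<Rightarrow> l2 \<Rightarrow> complex" where
  "cip u v = (LINT x|lborel. fn u x * fn v x)"

lemma cip_integrable: "integrable lborel (\<lambda>x. fn u x * fn v x)"
  by (intro L2_prod_integrable fn_L2)

lemma cip_cls:
  assumes "f \<in> L2" "g \<in> L2" shows "cip (cls f) (cls g) = (LINT x|lborel. f x * g x)"
proof -
  have [measurable]: "f \<in> borel_measurable borel" "g \<in> borel_measurable borel"
    using assms by (simp_all add: L2_measurable)
  show ?thesis unfolding cip_def
    by (rule integral_cong_AE) (use fn_cls[OF assms(1)] fn_cls[OF assms(2)] in auto)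
qed

lemma Re_cip: "Re (cip u v) = inner (cj v) u"
proof -
  have "Re (cip u v) = (LINT x|lborel. Re (fn u x * fn v x))"
    unfolding cip_def by (rule integral_Re[symmetric, OF cip_integrable])
  also have "\<dots> = inner (cj v) u"
    by (rule inner_l2_cong[symmetric]) (use fn_cj[of v] in \<open>auto simp: inner_complex_def mult.commute\<close>)
  finally show ?thesis .
qed

lemma cip_mul_const: "cip (mul (\<lambda>_. c) u) v = c * cip u v"
proof -
  have "cip (mul (\<lambda>_. c) u) v = (LINT x|lborel. c * (fn u x * fn v x))"
    unfolding cip_def by (rule integral_cong_AE) (use fn_mul[OF bmult_const, of c u] in auto)
  then show ?thesis by (simp add: cip_def)
qed

lemma Im_cip: "Im (cip u v) = inner (mul (\<lambda>_. \<i>) (cj v)) u"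
proof -
  have "Im (cip u v) = Re (cip (mul (\<lambda>_. - \<i>) u) v)" by (simp add: cip_mul_const)
  also have "\<dots> = inner (cj v) (mul (\<lambda>_. - \<i>) u)" by (rule Re_cip)
  also have "\<dots> = inner (mul (\<lambda>_. \<i>) (cj v)) u" by (simp add: inner_mul)
  finally show ?thesis .
qed

lemma bounded_bilinear_cip: "bounded_bilinear cip"
proof
  have add: "cip (u + v) w = cip u w + cip v w" for u v w
  proof -
    have "cip (u + v) w = (LINT x|lborel. fn u x * fn w x + fn v x * fn w x)"
      unfolding cip_def by (rule integral_cong_AE) (use fn_plus[of u v] in \<open>auto simp: distrib_right\<close>)
    then show ?thesis by (simp add: cip_def cip_integrable)
  qed
  have scale: "cip (r *\<^sub>R u) v = r *\<^sub>R cip u v" for r u v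
    using cip_mul_const[of "of_real r" u v] by (simp add: mul_const_real scaleR_conv_of_real)
  have comm: "cip u v = cip v u" for u v by (simp add: cip_def mult.commute)
  fix u u' v v' :: l2 and r :: real
  show "cip (u + u') v = cip u v + cip u' v" by (rule add)
  show "cip u (v + v') = cip u v + cip u v'" using add[of v v' u] comm by metis
  show "cip (r *\<^sub>R u) v = r *\<^sub>R cip u v" by (rule scale)
  show "cip u (r *\<^sub>R v) = r *\<^sub>R cip u v" using scale[of r v u] comm by metis
  have "norm (cip u v) \<le> norm u * norm v * 2" for u v
  proof -
    have "norm (cip u v) \<le> \<bar>Re (cip u v)\<bar> + \<bar>Im (cip u v)\<bar>" by (rule cmod_le)
    also have "\<dots> \<le> norm (cj v) * norm u + norm (mul (\<lambda>_. \<i>) (cj v)) * norm u"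
      unfolding Re_cip Im_cip by (intro add_mono Cauchy_Schwarz_ineq2)
    also have "\<dots> \<le> norm v * norm u + norm v * norm u"
      using norm_mul_le[of "\<lambda>_. \<i>" 1 "cj v"] by (intro add_mono mult_right_mono) auto
    finally show ?thesis by (simp add: mult.commute)
  qed
  then show "\<exists>K. \<forall>a b. norm (cip a b) \<le> norm a * norm b * K" by blast
qed

lemma cj_cx: "cx b \<in> L2 \<Longrightarrow> cj (cls (cx b)) = cls (cx b)"
  by (simp add: cj_cls cx_def[abs_def])

lemma fn_FT_cx:
  assumes "b \<in> test_functions"
  shows "AE \<xi> in lborel. fn (FT (cls (cx b))) \<xi> = ft (cx b) \<xi> / sqrt (2 * pi)"
  using fn_scaleR[of "1 / sqrt (2 * pi)" "cls (ft (cx b))"] fn_cls[OF plancherel_L12(1)[OF cx_L12[OF assms]]]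
  unfolding FT_cls[OF cx_L12[OF assms]] F1_def by eventually_elim (simp add: scaleR_conv_of_real)

lemma cip_FT:
  assumes b: "b \<in> test_functions"
  shows "cip u (cls (cx b)) = 1 / sqrt (2 * pi) * (LINT \<xi>|lborel. cnj (ft (cx b) \<xi>) * fn (FT u) \<xi>)"
proof -
  let ?v = "cls (cx b)"
  have bL: "cx b \<in> L2" using cx_L12[OF b] by simp
  let ?c = "1 / sqrt (2 * pi)"
  let ?h = "\<lambda>\<xi>. of_real ?c * (cnj (ft (cx b) \<xi>) * fn (FT u) \<xi>)"
  have cL: "(\<lambda>\<xi>. cnj (ft (cx b) \<xi>)) \<in> L2" by (intro L2_cnj plancherel_L12 cx_L12 b)
  then have [measurable]: "(\<lambda>\<xi>. cnj (ft (cx b) \<xi>)) \<in> borel_measurable borel" by (rule L2_measurable)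
  have [measurable]: "ft (cx b) \<in> borel_measurable borel"
    by (intro L2_measurable plancherel_L12 cx_L12 b)
  have i: "integrable lborel ?h" by (intro integrable_mult_right L2_prod_integrable cL fn_L2)
  have "Re (cip u ?v) = inner (FT ?v) (FT u)"
    by (simp add: Re_cip cj_cx[OF bL] inner_FT_FT)
  also have "\<dots> = (LINT \<xi>|lborel. Re (?h \<xi>))"
  proof (rule inner_l2_cong)
    show "AE \<xi> in lborel. inner (fn (FT ?v) \<xi>) (fn (FT u) \<xi>) = Re (?h \<xi>)"
      using fn_FT_cx[OF b] by eventually_elim (simp add: inner_complex_def add_divide_distrib)
  qed measurable
  also have "\<dots> = Re (LINT \<xi>|lborel. ?h \<xi>)" by (rule integral_Re[OF i])
  finally have re: "Re (cip u ?v) = Re (LINT \<xi>|lborel. ?h \<xi>)" .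
  have "Im (cip u ?v) = inner (mul (\<lambda>_. \<i>) (FT ?v)) (FT u)"
    by (simp add: Im_cip cj_cx[OF bL] FT_mul_const[symmetric] inner_FT_FT)
  also have "\<dots> = (LINT \<xi>|lborel. Im (?h \<xi>))"
  proof (rule inner_l2_cong)
    show "AE \<xi> in lborel. inner (fn (mul (\<lambda>_. \<i>) (FT ?v)) \<xi>) (fn (FT u) \<xi>) = Im (?h \<xi>)"
      using fn_FT_cx[OF b] fn_mul[OF bmult_const, of \<i> "FT ?v"]
      by eventually_elim (simp add: inner_complex_def diff_divide_distrib)
  qed measurable
  also have "\<dots> = Im (LINT \<xi>|lborel. ?h \<xi>)" by (rule integral_Im[OF i])
  finally have "cip u ?v = (LINT \<xi>|lborel. ?h \<xi>)" using re by (simp add: complex_eq_iff)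
  then show ?thesis by simp
qed

text \<open>
  Testing with all translates of \<open>b\<close> shows that the \<open>L\<^sup>1\<close> function
  \<open>cnj (ft b) ((-i\<xi>)\<^sup>k FT A - FT B)\<close> has vanishing Fourier transform.
\<close>

theorem weak_derivative_FT:
  assumes AB: "\<And>b. b \<in> test_functions \<Longrightarrow> cip A (cls (cx ((deriv ^^ k) b))) = cip B (cls (cx b))"
  shows "AE \<xi> in lborel. fn (FT B) \<xi> = (- \<i> * of_real \<xi>) ^ k * fn (FT A) \<xi>"
proof -
  have main: "AE \<xi> in lborel. cnj (ft (cx b) \<xi>) * ((- \<i> * of_real \<xi>) ^ k * fn (FT A) \<xi> - fn (FT B) \<xi>) = 0"
    if b: "b \<in> test_functions" for b
  proof -
    let ?d = "(deriv ^^ k) b"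
    have d: "?d \<in> test_functions" by (rule test_derivs[OF b])
    define h where "h \<xi> = cnj (ft (cx ?d) \<xi>) * fn (FT A) \<xi> - cnj (ft (cx b) \<xi>) * fn (FT B) \<xi>" for \<xi>
    have bm: "bmult (\<lambda>\<xi>. cnj (ft (cx c) \<xi>))" if "c \<in> test_functions" for c
    proof -
      have "ft (cx c) \<in> borel_measurable borel" by (intro ft_measurable L2_measurable L12_L2 cx_L12 that)
      then have "bmult (ft (cx c))" by (rule bmultI[OF _ norm_ft_le])
      then show ?thesis by (rule bmult_cnj)
    qed
    have L: "(\<lambda>\<xi>. cnj (ft (cx c) \<xi>) * fn v \<xi>) \<in> L12" if "c \<in> test_functions" for c v
      by (intro L12_I L2_bmult bm that fn_L2 L2_prod_integrable L2_cnj plancherel_L12 cx_L12)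
    have h: "h \<in> L12" unfolding h_def by (intro L12_diff L b d)
    have "ft h y = 0" for y
    proof -
      have sh: "cnj (ft (cx (\<lambda>x. c (x + y))) \<xi>) = exp (- (\<i> * of_real \<xi> * of_real y)) * cnj (ft (cx c) \<xi>)" for c \<xi>
        using ft_shift[of "cx c" y \<xi>] by (simp add: cx_def[abs_def] exp_cnj mult_ac)
      have "cip A (cls (cx (\<lambda>x. ?d (x + y)))) = cip B (cls (cx (\<lambda>x. b (x + y))))"
        using AB[OF test_shift[OF b, of y]] unfolding derivs_shift[OF b] .
      then have "(LINT \<xi>|lborel. exp (- (\<i> * of_real \<xi> * of_real y)) * (cnj (ft (cx ?d) \<xi>) * fn (FT A) \<xi>))
          = (LINT \<xi>|lborel. exp (- (\<i> * of_real \<xi> * of_real y)) * (cnj (ft (cx b) \<xi>) * fn (FT B) \<xi>))"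
        unfolding cip_FT[OF test_shift[OF d]] cip_FT[OF test_shift[OF b]] sh by (simp add: mult.assoc)
      then have "ft (\<lambda>\<xi>. cnj (ft (cx ?d) \<xi>) * fn (FT A) \<xi>) y = ft (\<lambda>\<xi>. cnj (ft (cx b) \<xi>) * fn (FT B) \<xi>) y"
        by (simp add: ft_def)
      then show ?thesis
        unfolding h_def using ft_diff[OF L12_integrable[OF L[OF d]] L12_integrable[OF L[OF b]]] by simp
    qed
    then have "ft h = (\<lambda>_. 0)" by auto
    \<comment> \<open>Plancherel is used in reverse: a vanishing transform forces \<open>h\<close>
      to vanish.\<close>
    then have "norm (cls h) = 0"
      using plancherel_L12(2)[OF h] norm_cls_sq[OF L2_0] by simp
    then have "AE \<xi> in lborel. h \<xi> = 0"
      using cls_eq_iff[OF L12_L2[OF h] L2_0] by (simp add: zero_l2_def)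
    then show ?thesis
    proof eventually_elim
      case (elim \<xi>)
      have "cnj (ft (cx ?d) \<xi>) = (- \<i> * of_real \<xi>) ^ k * cnj (ft (cx b) \<xi>)"
        by (simp add: ft_cx_derivs[OF b])
      then show ?case using elim by (simp add: h_def right_diff_distrib mult_ac)
    qed
  qed
  \<comment> \<open>One test function cannot serve for all frequencies. The bump dilated by n+1 has
    a transform without zeros on |\<xi>| < n+1, and countably many null sets are discarded.\<close>
  have "AE \<xi> in lborel. \<forall>n::nat. \<bar>\<xi>\<bar> < real (Suc n) \<longrightarrow> fn (FT B) \<xi> = (- \<i> * of_real \<xi>) ^ k * fn (FT A) \<xi>"
    unfolding AE_all_countable
  proof
    fix n
    have t: "(\<lambda>x. bump (real (Suc n) * x)) \<in> test_functions"
      using test_affine[OF bump_test, of "real (Suc n)" 0] by simp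
    show "AE \<xi> in lborel. \<bar>\<xi>\<bar> < real (Suc n) \<longrightarrow> fn (FT B) \<xi> = (- \<i> * of_real \<xi>) ^ k * fn (FT A) \<xi>"
      using main[OF t]
    proof eventually_elim
      case (elim \<xi>)
      then show ?case using ft_bump_nonzero[of "real (Suc n)" \<xi>] by auto
    qed
  qed
  then show ?thesis
  proof eventually_elim
    case (elim \<xi>)
    obtain n :: nat where "\<bar>\<xi>\<bar> \<le> real n" using real_arch_simple by blast
    then show ?case using elim[rule_format, of n] by simp
  qed
qed

text \<open>The converse of \<open>weak_derivative_FT\<close>: with the relation known on the
  frequency side, moving the powers of \<xi> onto the test function gives the identity of
  pairings.\<close>

lemma FT_weak_derivative:
  assumes AB: "AE \<xi> in lborel. fn (FT B) \<xi> = (- \<i> * of_real \<xi>) ^ k * fn (FT A) \<xi>" and b: "b \<in> test_functions"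
  shows "cip A (cls (cx ((deriv ^^ k) b))) = cip B (cls (cx b))"
proof -
  have m: "(\<lambda>\<xi>. cnj (ft (cx c) \<xi>)) \<in> borel_measurable borel" if "c \<in> test_functions" for c
    by (intro L2_measurable L2_cnj plancherel_L12 cx_L12 that)
  note [measurable] = m[OF b] m[OF test_derivs[OF b, of k]]
  show ?thesis
    unfolding cip_FT[OF b] cip_FT[OF test_derivs[OF b]]
    by (intro arg_cong2[where f = "(*)"] refl integral_cong_AE)
      (use AB in \<open>auto simp: ft_cx_derivs[OF b] mult_ac\<close>)
qed

section \<open>Distributional primitives in one variable\<close>

lemma integral_derivative_compact_support:
  fixes f :: "real \<Rightarrow> complex"
  assumes "\<And>x. (f has_vector_derivative f' x) (at x)" "continuous_on UNIV f'"
    "\<And>x. \<bar>x\<bar> \<ge> M \<Longrightarrow> f x = 0" "\<And>x. \<bar>x\<bar> \<ge> M \<Longrightarrow> f' x = 0"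
  shows "(LINT x|lborel. f' x) = 0"
proof -
  have "ft f' 0 = \<i> * of_real 0 * ft f 0" by (rule ft_derivative[OF assms])
  then show ?thesis by (simp add: ft_def)
qed

lemma integrable_mult_test:
  fixes f :: "real \<Rightarrow> complex"
  assumes "continuous_on UNIV f" "a \<in> test_functions"
  shows "integrable lborel (\<lambda>t. f t * of_real (a t))"
proof -
  obtain M where M: "\<And>x. norm x \<ge> M \<Longrightarrow> a x = 0" using test_support[OF assms(2)] by metis
  have "(\<lambda>t. f t * of_real (a t)) \<in> L12"
    by (rule compact_support_L12[of _ M]) (use M assms(1) test_continuous[OF assms(2)] in \<open>auto intro!: continuous_intros\<close>)
  then show ?thesis by simp
qed

lemma integral_by_parts_test:
  fixes f :: "real \<Rightarrow> complex"
  assumes f: "\<And>x. (f has_vector_derivative f' x) (at x)" "continuous_on UNIV f'" and a: "a \<in> test_functions"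
  shows "(LINT t|lborel. f t * of_real (deriv a t)) = - (LINT t|lborel. f' t * of_real (a t))"
proof -
  have fc: "continuous_on UNIV f"
    by (auto simp: continuous_on_eq_continuous_within intro: has_vector_derivative_continuous f)
  obtain M1 where M1: "\<And>x. norm x \<ge> M1 \<Longrightarrow> a x = 0" using test_support[OF a] by metis
  obtain M2 where M2: "\<And>x. norm x \<ge> M2 \<Longrightarrow> deriv a x = 0" using test_support[OF test_deriv[OF a]] by metis
  have "(LINT t|lborel. f t * of_real (deriv a t) + f' t * of_real (a t)) = 0"
  proof (rule integral_derivative_compact_support[where M = "max M1 M2" and f = "\<lambda>t. f t * of_real (a t)"])
    fix x
    have "((\<lambda>t. complex_of_real (a t)) has_vector_derivative of_real (deriv a x)) (at x)"
      using test_has_deriv[OF a, of x] by (intro has_vector_derivative_of_real) (simp add: has_real_derivative_iff_has_vector_derivative)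
    from has_vector_derivative_mult[OF f(1) this]
    show "((\<lambda>t. f t * of_real (a t)) has_vector_derivative f x * of_real (deriv a x) + f' x * of_real (a x)) (at x)" .
  qed (use M1 M2 fc f(2) test_continuous[OF a] test_continuous[OF test_deriv[OF a]] in \<open>auto intro!: continuous_intros\<close>)
  then show ?thesis
    using integrable_mult_test[OF fc test_deriv[OF a]] integrable_mult_test[OF f(2) a]
    by (simp add: eq_neg_iff_add_eq_0)
qed

lemma bump_integral_pos: "0 < (LINT x|lborel. bump x)"
proof -
  have "(LINT x|lborel. cx bump x) \<noteq> 0"
    using ft_bump_nonzero[of 1 0] by (simp add: ft_def)
  then have "(LINT x|lborel. bump x) \<noteq> 0" by (simp add: cx_def)
  moreover have "0 \<le> (LINT x|lborel. bump x)" by (simp add: bump_nonneg)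
  ultimately show ?thesis by simp
qed

lemma prim_outside_support:
  assumes f: "continuous_on UNIV f" and M: "\<And>x. \<bar>x\<bar> \<ge> M \<Longrightarrow> f x = 0" "0 \<le> M"
  shows "M \<le> x \<Longrightarrow> prim f x = prim f M" "x \<le> -M \<Longrightarrow> prim f x = prim f (-M)"
proof -
  have *: "prim f p = prim f q" if pq: "p \<le> q" and z: "\<And>x. p \<le> x \<Longrightarrow> x \<le> q \<Longrightarrow> f x = 0" for p q
  proof -
    have "\<exists>c. \<forall>x\<in>{p..q}. prim f x = c"
    proof (rule has_vector_derivative_zero_constant[of "{p..q}" "prim f"])
      show "(prim f has_vector_derivative 0) (at x within {p..q})" if "x \<in> {p..q}" for x
        using prim_has_vector_derivative[OF f, of x] z[of x] that by (auto intro: has_vector_derivative_at_within)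
      show "\<exists>c. \<forall>x\<in>{p..q}. prim f x = c" if "\<And>x. x \<in> {p..q} \<Longrightarrow> prim f x = c" for c
        using that by blast
    qed simp
    then show ?thesis using pq by auto
  qed
  show "M \<le> x \<Longrightarrow> prim f x = prim f M" using *[of M x] M by force
  show "x \<le> -M \<Longrightarrow> prim f x = prim f (-M)" using *[of x "-M"] M by force
qed

text \<open>The two bumps have equal mass, so the primitive of their difference is constant outside
  a bounded set, with value 0, and is a test function.\<close>

lemma bump_difference_antiderivative:
  assumes n: "0 < n"
  obtains a where "a \<in> test_functions" "deriv a = (\<lambda>t. bump (n * t + p) - bump (n * t + q))"
proof -
  have bc: "continuous_on UNIV bump" by (rule test_continuous[OF bump_test])
  define a where "a t = (prim bump (n * t + p) - prim bump (n * t + q)) / n" for t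
  define d where "d t = bump (n * t + p) - bump (n * t + q)" for t
  have B: "(prim bump has_real_derivative bump s) (at s)" for s
    using prim_has_vector_derivative[OF bc] by (simp add: has_real_derivative_iff_has_vector_derivative)
  have ad: "(a has_real_derivative d t) (at t)" for t
    unfolding a_def d_def using n
    by (auto intro!: derivative_eq_intros DERIV_chain2[OF B] simp: field_simps)
  have Ckd: "Ck k d" for k
    using Ck_add[OF Ck_affine[OF test_Ck[OF bump_test], of k n p]
        Ck_mult[OF Ck_const[of k "-1"] Ck_affine[OF test_Ck[OF bump_test], of k n q]]]
    by (simp add: d_def[abs_def])
  have "Ck k a" for k by (rule Ck_mono[OF Ck_Suc_I[OF ad Ckd]])
  moreover have "a t = 0" if "norm t > (1 + \<bar>p\<bar> + \<bar>q\<bar>) / n" for t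
  proof -
    have "1 + \<bar>p\<bar> + \<bar>q\<bar> < \<bar>n * t\<bar>" using that n by (simp add: divide_less_eq abs_mult mult.commute)
    then consider "1 \<le> n * t + p" "1 \<le> n * t + q" | "n * t + p \<le> - 1" "n * t + q \<le> - 1" by linarith
    then have "prim bump (n * t + p) = prim bump (n * t + q)"
    proof cases
      case 1
      then show ?thesis using prim_outside_support(1)[OF bc bump_outside zero_le_one] by metis
    next
      case 2
      then show ?thesis using prim_outside_support(2)[OF bc bump_outside zero_le_one] by metis
    qed
    then show ?thesis by (simp add: a_def)
  qed
  ultimately have "a \<in> test_functions" unfolding test_functions_iff by blast
  moreover have "deriv a = d" using ad by (auto intro: DERIV_imp_deriv)
  ultimately show thesis using that by (simp add: d_def[abs_def])
qed


text \<open>After subtracting the primitive of \<open>g\<close>, the remainder annihilates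
  derivatives of test functions. Differences of bumps are such derivatives, so the averages of the
  remainder around any two points agree, and shrinking the bumps compares the point values.\<close>

lemma du_Bois_Reymond:
  fixes c g :: "real \<Rightarrow> complex"
  assumes c: "continuous_on UNIV c" and g: "continuous_on UNIV g"
    and weak: "\<And>a. a \<in> test_functions \<Longrightarrow>
      (LINT t|lborel. c t * of_real (deriv a t)) = - (LINT t|lborel. g t * of_real (a t))"
  shows "c t - c 0 = prim g t"
proof -
  define h where "h t = c t - prim g t" for t
  have hc: "continuous_on UNIV h" unfolding h_def by (intro continuous_intros c prim_continuous g)
  have h0: "(LINT t|lborel. h t * of_real (deriv a t)) = 0" if a: "a \<in> test_functions" for a
  proof -
    have "(LINT t|lborel. prim g t * of_real (deriv a t)) = - (LINT t|lborel. g t * of_real (a t))"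
      by (rule integral_by_parts_test[OF prim_has_vector_derivative[OF g] g a])
    then show ?thesis
      using weak[OF a] integrable_mult_test[OF c test_deriv[OF a]]
        integrable_mult_test[OF prim_continuous[OF g] test_deriv[OF a]]
      by (simp add: h_def left_diff_distrib)
  qed
  \<comment> \<open>The average of \<open>h\<close> at scale 1/n around p, written after rescaling
    so that the weight does not depend on n.\<close>
  define J where "J n p = (LINT s|lborel. h (p + s / n) * of_real (bump s))" for n p :: real
  have J: "J n p = J n q" if n: "0 < n" for n p q
  proof -
    obtain a where a: "a \<in> test_functions" "deriv a = (\<lambda>t. bump (n * t + - n * p) - bump (n * t + - n * q))"
      by (rule bump_difference_antiderivative[OF n])
    have t: "(\<lambda>t. bump (n * t + - n * p)) \<in> test_functions" for p
      using n by (intro test_affine bump_test) simp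
    have e: "(LINT t|lborel. h t * of_real (bump (n * t + - n * p))) = (1 / n) *\<^sub>R J n p" for p
      unfolding J_def using n
      by (subst lborel_integral_real_affine[of "1 / n" _ p]) (auto simp: algebra_simps)
    have "(LINT t|lborel. h t * of_real (bump (n * t + - n * p))) = (LINT t|lborel. h t * of_real (bump (n * t + - n * q)))"
      using h0[OF a(1)] integrable_mult_test[OF hc t[of p]] integrable_mult_test[OF hc t[of q]]
      unfolding a(2) by (simp add: right_diff_distrib)
    then show ?thesis unfolding e using n by simp
  qed
  have Jlim: "(\<lambda>n. J (real (Suc n)) p) \<longlonglongrightarrow> (LINT s|lborel. h p * of_real (bump s))" for p
  proof -
    have "compact (h ` {p - 1..p + 1})" by (intro compact_continuous_image continuous_on_subset[OF hc]) auto
    then obtain C where C: "\<And>x. x \<in> {p - 1..p + 1} \<Longrightarrow> norm (h x) \<le> C"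
      using compact_imp_bounded bounded_iff by (metis imageI)
    have [measurable]: "h \<in> borel_measurable borel" "bump \<in> borel_measurable borel"
      using hc test_continuous[OF bump_test] by (auto intro: borel_measurable_continuous_onI)
    show ?thesis
      unfolding J_def
    proof (rule integral_dominated_convergence[where w = "\<lambda>s. C * bump s"])
      have "integrable lborel (\<lambda>s. Re (cx bump s))" by (intro integrable_Re L12_integrable cx_L12 bump_test)
      then show "integrable lborel (\<lambda>s. C * bump s)" by (simp add: cx_def)
      show "AE s in lborel. (\<lambda>n. h (p + s / real (Suc n)) * of_real (bump s)) \<longlonglongrightarrow> h p * of_real (bump s)"
      proof (rule AE_I2)
        fix s
        have "(\<lambda>n. p + s / real (Suc n)) \<longlonglongrightarrow> p + 0"
          by (intro tendsto_intros LIMSEQ_Suc[OF lim_const_over_n])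
        then have "(\<lambda>n. h (p + s / real (Suc n))) \<longlonglongrightarrow> h p"
          using hc by (intro continuous_on_tendsto_compose[OF hc]) auto
        then show "(\<lambda>n. h (p + s / real (Suc n)) * of_real (bump s)) \<longlonglongrightarrow> h p * of_real (bump s)"
          by (intro tendsto_intros)
      qed
      show "AE s in lborel. norm (h (p + s / real (Suc n)) * of_real (bump s)) \<le> C * bump s" for n
      proof (rule AE_I2)
        fix s
        show "norm (h (p + s / real (Suc n)) * of_real (bump s)) \<le> C * bump s"
        proof (cases "\<bar>s\<bar> < 1")
          case True
          have "\<bar>s / real (Suc n)\<bar> \<le> \<bar>s\<bar> / 1" unfolding abs_divide by (intro divide_left_mono) auto
          then have "\<bar>s / real (Suc n)\<bar> < 1" using True by linarith
          then have "p + s / real (Suc n) \<in> {p - 1..p + 1}" unfolding atLeastAtMost_iff by linarith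
          from C[OF this] show ?thesis using bump_nonneg[of s] by (simp add: norm_mult mult_right_mono)
        qed (simp add: bump_outside)
      qed
    qed measurable
  qed
  have "(LINT s|lborel. h t * of_real (bump s)) = (LINT s|lborel. h 0 * of_real (bump s))"
    by (rule LIMSEQ_unique[OF Jlim[of t]]) (use Jlim[of 0] J[of _ t 0] in simp)
  then have "h t = h 0" using bump_integral_pos by simp
  then show ?thesis by (simp add: h_def algebra_simps)
qed

subsection \<open>Test functions on the plane\<close>

lemma pair_Basis_real: "b \<in> (Basis :: (real \<times> real) set) \<longleftrightarrow> b = (1, 0) \<or> b = (0, 1)"
  by (auto simp: Basis_prod_def)

text \<open>Each partial derivative of a tensor product is again a tensor product, with one factor
  differentiated, so the induction runs over all pairs of factors.\<close>

lemma Ck_tensor: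
  fixes a b :: "real \<Rightarrow> real"
  assumes "\<And>k. Ck k a" "\<And>k. Ck k b"
  shows "Ck k (\<lambda>p. a (fst p) * b (snd p))"
  using assms
proof (induction k arbitrary: a b)
  case 0
  have "continuous_on UNIV (\<lambda>p :: real \<times> real. a (fst p))"
    by (rule continuous_on_compose2[OF Ck_continuous[OF 0(1)[of 0]] continuous_on_fst[OF continuous_on_id]]) simp
  moreover have "continuous_on UNIV (\<lambda>p :: real \<times> real. b (snd p))"
    by (rule continuous_on_compose2[OF Ck_continuous[OF 0(2)[of 0]] continuous_on_snd[OF continuous_on_id]]) simp
  ultimately show ?case by (simp add: continuous_on_mult)
next
  case (Suc k)
  have d: "((\<lambda>p. a (fst p) * b (snd p)) has_derivative
      (\<lambda>h. deriv a (fst p) * b (snd p) * fst h + a (fst p) * deriv b (snd p) * snd h)) (at p)" for p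
  proof -
    have a: "((\<lambda>p. a (fst p)) has_derivative (\<lambda>h. deriv a (fst p) * fst h)) (at p)"
      using Ck_Suc_D(1)[OF Suc.prems(1)] by (intro has_derivative_compose[OF has_derivative_fst[OF has_derivative_ident], unfolded o_def, where g = a])
        (simp add: has_field_derivative_def)
    have b: "((\<lambda>p. b (snd p)) has_derivative (\<lambda>h. deriv b (snd p) * snd h)) (at p)"
      using Ck_Suc_D(1)[OF Suc.prems(2)] by (intro has_derivative_compose[OF has_derivative_snd[OF has_derivative_ident], unfolded o_def, where g = b])
        (simp add: has_field_derivative_def)
    show ?thesis by (rule has_derivative_eq_rhs[OF has_derivative_mult[OF a b]]) (auto simp: fun_eq_iff algebra_simps)
  qed
  have fd: "frechet_derivative (\<lambda>p. a (fst p) * b (snd p)) (at p)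
      = (\<lambda>h. deriv a (fst p) * b (snd p) * fst h + a (fst p) * deriv b (snd p) * snd h)" for p
    by (rule frechet_derivative_at[OF d, symmetric])
  show ?case
    using d Suc.IH[of "deriv a" b] Suc.IH[of a "deriv b"] Suc.prems Ck_Suc_D(2)[OF Suc.prems(1)] Ck_Suc_D(2)[OF Suc.prems(2)]
    by (auto simp: pair_Basis_real fd differentiable_def)
qed

lemma test_tensor:
  assumes "a \<in> test_functions" "b \<in> test_functions"
  shows "(\<lambda>p. a (fst p) * b (snd p) :: real) \<in> (test_functions :: (real \<times> real \<Rightarrow> real) set)"
  unfolding test_functions_iff
proof (intro conjI allI)
  show "Ck k (\<lambda>p. a (fst p) * b (snd p))" for k by (rule Ck_tensor[OF test_Ck[OF assms(1)] test_Ck[OF assms(2)]])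
  obtain M1 where M1: "0 < M1" "\<And>x. norm x \<ge> M1 \<Longrightarrow> a x = 0" using test_support[OF assms(1)] by metis
  obtain M2 where M2: "0 < M2" "\<And>x. norm x \<ge> M2 \<Longrightarrow> b x = 0" using test_support[OF assms(2)] by metis
  have "a (fst p) * b (snd p) = 0" if "norm p > M1 + M2" for p :: "real \<times> real"
  proof -
    have "norm p \<le> norm (fst p) + norm (snd p)"
      by (cases p) (simp add: norm_Pair sqrt_sum_squares_le_sum_abs)
    then have "norm (fst p) \<ge> M1 \<or> norm (snd p) \<ge> M2" using that by linarith
    then show ?thesis using M1(2) M2(2) by auto
  qed
  then show "\<exists>M. \<forall>p. norm p > M \<longrightarrow> a (fst p) * b (snd p) = 0" by blast
qed

section \<open>Time slices of test functions on the plane\<close>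

definition D1 :: "(real \<times> real \<Rightarrow> real) \<Rightarrow> real \<times> real \<Rightarrow> real" where
  "D1 \<phi> p = frechet_derivative \<phi> (at p) (1, 0)"
definition D2 :: "(real \<times> real \<Rightarrow> real) \<Rightarrow> real \<times> real \<Rightarrow> real" where
  "D2 \<phi> p = frechet_derivative \<phi> (at p) (0, 1)"

lemma test_frechet:
  fixes \<phi> :: "real \<times> real \<Rightarrow> real"
  assumes \<phi>: "\<phi> \<in> test_functions" and b: "b \<in> Basis"
  shows "(\<lambda>p. frechet_derivative \<phi> (at p) b) \<in> test_functions"
  unfolding test_functions_iff
proof (intro conjI allI)
  show "Ck k (\<lambda>p. frechet_derivative \<phi> (at p) b)" for k using test_Ck[OF \<phi>, of "Suc k"] b by simp
  obtain M where M: "\<And>p. norm p \<ge> M \<Longrightarrow> \<phi> p = 0" using test_support[OF \<phi>] by metis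
  have "frechet_derivative \<phi> (at p) b = 0" if "norm p > M" for p
  proof -
    have "(\<phi> has_derivative (\<lambda>_. 0)) (at p)"
    proof (rule has_derivative_transform_within_open[OF has_derivative_const[of 0]])
      show "open {p. norm p > M}" by (intro open_Collect_less continuous_intros)
    qed (use that M in auto)
    then show ?thesis using frechet_derivative_at by metis
  qed
  then show "\<exists>M. \<forall>p. norm p > M \<longrightarrow> frechet_derivative \<phi> (at p) b = 0" by blast
qed

lemma test_D: "\<phi> \<in> test_functions \<Longrightarrow> D1 \<phi> \<in> test_functions" "\<phi> \<in> test_functions \<Longrightarrow> D2 \<phi> \<in> test_functions"
  unfolding D1_def[abs_def] D2_def[abs_def] by (auto intro!: test_frechet simp: pair_Basis_real)

lemma D_derivative:
  fixes \<phi> :: "real \<times> real \<Rightarrow> real"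
  assumes \<phi>: "\<phi> \<in> test_functions"
  shows "((\<lambda>s. \<phi> (s, x)) has_real_derivative D1 \<phi> (t, x)) (at t)"
    and "((\<lambda>y. \<phi> (t, y)) has_real_derivative D2 \<phi> (t, x)) (at x)"
proof -
  have d: "(\<phi> has_derivative frechet_derivative \<phi> (at p)) (at p)" for p
  proof -
    have "\<phi> differentiable (at p)" using test_Ck[OF \<phi>, of "Suc 0"] by (simp del: split_paired_All)
    then show ?thesis by (simp add: frechet_derivative_works)
  qed
  have lin: "frechet_derivative \<phi> (at p) (h *\<^sub>R v) = h * frechet_derivative \<phi> (at p) v" for p v and h :: real
    using linear_scale[OF has_derivative_linear[OF d[of p]], of h v] by simp
  have "((\<lambda>s. (s, x)) has_derivative (\<lambda>h. (h, 0))) (at t)" by (auto intro!: derivative_eq_intros)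
  from has_derivative_compose[OF this d]
  show "((\<lambda>s. \<phi> (s, x)) has_real_derivative D1 \<phi> (t, x)) (at t)"
  proof -
    assume "((\<lambda>s. \<phi> (s, x)) has_derivative (\<lambda>h. frechet_derivative \<phi> (at (t, x)) (h, 0))) (at t)"
    moreover have "frechet_derivative \<phi> (at (t, x)) (h, 0) = D1 \<phi> (t, x) * h" for h
      using lin[of "(t, x)" h "(1, 0)"] by (simp add: D1_def)
    ultimately show ?thesis by (simp add: has_field_derivative_def)
  qed
  have "((\<lambda>y. (t, y)) has_derivative (\<lambda>h. (0, h))) (at x)" by (auto intro!: derivative_eq_intros)
  from has_derivative_compose[OF this d]
  show "((\<lambda>y. \<phi> (t, y)) has_real_derivative D2 \<phi> (t, x)) (at x)"
  proof -
    assume "((\<lambda>s. \<phi> (t, s)) has_derivative (\<lambda>h. frechet_derivative \<phi> (at (t, x)) (0, h))) (at x)"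
    moreover have "frechet_derivative \<phi> (at (t, x)) (0, h) = D2 \<phi> (t, x) * h" for h
      using lin[of "(t, x)" h "(0, 1)"] by (simp add: D2_def)
    ultimately show ?thesis by (simp add: has_field_derivative_def)
  qed
qed

definition sl :: "(real \<times> real \<Rightarrow> real) \<Rightarrow> real \<Rightarrow> real \<Rightarrow> complex" where
  "sl \<phi> t x = of_real (\<phi> (t, x))"

lemma norm_Pair_ge: "\<bar>t\<bar> \<le> norm (t, x)" "\<bar>x\<bar> \<le> norm (t, x)" for t x :: real
  by (simp_all add: norm_Pair)

lemma sl_L12:
  assumes "\<phi> \<in> test_functions" shows "sl \<phi> t \<in> L12"
proof -
  obtain M where M: "\<And>p. norm p \<ge> M \<Longrightarrow> \<phi> p = 0" using test_support[OF assms] by metis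
  show ?thesis
  proof (rule compact_support_L12[of _ M])
    show "continuous_on UNIV (sl \<phi> t)"
      unfolding sl_def by (intro continuous_intros continuous_on_compose2[OF test_continuous[OF assms]]) auto
    show "sl \<phi> t x = 0" if "M \<le> \<bar>x\<bar>" for x
      using M[of "(t, x)"] norm_Pair_ge(2)[of x t] that by (simp add: sl_def)
  qed
qed

lemma sl_L2: "\<phi> \<in> test_functions \<Longrightarrow> sl \<phi> t \<in> L2"
  using sl_L12 by simp

lemma sl_support:
  assumes "\<phi> \<in> test_functions"
  obtains M where "\<And>t. \<bar>t\<bar> \<ge> M \<Longrightarrow> cls (sl \<phi> t) = 0"
proof -
  obtain M where M: "\<And>p. norm p \<ge> M \<Longrightarrow> \<phi> p = 0" using test_support[OF assms] by metis
  show thesis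
  proof (rule that)
    fix t assume "\<bar>t\<bar> \<ge> M"
    then have "sl \<phi> t = (\<lambda>_. 0)"
      using M norm_Pair_ge(1)[of t] by (auto simp: sl_def fun_eq_iff intro: order_trans)
    then show "cls (sl \<phi> t) = 0" by (simp add: zero_l2_def)
  qed
qed

text \<open>The second time derivative is bounded on the plane and the support is compact, so the
  Taylor remainder is quadratic uniformly in x and carried by a fixed interval. This turns pointwise
  differentiability into differentiability in L^2.\<close>

lemma sl_has_vector_derivative:
  assumes \<phi>: "\<phi> \<in> test_functions"
  shows "((\<lambda>t. cls (sl \<phi> t)) has_vector_derivative cls (sl (D1 \<phi>) t)) (at t)"
proof -
  have \<phi>1: "D1 \<phi> \<in> test_functions" and \<phi>11: "D1 (D1 \<phi>) \<in> test_functions" using \<phi> by (auto intro: test_D)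
  obtain M1 where M1: "0 < M1" "\<And>p. norm p \<ge> M1 \<Longrightarrow> \<phi> p = 0" using test_support[OF \<phi>] by metis
  obtain M2 where M2: "0 < M2" "\<And>p. norm p \<ge> M2 \<Longrightarrow> D1 \<phi> p = 0" using test_support[OF \<phi>1] by metis
  define M where "M = max M1 M2"
  obtain M3 where M3: "0 < M3" "\<And>p. norm p \<ge> M3 \<Longrightarrow> D1 (D1 \<phi>) p = 0" using test_support[OF \<phi>11] by metis
  have "compact (D1 (D1 \<phi>) ` cball 0 M3)"
    by (intro compact_continuous_image continuous_on_subset[OF test_continuous[OF \<phi>11]]) auto
  then obtain C0 where C0: "\<And>p. p \<in> cball 0 M3 \<Longrightarrow> norm (D1 (D1 \<phi>) p) \<le> C0"
    using compact_imp_bounded bounded_iff by (metis imageI)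
  have C: "\<bar>D1 (D1 \<phi>) p\<bar> \<le> \<bar>C0\<bar>" for p
    using C0[of p] M3(2)[of p] by (cases "norm p \<le> M3") auto
  have est: "\<bar>\<phi> (s, x) - \<phi> (t, x) - (s - t) * D1 \<phi> (t, x)\<bar> \<le> \<bar>C0\<bar> * (s - t)\<^sup>2" for s x
  proof -
    have 1: "\<bar>D1 \<phi> (r, x) - D1 \<phi> (t, x)\<bar> \<le> \<bar>C0\<bar> * \<bar>r - t\<bar>" for r
      using field_differentiable_bound[of UNIV "\<lambda>r. D1 \<phi> (r, x)" "\<lambda>r. D1 (D1 \<phi>) (r, x)" "\<bar>C0\<bar>" r t]
        D_derivative(1)[OF \<phi>1] C by simp
    have "norm ((\<phi> (s, x) - s * D1 \<phi> (t, x)) - (\<phi> (t, x) - t * D1 \<phi> (t, x))) \<le> \<bar>C0\<bar> * \<bar>s - t\<bar> * norm (s - t)"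
    proof (rule field_differentiable_bound[of "closed_segment t s" _ "\<lambda>r. D1 \<phi> (r, x) - D1 \<phi> (t, x)"])
      show "((\<lambda>r. \<phi> (r, x) - r * D1 \<phi> (t, x)) has_real_derivative D1 \<phi> (r, x) - D1 \<phi> (t, x)) (at r within closed_segment t s)" for r
        by (auto intro!: derivative_eq_intros has_field_derivative_at_within[OF D_derivative(1)[OF \<phi>]])
      show "norm (D1 \<phi> (r, x) - D1 \<phi> (t, x)) \<le> \<bar>C0\<bar> * \<bar>s - t\<bar>" if "r \<in> closed_segment t s" for r
      proof -
        have "\<bar>r - t\<bar> \<le> \<bar>s - t\<bar>" using that by (auto simp: closed_segment_eq_real_ivl split: if_splits)
        then show ?thesis using 1[of r] mult_left_mono[of "\<bar>r - t\<bar>" "\<bar>s - t\<bar>" "\<bar>C0\<bar>"] by simp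
      qed
    qed auto
    moreover have "(\<phi> (s, x) - s * D1 \<phi> (t, x)) - (\<phi> (t, x) - t * D1 \<phi> (t, x))
        = \<phi> (s, x) - \<phi> (t, x) - (s - t) * D1 \<phi> (t, x)"
      by (simp add: left_diff_distrib)
    moreover have "\<bar>C0\<bar> * \<bar>s - t\<bar> * norm (s - t) = \<bar>C0\<bar> * (s - t)\<^sup>2"
      by (simp add: power2_eq_square mult.assoc)
    ultimately show ?thesis by (simp only: real_norm_def)
  qed
  let ?I = "cls (indicator {-M..M})"
  have est2: "norm (cls (sl \<phi> s) - cls (sl \<phi> t) - (s - t) *\<^sub>R cls (sl (D1 \<phi>) t)) \<le> \<bar>C0\<bar> * (s - t)\<^sup>2 * norm ?I" for s
  proof -
    let ?f = "\<lambda>x. sl \<phi> s x - sl \<phi> t x - (s - t) *\<^sub>R sl (D1 \<phi>) t x"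
    have f: "?f \<in> L2" by (intro L2_diff L2_scaleR sl_L2 \<phi> \<phi>1)
    have "cls (sl \<phi> s) - cls (sl \<phi> t) - (s - t) *\<^sub>R cls (sl (D1 \<phi>) t) = cls ?f"
      by (simp add: cls_diff cls_scaleR L2_diff L2_scaleR sl_L2 \<phi> \<phi>1)
    also have "norm \<dots> \<le> \<bar>C0\<bar> * (s - t)\<^sup>2 * norm ?I"
    proof (rule norm_l2_mono)
      show "AE x in lborel. cmod (fn (cls ?f) x) \<le> \<bar>C0\<bar> * (s - t)\<^sup>2 * cmod (fn ?I x)"
        using fn_cls[OF f] fn_cls[OF L2_indicator_Icc[of "-M" M]]
      proof eventually_elim
        case (elim x)
        have "?f x = of_real (\<phi> (s, x) - \<phi> (t, x) - (s - t) * D1 \<phi> (t, x))"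
          by (simp add: sl_def scaleR_conv_of_real)
        then have "cmod (?f x) = \<bar>\<phi> (s, x) - \<phi> (t, x) - (s - t) * D1 \<phi> (t, x)\<bar>" by (simp only: norm_of_real)
        moreover have "\<phi> (s, x) - \<phi> (t, x) - (s - t) * D1 \<phi> (t, x) = 0" if "x \<notin> {-M..M}"
        proof -
          have "\<bar>x\<bar> \<ge> M" using that by auto
          then have "norm (r, x) \<ge> M1" "norm (r, x) \<ge> M2" for r :: real
            using norm_Pair_ge(2)[of x r] by (auto simp: M_def)
          then show ?thesis by (simp add: M1(2) M2(2))
        qed
        ultimately show ?case using est[of s x] elim by (cases "x \<in> {-M..M}") (auto simp: indicator_def)
      qed
    qed simp
    finally show ?thesis .
  qed
  have "((\<lambda>s. norm (cls (sl \<phi> s) - cls (sl \<phi> t) - (s - t) *\<^sub>R cls (sl (D1 \<phi>) t)) / norm (s - t)) \<longlongrightarrow> 0) (at t)"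
  proof (rule Lim_null_comparison)
    show "\<forall>\<^sub>F s in at t. norm (norm (cls (sl \<phi> s) - cls (sl \<phi> t) - (s - t) *\<^sub>R cls (sl (D1 \<phi>) t)) / norm (s - t))
        \<le> \<bar>C0\<bar> * norm ?I * \<bar>s - t\<bar>"
      unfolding eventually_at_filter
    proof (intro always_eventually allI impI)
      fix s assume "s \<noteq> t"
      then show "norm (norm (cls (sl \<phi> s) - cls (sl \<phi> t) - (s - t) *\<^sub>R cls (sl (D1 \<phi>) t)) / norm (s - t))
          \<le> \<bar>C0\<bar> * norm ?I * \<bar>s - t\<bar>"
        using est2[of s] by (simp add: divide_le_eq power2_eq_square mult_ac)
    qed
    show "((\<lambda>s. \<bar>C0\<bar> * norm ?I * \<bar>s - t\<bar>) \<longlongrightarrow> 0) (at t)" by (auto intro!: tendsto_eq_intros)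
  qed
  then show ?thesis
    by (simp add: has_vector_derivative_def has_derivative_iff_norm bounded_linear_scaleR_left)
qed

lemma sl_continuous: "\<phi> \<in> test_functions \<Longrightarrow> continuous_on UNIV (\<lambda>t. cls (sl \<phi> t))"
  by (auto simp: continuous_on_eq_continuous_within intro: has_vector_derivative_continuous sl_has_vector_derivative)

lemma cj_sl: "\<phi> \<in> test_functions \<Longrightarrow> cj (cls (sl \<phi> t)) = cls (sl \<phi> t)"
  by (simp add: cj_cls sl_L2) (simp add: sl_def[abs_def])

lemma FT_sl_D2:
  assumes \<phi>: "\<phi> \<in> test_functions"
  shows "AE \<xi> in lborel. fn (FT (cls (sl (D2 (D2 \<phi>)) t))) \<xi> = - of_real (\<xi>\<^sup>2) * fn (FT (cls (sl \<phi> t))) \<xi>"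
proof -
  have one: "ft (sl (D2 \<psi>) t) \<xi> = \<i> * of_real \<xi> * ft (sl \<psi> t) \<xi>" if \<psi>: "\<psi> \<in> test_functions" for \<psi> \<xi>
  proof -
    obtain M1 where M1: "\<And>p. norm p \<ge> M1 \<Longrightarrow> \<psi> p = 0" using test_support[OF \<psi>] by metis
    obtain M2 where M2: "\<And>p. norm p \<ge> M2 \<Longrightarrow> D2 \<psi> p = 0" using test_support[OF test_D(2)[OF \<psi>]] by metis
    show ?thesis
    proof (rule ft_derivative[where M = "max M1 M2"])
      show "(sl \<psi> t has_vector_derivative sl (D2 \<psi>) t x) (at x)" for x
        unfolding sl_def using D_derivative(2)[OF \<psi>]
        by (intro has_vector_derivative_of_real) (simp add: has_real_derivative_iff_has_vector_derivative)
      show "continuous_on UNIV (sl (D2 \<psi>) t)"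
        unfolding sl_def by (intro continuous_intros continuous_on_compose2[OF test_continuous[OF test_D(2)[OF \<psi>]]]) auto
      show "sl \<psi> t x = 0" "sl (D2 \<psi>) t x = 0" if "max M1 M2 \<le> \<bar>x\<bar>" for x
        using M1[of "(t, x)"] M2[of "(t, x)"] norm_Pair_ge(2)[of x t] that by (auto simp: sl_def)
    qed
  qed
  have f: "AE \<xi> in lborel. fn (FT (cls (sl \<psi> t))) \<xi> = ft (sl \<psi> t) \<xi> / sqrt (2 * pi)" if \<psi>: "\<psi> \<in> test_functions" for \<psi>
    using fn_scaleR[of "1 / sqrt (2 * pi)" "cls (ft (sl \<psi> t))"] fn_cls[OF plancherel_L12(1)[OF sl_L12[OF \<psi>]]]
    unfolding FT_cls[OF sl_L12[OF \<psi>]] F1_def by eventually_elim (simp add: scaleR_conv_of_real)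
  have \<phi>2: "D2 \<phi> \<in> test_functions" using \<phi> by (rule test_D)
  have e: "\<i> * of_real \<xi> * (\<i> * of_real \<xi> * F) = - of_real (\<xi>\<^sup>2) * F" for \<xi> :: real and F :: complex
    by (simp add: complex_eq_iff power2_eq_square algebra_simps)
  show ?thesis
    using f[OF \<phi>] f[OF test_D(2)[OF \<phi>2]]
    by eventually_elim (simp add: one[OF \<phi>] one[OF \<phi>2] e del: of_real_power)
qed

section \<open>Sobolev spaces on the Fourier side\<close>

lemma norm_mul_unit:
  assumes "cmod c = 1" shows "norm (mul (\<lambda>_. c) u) = norm u"
proof (rule antisym)
  have le: "norm (mul (\<lambda>_. d) v) \<le> norm v" if "cmod d = 1" for d v
    using norm_mul_le[of "\<lambda>_. d" 1 v] that by simp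
  show "norm (mul (\<lambda>_. c) u) \<le> norm u" by (rule le[OF assms])
  have "mul (\<lambda>_. cnj c) (mul (\<lambda>_. c) u) = u"
    using assms by (simp add: mul_mul complex_norm_square[symmetric] mult.commute)
  then show "norm u \<le> norm (mul (\<lambda>_. c) u)"
    using le[of "cnj c" "mul (\<lambda>_. c) u"] assms by simp
qed

lemma cip_cls_cx:
  assumes "f \<in> L2" "b \<in> test_functions"
  shows "cip (cls f) (cls (cx b)) = (LINT x|lborel. f x * of_real (b x))"
  using cip_cls[OF assms(1) L12_L2[OF cx_L12[OF assms(2)]]] by (simp add: cx_def)

lemma FT_uminus: "FT (- u) = - FT u"
  using bounded_linear_FT bounded_linear.linear linear_neg by blast

text \<open>The case k = 1 of \<open>weak_derivative_FT\<close> and its converse. The minus sign of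
  integration by parts is absorbed by taking \<open>- cls g\<close> as the second function, and the
  factor -i turns i \<xi> into \<xi>.\<close>

lemma has_weak_deriv_iff:
  assumes f: "f \<in> L2" and g: "g \<in> L2"
  shows "has_weak_deriv f g \<longleftrightarrow> has_xi (FT (cls f)) (mul (\<lambda>_. - \<i>) (FT (cls g)))"
proof -
  have "has_weak_deriv f g \<longleftrightarrow>
      (\<forall>b\<in>test_functions. cip (cls f) (cls (cx ((deriv ^^ 1) b))) = cip (- cls g) (cls (cx b)))"
    unfolding has_weak_deriv_def
    by (intro ball_cong refl)
      (simp add: bounded_bilinear.minus_left[OF bounded_bilinear_cip] cip_cls_cx f g test_deriv)
  also have "\<dots> \<longleftrightarrow> (AE \<xi> in lborel. fn (FT (- cls g)) \<xi> = (- \<i> * of_real \<xi>) ^ 1 * fn (FT (cls f)) \<xi>)"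
    using weak_derivative_FT[where k = 1 and A = "cls f" and B = "- cls g"] FT_weak_derivative[where k = 1 and A = "cls f" and B = "- cls g"] by blast
  also have "\<dots> \<longleftrightarrow> has_xi (FT (cls f)) (mul (\<lambda>_. - \<i>) (FT (cls g)))"
  proof -
    have "AE \<xi> in lborel. fn (FT (- cls g)) \<xi> = - fn (FT (cls g)) \<xi> \<and> fn (mul (\<lambda>_. - \<i>) (FT (cls g))) \<xi> = - \<i> * fn (FT (cls g)) \<xi>"
      using fn_uminus[of "FT (cls g)"] fn_mul[OF bmult_const, of "- \<i>" "FT (cls g)"] unfolding FT_uminus
      by eventually_elim simp
    then have "AE \<xi> in lborel. fn (FT (- cls g)) \<xi> = (- \<i> * of_real \<xi>) ^ 1 * fn (FT (cls f)) \<xi>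
        \<longleftrightarrow> fn (mul (\<lambda>_. - \<i>) (FT (cls g))) \<xi> = of_real \<xi> * fn (FT (cls f)) \<xi>"
    proof eventually_elim
      case (elim \<xi>)
      have "- G = - \<i> * of_real \<xi> * F \<longleftrightarrow> - \<i> * G = of_real \<xi> * F" for F G :: complex
        by (auto simp: complex_eq_iff)
      then show ?case using elim by simp
    qed
    then show ?thesis unfolding has_xi_def by (intro iffI) (auto elim: eventually_elim2)
  qed
  finally show ?thesis .
qed

lemma mul_i_cancel: "mul (\<lambda>_. - \<i>) (mul (\<lambda>_. \<i>) u) = u"
  by (simp add: mul_mul)

lemma H1_iff:
  assumes f: "f \<in> L2" shows "f \<in> H1 \<longleftrightarrow> (\<exists>b. has_xi (FT (cls f)) b)"
proof
  assume "f \<in> H1"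
  then show "\<exists>b. has_xi (FT (cls f)) b" unfolding H1_def using has_weak_deriv_iff[OF f] by blast
next
  assume "\<exists>b. has_xi (FT (cls f)) b"
  then obtain b where b: "has_xi (FT (cls f)) b" by blast
  have "has_weak_deriv f (fn (IFT (mul (\<lambda>_. \<i>) b)))"
    unfolding has_weak_deriv_iff[OF f fn_L2] by (simp add: mul_i_cancel b)
  then show "f \<in> H1" unfolding H1_def using f by blast
qed

lemma H1_norm_eq:
  assumes f: "f \<in> L2" and b: "has_xi (FT (cls f)) b"
  shows "H1_norm f = sqrt ((norm (FT (cls f)))\<^sup>2 + (norm b)\<^sup>2)"
proof -
  have "\<exists>g. g \<in> L2 \<and> has_weak_deriv f g" using H1_iff[OF f] b unfolding H1_def by blast
  then have "weak_deriv f \<in> L2 \<and> has_weak_deriv f (weak_deriv f)" unfolding weak_deriv_def by (rule someI_ex)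
  then have w: "weak_deriv f \<in> L2" and "has_xi (FT (cls f)) (mul (\<lambda>_. - \<i>) (FT (cls (weak_deriv f))))"
    using has_weak_deriv_iff[OF f] by auto
  then have "b = mul (\<lambda>_. - \<i>) (FT (cls (weak_deriv f)))" using has_xi_unique b by blast
  then have "norm b = L2_norm (weak_deriv f)" using norm_cls[OF w] by (simp add: norm_mul_unit)
  then show ?thesis using norm_cls[OF f] by (simp add: H1_norm_def)
qed

text \<open>\<open>pos\<close> is idempotent, so lying in the range of the projector is the same as
  being fixed by it.\<close>

lemma L2_plus_iff:
  assumes f: "f \<in> L2" shows "f \<in> L2_plus \<longleftrightarrow> mul pos (FT (cls f)) = FT (cls f)"
proof
  assume "f \<in> L2_plus"
  then obtain g where g: "g \<in> L2" "AE x in lborel. f x = szego g x" unfolding L2_plus_def by blast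
  have "cls f = cls (szego g)" using cls_eq_iff[OF f szego_IFT(1)[OF g(1)]] g(2) by simp
  then have "FT (cls f) = mul pos (FT (cls g))" by (simp add: szego_IFT(2)[OF g(1)])
  moreover have "(\<lambda>\<xi>. pos \<xi> * pos \<xi>) = pos" by (simp add: pos_def indicator_def fun_eq_iff)
  ultimately show "mul pos (FT (cls f)) = FT (cls f)" by (simp add: mul_mul)
next
  assume "mul pos (FT (cls f)) = FT (cls f)"
  then have "cls (szego f) = cls f" by (simp add: szego_IFT(2)[OF f])
  then have "AE x in lborel. f x = szego f x"
    using cls_eq_iff[OF f szego_IFT(1)[OF f]] by simp
  then show "f \<in> L2_plus" using f unfolding L2_plus_def by blast
qed

lemma H1_plus_iff:
  "f \<in> H1_plus \<longleftrightarrow> f \<in> L2 \<and> mul pos (FT (cls f)) = FT (cls f) \<and> (\<exists>b. has_xi (FT (cls f)) b)"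
proof -
  have "f \<in> H1_plus \<Longrightarrow> f \<in> L2" by (simp add: H1_plus_def H1_def)
  then show ?thesis unfolding H1_plus_def using H1_iff[of f] L2_plus_iff[of f] by blast
qed

lemma H1_norm_diff:
  assumes "f \<in> L2" "g \<in> L2" "has_xi (FT (cls f)) a" "has_xi (FT (cls g)) b"
  shows "H1_norm (\<lambda>x. f x - g x) = sqrt ((norm (FT (cls f) - FT (cls g)))\<^sup>2 + (norm (a - b))\<^sup>2)"
proof -
  have "FT (cls (\<lambda>x. f x - g x)) = FT (cls f) - FT (cls g)"
    by (simp add: cls_diff assms FT_diff)
  then show ?thesis
    using H1_norm_eq[OF L2_diff[OF assms(1,2)], of "a - b"] has_xi_diff[OF assms(3,4)] by simp
qed

text \<open>Continuity in H^1 splits into continuity of the transform and of its product with \<xi>,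
  both in L^2; \<open>C_H1_plusI\<close> is the converse.\<close>

lemma C_H1_plusD:
  assumes "v \<in> C_H1_plus"
  obtains b where "\<And>t. v t \<in> L2" "\<And>t. mul pos (FT (cls (v t))) = FT (cls (v t))"
    "\<And>t. has_xi (FT (cls (v t))) (b t)" "continuous_on UNIV (\<lambda>t. FT (cls (v t)))" "continuous_on UNIV b"
proof -
  have v: "v t \<in> L2" "mul pos (FT (cls (v t))) = FT (cls (v t))" "\<exists>b. has_xi (FT (cls (v t))) b" for t
    using assms H1_plus_iff[of "v t"] unfolding C_H1_plus_def by blast+
  obtain b where b: "\<And>t. has_xi (FT (cls (v t))) (b t)" using v(3) by metis
  have lim: "((\<lambda>s. sqrt ((norm (FT (cls (v s)) - FT (cls (v t))))\<^sup>2 + (norm (b s - b t))\<^sup>2)) \<longlongrightarrow> 0) (at t)" for t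
    using assms H1_norm_diff[OF v(1) v(1) b b] unfolding C_H1_plus_def by simp
  have "((\<lambda>s. norm (FT (cls (v s)) - FT (cls (v t)))) \<longlongrightarrow> 0) (at t)" for t
    by (rule Lim_null_comparison[OF always_eventually lim[of t]]) simp
  moreover have "((\<lambda>s. norm (b s - b t)) \<longlongrightarrow> 0) (at t)" for t
    by (rule Lim_null_comparison[OF always_eventually lim[of t]]) simp
  ultimately have "continuous_on UNIV (\<lambda>t. FT (cls (v t)))" "continuous_on UNIV b"
    unfolding continuous_on_def by (auto simp: tendsto_norm_zero_iff LIM_zero_iff)
  with v(1,2) b show thesis by (rule that)
qed

lemma C_H1_plusI:
  assumes v: "\<And>t. v t \<in> L2" "\<And>t. mul pos (FT (cls (v t))) = FT (cls (v t))"
    and b: "\<And>t. has_xi (FT (cls (v t))) (b t)"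
    and c: "continuous_on UNIV (\<lambda>t. FT (cls (v t)))" "continuous_on UNIV b"
  shows "v \<in> C_H1_plus"
proof -
  have "((\<lambda>s. H1_norm (\<lambda>x. v s x - v t x)) \<longlongrightarrow> 0) (at t)" for t
  proof -
    have "((\<lambda>s. sqrt ((norm (FT (cls (v s)) - FT (cls (v t))))\<^sup>2 + (norm (b s - b t))\<^sup>2)) \<longlongrightarrow>
        sqrt ((norm (FT (cls (v t)) - FT (cls (v t))))\<^sup>2 + (norm (b t - b t))\<^sup>2)) (at t)"
      using c unfolding continuous_on_def by (intro tendsto_intros) auto
    then show ?thesis by (simp add: H1_norm_diff[OF v(1) v(1) b b])
  qed
  then show ?thesis unfolding C_H1_plus_def using v b H1_plus_iff by blast
qed

text \<open>An arbitrary solution carries no a priori bound, but on a compact time interval its H^1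
  norm is bounded by continuity. \<open>sup_bound_sb\<close> then supplies a height at which the
  truncation is invisible there.\<close>

lemma locally_bounded:
  fixes T :: real
  assumes y: "continuous_on UNIV y" "\<And>t. mul pos (y t) = y t" and b: "\<And>t. has_xi (y t) (b t)" "continuous_on UNIV b"
  obtains R where "0 < R" "\<And>t. \<bar>t\<bar> \<le> T \<Longrightarrow> AE x in lborel. cmod (fn (IFT (y t)) x) \<le> R"
proof -
  have cb: "\<exists>C. \<forall>t\<in>{-T..T}. norm (f t) \<le> C" if "continuous_on UNIV f" for f :: "real \<Rightarrow> l2"
  proof -
    have "compact (f ` {-T..T})" by (intro compact_continuous_image continuous_on_subset[OF that]) auto
    then show ?thesis using compact_imp_bounded bounded_iff by (metis imageI)
  qed
  obtain C1 C2 where C: "\<And>t. t \<in> {-T..T} \<Longrightarrow> norm (y t) \<le> C1" "\<And>t. t \<in> {-T..T} \<Longrightarrow> norm (b t) \<le> C2"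
    using cb[OF y(1)] cb[OF b(2)] by metis
  define C where "C = max 0 (max C1 C2)"
  have C0: "0 \<le> C" by (simp add: C_def)
  show thesis
  proof (rule that)
    show "0 < sb (2 * C) C" using C0 by (simp add: sb_def add_nonneg_pos)
    fix t assume t: "\<bar>t\<bar> \<le> T"
    have "t \<in> {-T..T}" using t by auto
    then have n: "norm (y t) \<le> C" "norm (b t) \<le> C"
      using C[of t] by (auto simp: C_def le_max_iff_disj)
    show "AE x in lborel. cmod (fn (IFT (y t)) x) \<le> sb (2 * C) C"
    proof (rule sup_bound_sb[OF b(1) y(2)])
      have "inner (y t) (b t) \<le> norm (y t) * norm (b t)" by (rule norm_cauchy_schwarz)
      also have "\<dots> \<le> C * C" using n C0 by (intro mult_mono) auto
      finally have "inner (y t) (b t) \<le> C * C" .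
      moreover have "(norm (y t))\<^sup>2 \<le> C\<^sup>2" using n by (intro power_mono) auto
      moreover have "0 \<le> C * C" "C\<^sup>2 = C * C" "(2 * C)\<^sup>2 = 4 * (C * C)"
        by (simp_all add: power2_eq_square)
      ultimately show "(norm (y t))\<^sup>2 + inner (y t) (b t) \<le> (2 * C)\<^sup>2" by linarith
    qed (use C0 n in auto)
  qed
qed

lemma prim_linear:
  assumes h: "bounded_linear h" and f: "continuous_on UNIV f"
  shows "prim (\<lambda>s. h (f s)) t = h (prim f t)"
proof -
  have i: "f integrable_on {a..b}" for a b
    by (rule integrable_continuous_real) (rule continuous_on_subset[OF f subset_UNIV])
  have "integral {a..b} (\<lambda>s. h (f s)) = h (integral {a..b} f)" for a b
    using integral_linear[OF i h] by (simp add: o_def)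
  then show ?thesis
    by (simp add: prim_def linear_diff[OF bounded_linear.linear[OF h]])
qed

section \<open>The weak formulation\<close>

lemma weak_product:
  assumes f: "f \<in> L2" and b: "b \<in> test_functions" and a: "a \<in> test_functions"
  shows "(LINT x|lborel. f x * (- \<i> * of_real (deriv (\<lambda>s. a s * b x) t) + of_real ((deriv ^^ 2) (\<lambda>y. a t * b y) x)))
     = - \<i> * of_real (deriv a t) * cip (cls f) (cls (cx b)) + of_real (a t) * cip (cls f) (cls (cx ((deriv ^^ 2) b)))"
proof -
  have d1: "deriv (\<lambda>s. a s * b x) t = deriv a t * b x" for x
    by (intro DERIV_imp_deriv DERIV_cmult_right test_has_deriv a)
  have d2: "deriv (\<lambda>y. a t * c y) = (\<lambda>y. a t * deriv c y)" if "c \<in> test_functions" for c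
    by (intro ext DERIV_imp_deriv DERIV_cmult test_has_deriv that)
  have b2: "(deriv ^^ 2) b \<in> test_functions" by (rule test_derivs[OF b])
  have "(deriv ^^ 2) (\<lambda>y. a t * b y) = (\<lambda>y. a t * (deriv ^^ 2) b y)"
    by (simp add: numeral_2_eq_2 d2[OF b] d2[OF test_deriv[OF b]])
  then have "(LINT x|lborel. f x * (- \<i> * of_real (deriv (\<lambda>s. a s * b x) t) + of_real ((deriv ^^ 2) (\<lambda>y. a t * b y) x)))
      = (LINT x|lborel. - \<i> * of_real (deriv a t) * (f x * cx b x) + of_real (a t) * (f x * cx ((deriv ^^ 2) b) x))"
    by (intro Bochner_Integration.integral_cong refl) (simp add: d1 cx_def algebra_simps)
  also have "\<dots> = - \<i> * of_real (deriv a t) * (LINT x|lborel. f x * cx b x)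
      + of_real (a t) * (LINT x|lborel. f x * cx ((deriv ^^ 2) b) x)"
    using L2_prod_integrable[OF f L12_L2[OF cx_L12[OF b]]] L2_prod_integrable[OF f L12_L2[OF cx_L12[OF b2]]] by simp
  finally show ?thesis by (simp add: cip_cls f b b2 cx_L12)
qed

lemma bounded_linear_cip: "bounded_linear (\<lambda>u. cip u w)"
  by (rule bounded_bilinear.bounded_linear_left[OF bounded_bilinear_cip])

text \<open>
  Every solution satisfies the truncated Duhamel equations: testing with products \<open>a(t) b(x)\<close>
  and integrating in time, the spatial equation is read off by \<open>weak_derivative_FT\<close>.
\<close>

lemma solution_truncated:
  assumes m: "0 \<le> m" and v: "v \<in> C_H1_plus" and sol: "solves_equation m lam v"
  defines "y \<equiv> \<lambda>t. FT (cls (v t))" and "G \<equiv> \<lambda>t. FT (cls (nonlinearity m (v t)))"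
  shows "((\<lambda>t. mul (chi n) (y t)) has_vector_derivative
      mul (\<lambda>\<xi>. - \<i> * chi n \<xi>) (mul (xi2 n) (y t) + lam *\<^sub>R G t)) (at t)"
    and "\<exists>R>0. \<forall>t. \<bar>t\<bar> \<le> T \<longrightarrow> (AE x in lborel. cmod (v t x) \<le> R)"
proof -
  obtain b where vL: "\<And>t. v t \<in> L2" and pos: "\<And>t. mul pos (y t) = y t"
    and b: "\<And>t. has_xi (y t) (b t)" and yc: "continuous_on UNIV y" and bc: "continuous_on UNIV b"
    using C_H1_plusD[OF v] unfolding y_def by metis
  have bnd: "\<exists>R>0. \<forall>t. \<bar>t\<bar> \<le> T \<longrightarrow> (AE x in lborel. cmod (v t x) \<le> R)" for T
  proof -
    obtain R where R: "0 < R" "\<And>t. \<bar>t\<bar> \<le> T \<Longrightarrow> AE x in lborel. cmod (fn (IFT (y t)) x) \<le> R"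
      using locally_bounded[OF yc pos b bc, of T] by metis
    have "AE x in lborel. cmod (v t x) \<le> R" if "\<bar>t\<bar> \<le> T" for t
      using R(2)[OF that] fn_cls[OF vL[of t]] unfolding y_def IFT_FT by eventually_elim simp
    with R(1) show ?thesis by blast
  qed
  then show "\<exists>R>0. \<forall>t. \<bar>t\<bar> \<le> T \<longrightarrow> (AE x in lborel. cmod (v t x) \<le> R)" .
  \<comment> \<open>On each bounded time interval the true nonlinearity coincides with a truncated
    one, so it is in L^2 and inherits the Lipschitz continuity.\<close>
  have nl: "\<exists>R>0. \<forall>s. \<bar>s\<bar> \<le> T \<longrightarrow> nonlinearity m (v s) \<in> L2 \<and> G s = FT (nlop m R (IFT (y s)))" for T
  proof -
    obtain R where Rb: "0 < R" "\<And>t. \<bar>t\<bar> \<le> T \<Longrightarrow> AE x in lborel. cmod (v t x) \<le> R" using bnd[of T] by blast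
    interpret truncation m R by unfold_locales (use m Rb(1) in auto)
    show ?thesis
      using nlop_eq_nonlinearity[OF vL Rb(2)] Rb(1) by (auto simp: G_def y_def intro!: exI[of _ R])
  qed
  have nL: "nonlinearity m (v t) \<in> L2" for t using nl[of "\<bar>t\<bar>"] by blast
  have Gc: "continuous_on UNIV G"
    unfolding continuous_on_eq_continuous_at[OF open_UNIV]
  proof
    fix t :: real
    let ?T = "\<bar>t\<bar> + 1"
    obtain R where Rb: "0 < R" "\<And>s. \<bar>s\<bar> \<le> ?T \<Longrightarrow> G s = FT (nlop m R (IFT (y s)))" using nl[of ?T] by blast
    interpret truncation m R by unfold_locales (use m Rb(1) in auto)
    have nc: "continuous_on UNIV (nlop m R)"
      using nlop_lipschitz Lip_nonneg[OF m]
      by (intro lipschitz_on_continuous_on[of "Lip m R"]) (auto simp: lipschitz_on_def dist_norm)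
    have "continuous_on UNIV (\<lambda>s. nlop m R (IFT (y s)))"
      by (rule continuous_on_compose2[OF nc bounded_linear.continuous_on[OF bounded_linear_IFT yc]]) simp
    then have "continuous_on UNIV (\<lambda>s. FT (nlop m R (IFT (y s))))"
      by (rule bounded_linear.continuous_on[OF bounded_linear_FT])
    then have "continuous_on {-?T<..<?T} (\<lambda>s. FT (nlop m R (IFT (y s))))" by (rule continuous_on_subset) simp
    then have "continuous_on {-?T<..<?T} G"
      by (rule continuous_on_cong[THEN iffD2, OF refl, rotated]) (use Rb(2) in \<open>auto simp: abs_le_iff\<close>)
    then show "isCont G t" by (rule continuous_on_interior) auto
  qed
  define A where "A t = cls (v t)" for t
  define Z where "Z t = cls (szego (nonlinearity m (v t)))" for t
  have Aeq: "A t = IFT (y t)" for t by (simp add: A_def y_def)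
  have Zeq: "Z t = IFT (mul pos (G t))" for t unfolding Z_def G_def by (rule szego_IFT(2)[OF nL])
  have Ac: "continuous_on UNIV A" unfolding Aeq by (rule bounded_linear.continuous_on[OF bounded_linear_IFT yc])
  have Zc: "continuous_on UNIV Z" unfolding Zeq
    by (intro bounded_linear.continuous_on[OF bounded_linear_IFT] bounded_linear.continuous_on[OF bounded_linear_mul] bmult_pos Gc)
  \<comment> \<open>The equation integrated in time reads A(t) - A(0) = i d^2/dx^2 prim A - i lam
    prim Z. So \<open>B'\<close> is the second space derivative of \<open>A'\<close> in the sense of
    distributions, the shape required by \<open>weak_derivative_FT\<close> with k = 2.\<close>
  define A' where "A' t = mul (\<lambda>_. \<i>) (prim A t)" for t
  define B' where "B' t = A t - A 0 + lam *\<^sub>R mul (\<lambda>_. \<i>) (prim Z t)" for t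
  have weak: "cip (A' t) (cls (cx ((deriv ^^ 2) \<beta>))) = cip (B' t) (cls (cx \<beta>))" if \<beta>: "\<beta> \<in> test_functions" for \<beta> t
  proof -
    let ?b = "cls (cx \<beta>)" and ?d = "cls (cx ((deriv ^^ 2) \<beta>))"
    define c where "c t = cip (A t) ?b" for t
    define e where "e t = cip (A t) ?d" for t
    define g where "g t = cip (Z t) ?b" for t
    have cc: "continuous_on UNIV c" and ec: "continuous_on UNIV e" and gc: "continuous_on UNIV g"
      unfolding c_def e_def g_def
      by (intro bounded_linear.continuous_on[OF bounded_linear_cip] Ac Zc)+
    \<comment> \<open>For a fixed spatial test function the tested equation is a scalar one in time;
      the continuity of all pairings lets du Bois-Reymond integrate it.\<close>
    have "c t - c 0 = prim (\<lambda>t. \<i> * (e t - of_real lam * g t)) t"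
    proof (rule du_Bois_Reymond[OF cc])
      show "continuous_on UNIV (\<lambda>t. \<i> * (e t - of_real lam * g t))" by (intro continuous_intros ec gc)
      fix a :: "real \<Rightarrow> real" assume a: "a \<in> test_functions"
      have "(LINT t|lborel. LINT x|lborel. v t x * (- \<i> * of_real (deriv (\<lambda>s. a s * \<beta> x) t)
            + of_real ((deriv ^^ 2) (\<lambda>y. a t * \<beta> y) x)))
          = of_real lam * (LINT t|lborel. LINT x|lborel. szego (nonlinearity m (v t)) x * of_real (a t * \<beta> x))"
        using sol[unfolded solves_equation_def, rule_format, OF test_tensor[OF a \<beta>]] by simp
      moreover have "(LINT x|lborel. szego (nonlinearity m (v t)) x * of_real (a t * \<beta> x)) = g t * of_real (a t)" for t
      proof -
        have "(LINT x|lborel. szego (nonlinearity m (v t)) x * of_real (a t * \<beta> x))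
            = (LINT x|lborel. of_real (a t) * (szego (nonlinearity m (v t)) x * of_real (\<beta> x)))"
          by (intro Bochner_Integration.integral_cong refl) simp
        then show ?thesis by (simp add: g_def Z_def cip_cls_cx[OF szego_IFT(1)[OF nL] \<beta>])
      qed
      ultimately have "(LINT t|lborel. - \<i> * (c t * of_real (deriv a t)) + e t * of_real (a t))
          = of_real lam * (LINT t|lborel. g t * of_real (a t))"
        unfolding weak_product[OF vL \<beta> a] by (simp add: c_def e_def A_def mult_ac)
      then have "- \<i> * (LINT t|lborel. c t * of_real (deriv a t)) + (LINT t|lborel. e t * of_real (a t))
          = of_real lam * (LINT t|lborel. g t * of_real (a t))"
        using integrable_mult_test[OF cc test_deriv[OF a]] integrable_mult_test[OF ec a] by simp
      then have "\<i> * (- \<i> * (LINT t|lborel. c t * of_real (deriv a t)) + (LINT t|lborel. e t * of_real (a t)))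
          = \<i> * (of_real lam * (LINT t|lborel. g t * of_real (a t)))" by simp
      then have "(LINT t|lborel. c t * of_real (deriv a t))
          = - (\<i> * ((LINT t|lborel. e t * of_real (a t)) - of_real lam * (LINT t|lborel. g t * of_real (a t))))"
        by (simp add: algebra_simps)
      also have "\<i> * ((LINT t|lborel. e t * of_real (a t)) - of_real lam * (LINT t|lborel. g t * of_real (a t)))
          = (LINT t|lborel. \<i> * (e t * of_real (a t) - of_real lam * (g t * of_real (a t))))"
        using integrable_mult_test[OF ec a] integrable_mult_test[OF gc a] by simp
      also have "\<dots> = (LINT t|lborel. \<i> * (e t - of_real lam * g t) * of_real (a t))"
        by (intro Bochner_Integration.integral_cong refl) (simp add: algebra_simps)
      finally show "(LINT t|lborel. c t * of_real (deriv a t)) = - (LINT t|lborel. \<i> * (e t - of_real lam * g t) * of_real (a t))" .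
    qed
    also have "\<dots> = \<i> * (prim e t - of_real lam * prim g t)"
    proof -
      have "((\<lambda>t. \<i> * (prim e t - of_real lam * prim g t)) has_vector_derivative \<i> * (e s - of_real lam * g s)) (at s)" for s
        by (intro bounded_linear.has_vector_derivative[OF bounded_linear_mult_right] has_vector_derivative_diff
            prim_has_vector_derivative ec gc)
      moreover have "(prim (\<lambda>t. \<i> * (e t - of_real lam * g t)) has_vector_derivative \<i> * (e s - of_real lam * g s)) (at s)" for s
        by (intro prim_has_vector_derivative continuous_intros ec gc)
      ultimately have d: "((\<lambda>t. prim (\<lambda>t. \<i> * (e t - of_real lam * g t)) t - \<i> * (prim e t - of_real lam * prim g t))
          has_vector_derivative 0) (at s)" for s
        using has_vector_derivative_diff by fastforce
      obtain k where "\<And>t. prim (\<lambda>t. \<i> * (e t - of_real lam * g t)) t - \<i> * (prim e t - of_real lam * prim g t) = k"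
        using has_vector_derivative_zero_constant[of UNIV "\<lambda>t. prim (\<lambda>t. \<i> * (e t - of_real lam * g t)) t
          - \<i> * (prim e t - of_real lam * prim g t)"] d by auto
      from this[of t] this[of 0] show ?thesis by simp
    qed
    also have "prim e t = cip (prim A t) ?d" unfolding e_def by (rule prim_linear[OF bounded_linear_cip Ac])
    also have "prim g t = cip (prim Z t) ?b" unfolding g_def by (rule prim_linear[OF bounded_linear_cip Zc])
    finally show ?thesis
      unfolding A'_def B'_def c_def
      by (simp add: cip_mul_const bounded_bilinear.add_left[OF bounded_bilinear_cip] bounded_bilinear.diff_left[OF bounded_bilinear_cip]
          bounded_bilinear.scaleR_left[OF bounded_bilinear_cip] scaleR_conv_of_real algebra_simps)
  qed
  \<comment> \<open>The relation between \<open>A'\<close> and \<open>B'\<close> holds frequency by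
    frequency. After cutting to the band all symbols are bounded, so both sides are differentiable
    in t.\<close>
  have key: "mul (chi n) (y t) = mul (chi n) (y 0) + mul (\<lambda>\<xi>. - \<i> * chi n \<xi>) (mul (xi2 n) (prim y t) + lam *\<^sub>R prim G t)" for t
  proof -
    have ae: "AE \<xi> in lborel. fn (FT (B' t)) \<xi> = (- \<i> * of_real \<xi>) ^ 2 * fn (FT (A' t)) \<xi>"
      by (rule weak_derivative_FT[OF weak])
    have FA: "FT (A' t) = mul (\<lambda>_. \<i>) (prim y t)"
      using prim_linear[OF bounded_linear_FT Ac, of t] by (simp add: A'_def FT_mul_const Aeq)
    have FZ: "FT (prim Z t) = mul pos (prim G t)"
      using prim_linear[OF bounded_linear_FT Zc, of t] prim_linear[OF bounded_linear_mul[OF bmult_pos] Gc, of t]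
      by (simp add: Zeq)
    have FB: "FT (B' t) = y t - y 0 + lam *\<^sub>R mul (\<lambda>_. \<i>) (mul pos (prim G t))"
      by (simp add: B'_def FT_add FT_diff FT_scaleR FT_mul_const FZ Aeq)
    have "mul (chi n) (FT (B' t)) = - mul (xi2 n) (FT (A' t))"
      unfolding l2_eq_iff
      using ae fn_mul[OF bmult_chi, of n "FT (B' t)"] fn_mul[OF bmult_xi(2), of n "FT (A' t)"] fn_uminus[of "mul (xi2 n) (FT (A' t))"]
      by eventually_elim (simp add: xi2_def power_mult_distrib)
    then have "mul (chi n) (y t) = mul (chi n) (y 0) - lam *\<^sub>R mul (chi n) (mul (\<lambda>_. \<i>) (mul pos (prim G t)))
        - mul (xi2 n) (mul (\<lambda>_. \<i>) (prim y t))"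
      unfolding FA FB by (simp add: mul_add mul_diff mul_scaleR algebra_simps)
    also have "mul (chi n) (mul (\<lambda>_. \<i>) (mul pos (prim G t))) = - mul (\<lambda>\<xi>. - \<i> * chi n \<xi>) (prim G t)"
    proof -
      have "chi n \<xi> * (\<i> * pos \<xi>) = of_real (- 1) * (- \<i> * chi n \<xi>)" for \<xi>
        by (simp add: chi_def pos_def indicator_def)
      then have "mul (chi n) (mul (\<lambda>_. \<i>) (mul pos (prim G t))) = mul (\<lambda>\<xi>. of_real (- 1) * (- \<i> * chi n \<xi>)) (prim G t)"
        by (simp only: mul_mul bmult_chi bmult_const bmult_pos bmult_times)
      then show ?thesis
        unfolding mul_real_left[OF bmult_times[OF bmult_const bmult_chi]] by simp
    qed
    also have "mul (xi2 n) (mul (\<lambda>_. \<i>) (prim y t)) = - mul (\<lambda>\<xi>. - \<i> * chi n \<xi>) (mul (xi2 n) (prim y t))"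
    proof -
      have "xi2 n \<xi> * \<i> = of_real (- 1) * (- \<i> * chi n \<xi> * xi2 n \<xi>)" for \<xi>
        by (simp add: xi2_def chi_def indicator_def)
      then have "mul (xi2 n) (mul (\<lambda>_. \<i>) (prim y t)) = mul (\<lambda>\<xi>. of_real (- 1) * (- \<i> * chi n \<xi> * xi2 n \<xi>)) (prim y t)"
        by (simp only: mul_mul bmult_xi bmult_const)
      then show ?thesis
        unfolding mul_real_left[OF bmult_times[OF bmult_times[OF bmult_const bmult_chi] bmult_xi(2)]]
          mul_mul[OF bmult_times[OF bmult_const bmult_chi] bmult_xi(2)] by simp
    qed
    finally show ?thesis
      unfolding mul_add[OF bmult_times[OF bmult_const bmult_chi]] mul_scaleR[OF bmult_times[OF bmult_const bmult_chi]]
      by simp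
  qed
  have "((\<lambda>t. mul (chi n) (y 0) + mul (\<lambda>\<xi>. - \<i> * chi n \<xi>) (mul (xi2 n) (prim y t) + lam *\<^sub>R prim G t)) has_vector_derivative
      0 + mul (\<lambda>\<xi>. - \<i> * chi n \<xi>) (mul (xi2 n) (y t) + lam *\<^sub>R G t)) (at t)"
    by (intro has_vector_derivative_add has_vector_derivative_const
        bounded_linear.has_vector_derivative[OF bounded_linear_mul[OF bmult_times[OF bmult_const bmult_chi]]]
        bounded_linear.has_vector_derivative[OF bounded_linear_mul[OF bmult_xi(2)]]
        bounded_linear.has_vector_derivative[OF bounded_linear_scaleR_right] prim_has_vector_derivative yc Gc)
  then show "((\<lambda>t. mul (chi n) (y t)) has_vector_derivative
      mul (\<lambda>\<xi>. - \<i> * chi n \<xi>) (mul (xi2 n) (y t) + lam *\<^sub>R G t)) (at t)"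
    unfolding key[symmetric] by simp
qed

section \<open>Uniqueness\<close>

theorem solution_unique:
  assumes m: "0 \<le> m" and lam: "lam \<in> {1, -1}"
    and u: "is_solution m lam u0 u" and v: "is_solution m lam u0 v"
  shows "AE x in lborel. v t x = u t x"
proof -
  have uC: "u \<in> C_H1_plus" "solves_equation m lam u" and vC: "v \<in> C_H1_plus" "solves_equation m lam v"
    using u v by (auto simp: is_solution_def)
  define w where "w t = FT (cls (u t)) - FT (cls (v t))" for t
  define g where "g t = lam *\<^sub>R (FT (cls (nonlinearity m (u t))) - FT (cls (nonlinearity m (v t))))" for t
  obtain bu where uD: "\<And>t. u t \<in> L2" "\<And>t. mul pos (FT (cls (u t))) = FT (cls (u t))"
    "\<And>t. has_xi (FT (cls (u t))) (bu t)" "continuous_on UNIV (\<lambda>t. FT (cls (u t)))"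
    by (rule C_H1_plusD[OF uC(1)]) (rule that; assumption)
  obtain bv where vD: "\<And>t. v t \<in> L2" "\<And>t. mul pos (FT (cls (v t))) = FT (cls (v t))"
    "\<And>t. has_xi (FT (cls (v t))) (bv t)" "continuous_on UNIV (\<lambda>t. FT (cls (v t)))"
    by (rule C_H1_plusD[OF vC(1)]) (rule that; assumption)
  have wc: "continuous_on UNIV w" unfolding w_def by (intro continuous_intros uD vD)
  have wpos: "mul pos (w s) = w s" for s by (simp add: w_def mul_diff uD vD)
  have w0: "w 0 = 0"
  proof -
    have "AE x in lborel. u 0 x = v 0 x"
      using u v unfolding is_solution_def by (auto elim: eventually_elim2)
    then show ?thesis using cls_eq_iff[OF uD(1)[of 0] vD(1)[of 0]] by (simp add: w_def)
  qed
  obtain Ru where Ru: "\<And>s. \<bar>s\<bar> \<le> \<bar>t\<bar> \<Longrightarrow> AE x in lborel. cmod (u s x) \<le> Ru" "0 < Ru"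
    using solution_truncated(2)[OF m uC, of "\<bar>t\<bar>"] by blast
  obtain Rv where Rv: "\<And>s. \<bar>s\<bar> \<le> \<bar>t\<bar> \<Longrightarrow> AE x in lborel. cmod (v s x) \<le> Rv" "0 < Rv"
    using solution_truncated(2)[OF m vC, of "\<bar>t\<bar>"] by blast
  \<comment> \<open>One height serves both solutions on the time interval, so the difference of the
    nonlinearities is a difference of values of one Lipschitz map.\<close>
  define R where "R = max Ru Rv"
  have Rb: "AE x in lborel. cmod (u s x) \<le> R" "AE x in lborel. cmod (v s x) \<le> R" if "\<bar>s\<bar> \<le> \<bar>t\<bar>" for s
  proof -
    show "AE x in lborel. cmod (u s x) \<le> R" using Ru(1)[OF that] by eventually_elim (simp add: R_def)
    show "AE x in lborel. cmod (v s x) \<le> R" using Rv(1)[OF that] by eventually_elim (simp add: R_def)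
  qed
  interpret truncation m R by unfold_locales (use m Ru(2) in \<open>auto simp: R_def\<close>)
  have gle: "norm (g s) \<le> Lip m R * norm (w s)" if "\<bar>s\<bar> \<le> \<bar>t\<bar>" for s
  proof -
    have "norm (g s) = norm (nlop m R (cls (u s)) - nlop m R (cls (v s)))"
      using lam nlop_eq_nonlinearity(2)[OF uD(1) Rb(1)[OF that]] nlop_eq_nonlinearity(2)[OF vD(1) Rb(2)[OF that]]
      by (auto simp: g_def FT_diff[symmetric])
    also have "\<dots> \<le> Lip m R * norm (cls (u s) - cls (v s))" by (rule nlop_lipschitz)
    finally show ?thesis by (simp add: w_def FT_diff[symmetric])
  qed
  have lim: "(\<lambda>n. mul (chi (real n)) (w s)) \<longlonglongrightarrow> w s" for s by (rule mul_chi_tendsto[OF wpos])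
  have "(\<lambda>n. mul (chi (real n)) (w t)) \<longlonglongrightarrow> 0"
  \<comment> \<open>The sequences in \<open>chi_gronwall\<close> are constant here: only the band
    varies, and the tails of the fixed difference tend to 0.\<close>
  proof (rule chi_gronwall[where w = "\<lambda>_. w" and g = "\<lambda>_. g" and L = "Lip m R" and T = "\<bar>t\<bar>" and h = "\<lambda>s. 2 * norm (w s)"])
    show "((\<lambda>s. mul (chi (real n)) (w s)) has_vector_derivative
        mul (\<lambda>\<xi>. - \<i> * chi (real n) \<xi>) (mul (xi2 (real n)) (w s) + g s)) (at s)" for n s
    proof -
      let ?c = "\<lambda>\<xi>. - \<i> * chi (real n) \<xi>"
      have bc: "bmult ?c" by (rule bmult_times[OF bmult_const bmult_chi])
      have e: "mul ?c (mul (xi2 (real n)) (w s) + g s)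
          = mul ?c (mul (xi2 (real n)) (FT (cls (u s))) + lam *\<^sub>R FT (cls (nonlinearity m (u s))))
            - mul ?c (mul (xi2 (real n)) (FT (cls (v s))) + lam *\<^sub>R FT (cls (nonlinearity m (v s))))"
        unfolding mul_diff[OF bc, symmetric] w_def g_def mul_diff[OF bmult_xi(2)] scaleR_diff_right
        by (simp add: algebra_simps)
      show ?thesis
        unfolding e using has_vector_derivative_diff[OF solution_truncated(1)[OF m uC, of "real n" s] solution_truncated(1)[OF m vC, of "real n" s]]
        by (simp add: w_def mul_diff)
    qed
    show "norm (w s - mul (chi (real n)) (w s)) \<le> 2 * norm (w s)" for n s
      using norm_triangle_ineq4[of "w s" "mul (chi (real n)) (w s)"] norm_mul_chi_le[of "real n" "w s"] by linarith
    show "(\<lambda>n. w s - mul (chi (real n)) (w s)) \<longlonglongrightarrow> 0" for s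
      using tendsto_diff[OF tendsto_const lim[of s], of "w s"] by simp
  qed (use wc gle w0 Lip_nonneg[OF m] in \<open>auto intro!: continuous_intros\<close>)
  then have "w t = 0" using LIMSEQ_unique lim by blast
  then have "FT (cls (u t) - cls (v t)) = 0" by (simp add: w_def FT_diff)
  then have "cls (v t) = cls (u t)" using norm_FT[of "cls (u t) - cls (v t)"] by simp
  then show ?thesis using cls_eq_iff[OF vD(1) uD(1)] by simp
qed

section \<open>Existence: return to the distributional equation\<close>

lemma cip_IFT_xi2:
  assumes \<phi>: "\<phi> \<in> test_functions"
  shows "cip (IFT (mul (\<lambda>\<xi>. - \<i> * chi n \<xi>) (mul (xi2 n) y))) (cls (sl \<phi> t))
    = \<i> * cip (IFT (mul (chi n) y)) (cls (sl (D2 (D2 \<phi>)) t))"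
proof -
  let ?p = "cls (sl \<phi> t)" and ?q = "cls (sl (D2 (D2 \<phi>)) t)"
  let ?c = "\<lambda>\<xi>. - \<i> * chi n \<xi> * xi2 n \<xi>"
  have \<phi>2: "D2 (D2 \<phi>) \<in> test_functions" by (intro test_D \<phi>)
  have bi: "bmult (\<lambda>\<xi>. - \<i> * chi n \<xi>)" by (rule bmult_times[OF bmult_const bmult_chi])
  have bc: "bmult ?c" by (rule bmult_times[OF bi bmult_xi(2)])
  have cc: "cnj (chi n \<xi>) = chi n \<xi>" "cnj (xi2 n \<xi>) = xi2 n \<xi>" for \<xi>
    by (simp_all add: xi2_def chi_def indicator_def)
  have cn: "(\<lambda>\<xi>. cnj (?c \<xi>)) = (\<lambda>\<xi>. \<i> * xi2 n \<xi>)"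
    by (auto simp: fun_eq_iff xi2_def chi_def indicator_def)
  \<comment> \<open>The multiplier \<xi>^2 is moved onto the test function, where it is minus the
    second space derivative. The constant k = 1 yields the real part of the pairing and k = i the
    imaginary part.\<close>
  have re: "inner (mul (\<lambda>_. k) (FT ?p)) (mul ?c y) = inner (mul (\<lambda>_. k * - \<i>) (FT ?q)) (mul (chi n) y)" for k
  proof -
    have "inner (mul (\<lambda>_. k) (FT ?p)) (mul ?c y) = inner (mul (\<lambda>\<xi>. (\<i> * xi2 n \<xi>) * k) (FT ?p)) y"
      unfolding inner_mul_right[OF bc] cn by (subst mul_mul) simp_all
    also have "mul (\<lambda>\<xi>. (\<i> * xi2 n \<xi>) * k) (FT ?p) = mul (\<lambda>\<xi>. chi n \<xi> * (k * - \<i>)) (FT ?q)"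
    proof -
      have b1: "bmult (\<lambda>\<xi>. (\<i> * xi2 n \<xi>) * k)" and b2: "bmult (\<lambda>\<xi>. chi n \<xi> * (k * - \<i>))"
        by (intro bmult_times bmult_const bmult_xi bmult_chi)+
      show ?thesis
        unfolding l2_eq_iff
        using fn_mul[OF b1, of "FT ?p"] fn_mul[OF b2, of "FT ?q"] FT_sl_D2[OF \<phi>, of t]
        by eventually_elim (simp add: xi2_def)
    qed
    also have "inner \<dots> y = inner (mul (\<lambda>_. k * - \<i>) (FT ?q)) (mul (chi n) y)"
      unfolding inner_mul_right[OF bmult_chi] cc by (subst mul_mul) simp_all
    finally show ?thesis .
  qed
  have e: "mul (\<lambda>\<xi>. - \<i> * chi n \<xi>) (mul (xi2 n) y) = mul ?c y" by (rule mul_mul[OF bi bmult_xi(2)])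
  have "Re (cip (IFT (mul ?c y)) ?p) = inner (FT ?p) (mul ?c y)"
    by (simp add: Re_cip cj_sl[OF \<phi>] inner_FT)
  also have "\<dots> = inner (mul (\<lambda>_. - \<i>) (FT ?q)) (mul (chi n) y)" using re[of 1] by simp
  also have "\<dots> = - inner (mul (\<lambda>_. \<i>) (FT ?q)) (mul (chi n) y)"
    using mul_real_left[OF bmult_const, of "-1" \<i> "FT ?q"] by simp
  also have "\<dots> = Re (\<i> * cip (IFT (mul (chi n) y)) ?q)"
    by (simp add: Im_cip cj_sl[OF \<phi>2] inner_FT[symmetric] FT_mul_const)
  finally have r: "Re (cip (IFT (mul ?c y)) ?p) = Re (\<i> * cip (IFT (mul (chi n) y)) ?q)" .
  have "Im (cip (IFT (mul ?c y)) ?p) = inner (mul (\<lambda>_. \<i>) (FT ?p)) (mul ?c y)"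
    by (simp add: Im_cip cj_sl[OF \<phi>] inner_FT[symmetric] FT_mul_const)
  also have "\<dots> = inner (FT ?q) (mul (chi n) y)" using re[of \<i>] by simp
  also have "\<dots> = Im (\<i> * cip (IFT (mul (chi n) y)) ?q)"
    by (simp add: Re_cip cj_sl[OF \<phi>2] inner_FT)
  finally show ?thesis unfolding e using r by (simp add: complex_eq_iff)
qed

text \<open>The solution is only continuous into H^1, so it is not differentiated in time directly.
  The pairing of its band truncation with a slice of the test function is differentiable and
  compactly supported in time; integrating its derivative gives the weak equation on the band, and
  the band is then removed.\<close>

theorem solution_exists:
  assumes m: "0 \<le> m" and lam: "lam \<in> {1, -1}" and u0: "u0 \<in> H1_plus"
  shows "\<exists>u. is_solution m lam u0 u"
proof -
  have u0L: "u0 \<in> L2" and u0p: "mul pos (FT (cls u0)) = FT (cls u0)" using u0 by (auto simp: H1_plus_iff)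
  obtain c where c: "has_xi (FT (cls u0)) c" using u0 by (auto simp: H1_plus_iff)
  obtain R y b where nls: "nls m R lam" and y0: "y 0 = FT (cls u0)" and yc: "continuous_on UNIV y"
    and bc: "continuous_on UNIV b" and pos: "\<And>t. mul pos (y t) = y t" and xi: "\<And>t. has_xi (y t) (b t)"
    and sup: "\<And>t. AE x in lborel. cmod (fn (IFT (y t)) x) \<le> R"
    and ode: "\<And>n t. ((\<lambda>t. mul (chi n) (y t)) has_vector_derivative nls.vf m R lam n (y t)) (at t)"
    by (rule regular_solution[OF m lam u0p c]) (rule that; assumption)
  interpret nls m R lam by (rule nls)
  define u where "u t = fn (IFT (y t))" for t
  have uL: "u t \<in> L2" and clsu: "cls (u t) = IFT (y t)" for t by (simp_all add: u_def)
  have FTu: "FT (cls (u t)) = y t" for t by (simp add: clsu)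
  have uC: "u \<in> C_H1_plus"
    by (rule C_H1_plusI[where b = b]) (simp_all add: FTu uL pos xi yc bc)
  have init: "AE x in lborel. u 0 x = u0 x"
    using fn_cls[OF u0L] by (simp add: u_def y0)
  have nL: "nonlinearity m (u t) \<in> L2" and nN: "FT (cls (nonlinearity m (u t))) = N (y t)" for t
    using nlop_eq_nonlinearity[OF uL sup[of t, folded u_def]] by (simp_all add: N_def clsu)
  have sz: "szego (nonlinearity m (u t)) \<in> L2" "cls (szego (nonlinearity m (u t))) = IFT (mul pos (N (y t)))" for t
    using szego_IFT[OF nL] by (simp_all add: nN)
  have Nc: "continuous_on UNIV (\<lambda>t. N (y t))"
    by (rule continuous_on_compose2[OF lipschitz_on_continuous_on[of "Lip m R" UNIV N] yc])
      (use N_lipschitz Lip_nonneg[OF m] in \<open>auto simp: lipschitz_on_def dist_norm\<close>)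
  have "solves_equation m lam u"
    unfolding solves_equation_def
  proof
    fix \<phi> :: "real \<times> real \<Rightarrow> real" assume \<phi>: "\<phi> \<in> test_functions"
    have \<phi>1: "D1 \<phi> \<in> test_functions" and \<phi>2: "D2 (D2 \<phi>) \<in> test_functions" by (intro test_D \<phi>)+
    define P where "P t = cls (sl \<phi> t)" for t
    define P1 where "P1 t = cls (sl (D1 \<phi>) t)" for t
    define P2 where "P2 t = cls (sl (D2 (D2 \<phi>)) t)" for t
    have Pc: "continuous_on UNIV P" "continuous_on UNIV P1" "continuous_on UNIV P2"
      unfolding P_def P1_def P2_def by (intro sl_continuous \<phi> \<phi>1 \<phi>2)+
    obtain Ma where Ma: "\<And>t. \<bar>t\<bar> \<ge> Ma \<Longrightarrow> P t = 0" unfolding P_def using sl_support[OF \<phi>] by metis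
    obtain Mb where Mb: "\<And>t. \<bar>t\<bar> \<ge> Mb \<Longrightarrow> P1 t = 0" unfolding P1_def using sl_support[OF \<phi>1] by metis
    obtain Mc where Mc: "\<And>t. \<bar>t\<bar> \<ge> Mc \<Longrightarrow> P2 t = 0" unfolding P2_def using sl_support[OF \<phi>2] by metis
    define M where "M = max Ma (max Mb Mc)"
    have M: "P t = 0" "P1 t = 0" "P2 t = 0" if "\<bar>t\<bar> \<ge> M" for t
      using Ma[of t] Mb[of t] Mc[of t] that by (auto simp: M_def)
    note cip0 = bounded_bilinear.zero_right[OF bounded_bilinear_cip]
    note cipc = bounded_bilinear.continuous_on[OF bounded_bilinear_cip]
    note cipt = bounded_bilinear.tendsto[OF bounded_bilinear_cip]
    note IFTc = bounded_linear.continuous_on[OF bounded_linear_IFT]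
    note mulc = bounded_linear.continuous_on[OF bounded_linear_mul]
    \<comment> \<open>The left minus the right side of the weak equation at time t, with a
      projection \<open>Q\<close> inserted: \<open>Q\<close> is a band for the truncated identity
      and \<open>mul pos\<close> in the limit.\<close>
    define E where "E Q t = - \<i> * cip (IFT (Q (y t))) (P1 t) + cip (IFT (Q (y t))) (P2 t)
        - of_real lam * cip (IFT (Q (N (y t)))) (P t)" for Q t
    have Ec: "continuous_on UNIV (E (mul a))" if "bmult a" for a
      unfolding E_def by (intro continuous_intros cipc IFTc mulc that yc Nc Pc)
    have E0: "E Q t = 0" if "\<bar>t\<bar> \<ge> M" for Q t using M[OF that] by (simp add: E_def cip0)
    have trunc: "(LINT t|lborel. E (mul (chi n)) t) = 0" for n
    proof -
      \<comment> \<open>By the equation on the band, i E is the time derivative of the pairing with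
        the slice, and the slice vanishes for large times.\<close>
      have "(LINT t|lborel. \<i> * E (mul (chi n)) t) = 0"
      proof (rule integral_derivative_compact_support[where M = M and f = "\<lambda>t. cip (IFT (mul (chi n) (y t))) (P t)"])
        fix t
        let ?a = "\<lambda>\<xi>. - \<i> * chi n \<xi>"
        have ba: "bmult ?a" by (rule bmult_times[OF bmult_const bmult_chi])
        have d: "((\<lambda>t. cip (IFT (mul (chi n) (y t))) (P t)) has_vector_derivative
            cip (IFT (mul (chi n) (y t))) (P1 t) + cip (IFT (vf n (y t))) (P t)) (at t)"
          using bounded_bilinear.has_vector_derivative[OF bounded_bilinear_cip
              bounded_linear.has_vector_derivative[OF bounded_linear_IFT ode] sl_has_vector_derivative[OF \<phi>]]
          by (simp add: P_def P1_def)
        have "IFT (vf n (y t)) = IFT (mul ?a (mul (xi2 n) (y t))) + (lam *\<^sub>R IFT (mul ?a (N (y t))))"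
          unfolding vf_def grad_def mul_add[OF ba] mul_scaleR[OF ba] IFT_add
          by (simp add: linear_scale[OF bounded_linear.linear[OF bounded_linear_IFT]])
        moreover have "IFT (mul ?a (N (y t))) = mul (\<lambda>_. - \<i>) (IFT (mul (chi n) (N (y t))))"
          unfolding IFT_mul_const[symmetric] mul_mul[OF bmult_const bmult_chi] ..
        ultimately have "cip (IFT (vf n (y t))) (P t)
            = \<i> * cip (IFT (mul (chi n) (y t))) (P2 t) + of_real lam * (- \<i> * cip (IFT (mul (chi n) (N (y t)))) (P t))"
          using cip_IFT_xi2[OF \<phi>, of n "y t" t]
          by (simp add: P_def P2_def bounded_bilinear.add_left[OF bounded_bilinear_cip]
              bounded_bilinear.scaleR_left[OF bounded_bilinear_cip] cip_mul_const scaleR_conv_of_real)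
        then have "cip (IFT (mul (chi n) (y t))) (P1 t) + cip (IFT (vf n (y t))) (P t) = \<i> * E (mul (chi n)) t"
          by (simp add: E_def algebra_simps)
        with d show "((\<lambda>t. cip (IFT (mul (chi n) (y t))) (P t)) has_vector_derivative \<i> * E (mul (chi n)) t) (at t)" by simp
      qed (auto intro!: continuous_intros Ec simp: E0 M cip0)
      then show ?thesis by simp
    qed
    obtain K where K: "0 \<le> K" "\<And>p q. norm (cip p q) \<le> norm p * norm q * K"
      using bounded_bilinear.nonneg_bounded[OF bounded_bilinear_cip] by blast
    \<comment> \<open>A majorant independent of the band, integrable because the slices vanish
      outside a bounded time interval.\<close>
    define H where "H t = norm (y t) * norm (P1 t) * K + norm (y t) * norm (P2 t) * K + norm (N (y t)) * norm (P t) * K" for t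
    have Hint: "integrable lborel H"
    proof -
      have "(\<lambda>t. complex_of_real (H t)) \<in> L12"
        by (rule compact_support_L12[of _ M]) (auto simp: H_def M intro!: continuous_intros yc Nc Pc)
      from integrable_Re[OF L12_integrable[OF this]] show ?thesis by simp
    qed
    have Ele: "norm (E (mul (chi n)) t) \<le> H t" for n t
    proof -
      have le: "norm (cip (IFT (mul (chi n) p)) q) \<le> norm p * norm q * K" for p q
        using K(2)[of "IFT (mul (chi n) p)" q] norm_mul_chi_le[of n p] K(1)
        by (smt (verit, best) mult_right_mono norm_IFT norm_ge_zero)
      have "norm (E (mul (chi n)) t) \<le> norm (- \<i> * cip (IFT (mul (chi n) (y t))) (P1 t))
          + norm (cip (IFT (mul (chi n) (y t))) (P2 t)) + norm (of_real lam * cip (IFT (mul (chi n) (N (y t)))) (P t))"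
        unfolding E_def by (intro order_trans[OF norm_triangle_ineq4] add_right_mono norm_triangle_ineq)
      then show ?thesis
        using le[of "y t" "P1 t"] le[of "y t" "P2 t"] le[of "N (y t)" "P t"]
        by (simp add: H_def norm_mult)
    qed
    have EI: "integrable lborel (E (mul a))" if "bmult a" for a
      using compact_support_L12[OF Ec[OF that] E0] by simp
    have "(\<lambda>n. LINT t|lborel. E (mul (chi (real n))) t) \<longlonglongrightarrow> (LINT t|lborel. E (mul pos) t)"
    proof (rule integral_dominated_convergence[where w = H])
      have lim: "(\<lambda>n. mul (chi (real n)) p) \<longlonglongrightarrow> mul pos p" for p
      proof -
        have "(\<lambda>\<xi>. pos \<xi> * pos \<xi>) = pos" by (simp add: pos_def indicator_def fun_eq_iff)
        then have "(\<lambda>n. mul (chi (real n)) (mul pos p)) \<longlonglongrightarrow> mul pos p"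
          by (intro mul_chi_tendsto) (simp add: mul_mul)
        then show ?thesis by (simp add: mul_mul chi_pos)
      qed
      show "AE t in lborel. (\<lambda>n. E (mul (chi (real n))) t) \<longlonglongrightarrow> E (mul pos) t"
        unfolding E_def
        by (intro AE_I2 tendsto_intros cipt bounded_linear.tendsto[OF bounded_linear_IFT] lim)
    qed (use Ele Hint EI in \<open>auto intro: borel_measurable_integrable\<close>)
    then have E: "(LINT t|lborel. E (mul pos) t) = 0"
      unfolding trunc using LIMSEQ_unique tendsto_const by blast
    have lhs: "(LINT x|lborel. u t x * (- \<i> * of_real (deriv (\<lambda>s. \<phi> (s, x)) t) + of_real ((deriv ^^ 2) (\<lambda>y. \<phi> (t, y)) x)))
        = - \<i> * cip (IFT (y t)) (P1 t) + cip (IFT (y t)) (P2 t)" for t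
    proof -
      have "deriv (\<lambda>s. \<phi> (s, x)) t = D1 \<phi> (t, x)" for x by (intro DERIV_imp_deriv D_derivative \<phi>)
      moreover have "(deriv ^^ 2) (\<lambda>y. \<phi> (t, y)) x = D2 (D2 \<phi>) (t, x)" for x
      proof -
        have "deriv (\<lambda>y. \<phi> (t, y)) = (\<lambda>y. D2 \<phi> (t, y))" by (intro ext DERIV_imp_deriv D_derivative \<phi>)
        then show ?thesis by (simp add: numeral_2_eq_2) (intro DERIV_imp_deriv D_derivative test_D \<phi>)
      qed
      ultimately have "(LINT x|lborel. u t x * (- \<i> * of_real (deriv (\<lambda>s. \<phi> (s, x)) t) + of_real ((deriv ^^ 2) (\<lambda>y. \<phi> (t, y)) x)))
          = (LINT x|lborel. - \<i> * (u t x * sl (D1 \<phi>) t x) + u t x * sl (D2 (D2 \<phi>)) t x)"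
        by (intro Bochner_Integration.integral_cong refl) (simp add: sl_def algebra_simps)
      also have "\<dots> = - \<i> * cip (cls (u t)) (P1 t) + cip (cls (u t)) (P2 t)"
        unfolding P1_def P2_def
        using L2_prod_integrable[OF uL sl_L2[OF \<phi>1], of t t] L2_prod_integrable[OF uL sl_L2[OF \<phi>2], of t t]
        by (simp add: cip_cls uL sl_L2 \<phi>1 \<phi>2)
      finally show ?thesis by (simp add: clsu)
    qed
    have rhs: "(LINT x|lborel. szego (nonlinearity m (u t)) x * of_real (\<phi> (t, x))) = cip (IFT (mul pos (N (y t)))) (P t)" for t
      using cip_cls[OF sz(1)[of t] sl_L2[OF \<phi>, of t]] by (simp add: sz(2) P_def sl_def)
    have i: "integrable lborel (\<lambda>t. cip (IFT (mul pos (N (y t)))) (P t))"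
      by (rule L12_integrable, rule compact_support_L12[of _ M])
        (auto intro!: cipc IFTc mulc Nc Pc simp: M cip0)
    \<comment> \<open>The projection disappears from the linear terms because y has no negative
      frequencies, and stays on the nonlinear term, where it is the projector in the
      equation.\<close>
    have "E (mul pos) t = (- \<i> * cip (IFT (y t)) (P1 t) + cip (IFT (y t)) (P2 t)) - of_real lam * cip (IFT (mul pos (N (y t)))) (P t)" for t
      by (simp add: E_def pos)
    then have "(LINT t|lborel. (- \<i> * cip (IFT (y t)) (P1 t) + cip (IFT (y t)) (P2 t)))
        = (LINT t|lborel. E (mul pos) t + of_real lam * cip (IFT (mul pos (N (y t)))) (P t))" by simp
    also have "\<dots> = of_real lam * (LINT t|lborel. cip (IFT (mul pos (N (y t)))) (P t))"
      using E EI[OF bmult_pos] i by simp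
    finally show "(LINT t|lborel. LINT x|lborel. u t x * (- \<i> * of_real (deriv (\<lambda>s. \<phi> (s, x)) t) + of_real ((deriv ^^ 2) (\<lambda>y. \<phi> (t, y)) x)))
        = of_real lam * (LINT t|lborel. LINT x|lborel. szego (nonlinearity m (u t)) x * of_real (\<phi> (t, x)))"
      unfolding lhs rhs .
  qed
  with uC init show ?thesis unfolding is_solution_def by blast
qed

theorem theorem1p3:
  fixes m lam :: real and u0 :: "real \<Rightarrow> complex"
  assumes "m \<ge> 0" and "lam \<in> {1, -1}" and "u0 \<in> H1_plus"
  shows "\<exists>u. is_solution m lam u0 u \<and>
           (\<forall>v. is_solution m lam u0 v \<longrightarrow> (\<forall>t. AE x in lborel. v t x = u t x))"
  using solution_exists[OF assms] solution_unique[OF assms(1,2)] by blast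

end
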